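(* Let $G$ be a compact Lie group, $\rho\colon G\to O(2)$ an orthogonal representation, and $S(\rho)$ the unit circle of the corresponding $G$-module. If $\rho(G)=D_1$, then the reduced equivariant $K$-group $\widetilde K_G(S(\rho))$ is isomorphic to the ideal $R(G)(\mathbb{C}_+-\mathbb{C}_-)$ of the representation ring $R(G)$ generated by $\mathbb{C}_+-\mathbb{C}_-$. In particular, $\widetilde K_G(S(\rho))$ is torsion-free for any compact Lie group $G$.
   Context: $D_1\subset O(2)$ is the group of order two generated by the reflection about the $x$-axis, and $S(\rho)$ is identified with the unit circle in $\mathbb{C}$, so that the $G$-fixed point set of $S(\rho)$ is $\{1,-1\}$ when $\rho(G)=D_1$. $R(G)$ is the complex representation ring of $G$. $K_G(X)$ is the Grothendieck group of finite-dimensional complex $G$-vector bundles over the compact $G$-space $X$; for a base point $*$ of $X$ fixed by $G$, $\widetilde K_G(X)$ is the kernel of the restriction homomorphism $K_G(X)\to K_G( * )$. Both are algebras over $R(G)$ (without identity in the case of $\widetilde K_G(X)$). The base point of $S(\rho)$ is $-1$. Let $H=\rho^{-1}(1)$; $\mathbb{C}_+$ and $\mathbb{C}_-$ are the one-dimensional $G$-modules induced, via $G\to G/H\cong D_1$, from the trivial and the nontrivial one-dimensional $D_1$-modules respectively. The isomorphism is the one given by the restriction homomorphism $\widetilde K_G(S(\rho))\to R(G)$ to fibers at $1$, i.e. this homomorphism is injective with image the stated ideal. *)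

theory Defs
  imports
    "HOL-Analysis.Analysis"
    "HOL-Algebra.RingHom"
    "Jordan_Normal_Form.Matrix"
begin

section \<open>Compact Lie groups\<close>

text \<open>
  Smoothness of functions on open subsets of \<open>\<real>\<^sup>n\<close>, where \<open>\<real>\<^sup>n\<close> is the library's
  \<^const>\<open>Euclidean_space\<close>; thus \<open>n = 0\<close> is allowed and finite groups are Lie groups.
  A function is of class \<open>C\<^sup>k\<^sup>+\<^sup>1\<close> if it is continuous and has all first partial
  derivatives, and these are of class \<open>C\<^sup>k\<close>.
\<close>

primrec Ck_on :: "nat \<Rightarrow> nat \<Rightarrow> (nat \<Rightarrow> real) set \<Rightarrow> ((nat \<Rightarrow> real) \<Rightarrow> real) \<Rightarrow> bool" where
  "Ck_on n 0 U f \<longleftrightarrow> continuous_map (subtopology (Euclidean_space n) U) euclideanreal f"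
| "Ck_on n (Suc k) U f \<longleftrightarrow>
     continuous_map (subtopology (Euclidean_space n) U) euclideanreal f \<and>
     (\<forall>i<n. \<exists>f'. (\<forall>x\<in>U. ((\<lambda>t. f (x(i := t))) has_real_derivative f' x) (at (x i))) \<and>
                 Ck_on n k U f')"

definition smooth_map ::
  "nat \<Rightarrow> nat \<Rightarrow> (nat \<Rightarrow> real) set \<Rightarrow> ((nat \<Rightarrow> real) \<Rightarrow> (nat \<Rightarrow> real)) \<Rightarrow> bool" where
  "smooth_map n m U f \<longleftrightarrow> (\<forall>i<m. \<forall>k. Ck_on n k U (\<lambda>x. f x i))"

type_synonym 'g chart = "'g set \<times> ('g \<Rightarrow> nat \<Rightarrow> real)"

definition is_chart :: "'g topology \<Rightarrow> nat \<Rightarrow> 'g set \<Rightarrow> ('g \<Rightarrow> nat \<Rightarrow> real) \<Rightarrow> bool" where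
  "is_chart T n U \<phi> \<longleftrightarrow>
     openin T U \<and> openin (Euclidean_space n) (\<phi> ` U) \<and>
     homeomorphic_map (subtopology T U) (subtopology (Euclidean_space n) (\<phi> ` U)) \<phi>"

definition smooth_atlas :: "'g topology \<Rightarrow> nat \<Rightarrow> 'g chart set \<Rightarrow> bool" where
  "smooth_atlas T n \<A> \<longleftrightarrow>
     (\<forall>(U, \<phi>)\<in>\<A>. is_chart T n U \<phi>) \<and>
     (\<Union>(U, \<phi>)\<in>\<A>. U) = topspace T \<and>
     (\<forall>(U, \<phi>)\<in>\<A>. \<forall>(V, \<psi>)\<in>\<A>. smooth_map n n (\<phi> ` (U \<inter> V)) (\<psi> \<circ> inv_into U \<phi>))"

text \<open>The two halves of a point of \<open>\<real>\<^sup>n\<^sup>+\<^sup>n = \<real>\<^sup>n \<times> \<real>\<^sup>n\<close>.\<close>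

definition fst_half :: "nat \<Rightarrow> (nat \<Rightarrow> real) \<Rightarrow> (nat \<Rightarrow> real)" where
  "fst_half n z = (\<lambda>i. if i < n then z i else 0)"

definition snd_half :: "nat \<Rightarrow> (nat \<Rightarrow> real) \<Rightarrow> (nat \<Rightarrow> real)" where
  "snd_half n z = (\<lambda>i. if i < n then z (n + i) else 0)"

text \<open>
  Since compact manifolds are second countable, second countability is not part of the
  definition below (it is automatic in the case of interest).
\<close>

locale lie_group = group G for G (structure) +
  fixes T :: "'a topology" and n :: nat and \<A> :: "'a chart set"
  assumes topspace_eq: "topspace T = carrier G"
    and Hausdorff: "Hausdorff_space T"
    and atlas: "smooth_atlas T n \<A>"
    and continuous_mult: "continuous_map (prod_topology T T) T (\<lambda>(x, y). x \<otimes> y)"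
    and continuous_inv: "continuous_map T T (\<lambda>x. inv x)"
    and smooth_mult:
      "\<lbrakk>(U, \<phi>) \<in> \<A>; (V, \<psi>) \<in> \<A>; (W, \<theta>) \<in> \<A>\<rbrakk> \<Longrightarrow>
         smooth_map (n + n) n
           {z \<in> topspace (Euclidean_space (n + n)).
              fst_half n z \<in> \<phi> ` U \<and> snd_half n z \<in> \<psi> ` V \<and>
              inv_into U \<phi> (fst_half n z) \<otimes> inv_into V \<psi> (snd_half n z) \<in> W}
           (\<lambda>z. \<theta> (inv_into U \<phi> (fst_half n z) \<otimes> inv_into V \<psi> (snd_half n z)))"
    and smooth_inv:
      "\<lbrakk>(U, \<phi>) \<in> \<A>; (V, \<psi>) \<in> \<A>\<rbrakk> \<Longrightarrow>
         smooth_map n n (\<phi> ` {x \<in> U. inv x \<in> V}) (\<lambda>z. \<psi> (inv (inv_into U \<phi> z)))"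

locale compact_lie_group = lie_group +
  assumes compact: "compact_space T"


section \<open>The Grothendieck ring of a commutative semiring\<close>

text \<open>
  Semirings are presented by the record type of rings.  The class of a pair \<open>(a, b)\<close> is the
  formal difference \<open>a - b\<close>.
\<close>

definition groth_rel :: "('a, 'm) ring_scheme \<Rightarrow> (('a \<times> 'a) \<times> ('a \<times> 'a)) set" where
  "groth_rel S =
     {((a, b), (c, d)) | a b c d.
        a \<in> carrier S \<and> b \<in> carrier S \<and> c \<in> carrier S \<and> d \<in> carrier S \<and>
        (\<exists>k\<in>carrier S. a \<oplus>\<^bsub>S\<^esub> d \<oplus>\<^bsub>S\<^esub> k = c \<oplus>\<^bsub>S\<^esub> b \<oplus>\<^bsub>S\<^esub> k)}"

definition groth_diff :: "('a, 'm) ring_scheme \<Rightarrow> 'a \<Rightarrow> 'a \<Rightarrow> ('a \<times> 'a) set" where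
  "groth_diff S a b = groth_rel S `` {(a, b)}"

definition groth_ring :: "('a, 'm) ring_scheme \<Rightarrow> ('a \<times> 'a) set ring" where
  "groth_ring S =
     \<lparr>carrier = (carrier S \<times> carrier S) // groth_rel S,
      monoid.mult = (\<lambda>P Q. \<Union>(a, b)\<in>P. \<Union>(c, d)\<in>Q.
        groth_diff S (a \<otimes>\<^bsub>S\<^esub> c \<oplus>\<^bsub>S\<^esub> b \<otimes>\<^bsub>S\<^esub> d) (a \<otimes>\<^bsub>S\<^esub> d \<oplus>\<^bsub>S\<^esub> b \<otimes>\<^bsub>S\<^esub> c)),
      monoid.one = groth_diff S \<one>\<^bsub>S\<^esub> \<zero>\<^bsub>S\<^esub>,
      ring.zero = groth_diff S \<zero>\<^bsub>S\<^esub> \<zero>\<^bsub>S\<^esub>,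
      ring.add = (\<lambda>P Q. \<Union>(a, b)\<in>P. \<Union>(c, d)\<in>Q. groth_diff S (a \<oplus>\<^bsub>S\<^esub> c) (b \<oplus>\<^bsub>S\<^esub> d))\<rparr>"

definition groth_of :: "('a, 'm) ring_scheme \<Rightarrow> 'a \<Rightarrow> ('a \<times> 'a) set" where
  "groth_of S a = groth_diff S a \<zero>\<^bsub>S\<^esub>"

text \<open>The map of Grothendieck rings induced by a semiring homomorphism \<open>f\<close> into \<open>S\<close>.\<close>

definition groth_map :: "('b, 'm) ring_scheme \<Rightarrow> ('a \<Rightarrow> 'b) \<Rightarrow> ('a \<times> 'a) set \<Rightarrow> ('b \<times> 'b) set" where
  "groth_map S f P = (\<Union>(a, b)\<in>P. groth_diff S (f a) (f b))"


section \<open>The complex representation ring\<close>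

text \<open>
  A finite-dimensional complex representation, in coordinates: a continuous homomorphism
  to \<open>GL\<^sub>n(\<complex>)\<close>, \<open>n \<ge> 0\<close>.
\<close>

definition is_rep ::
  "('g, 'm) monoid_scheme \<Rightarrow> 'g topology \<Rightarrow> nat \<Rightarrow> ('g \<Rightarrow> complex mat) \<Rightarrow> bool" where
  "is_rep G T n r \<longleftrightarrow>
     (\<forall>g\<in>carrier G. r g \<in> carrier_mat n n) \<and>
     r \<one>\<^bsub>G\<^esub> = 1\<^sub>m n \<and>
     (\<forall>g\<in>carrier G. \<forall>h\<in>carrier G. r (g \<otimes>\<^bsub>G\<^esub> h) = r g * r h) \<and>
     (\<forall>i<n. \<forall>j<n. continuous_map T euclidean (\<lambda>g. r g $$ (i, j)))"

definition rep_iso ::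
  "('g, 'm) monoid_scheme \<Rightarrow> 'g topology \<Rightarrow> ('g \<Rightarrow> complex mat) \<Rightarrow> ('g \<Rightarrow> complex mat) \<Rightarrow> bool" where
  "rep_iso G T r s \<longleftrightarrow>
     (\<exists>n P. is_rep G T n r \<and> is_rep G T n s \<and>
            P \<in> carrier_mat n n \<and> invertible_mat P \<and> (\<forall>g\<in>carrier G. P * r g = s g * P))"

definition rep_class ::
  "('g, 'm) monoid_scheme \<Rightarrow> 'g topology \<Rightarrow> ('g \<Rightarrow> complex mat) \<Rightarrow> ('g \<Rightarrow> complex mat) set" where
  "rep_class G T r = {s. rep_iso G T r s}"

definition rep_sum ::
  "('g \<Rightarrow> complex mat) \<Rightarrow> ('g \<Rightarrow> complex mat) \<Rightarrow> ('g \<Rightarrow> complex mat)" where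
  "rep_sum r s = (\<lambda>g. four_block_mat (r g) (0\<^sub>m (dim_row (r g)) (dim_col (s g)))
                                     (0\<^sub>m (dim_row (s g)) (dim_col (r g))) (s g))"

text \<open>The Kronecker product of matrices, for the basis \<open>e\<^sub>i \<otimes> e\<^sub>j\<close> in lexicographic order.\<close>

definition kron_mat :: "complex mat \<Rightarrow> complex mat \<Rightarrow> complex mat" where
  "kron_mat A B = mat (dim_row A * dim_row B) (dim_col A * dim_col B)
     (\<lambda>(i, j). A $$ (i div dim_row B, j div dim_col B) * B $$ (i mod dim_row B, j mod dim_col B))"

definition rep_tensor ::
  "('g \<Rightarrow> complex mat) \<Rightarrow> ('g \<Rightarrow> complex mat) \<Rightarrow> ('g \<Rightarrow> complex mat)" where
  "rep_tensor r s = (\<lambda>g. kron_mat (r g) (s g))"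

definition triv_rep :: "nat \<Rightarrow> 'g \<Rightarrow> complex mat" where
  "triv_rep n = (\<lambda>g. 1\<^sub>m n)"

definition rep_semiring ::
  "('g, 'm) monoid_scheme \<Rightarrow> 'g topology \<Rightarrow> ('g \<Rightarrow> complex mat) set ring" where
  "rep_semiring G T =
     \<lparr>carrier = {rep_class G T r | r n. is_rep G T n r},
      monoid.mult = (\<lambda>c d. \<Union>r\<in>c. \<Union>s\<in>d. rep_class G T (rep_tensor r s)),
      monoid.one = rep_class G T (triv_rep 1),
      ring.zero = rep_class G T (triv_rep 0),
      ring.add = (\<lambda>c d. \<Union>r\<in>c. \<Union>s\<in>d. rep_class G T (rep_sum r s))\<rparr>"

definition rep_ring ::
  "('g, 'm) monoid_scheme \<Rightarrow> 'g topology \<Rightarrow>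
   (('g \<Rightarrow> complex mat) set \<times> ('g \<Rightarrow> complex mat) set) set ring" where
  "rep_ring G T = groth_ring (rep_semiring G T)"


section \<open>Complex \<open>G\<close>-vector bundles\<close>

definition complex_space :: "nat \<Rightarrow> (nat \<Rightarrow> complex) topology" where
  "complex_space n = subtopology (product_topology (\<lambda>i. euclidean) UNIV) {v. \<forall>i\<ge>n. v i = 0}"

text \<open>
  The data of a \<open>G\<close>-vector bundle over a space with points in \<open>'x\<close>: total space, projection,
  fibrewise addition and scalar multiplication, and the action of \<open>G\<close> on the total space.
\<close>

record ('e, 'x, 'g) gbundle =
  total_space :: "'e topology"
  bproj :: "'e \<Rightarrow> 'x"
  fadd :: "'e \<Rightarrow> 'e \<Rightarrow> 'e"
  fscale :: "complex \<Rightarrow> 'e \<Rightarrow> 'e"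
  gact :: "'g \<Rightarrow> 'e \<Rightarrow> 'e"

definition fibre :: "('e, 'x, 'g) gbundle \<Rightarrow> 'x \<Rightarrow> 'e set" where
  "fibre E x = {e \<in> topspace (total_space E). bproj E e = x}"

text \<open>\<open>\<beta>\<close> is a linear isomorphism from \<open>\<complex>\<^sup>n\<close> onto the fibre at \<open>x\<close>.\<close>

definition fibre_coords ::
  "('e, 'x, 'g) gbundle \<Rightarrow> 'x \<Rightarrow> nat \<Rightarrow> ((nat \<Rightarrow> complex) \<Rightarrow> 'e) \<Rightarrow> bool" where
  "fibre_coords E x n \<beta> \<longleftrightarrow>
     bij_betw \<beta> (topspace (complex_space n)) (fibre E x) \<and>
     (\<forall>v\<in>topspace (complex_space n). \<forall>w\<in>topspace (complex_space n).
        \<beta> (\<lambda>i. v i + w i) = fadd E (\<beta> v) (\<beta> w)) \<and>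
     (\<forall>c. \<forall>v\<in>topspace (complex_space n). \<beta> (\<lambda>i. c * v i) = fscale E c (\<beta> v))"

text \<open>
  \<open>G\<close>-vector bundles over the \<open>G\<close>-space \<open>X\<close> with action \<open>a\<close>.  That the fibres are
  finite-dimensional complex vector spaces is part of local triviality, through
  \<^const>\<open>fibre_coords\<close>.  The rank is only required to be locally constant.
\<close>

definition is_bundle ::
  "('g, 'm) monoid_scheme \<Rightarrow> 'g topology \<Rightarrow> 'x topology \<Rightarrow> ('g \<Rightarrow> 'x \<Rightarrow> 'x) \<Rightarrow>
   ('e, 'x, 'g) gbundle \<Rightarrow> bool" where
  "is_bundle G T X a E \<longleftrightarrow>
     continuous_map (total_space E) X (bproj E) \<and>
     (\<forall>x\<in>topspace X. \<exists>U n h. openin X U \<and> x \<in> U \<and>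
        homeomorphic_map (prod_topology (subtopology X U) (complex_space n))
          (subtopology (total_space E) {e \<in> topspace (total_space E). bproj E e \<in> U}) h \<and>
        (\<forall>y\<in>U. fibre_coords E y n (\<lambda>v. h (y, v)))) \<and>
     continuous_map (prod_topology T (total_space E)) (total_space E) (\<lambda>(g, e). gact E g e) \<and>
     (\<forall>e\<in>topspace (total_space E). gact E \<one>\<^bsub>G\<^esub> e = e) \<and>
     (\<forall>g\<in>carrier G. \<forall>h\<in>carrier G. \<forall>e\<in>topspace (total_space E).
        gact E (g \<otimes>\<^bsub>G\<^esub> h) e = gact E g (gact E h e)) \<and>
     (\<forall>g\<in>carrier G. \<forall>e\<in>topspace (total_space E). bproj E (gact E g e) = a g (bproj E e)) \<and>
     (\<forall>g\<in>carrier G. \<forall>x\<in>topspace X. \<forall>e\<in>fibre E x. \<forall>e'\<in>fibre E x.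
        gact E g (fadd E e e') = fadd E (gact E g e) (gact E g e')) \<and>
     (\<forall>g\<in>carrier G. \<forall>c. \<forall>e\<in>topspace (total_space E). gact E g (fscale E c e) = fscale E c (gact E g e))"

definition bundle_iso ::
  "('g, 'm) monoid_scheme \<Rightarrow> ('e, 'x, 'g) gbundle \<Rightarrow> ('f, 'x, 'g) gbundle \<Rightarrow> bool" where
  "bundle_iso G E F \<longleftrightarrow>
     (\<exists>f. homeomorphic_map (total_space E) (total_space F) f \<and>
        (\<forall>e\<in>topspace (total_space E). bproj F (f e) = bproj E e) \<and>
        (\<forall>e\<in>topspace (total_space E). \<forall>e'\<in>topspace (total_space E). bproj E e = bproj E e' \<longrightarrow>
           f (fadd E e e') = fadd F (f e) (f e')) \<and>
        (\<forall>c. \<forall>e\<in>topspace (total_space E). f (fscale E c e) = fscale F c (f e)) \<and>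
        (\<forall>g\<in>carrier G. \<forall>e\<in>topspace (total_space E). f (gact E g e) = gact F g (f e)))"

definition fibre_product ::
  "('e, 'x, 'g) gbundle \<Rightarrow> ('f, 'x, 'g) gbundle \<Rightarrow> ('e \<times> 'f) topology" where
  "fibre_product E F = subtopology (prod_topology (total_space E) (total_space F)) {(e, f). bproj E e = bproj F f}"

definition whitney_sum ::
  "('e, 'x, 'g) gbundle \<Rightarrow> ('f, 'x, 'g) gbundle \<Rightarrow> ('e \<times> 'f, 'x, 'g) gbundle" where
  "whitney_sum E F =
     \<lparr>total_space = fibre_product E F,
      bproj = (\<lambda>(e, f). bproj E e),
      fadd = (\<lambda>(e, f) (e', f'). (fadd E e e', fadd F f f')),
      fscale = (\<lambda>c (e, f). (fscale E c e, fscale F c f)),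
      gact = (\<lambda>g (e, f). (gact E g e, gact F g f))\<rparr>"

text \<open>
  \<open>v \<otimes> w\<close> for \<open>w \<in> \<complex>\<^sup>n\<close>, with the same ordering of the basis as in \<^const>\<open>kron_mat\<close>.
\<close>

definition kron_vec :: "nat \<Rightarrow> (nat \<Rightarrow> complex) \<Rightarrow> (nat \<Rightarrow> complex) \<Rightarrow> (nat \<Rightarrow> complex)" where
  "kron_vec n v w = (\<lambda>k. v (k div n) * w (k mod n))"

text \<open>
  The bundle \<open>P\<close> is a tensor product of \<open>E\<close> and \<open>F\<close> over \<open>X\<close>: there is a continuous
  equivariant map \<open>E \<times>\<^sub>X F \<rightarrow> P\<close> over \<open>X\<close> which on each fibre is, in linear coordinates, the
  canonical bilinear map \<open>\<complex>\<^sup>m \<times> \<complex>\<^sup>n \<rightarrow> \<complex>\<^sup>m \<otimes> \<complex>\<^sup>n\<close>.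
\<close>

definition is_bundle_tensor ::
  "('g, 'm) monoid_scheme \<Rightarrow> 'x topology \<Rightarrow> ('e, 'x, 'g) gbundle \<Rightarrow> ('f, 'x, 'g) gbundle \<Rightarrow>
   ('p, 'x, 'g) gbundle \<Rightarrow> bool" where
  "is_bundle_tensor G X E F P \<longleftrightarrow>
     (\<exists>t. continuous_map (fibre_product E F) (total_space P) t \<and>
        (\<forall>(e, f)\<in>topspace (fibre_product E F). bproj P (t (e, f)) = bproj E e) \<and>
        (\<forall>g\<in>carrier G. \<forall>(e, f)\<in>topspace (fibre_product E F).
           t (gact E g e, gact F g f) = gact P g (t (e, f))) \<and>
        (\<forall>x\<in>topspace X. \<exists>m n \<beta> \<gamma> \<delta>.
           fibre_coords E x m \<beta> \<and> fibre_coords F x n \<gamma> \<and> fibre_coords P x (m * n) \<delta> \<and>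
           (\<forall>v\<in>topspace (complex_space m). \<forall>w\<in>topspace (complex_space n).
              t (\<beta> v, \<gamma> w) = \<delta> (kron_vec n v w))))"

definition mat_act :: "complex mat \<Rightarrow> (nat \<Rightarrow> complex) \<Rightarrow> (nat \<Rightarrow> complex)" where
  "mat_act A v = (\<lambda>i. if i < dim_row A then \<Sum>j<dim_col A. A $$ (i, j) * v j else 0)"

text \<open>The bundle \<open>X \<times> V \<rightarrow> X\<close> for a representation \<open>V\<close> of degree \<open>n\<close>.\<close>

definition product_bundle ::
  "'x topology \<Rightarrow> ('g \<Rightarrow> 'x \<Rightarrow> 'x) \<Rightarrow> nat \<Rightarrow> ('g \<Rightarrow> complex mat) \<Rightarrow>
   ('x \<times> (nat \<Rightarrow> complex), 'x, 'g) gbundle" where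
  "product_bundle X a n r =
     \<lparr>total_space = prod_topology X (complex_space n),
      bproj = fst,
      fadd = (\<lambda>(x, v) (y, w). (x, \<lambda>i. v i + w i)),
      fscale = (\<lambda>c (x, v). (x, \<lambda>i. c * v i)),
      gact = (\<lambda>g (x, v). (a g x, mat_act (r g) v))\<rparr>"


section \<open>Equivariant K-theory\<close>

text \<open>
  Isomorphism classes are formed among bundles whose total space is a set of elements of
  \<open>'x \<times> (nat \<Rightarrow> complex)\<close>, with arbitrary topology, projection and operations.  This is no
  restriction: the underlying set of any vector bundle over a space with points in \<open>'x\<close> is in
  bijection, over the base, with a disjoint union of spaces \<open>{x} \<times> \<complex>\<^sup>n\<^sup>(\<^sup>x\<^sup>)\<close>, and
  all structure can be transported along this bijection.
\<close>

type_synonym ('x, 'g) vbundle = "('x \<times> (nat \<Rightarrow> complex), 'x, 'g) gbundle"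

definition bundle_class ::
  "('g, 'm) monoid_scheme \<Rightarrow> 'g topology \<Rightarrow> 'x topology \<Rightarrow> ('g \<Rightarrow> 'x \<Rightarrow> 'x) \<Rightarrow>
   ('e, 'x, 'g) gbundle \<Rightarrow> ('x, 'g) vbundle set" where
  "bundle_class G T X a E = {F. is_bundle G T X a F \<and> bundle_iso G E F}"

definition bundle_semiring ::
  "('g, 'm) monoid_scheme \<Rightarrow> 'g topology \<Rightarrow> 'x topology \<Rightarrow> ('g \<Rightarrow> 'x \<Rightarrow> 'x) \<Rightarrow>
   ('x, 'g) vbundle set ring" where
  "bundle_semiring G T X a =
     \<lparr>carrier = {bundle_class G T X a E | E :: ('x, 'g) vbundle. is_bundle G T X a E},
      monoid.mult = (\<lambda>c d. {P. is_bundle G T X a P \<and> (\<exists>E\<in>c. \<exists>F\<in>d. is_bundle_tensor G X E F P)}),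
      monoid.one = bundle_class G T X a (product_bundle X a 1 (triv_rep 1)),
      ring.zero = bundle_class G T X a (product_bundle X a 0 (triv_rep 0)),
      ring.add = (\<lambda>c d. \<Union>E\<in>c. \<Union>F\<in>d. bundle_class G T X a (whitney_sum E F))\<rparr>"

definition K_ring ::
  "('g, 'm) monoid_scheme \<Rightarrow> 'g topology \<Rightarrow> 'x topology \<Rightarrow> ('g \<Rightarrow> 'x \<Rightarrow> 'x) \<Rightarrow>
   (('x, 'g) vbundle set \<times> ('x, 'g) vbundle set) set ring" where
  "K_ring G T X a = groth_ring (bundle_semiring G T X a)"

text \<open>The \<open>R(G)\<close>-algebra structure of \<open>K\<^sub>G(X)\<close>: the class of \<open>V\<close> acts as that of \<open>X \<times> V\<close>.\<close>

definition K_scalar ::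
  "('g, 'm) monoid_scheme \<Rightarrow> 'g topology \<Rightarrow> 'x topology \<Rightarrow> ('g \<Rightarrow> 'x \<Rightarrow> 'x) \<Rightarrow>
   (('g \<Rightarrow> complex mat) set \<times> ('g \<Rightarrow> complex mat) set) set \<Rightarrow>
   (('x, 'g) vbundle set \<times> ('x, 'g) vbundle set) set" where
  "K_scalar G T X a =
     groth_map (bundle_semiring G T X a)
       (\<lambda>c. \<Union>r\<in>c. bundle_class G T X a (product_bundle X a (dim_row (r \<one>\<^bsub>G\<^esub>)) r))"

definition K_smult ::
  "('g, 'm) monoid_scheme \<Rightarrow> 'g topology \<Rightarrow> 'x topology \<Rightarrow> ('g \<Rightarrow> 'x \<Rightarrow> 'x) \<Rightarrow>
   (('g \<Rightarrow> complex mat) set \<times> ('g \<Rightarrow> complex mat) set) set \<Rightarrow>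
   (('x, 'g) vbundle set \<times> ('x, 'g) vbundle set) set \<Rightarrow>
   (('x, 'g) vbundle set \<times> ('x, 'g) vbundle set) set" where
  "K_smult G T X a \<alpha> \<xi> = K_scalar G T X a \<alpha> \<otimes>\<^bsub>K_ring G T X a\<^esub> \<xi>"

text \<open>Restriction \<open>K\<^sub>G(X) \<rightarrow> K\<^sub>G(Y)\<close> to a \<open>G\<close>-subspace \<open>Y\<close>.\<close>

definition restrict_bundle :: "'x set \<Rightarrow> ('e, 'x, 'g) gbundle \<Rightarrow> ('e, 'x, 'g) gbundle" where
  "restrict_bundle Y E = E\<lparr>total_space := subtopology (total_space E) {e. bproj E e \<in> Y}\<rparr>"

definition K_restrict ::
  "('g, 'm) monoid_scheme \<Rightarrow> 'g topology \<Rightarrow> 'x topology \<Rightarrow> ('g \<Rightarrow> 'x \<Rightarrow> 'x) \<Rightarrow> 'x set \<Rightarrow>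
   (('x, 'g) vbundle set \<times> ('x, 'g) vbundle set) set \<Rightarrow>
   (('x, 'g) vbundle set \<times> ('x, 'g) vbundle set) set" where
  "K_restrict G T X a Y =
     groth_map (bundle_semiring G T (subtopology X Y) a)
       (\<lambda>c. \<Union>E\<in>c. bundle_class G T (subtopology X Y) a (restrict_bundle Y E))"

text \<open>
  The reduced group for a fixed base point \<open>b\<close>, with the operations of \<open>K\<^sub>G(X)\<close>.  It has no
  identity; the field \<^const>\<open>monoid.one\<close> of the record, inherited from \<open>K\<^sub>G(X)\<close>, is meaningless.
\<close>

definition reduced_K ::
  "('g, 'm) monoid_scheme \<Rightarrow> 'g topology \<Rightarrow> 'x topology \<Rightarrow> ('g \<Rightarrow> 'x \<Rightarrow> 'x) \<Rightarrow> 'x \<Rightarrow>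
   (('x, 'g) vbundle set \<times> ('x, 'g) vbundle set) set ring" where
  "reduced_K G T X a b =
     (K_ring G T X a)\<lparr>carrier :=
        a_kernel (K_ring G T X a) (K_ring G T (subtopology X {b}) a) (K_restrict G T X a {b})\<rparr>"

text \<open>
  For a fixed point \<open>x\<close>, the class of the representation of \<open>G\<close> on the fibre at \<open>x\<close>, and the
  induced homomorphism \<open>K\<^sub>G(X) \<rightarrow> R(G)\<close>.
\<close>

definition fibre_rep_class ::
  "('g, 'm) monoid_scheme \<Rightarrow> 'g topology \<Rightarrow> 'x \<Rightarrow> ('e, 'x, 'g) gbundle \<Rightarrow>
   ('g \<Rightarrow> complex mat) set" where
  "fibre_rep_class G T x E =
     {r. \<exists>n \<beta>. is_rep G T n r \<and> fibre_coords E x n \<beta> \<and>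
        (\<forall>g\<in>carrier G. \<forall>v\<in>topspace (complex_space n). \<beta> (mat_act (r g) v) = gact E g (\<beta> v))}"

definition K_fibre ::
  "('g, 'm) monoid_scheme \<Rightarrow> 'g topology \<Rightarrow> 'x \<Rightarrow>
   (('x, 'g) vbundle set \<times> ('x, 'g) vbundle set) set \<Rightarrow>
   (('g \<Rightarrow> complex mat) set \<times> ('g \<Rightarrow> complex mat) set) set" where
  "K_fibre G T x = groth_map (rep_semiring G T) (\<lambda>c. \<Union>E\<in>c. fibre_rep_class G T x E)"


section \<open>The circle of a two-dimensional orthogonal representation\<close>

definition O2 :: "(real^2^2) monoid" where
  "O2 = \<lparr>carrier = {A. orthogonal_matrix A}, monoid.mult = (**), monoid.one = Finite_Cartesian_Product.mat 1\<rparr>"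

definition x_axis_reflection :: "real^2^2" where
  "x_axis_reflection = vector [vector [1, 0], vector [0, -1]]"

definition D1 :: "(real^2^2) set" where
  "D1 = {Finite_Cartesian_Product.mat 1, x_axis_reflection}"

definition orthogonal_rep ::
  "('g, 'm) monoid_scheme \<Rightarrow> 'g topology \<Rightarrow> ('g \<Rightarrow> real^2^2) \<Rightarrow> bool" where
  "orthogonal_rep G T \<rho> \<longleftrightarrow> \<rho> \<in> hom G O2 \<and> continuous_map T euclidean \<rho>"

definition unit_circle :: "complex topology" where
  "unit_circle = top_of_set (sphere 0 1)"

text \<open>The action of \<open>G\<close> on \<open>\<real>\<^sup>2 = \<complex>\<close> through \<open>\<rho>\<close>; on \<^const>\<open>unit_circle\<close>, this is \<open>S(\<rho>)\<close>.\<close>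

definition circle_act :: "('g \<Rightarrow> real^2^2) \<Rightarrow> 'g \<Rightarrow> complex \<Rightarrow> complex" where
  "circle_act \<rho> g z =
     (let v = \<rho> g *v vector [Re z, Im z] in Complex (vec_nth v 1) (vec_nth v 2))"

text \<open>
  The trivial and the nontrivial one-dimensional module of \<^const>\<open>D1\<close>, pulled back along \<open>\<rho>\<close>.
\<close>

definition C_plus :: "('g \<Rightarrow> real^2^2) \<Rightarrow> 'g \<Rightarrow> complex mat" where
  "C_plus \<rho> = (\<lambda>g. 1\<^sub>m 1)"

definition C_minus :: "('g \<Rightarrow> real^2^2) \<Rightarrow> 'g \<Rightarrow> complex mat" where
  "C_minus \<rho> = (\<lambda>g. if \<rho> g = Finite_Cartesian_Product.mat 1 then 1\<^sub>m 1 else - 1\<^sub>m 1)"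

definition rep_elem ::
  "('g, 'm) monoid_scheme \<Rightarrow> 'g topology \<Rightarrow> ('g \<Rightarrow> complex mat) \<Rightarrow>
   (('g \<Rightarrow> complex mat) set \<times> ('g \<Rightarrow> complex mat) set) set" where
  "rep_elem G T r = groth_of (rep_semiring G T) (rep_class G T r)"

end

theory Submission
  imports Defs "Jordan_Normal_Form.Determinant"
begin

text \<open>
  Every \<open>G\<close>-bundle over the circle has a global frame, because frames can be propagated along the circle and
  closed up inside the connected group \<open>GL\<^sub>n(\<complex>)\<close>; it is therefore given by a matrix cocycle.  Let
  \<open>H = \<rho>\<^sup>-\<^sup>1(1)\<close>, which acts trivially on the circle.  A continuous family of representations of \<open>H\<close> over an
  interval is constant up to isomorphism, and this lets one extend isomorphisms from the fixed points \<open>1\<close> and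
  \<open>-1\<close>, so a bundle is determined by its two fibres \<open>V\<close> and \<open>W\<close> there, and these agree over \<open>H\<close>.  As \<open>H\<close>
  has index two in \<open>G\<close>, this means \<open>W = U + A\<close> and \<open>V = U + A \<otimes> \<complex>\<^sub>-\<close> for some \<open>U\<close> and \<open>A\<close>.  Hence the value at
  \<open>1\<close> of a class that vanishes at \<open>-1\<close> is a multiple of \<open>\<complex>\<^sub>+ - \<complex>\<^sub>-\<close>.  All multiples occur, since every
  representation \<open>A\<close> is the fibre at \<open>1\<close> of the bundle with cocycle \<open>A(g)\<close> for \<open>g \<in> H\<close> and \<open>z A(g)\<close> for \<open>g \<notin> H\<close>.

  Integration over \<open>G\<close> is replaced by a fixed point theorem: a bounded affine action of a group on \<open>\<complex>\<^sup>N\<close> has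
  a fixed point in the closed convex hull of each orbit, namely the limit of a sequence in the hull along which
  the largest norm over the orbit tends to its infimum (parallelogram law).
\<close>

section \<open>Bounded affine actions and invertible matrices\<close>

text \<open>Bundles are compared through their fibres at fixed points, which give homomorphisms to
  the semiring of representation classes that are jointly injective on bundle classes. The semiring
  laws for bundles and the uniqueness of tensor products are pulled back along them, and the base
  point is treated in the same way.

  Two obstacles shape the rest. Equality in a Grothendieck ring is only stable equality; it becomes
  isomorphism because representations cancel, and with the torsion-freeness of the representation
  semiring this makes the K-group torsion-free. Cancellation and the splitting into \<open>U\<close>
  and \<open>A\<close> are linear algebra on intertwiners: the absence of nonzero intertwiners
  stands for having no common constituent. Secondly, straightening a family of representations
  requires fixed points that vary continuously with the parameter. A separate choice for each
  parameter would not ensure this, so they are chosen together in a compact product, subject to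
  closed conditions that bound their differences by those of the orbits.\<close>

inductive_set mid_hull :: "('i \<Rightarrow> complex) set \<Rightarrow> ('i \<Rightarrow> complex) set" for S where
  base: "x \<in> S \<Longrightarrow> x \<in> mid_hull S"
| mid: "x \<in> mid_hull S \<Longrightarrow> y \<in> mid_hull S \<Longrightarrow> (\<lambda>i. (x i + y i) / 2) \<in> mid_hull S"

lemma parallelogram_cmod:
  "(cmod ((x + y) / 2))\<^sup>2 = ((cmod x)\<^sup>2 + (cmod y)\<^sup>2) / 2 - (cmod (x - y))\<^sup>2 / 4"
  unfolding cmod_power2 by (simp add: power2_eq_square field_simps)

text \<open>The supremum \<open>f\<close> of the squared norm over an orbit does not increase under
  the action and is uniformly midpoint convex. A minimizing sequence therefore converges, and its
  image under a group element is minimizing as well, with the same limit. The sequence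
  \<open>s\<close> is returned together with the fixed point because bounds valid on the orbit pass
  to midpoints and then to limits.\<close>

lemma affine_fixed_point:
  fixes G :: "('g, 'm) monoid_scheme"
    and K :: "'g \<Rightarrow> 'i \<Rightarrow> 'i \<Rightarrow> complex" and b :: "'g \<Rightarrow> 'i \<Rightarrow> complex" and I :: "'i set"
  defines "act \<equiv> \<lambda>g x i. if i \<in> I then (\<Sum>j\<in>I. K g i j * x j) + b g i else 0"
  assumes "group G" and fin: "finite I"
    and K: "\<And>g i j. g \<in> carrier G \<Longrightarrow> i \<in> I \<Longrightarrow> j \<in> I \<Longrightarrow> cmod (K g i j) \<le> C"
    and b: "\<And>g i. g \<in> carrier G \<Longrightarrow> i \<in> I \<Longrightarrow> cmod (b g i) \<le> C"
    and act_one: "\<And>x. (\<And>i. i \<notin> I \<Longrightarrow> x i = 0) \<Longrightarrow> act \<one>\<^bsub>G\<^esub> x = x"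
    and act_mult: "\<And>g h x. g \<in> carrier G \<Longrightarrow> h \<in> carrier G \<Longrightarrow> act (g \<otimes>\<^bsub>G\<^esub> h) x = act g (act h x)"
  obtains x s where "\<And>g. g \<in> carrier G \<Longrightarrow> act g x = x"
    and "\<And>k. s k \<in> mid_hull {act g x0 | g. g \<in> carrier G}"
    and "\<And>i. (\<lambda>k::nat. s k i) \<longlonglongrightarrow> x i"
proof -
  interpret group G by fact
  define N where "N x = (\<Sum>i\<in>I. (cmod (x i))\<^sup>2)" for x :: "'i \<Rightarrow> complex"
  define Hu where "Hu = mid_hull {act g x0 | g. g \<in> carrier G}"
  define m where "m x y = (\<lambda>i. (x i + y i) / (2::complex))" for x y :: "'i \<Rightarrow> complex"
  have C0: "C \<ge> 0" if "I \<noteq> {}"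
    using b[OF one_closed] that norm_ge_zero order_trans by blast
  have N0: "N x \<ge> 0" for x by (simp add: N_def sum_nonneg)
  have Nmid: "N (m x y) = (N x + N y) / 2 - N (\<lambda>i. x i - y i) / 4" for x y
    unfolding N_def m_def parallelogram_cmod
    by (simp add: sum.distrib sum_subtractf sum_divide_distrib[symmetric])
  \<comment> \<open>A bound for the squared Lipschitz constant of every \<open>act g\<close>:
    Cauchy-Schwarz contributes the factor \<open>C\<^sup>2 * card I\<close> for each of the
    \<open>card I\<close> coordinates. The summand 1 keeps \<open>D\<close> positive when
    \<open>I\<close> is empty or \<open>C\<close> is 0.\<close>
  define D where "D = real (card I) * (C\<^sup>2 * real (card I)) + 1"
  have D0: "D > 0" unfolding D_def by (simp add: add_nonneg_pos)
  have lip: "N (\<lambda>i. act g x i - act g y i) \<le> D * N (\<lambda>i. x i - y i)" if g: "g \<in> carrier G" for g x y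
  proof -
    have "(cmod (act g x i - act g y i))\<^sup>2 \<le> C\<^sup>2 * (real (card I) * N (\<lambda>i. x i - y i))" if i: "i \<in> I" for i
    proof -
      have "act g x i - act g y i = (\<Sum>j\<in>I. K g i j * (x j - y j))"
        using i by (simp add: act_def sum_subtractf algebra_simps)
      then have "cmod (act g x i - act g y i) \<le> (\<Sum>j\<in>I. C * cmod (x j - y j))"
        using K[OF g i] by (auto intro!: sum_norm_le simp: norm_mult mult_right_mono)
      then have "(cmod (act g x i - act g y i))\<^sup>2 \<le> (C * (\<Sum>j\<in>I. cmod (x j - y j)))\<^sup>2"
        by (intro power_mono) (auto simp: sum_distrib_left)
      also have "\<dots> \<le> C\<^sup>2 * (real (card I) * N (\<lambda>i. x i - y i))"
        unfolding power_mult_distrib N_def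
        using sum_squared_le_sum_of_squares[of "\<lambda>j. cmod (x j - y j)" I] fin
        by (intro mult_left_mono) (auto simp: mult.commute)
      finally show ?thesis .
    qed
    then have "N (\<lambda>i. act g x i - act g y i) \<le> (\<Sum>i\<in>I. C\<^sup>2 * (real (card I) * N (\<lambda>i. x i - y i)))"
      unfolding N_def[of "\<lambda>i. act g x i - act g y i"] by (intro sum_mono) auto
    also have "\<dots> \<le> D * N (\<lambda>i. x i - y i)"
      using N0 by (simp add: D_def algebra_simps)
    finally show ?thesis .
  qed
  have actmid: "act g (m x y) = m (act g x) (act g y)" for g x y
  proof
    fix i
    have "(\<Sum>j\<in>I. K g i j * m x y j) = ((\<Sum>j\<in>I. K g i j * x j) + (\<Sum>j\<in>I. K g i j * y j)) / 2"
      by (simp add: m_def distrib_left sum.distrib add_divide_distrib sum_divide_distrib)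
    then show "act g (m x y) i = m (act g x) (act g y) i"
      by (simp add: act_def m_def field_simps)
  qed
  have Hu_act: "act g x \<in> Hu" if "x \<in> Hu" "g \<in> carrier G" for x g
    using that(1) unfolding Hu_def
  proof induction
    case (base x)
    then obtain h where h: "h \<in> carrier G" "x = act h x0" by auto
    then have "act g x = act (g \<otimes>\<^bsub>G\<^esub> h) x0" using act_mult that(2) by simp
    then show ?case using h(1) that(2) by (intro mid_hull.base) auto
  next
    case (mid x y)
    have "m (act g x) (act g y) \<in> mid_hull {act g x0 | g. g \<in> carrier G}"
      unfolding m_def by (rule mid_hull.mid[OF mid.IH])
    then show ?case unfolding actmid[symmetric] by (simp only: m_def)
  qed
  have Hu_mid: "m x y \<in> Hu" if "x \<in> Hu" "y \<in> Hu" for x y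
    using that unfolding Hu_def m_def by (rule mid_hull.mid)
  have Hu_off: "x i = 0" if "x \<in> Hu" "i \<notin> I" for x i
    using that(1) unfolding Hu_def by induction (use that(2) in \<open>auto simp: act_def\<close>)
  \<comment> \<open>Bounds \<open>N\<close> on the orbit of \<open>x0\<close> and, by convexity, on
    its hull, so that the supremum \<open>f\<close> below is finite.\<close>
  define M where "M = (\<Sum>i\<in>I. (C * (\<Sum>j\<in>I. cmod (x0 j)) + C)\<^sup>2)"
  have M: "N x \<le> M" if "x \<in> Hu" for x
    using that unfolding Hu_def
  proof induction
    case (base x)
    then obtain g where g: "g \<in> carrier G" "x = act g x0" by auto
    have "cmod (x i) \<le> C * (\<Sum>j\<in>I. cmod (x0 j)) + C" if i: "i \<in> I" for i
    proof -
      have "cmod (\<Sum>j\<in>I. K g i j * x0 j) \<le> (\<Sum>j\<in>I. C * cmod (x0 j))"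
        using K[OF g(1) i] by (auto intro!: sum_norm_le simp: norm_mult mult_right_mono)
      then show ?thesis
        using b[OF g(1) i] i unfolding g act_def
        by (simp add: sum_distrib_left) (smt (verit) norm_triangle_ineq)
    qed
    then show ?case unfolding M_def N_def by (intro sum_mono power_mono) auto
  next
    case (mid x y)
    have avg: "(a + b) / 2 - c / 4 \<le> M" if "a \<le> M" "b \<le> M" "0 \<le> c" for a b c :: real
      using that by argo
    show ?case using avg[OF mid.IH N0[of "\<lambda>i. x i - y i"]] unfolding Nmid[symmetric] by (simp only: m_def)
  qed
  define f where "f x = (SUP g\<in>carrier G. N (act g x))" for x
  have bdd: "bdd_above ((\<lambda>g. N (act g x)) ` carrier G)" if "x \<in> Hu" for x
    using M Hu_act that by (intro bdd_aboveI[of _ M]) auto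
  have f_ge: "N (act g x) \<le> f x" if "x \<in> Hu" "g \<in> carrier G" for x g
    unfolding f_def using bdd that by (intro cSUP_upper) auto
  have f0: "f x \<ge> 0" if "x \<in> Hu" for x
    using f_ge[OF that one_closed] N0 order_trans by blast
  have f_act: "f (act g x) \<le> f x" if "x \<in> Hu" "g \<in> carrier G" for x g
    unfolding f_def[of "act g x"] using that act_mult f_ge
    by (intro cSUP_least) (auto simp: carrier_not_empty simp flip: act_mult)
  \<comment> \<open>The gain in the parallelogram law survives the supremum over \<open>g\<close>:
    since \<open>x - y\<close> is recovered from \<open>act g x - act g y\<close> by the inverse of
    \<open>g\<close>, the latter cannot be smaller than the former by more than the factor
    \<open>D\<close>.\<close>
  have key: "f (m x y) \<le> (f x + f y) / 2 - N (\<lambda>i. x i - y i) / (4 * D)" if xy: "x \<in> Hu" "y \<in> Hu" for x y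
    unfolding f_def[of "m x y"]
  proof (intro cSUP_least)
    fix g assume g: "g \<in> carrier G"
    have inv: "act (inv\<^bsub>G\<^esub> g) (act g z) = z" if "z \<in> Hu" for z
      using act_mult[of "inv\<^bsub>G\<^esub> g" g z] act_one[of z] g Hu_off[OF that] by auto
    have "N (\<lambda>i. x i - y i) \<le> D * N (\<lambda>i. act g x i - act g y i)"
      using lip[of "inv\<^bsub>G\<^esub> g" "act g x" "act g y"] g inv xy by auto
    then have "N (\<lambda>i. x i - y i) / (4 * D) \<le> N (\<lambda>i. act g x i - act g y i) / 4"
      using D0 by (simp add: field_simps)
    then show "N (act g (m x y)) \<le> (f x + f y) / 2 - N (\<lambda>i. x i - y i) / (4 * D)"
      unfolding actmid Nmid using f_ge[OF xy(1) g] f_ge[OF xy(2) g] by argo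
  qed (simp add: carrier_not_empty)
  define mu where "mu = Inf (f ` Hu)"
  have "act \<one>\<^bsub>G\<^esub> x0 \<in> Hu" unfolding Hu_def by (rule mid_hull.base) auto
  then have Hu_ne: "Hu \<noteq> {}" by auto
  have bdb: "bdd_below (f ` Hu)" using f0 by (intro bdd_belowI[of _ 0]) auto
  have mu: "mu \<le> f x" if "x \<in> Hu" for x
    unfolding mu_def using bdb that by (intro cINF_lower)
  have "\<exists>x\<in>Hu. f x < mu + 1 / Suc k" for k
    using cInf_lessD[of "f ` Hu" "mu + 1 / Suc k"] Hu_ne unfolding mu_def by force
  then obtain s where s: "\<And>k. s k \<in> Hu" "\<And>k. f (s k) < mu + 1 / Suc k" by metis
  have close: "N (\<lambda>i. x i - y i) \<le> 2 * D * ((f x - mu) + (f y - mu))" if "x \<in> Hu" "y \<in> Hu" for x y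
  proof -
    have "N (\<lambda>i. x i - y i) / (4 * D) \<le> ((f x - mu) + (f y - mu)) / 2"
      using key[OF that] mu[OF Hu_mid[OF that]] by argo
    then show ?thesis using D0 by (simp add: field_simps)
  qed
  have coord: "cmod (x i) \<le> sqrt (N x)" if "i \<in> I" for x i
    using that fin unfolding N_def by (intro real_le_rsqrt member_le_sum[of i I]) auto
  have "\<exists>l. (\<lambda>k. s k i) \<longlonglongrightarrow> l" for i
  proof (cases "i \<in> I")
    case True
    have "Cauchy (\<lambda>k. s k i)"
    proof (rule CauchyI)
      fix e :: real assume e: "e > 0"
      \<comment> \<open>By \<open>close\<close>, points of index at least \<open>k0\<close> differ
        by at most \<open>2 * D * (2 / Suc k0)\<close> in \<open>N\<close>; this choice makes it
        less than the square of \<open>e\<close>.\<close>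
      obtain k0 :: nat where k0: "k0 > 4 * D / e\<^sup>2" using reals_Archimedean2 by blast
      have "cmod (s k i - s l i) < e" if "k \<ge> k0" "l \<ge> k0" for k l
      proof -
        have "1 / real (Suc k) \<le> 1 / Suc k0" "1 / real (Suc l) \<le> 1 / Suc k0"
          using that by (auto simp: frac_le)
        then have "(f (s k) - mu) + (f (s l) - mu) \<le> 2 / Suc k0"
          using s(2)[of k] s(2)[of l] by simp
        then have "2 * D * ((f (s k) - mu) + (f (s l) - mu)) \<le> 2 * D * (2 / Suc k0)"
          using D0 by (intro mult_left_mono) auto
        also have "\<dots> < e\<^sup>2"
        proof -
          have "4 * D < e\<^sup>2 * k0" using k0 e by (simp add: field_simps)
          also have "\<dots> \<le> e\<^sup>2 * Suc k0" by (simp add: mult_left_mono)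
          finally show ?thesis by (simp add: field_simps)
        qed
        finally have "N (\<lambda>i. s k i - s l i) < e\<^sup>2" using close[OF s(1) s(1), of k l] by simp
        then have "sqrt (N (\<lambda>i. s k i - s l i)) < e"
          using e by (metis abs_of_pos real_sqrt_abs real_sqrt_less_iff)
        then show ?thesis using coord[OF True, of "\<lambda>i. s k i - s l i"] by simp
      qed
      then show "\<exists>M. \<forall>m\<ge>M. \<forall>n\<ge>M. cmod (s m i - s n i) < e" by blast
    qed
    then show ?thesis using Cauchy_convergent_iff convergent_def by metis
  next
    case False
    then show ?thesis using Hu_off[OF s(1)] by (intro exI[of _ 0]) simp
  qed
  then obtain x where x: "\<And>i. (\<lambda>k. s k i) \<longlonglongrightarrow> x i" by metis
  have "act g x = x" if g: "g \<in> carrier G" for g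
  proof
    fix i
    show "act g x i = x i"
    proof (cases "i \<in> I")
      case True
      have "(\<lambda>k. act g (s k) i) \<longlonglongrightarrow> act g x i"
        using True unfolding act_def by (auto intro!: tendsto_intros x)
      then have 1: "(\<lambda>k. act g (s k) i - s k i) \<longlonglongrightarrow> act g x i - x i" by (intro tendsto_diff x)
      \<comment> \<open>Since \<open>f\<close> does not increase under \<open>act g\<close>, the
        translated sequence is minimizing at the same rate, and \<open>close\<close> compares it
        with the original one.\<close>
      have bd: "cmod (act g (s k) i - s k i) \<le> sqrt (4 * D * (1 / Suc k))" for k
      proof -
        have "N (\<lambda>i. act g (s k) i - s k i) \<le> 2 * D * ((f (act g (s k)) - mu) + (f (s k) - mu))"
          using close[OF Hu_act[OF s(1) g] s(1)] .
        also have "\<dots> \<le> 2 * D * (2 * (1 / Suc k))"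
          using f_act[OF s(1) g, of k] s(2)[of k] D0 by (intro mult_left_mono) auto
        also have "\<dots> = 4 * D * (1 / Suc k)" by (simp only: mult.assoc mult.left_commute)
        finally have "sqrt (N (\<lambda>i. act g (s k) i - s k i)) \<le> sqrt (4 * D * (1 / Suc k))"
          by (rule real_sqrt_le_mono)
        with coord[OF True, of "\<lambda>i. act g (s k) i - s k i"] show ?thesis by (rule order_trans)
      qed
      have "(\<lambda>k. sqrt (4 * D * (1 / Suc k))) \<longlonglongrightarrow> sqrt (4 * D * 0)"
        by (intro tendsto_intros LIMSEQ_Suc lim_1_over_n)
      then have "(\<lambda>k. sqrt (4 * D * (1 / Suc k))) \<longlonglongrightarrow> 0"
        by (simp only: mult_zero_right real_sqrt_zero)
      from Lim_null_comparison[OF always_eventually[OF allI[OF bd]] this]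
      show ?thesis using LIMSEQ_unique[OF 1] by (metis right_minus_eq)
    next
      case False
      have "(\<lambda>k. s k i) = (\<lambda>k. 0)" using Hu_off[OF s(1) False] by (intro ext)
      then have "x i = 0" using x[of i] by (simp only: LIMSEQ_const_iff)
      then show ?thesis using False by (simp add: act_def)
    qed
  qed
  then show thesis using that s(1) x unfolding Hu_def by blast
qed



section \<open>Invertible complex matrices and the rank normal form\<close>

lemma invertible_matE:
  fixes P :: "complex mat"
  assumes "invertible_mat P" "P \<in> carrier_mat n n"
  obtains Q where "Q \<in> carrier_mat n n" "P * Q = 1\<^sub>m n" "Q * P = 1\<^sub>m n"
proof -
  from assms obtain Q where PQ: "P * Q = 1\<^sub>m (dim_row P)" and QP: "Q * P = 1\<^sub>m (dim_row Q)"
    unfolding invertible_mat_def inverts_mat_def by blast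
  have "Q \<in> carrier_mat n n"
    using arg_cong[OF PQ, of dim_col] arg_cong[OF QP, of dim_col] assms(2)
    by (intro carrier_matI) auto
  then show thesis using that PQ QP assms(2) by auto
qed

lemma invertible_matI:
  fixes P :: "complex mat"
  assumes "P \<in> carrier_mat n n" "Q \<in> carrier_mat n n" "P * Q = 1\<^sub>m n"
  shows "invertible_mat P"
  using assms mat_mult_left_right_inverse[OF assms]
  unfolding invertible_mat_def inverts_mat_def by auto

lemma invertible_mat_iff_det:
  fixes P :: "complex mat"
  assumes P: "P \<in> carrier_mat n n"
  shows "invertible_mat P \<longleftrightarrow> Determinant.det P \<noteq> 0"
proof
  assume "invertible_mat P"
  then obtain Q where Q: "Q \<in> carrier_mat n n" "P * Q = 1\<^sub>m n" using invertible_matE P by metis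
  then have "Determinant.det P * Determinant.det Q = 1" using det_mult[OF P Q(1)] by simp
  then show "Determinant.det P \<noteq> 0" by auto
next
  assume "Determinant.det P \<noteq> 0"
  then have "P * ((1 / Determinant.det P) \<cdot>\<^sub>m adj_mat P) = 1\<^sub>m n"
    using adj_mat[OF P] P by (simp add: mult_smult_distrib[of _ n n _ n]) auto
  then show "invertible_mat P" using P adj_mat(1)[OF P] by (intro invertible_matI) auto
qed

lemma invertible_one_mat [simp]: "invertible_mat (1\<^sub>m n :: complex mat)"
  by (rule invertible_matI[of _ n "1\<^sub>m n"]) auto

lemma invertible_mat_times:
  fixes P Q :: "complex mat"
  assumes "invertible_mat P" "invertible_mat Q" "P \<in> carrier_mat n n" "Q \<in> carrier_mat n n"
  shows "invertible_mat (P * Q)"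
  using assms det_mult[of P n Q] invertible_mat_iff_det[of _ n] by auto

text \<open>Along the line, the determinant is a polynomial in \<open>z\<close> that does not vanish
  at 0. It is obtained as the determinant of a matrix \<open>M\<close> of linear polynomials, since
  evaluation is a ring homomorphism.\<close>

lemma finite_singular_pencil:
  fixes A B :: "complex mat"
  assumes A: "A \<in> carrier_mat n n" and B: "B \<in> carrier_mat n n" and inv: "invertible_mat A"
  shows "finite {z. \<not> invertible_mat (A + z \<cdot>\<^sub>m B)}"
proof -
  define M where "M = mat n n (\<lambda>ij. [:A $$ ij, B $$ ij:])"
  have ev: "poly (Determinant.det M) z = Determinant.det (A + z \<cdot>\<^sub>m B)" for z
  proof -
    interpret comm_ring_hom "\<lambda>p. poly p z" by unfold_locales auto
    have "map_mat (\<lambda>p. poly p z) M = A + z \<cdot>\<^sub>m B"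
      using A B by (intro eq_matI) (auto simp: M_def)
    then show ?thesis using hom_det[of M] by simp
  qed
  have "A + 0 \<cdot>\<^sub>m B = A" using A B by (intro eq_matI) auto
  then have "poly (Determinant.det M) 0 \<noteq> 0"
    using inv invertible_mat_iff_det[OF A] by (simp add: ev)
  then have "finite {z. poly (Determinant.det M) z = 0}" by (intro poly_roots_finite) auto
  moreover have "invertible_mat (A + z \<cdot>\<^sub>m B) \<longleftrightarrow> Determinant.det (A + z \<cdot>\<^sub>m B) \<noteq> 0" for z
    using A B by (intro invertible_mat_iff_det) auto
  ultimately show ?thesis by (simp add: ev)
qed

text \<open>A complex line meets the singular matrices in finitely many points, which a path avoids.\<close>

lemma path_in_invertible_pencil:
  fixes A B :: "complex mat"
  assumes A: "A \<in> carrier_mat n n" "invertible_mat A" and B: "B \<in> carrier_mat n n" "invertible_mat B"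
  obtains \<gamma> :: "real \<Rightarrow> complex" where "continuous_on {0..1} \<gamma>" "\<gamma> 0 = 0" "\<gamma> 1 = 1"
    "\<And>t. t \<in> {0..1} \<Longrightarrow> invertible_mat (A + \<gamma> t \<cdot>\<^sub>m (B - A))"
proof -
  define S where "S = {z. \<not> invertible_mat (A + z \<cdot>\<^sub>m (B - A))}"
  have "finite S" unfolding S_def using A B by (intro finite_singular_pencil) auto
  then have pc: "path_connected (- S)"
    by (intro path_connected_complement_countable) (auto simp: countable_finite)
  have "A + 0 \<cdot>\<^sub>m (B - A) = A" "A + 1 \<cdot>\<^sub>m (B - A) = B" using A B by (auto intro!: eq_matI)
  then have "0 \<in> - S" "1 \<in> - S" using A B by (auto simp: S_def)
  then obtain g where "path g" "path_image g \<subseteq> - S" "pathstart g = 0" "pathfinish g = 1"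
    using pc unfolding path_connected_def by blast
  then show thesis
    by (intro that[of g]) (auto simp: path_def path_image_def pathstart_def pathfinish_def S_def
        image_subset_iff)
qed

definition perm_mat :: "nat \<Rightarrow> (nat \<Rightarrow> nat) \<Rightarrow> complex mat" where
  "perm_mat n \<sigma> = mat n n (\<lambda>(i, j). if j = \<sigma> i then 1 else 0)"

lemma perm_mat_carrier [simp]: "perm_mat n \<sigma> \<in> carrier_mat n n"
  by (simp add: perm_mat_def)

lemma perm_mat_mult_left:
  assumes A: "A \<in> carrier_mat n m" and \<sigma>: "\<And>i. i < n \<Longrightarrow> \<sigma> i < n"
  shows "perm_mat n \<sigma> * A = mat n m (\<lambda>(i, j). A $$ (\<sigma> i, j))"
proof (rule eq_matI, goal_cases)
  case (1 i j)
  then have "(perm_mat n \<sigma> * A) $$ (i, j) = (\<Sum>k = 0..<n. (if k = \<sigma> i then 1 else 0) * A $$ (k, j))"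
    using A by (auto simp: perm_mat_def scalar_prod_def intro!: sum.cong)
  also have "\<dots> = A $$ (\<sigma> i, j)"
    using 1 \<sigma>[of i] by (subst sum.cong[OF refl, of _ _ "\<lambda>k. if k = \<sigma> i then A $$ (\<sigma> i, j) else 0"]) auto
  finally show ?case using 1 by simp
qed (use A in \<open>auto simp: perm_mat_def\<close>)

lemma perm_mat_mult_right:
  assumes A: "A \<in> carrier_mat m n" and \<sigma>: "\<And>i. i < n \<Longrightarrow> \<sigma> i < n \<and> \<tau> (\<sigma> i) = i"
    and \<tau>: "\<And>i. i < n \<Longrightarrow> \<tau> i < n \<and> \<sigma> (\<tau> i) = i"
  shows "A * perm_mat n \<tau> = mat m n (\<lambda>(i, j). A $$ (i, \<sigma> j))"
proof (rule eq_matI, goal_cases)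
  case (1 i j)
  then have "(A * perm_mat n \<tau>) $$ (i, j) = (\<Sum>k = 0..<n. A $$ (i, k) * (if j = \<tau> k then 1 else 0))"
    using A by (auto simp: perm_mat_def scalar_prod_def intro!: sum.cong)
  also have "\<dots> = (\<Sum>k = 0..<n. if k = \<sigma> j then A $$ (i, \<sigma> j) else 0)"
    using 1 \<sigma> \<tau> by (intro sum.cong) auto
  also have "\<dots> = A $$ (i, \<sigma> j)"
    using 1 \<sigma>[of j] by auto
  finally show ?case using 1 by simp
qed (use A in \<open>auto simp: perm_mat_def\<close>)

lemma invertible_perm_mat:
  assumes \<sigma>: "\<And>i. i < n \<Longrightarrow> \<sigma> i < n \<and> \<tau> (\<sigma> i) = i"
    and \<tau>: "\<And>i. i < n \<Longrightarrow> \<tau> i < n \<and> \<sigma> (\<tau> i) = i"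
  shows "invertible_mat (perm_mat n \<sigma>)"
proof (rule invertible_matI)
  have "perm_mat n \<sigma> * perm_mat n \<tau> = mat n n (\<lambda>(i, j). perm_mat n \<tau> $$ (\<sigma> i, j))"
    using \<sigma> by (intro perm_mat_mult_left) auto
  also have "\<dots> = 1\<^sub>m n" using \<sigma> by (intro eq_matI) (auto simp: perm_mat_def)
  finally show "perm_mat n \<sigma> * perm_mat n \<tau> = 1\<^sub>m n" .
qed auto

abbreviation diag_block :: "complex mat \<Rightarrow> complex mat \<Rightarrow> complex mat" where
  "diag_block A B \<equiv> four_block_mat A (0\<^sub>m (dim_row A) (dim_col B)) (0\<^sub>m (dim_row B) (dim_col A)) B"

lemma diag_block_times:
  assumes "A \<in> carrier_mat a b" "B \<in> carrier_mat c d" "A' \<in> carrier_mat b e" "B' \<in> carrier_mat d f"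
  shows "diag_block A B * diag_block A' B' = diag_block (A * A') (B * B')"
  using assms
  by (subst mult_four_block_mat[of _ a b _ d _ c _ _ e _ f]) (auto intro!: cong_four_block_mat)

lemma invertible_diag_block:
  assumes "A \<in> carrier_mat a a" "B \<in> carrier_mat b b" "invertible_mat A" "invertible_mat B"
  shows "invertible_mat (diag_block A B)"
proof -
  obtain A' where A': "A' \<in> carrier_mat a a" "A * A' = 1\<^sub>m a" using assms invertible_matE by metis
  obtain B' where B': "B' \<in> carrier_mat b b" "B * B' = 1\<^sub>m b" using assms invertible_matE by metis
  have "diag_block A B * diag_block A' B' = 1\<^sub>m (a + b)"
    using A' B' assms by (subst diag_block_times[of _ a a _ b b _ a _ b]) auto
  then show ?thesis using assms A' B' by (intro invertible_matI[of _ "a + b" "diag_block A' B'"]) auto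
qed

lemma invertible_lower_unitriangular:
  assumes "X \<in> carrier_mat b a"
  shows "invertible_mat (four_block_mat (1\<^sub>m a) (0\<^sub>m a b) X (1\<^sub>m b) :: complex mat)"
proof (rule invertible_matI)
  show "four_block_mat (1\<^sub>m a) (0\<^sub>m a b) X (1\<^sub>m b) * four_block_mat (1\<^sub>m a) (0\<^sub>m a b) (- X) (1\<^sub>m b) = 1\<^sub>m (a + b)"
    using assms by (subst mult_four_block_mat[of _ a a _ b _ b _ _ a _ b]) (auto intro!: eq_matI)
qed (use assms in auto)

lemma invertible_upper_unitriangular:
  assumes "X \<in> carrier_mat a b"
  shows "invertible_mat (four_block_mat (1\<^sub>m a) X (0\<^sub>m b a) (1\<^sub>m b) :: complex mat)"
proof (rule invertible_matI)
  show "four_block_mat (1\<^sub>m a) X (0\<^sub>m b a) (1\<^sub>m b) * four_block_mat (1\<^sub>m a) (- X) (0\<^sub>m b a) (1\<^sub>m b) = 1\<^sub>m (a + b)"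
    using assms by (subst mult_four_block_mat[of _ a a _ b _ b _ _ a _ b]) (auto intro!: eq_matI)
qed (use assms in auto)

lemma assoc_mult_mat5:
  assumes "L \<in> carrier_mat a b" "P \<in> carrier_mat b c" "A \<in> carrier_mat c d" "Q \<in> carrier_mat d e"
    "R \<in> carrier_mat e f"
  shows "L * P * A * (Q * R) = L * (P * A * Q) * (R :: 'a :: semiring_0 mat)"
proof -
  have 1: "L * P * A * (Q * R) = L * P * A * Q * R"
    by (rule assoc_mult_mat[symmetric, of _ a d _ e _ f]) (use assms in \<open>auto intro!: mult_carrier_mat\<close>)
  have 2: "L * P * A = L * (P * A)" by (rule assoc_mult_mat) (fact assms)+
  have 3: "L * (P * A) * Q = L * (P * A * Q)"
    by (rule assoc_mult_mat[of _ a b _ d _ e]) (use assms in \<open>auto intro!: mult_carrier_mat\<close>)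
  show ?thesis
    by (rule trans[OF 1 trans[OF arg_cong[OF 2, of "\<lambda>X. X * Q * R"] arg_cong[OF 3, of "\<lambda>X. X * R"]]])
qed

text \<open>One step of Gaussian elimination: a nonzero entry is moved to the corner by two
  transpositions, and its row and column are cleared.\<close>

lemma eliminate_pivot:
  fixes A :: "complex mat"
  assumes A: "A \<in> carrier_mat (Suc m) (Suc n)" and ij: "i < Suc m" "j < Suc n" "A $$ (i, j) \<noteq> 0"
  obtains P Q D where "P \<in> carrier_mat (Suc m) (Suc m)" "Q \<in> carrier_mat (Suc n) (Suc n)"
    "invertible_mat P" "invertible_mat Q" "D \<in> carrier_mat m n" "P * A * Q = diag_block (1\<^sub>m 1) D"
proof -
  define s where "s = Transposition.transpose 0 i"
  define t where "t = Transposition.transpose 0 j"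
  have s: "k < Suc m \<Longrightarrow> s k < Suc m \<and> s (s k) = k" for k
    using ij by (auto simp: s_def Transposition.transpose_def)
  have t: "k < Suc n \<Longrightarrow> t k < Suc n \<and> t (t k) = k" for k
    using ij by (auto simp: t_def Transposition.transpose_def)
  have s0: "s 0 = i" and t0: "t 0 = j" by (auto simp: s_def t_def)
  define B where "B = perm_mat (Suc m) s * A * perm_mat (Suc n) t"
  have B: "B \<in> carrier_mat (1 + m) (1 + n)"
    unfolding B_def using mult_carrier_mat[OF mult_carrier_mat[OF perm_mat_carrier A] perm_mat_carrier] by simp
  define d where "d = A $$ (i, j)"
  have Bd: "B $$ (0, 0) = d"
    unfolding B_def using s t A ij
    by (subst perm_mat_mult_right[of _ "Suc m" _ t]) (auto simp: perm_mat_mult_left[OF A] d_def s0 t0)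
  define r where "r = mat 1 n (\<lambda>(_, l). B $$ (0, Suc l))"
  define c where "c = mat m 1 (\<lambda>(k, _). B $$ (Suc k, 0))"
  define E where "E = mat m n (\<lambda>(k, l). B $$ (Suc k, Suc l))"
  have c1: "r \<in> carrier_mat 1 n" "c \<in> carrier_mat m 1" "E \<in> carrier_mat m n"
    by (auto simp: r_def c_def E_def)
  have split: "B = four_block_mat (d \<cdot>\<^sub>m 1\<^sub>m 1) r c E"
    using B c1 by (intro eq_matI) (auto simp: r_def c_def E_def Bd gr0_conv_Suc)
  \<comment> \<open>\<open>L\<close> divides the first row by the pivot \<open>d\<close> and clears
    the column \<open>c\<close> below it; \<open>R\<close> then clears the remainder of the first
    row.\<close>
  define L where "L = four_block_mat ((1/d) \<cdot>\<^sub>m 1\<^sub>m 1) (0\<^sub>m 1 m) (- ((1/d) \<cdot>\<^sub>m c)) (1\<^sub>m m)"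
  define R where "R = four_block_mat (1\<^sub>m 1) (- ((1/d) \<cdot>\<^sub>m r)) (0\<^sub>m n 1) (1\<^sub>m n)"
  \<comment> \<open>The Schur complement of the pivot.\<close>
  define D where "D = - ((1/d) \<cdot>\<^sub>m c) * r + E"
  have cD: "D \<in> carrier_mat m n" "L \<in> carrier_mat (1 + m) (1 + m)" "R \<in> carrier_mat (1 + n) (1 + n)"
    using c1 by (auto simp: D_def L_def R_def)
  have d: "d \<noteq> 0" using ij d_def by simp
  have "L * B = four_block_mat (1\<^sub>m 1) ((1/d) \<cdot>\<^sub>m r) (0\<^sub>m m 1) D"
    unfolding L_def split using c1 d
    by (subst mult_four_block_mat[of _ 1 1 _ m _ m _ _ 1 _ n])
      (auto intro!: cong_four_block_mat eq_matI simp: D_def scalar_prod_def)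
  then have LBR: "L * B * R = diag_block (1\<^sub>m 1) D"
    unfolding R_def using c1 cD
    by (simp, subst mult_four_block_mat[of _ 1 1 _ n _ m _ _ 1 _ n])
      (auto intro!: cong_four_block_mat eq_matI simp: scalar_prod_def)
  \<comment> \<open>The inverse of \<open>L\<close> is written down directly: it restores the pivot
    and the column below it.\<close>
  have "L * four_block_mat (d \<cdot>\<^sub>m 1\<^sub>m 1) (0\<^sub>m 1 m) c (1\<^sub>m m) = 1\<^sub>m (1 + m)"
    unfolding L_def using c1 d
    by (subst mult_four_block_mat[of _ 1 1 _ m _ m _ _ 1 _ m])
      (auto intro!: eq_matI simp: scalar_prod_def)
  then have iL: "invertible_mat L" using cD c1 by (intro invertible_matI[of _ "1 + m"]) auto
  have iR: "invertible_mat R" unfolding R_def using c1 by (intro invertible_upper_unitriangular) auto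
  show thesis
  proof (rule that[of "L * perm_mat (Suc m) s" "perm_mat (Suc n) t * R" D])
    have "L * perm_mat (Suc m) s * A * (perm_mat (Suc n) t * R) = L * B * R"
      unfolding B_def using cD A
      by (intro assoc_mult_mat5) auto
    then show "L * perm_mat (Suc m) s * A * (perm_mat (Suc n) t * R) = diag_block (1\<^sub>m 1) D" using LBR by simp
    show "invertible_mat (L * perm_mat (Suc m) s)"
      using cD s iL by (intro invertible_mat_times[of _ _ "Suc m"] invertible_perm_mat[of _ _ s]) auto
    show "invertible_mat (perm_mat (Suc n) t * R)"
      using cD t iR by (intro invertible_mat_times[of _ _ "Suc n"] invertible_perm_mat[of _ _ t]) auto
    show "L * perm_mat (Suc m) s \<in> carrier_mat (Suc m) (Suc m)"
      using cD by (intro mult_carrier_mat[of _ _ "Suc m"]) auto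
    show "perm_mat (Suc n) t * R \<in> carrier_mat (Suc n) (Suc n)"
      using cD by (intro mult_carrier_mat[of _ _ "Suc n"]) auto
  qed fact
qed

text \<open>Induction on the number of rows by \<open>eliminate_pivot\<close>. The last clause will
  ensure that a nonzero intertwiner splits off a summand of positive degree, so that the induction
  in \<open>maximal_common_summand\<close> makes progress.\<close>

lemma rank_normal_form:
  fixes A :: "complex mat"
  assumes "A \<in> carrier_mat m n"
  obtains P Q k where "P \<in> carrier_mat m m" "Q \<in> carrier_mat n n" "invertible_mat P" "invertible_mat Q"
    "k \<le> m" "k \<le> n" "P * A * Q = diag_block (1\<^sub>m k) (0\<^sub>m (m - k) (n - k))" "A \<noteq> 0\<^sub>m m n \<Longrightarrow> k > 0"
proof -
  have "\<exists>P Q k. P \<in> carrier_mat m m \<and> Q \<in> carrier_mat n n \<and> invertible_mat P \<and> invertible_mat Q \<and>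
      k \<le> m \<and> k \<le> n \<and> P * A * Q = diag_block (1\<^sub>m k) (0\<^sub>m (m - k) (n - k)) \<and> (A \<noteq> 0\<^sub>m m n \<longrightarrow> k > 0)"
    using assms
  proof (induction m arbitrary: n A)
    case 0
    then show ?case
      by (intro exI[of _ "1\<^sub>m 0"] exI[of _ "1\<^sub>m n"] exI[of _ 0])
        (auto intro!: eq_matI)
  next
    case (Suc m)
    show ?case
    proof (cases "A = 0\<^sub>m (Suc m) n")
      case True
      then show ?thesis
        by (intro exI[of _ "1\<^sub>m (Suc m)"] exI[of _ "1\<^sub>m n"] exI[of _ 0])
          (auto intro!: eq_matI)
    next
      case False
      then obtain i j where ij: "i < Suc m" "j < n" "A $$ (i, j) \<noteq> 0"
        using Suc.prems by (metis carrier_matD eq_matI index_zero_mat)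
      then obtain n' where n: "n = Suc n'" by (cases n) auto
      obtain P Q D where PQ: "P \<in> carrier_mat (Suc m) (Suc m)" "Q \<in> carrier_mat n n"
        "invertible_mat P" "invertible_mat Q" "D \<in> carrier_mat m n'" "P * A * Q = diag_block (1\<^sub>m 1) D"
        using eliminate_pivot[of A m n' i j] Suc.prems ij n by metis
      obtain P' Q' k where P': "P' \<in> carrier_mat m m" "Q' \<in> carrier_mat n' n'" "invertible_mat P'"
        "invertible_mat Q'" "k \<le> m" "k \<le> n'" "P' * D * Q' = diag_block (1\<^sub>m k) (0\<^sub>m (m - k) (n' - k))"
        using Suc.IH[OF PQ(5)] by blast
      define L where "L = diag_block (1\<^sub>m 1) P'"
      define R where "R = diag_block (1\<^sub>m 1) Q'"
      have LR: "L \<in> carrier_mat (Suc m) (Suc m)" "R \<in> carrier_mat n n" "invertible_mat L" "invertible_mat R"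
        unfolding L_def R_def n using P'
        using invertible_diag_block[of "1\<^sub>m 1" 1 P' m] invertible_diag_block[of "1\<^sub>m 1" 1 Q' n'] by auto
      have "L * P * A * (Q * R) = L * (P * A * Q) * R"
        using LR PQ Suc.prems
        by (intro assoc_mult_mat5) auto
      also have "\<dots> = diag_block (1\<^sub>m 1) (P' * D * Q')"
      proof -
        have 1: "L * (P * A * Q) = diag_block (1\<^sub>m 1 * 1\<^sub>m 1) (P' * D)"
          unfolding PQ(6) L_def by (rule diag_block_times) (use P'(1) PQ(5) in auto)
        have 2: "diag_block (1\<^sub>m 1 * 1\<^sub>m 1) (P' * D) * R = diag_block (1\<^sub>m 1 * 1\<^sub>m 1 * 1\<^sub>m 1) (P' * D * Q')"
          unfolding R_def by (rule diag_block_times[of _ 1 1 _ m n' _ 1 _ n']) (use P'(1,2) PQ(5) in auto)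
        show ?thesis unfolding 1 2 by simp
      qed
      also have "\<dots> = diag_block (1\<^sub>m (Suc k)) (0\<^sub>m (Suc m - Suc k) (n - Suc k))"
        unfolding P'(7) n using P' by (intro eq_matI) auto
      finally show ?thesis using LR PQ P' n
        by (intro exI[of _ "L * P"] exI[of _ "Q * R"] exI[of _ "Suc k"])
          (auto intro!: invertible_mat_times mult_carrier_mat)
    qed
  qed
  then show thesis using that by metis
qed

section \<open>Families of affine actions on matrices\<close>

lemma triple_product_entry:
  assumes "D \<in> carrier_mat q q" "X \<in> carrier_mat q p" "A \<in> carrier_mat p p" "i < q" "j < p"
  shows "(D * X * A) $$ (i, j) = (\<Sum>k<q. \<Sum>l<p. D $$ (i, k) * A $$ (l, j) * (X $$ (k, l) :: complex))"
proof -
  have "(D * X * A) $$ (i, j) = (\<Sum>k<q. D $$ (i, k) * (\<Sum>l<p. X $$ (k, l) * A $$ (l, j)))"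
    using assms by (simp add: scalar_prod_def lessThan_atLeast0)
  then show ?thesis by (simp add: sum_distrib_left mult.commute mult.left_commute)
qed

text \<open>
  For finitely many parameters \<open>t\<close> this is \<open>affine_fixed_point\<close>; the general case follows by
  compactness.  The last two clauses make the fixed points depend continuously on \<open>t\<close> when the
  action does: they replace averaging over a Haar measure.
\<close>

lemma equivariant_family:
  fixes G :: "('g, 'm) monoid_scheme" and D A B :: "'t \<Rightarrow> 'g \<Rightarrow> complex mat"
  assumes "group G"
    and carD: "\<And>t g. g \<in> carrier G \<Longrightarrow> D t g \<in> carrier_mat q q"
    and carA: "\<And>t g. g \<in> carrier G \<Longrightarrow> A t g \<in> carrier_mat p p"
    and carB: "\<And>t g. g \<in> carrier G \<Longrightarrow> B t g \<in> carrier_mat q p"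
    and bounded: "\<And>t. \<exists>C. \<forall>g\<in>carrier G. (\<forall>i<q. \<forall>j<q. cmod (D t g $$ (i, j)) \<le> C) \<and>
        (\<forall>i<p. \<forall>j<p. cmod (A t g $$ (i, j)) \<le> C) \<and> (\<forall>i<q. \<forall>j<p. cmod (B t g $$ (i, j)) \<le> C)"
    and one: "\<And>t. D t \<one>\<^bsub>G\<^esub> = 1\<^sub>m q" "\<And>t. A t \<one>\<^bsub>G\<^esub> = 1\<^sub>m p" "\<And>t. B t \<one>\<^bsub>G\<^esub> = 0\<^sub>m q p"
    and mult: "\<And>t g h. g \<in> carrier G \<Longrightarrow> h \<in> carrier G \<Longrightarrow> D t (g \<otimes>\<^bsub>G\<^esub> h) = D t g * D t h"
      "\<And>t g h. g \<in> carrier G \<Longrightarrow> h \<in> carrier G \<Longrightarrow> A t (g \<otimes>\<^bsub>G\<^esub> h) = A t h * A t g"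
      "\<And>t g h. g \<in> carrier G \<Longrightarrow> h \<in> carrier G \<Longrightarrow>
         B t (g \<otimes>\<^bsub>G\<^esub> h) = D t g * B t h * A t g + B t g"
    and X0: "X0 \<in> carrier_mat q p"
  defines "orb \<equiv> \<lambda>t g. D t g * X0 * A t g + B t g"
  obtains X where "\<And>t. X t \<in> carrier_mat q p"
    and "\<And>t g. g \<in> carrier G \<Longrightarrow> D t g * X t * A t g + B t g = X t"
    and "\<And>t t' i j e. i < q \<Longrightarrow> j < p \<Longrightarrow>
      (\<And>g. g \<in> carrier G \<Longrightarrow> cmod (orb t g $$ (i, j) - orb t' g $$ (i, j)) \<le> e) \<Longrightarrow>
      cmod (X t $$ (i, j) - X t' $$ (i, j)) \<le> e"
    and "\<And>t i j y e. i < q \<Longrightarrow> j < p \<Longrightarrow>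
      (\<And>g. g \<in> carrier G \<Longrightarrow> cmod (orb t g $$ (i, j) - y) \<le> e) \<Longrightarrow> cmod (X t $$ (i, j) - y) \<le> e"
proof -
  interpret group G by fact
  define lin where "lin t g x i j = (\<Sum>k<q. \<Sum>l<p. D t g $$ (i, k) * A t g $$ (l, j) * x (t, k, l)) + B t g $$ (i, j)"
    for t g and x :: "'t \<times> nat \<times> nat \<Rightarrow> complex" and i j
  define mx where "mx x t = mat q p (\<lambda>(k, l). x (t, k, l))" for x :: "'t \<times> nat \<times> nat \<Rightarrow> complex" and t
  have mx: "mx x t \<in> carrier_mat q p" for x t by (simp add: mx_def)
  have lin_mx: "(D t g * mx x t * A t g + B t g) $$ (i, j) = lin t g x i j"
    if "g \<in> carrier G" "i < q" "j < p" for t g x i j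
    using that carA carB[of g t] carD triple_product_entry[of "D t g" q "mx x t" p "A t g" i j] mx
    by (simp add: lin_def) (simp add: mx_def)
  have "\<exists>M. \<forall>g\<in>carrier G. \<forall>i<q. \<forall>j<p. cmod (orb t g $$ (i, j)) \<le> M" for t
  proof -
    obtain C where "\<forall>g\<in>carrier G. (\<forall>i<q. \<forall>j<q. cmod (D t g $$ (i, j)) \<le> C) \<and>
        (\<forall>i<p. \<forall>j<p. cmod (A t g $$ (i, j)) \<le> C) \<and> (\<forall>i<q. \<forall>j<p. cmod (B t g $$ (i, j)) \<le> C)"
      using bounded[of t] by (rule exE)
    note C = bspec[OF this]
    have "cmod (orb t g $$ (i, j)) \<le> (\<Sum>k<q. \<Sum>l<p. \<bar>C\<bar> * \<bar>C\<bar> * cmod (X0 $$ (k, l))) + \<bar>C\<bar>"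
      if g: "g \<in> carrier G" and "i < q" "j < p" for g i j
    proof -
      have "orb t g $$ (i, j) = (\<Sum>k<q. \<Sum>l<p. D t g $$ (i, k) * A t g $$ (l, j) * X0 $$ (k, l)) + B t g $$ (i, j)"
        using that carA carB[of g t] carD X0 triple_product_entry[of "D t g" q X0 p "A t g" i j]
        by (simp add: orb_def)
      also have "cmod \<dots> \<le> cmod (\<Sum>k<q. \<Sum>l<p. D t g $$ (i, k) * A t g $$ (l, j) * X0 $$ (k, l)) + cmod (B t g $$ (i, j))"
        by (rule norm_triangle_ineq)
      also have "\<dots> \<le> (\<Sum>k<q. \<Sum>l<p. \<bar>C\<bar> * \<bar>C\<bar> * cmod (X0 $$ (k, l))) + \<bar>C\<bar>"
      proof (intro add_mono sum_norm_le)
        fix k l assume "k \<in> {..<q}" "l \<in> {..<p}"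
        then have "cmod (D t g $$ (i, k)) \<le> \<bar>C\<bar>" "cmod (A t g $$ (l, j)) \<le> \<bar>C\<bar>"
          using C[OF g] that by (auto intro: order_trans[OF _ abs_ge_self])
        then show "cmod (D t g $$ (i, k) * A t g $$ (l, j) * X0 $$ (k, l)) \<le> \<bar>C\<bar> * \<bar>C\<bar> * cmod (X0 $$ (k, l))"
          unfolding norm_mult by (intro mult_mono) auto
      qed (use C[OF g] that in \<open>auto intro: order_trans[OF _ abs_ge_self]\<close>)
      finally show ?thesis .
    qed
    then show ?thesis by blast
  qed
  then obtain M where M: "\<And>t g i j. g \<in> carrier G \<Longrightarrow> i < q \<Longrightarrow> j < p \<Longrightarrow> cmod (orb t g $$ (i, j)) \<le> M t"
    by metis
  \<comment> \<open>The conditions on the unknown entries that concern only the parameters in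
    \<open>F\<close>: the fixed point equation, membership in every disc that contains the orbit,
    and the bound for differences between two parameters. All of them are closed, and
    \<open>Z\<close> shrinks as \<open>F\<close> grows.\<close>
  define Z where "Z F = {x. \<forall>t\<in>F. \<forall>i<q. \<forall>j<p. (\<forall>g\<in>carrier G. lin t g x i j = x (t, i, j)) \<and>
      (\<forall>y e. (\<forall>g\<in>carrier G. cmod (orb t g $$ (i, j) - y) \<le> e) \<longrightarrow> cmod (x (t, i, j) - y) \<le> e) \<and>
      (\<forall>t'\<in>F. \<forall>e. (\<forall>g\<in>carrier G. cmod (orb t g $$ (i, j) - orb t' g $$ (i, j)) \<le> e) \<longrightarrow>
         cmod (x (t, i, j) - x (t', i, j)) \<le> e)}" for F
  \<comment> \<open>Discs that contain the orbit coordinatewise. Their product is compact by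
    Tychonoff's theorem, whatever the number of parameters.\<close>
  define S where "S = (\<lambda>(t, i::nat, j::nat). cball (0::complex) \<bar>M t\<bar>)"
  have "compactin (product_topology (\<lambda>_. euclidean) UNIV) (PiE UNIV S)"
    unfolding compactin_PiE by (auto simp: S_def)
  then have compact: "compact (PiE UNIV S)" by (simp add: euclidean_product_topology)
  have closed: "closed (Z F)" for F
    unfolding Z_def lin_def Ball_def
    by (intro closed_Collect_all closed_Collect_conj closed_Collect_imp open_Collect_const
        closed_Collect_eq closed_Collect_le continuous_intros continuous_on_product_coordinates)
  have finite: "PiE UNIV S \<inter> Z F \<noteq> {}" if F: "finite F" for F
  proof -
    define I where "I = F \<times> {..<q} \<times> {..<p}"
    have finI: "finite I" using F by (simp add: I_def)
    \<comment> \<open>The action on all parameters in \<open>F\<close> simultaneously: it is block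
      diagonal, with one block for each parameter.\<close>
    define K where "K g = (\<lambda>(t, i, j) (t', k, l). if t = t' then D t g $$ (i, k) * A t g $$ (l, j) else 0)" for g
    define b where "b g = (\<lambda>(t, i, j). B t g $$ (i, j))" for g
    define act where "act g x i = (if i \<in> I then (\<Sum>j\<in>I. K g i j * x j) + b g i else 0)" for g x i
    have act_fold: "(\<lambda>i. if i \<in> I then (\<Sum>j\<in>I. K g i j * x j) + b g i else 0) = act g x" for g x
      by (rule ext) (simp add: act_def)
    have act_eq: "act g x (t, i, j) = lin t g x i j" if "t \<in> F" "i < q" "j < p" for g x t i j
    proof -
      have "(\<Sum>c\<in>I. K g (t, i, j) c * x c) =
          (\<Sum>t'\<in>F. \<Sum>k<q. \<Sum>l<p. (if t = t' then D t g $$ (i, k) * A t g $$ (l, j) else 0) * x (t', k, l))"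
        unfolding I_def sum.cartesian_product by (intro sum.cong) (auto simp: K_def)
      also have "\<dots> = (\<Sum>t'\<in>F. if t' = t then \<Sum>k<q. \<Sum>l<p. D t g $$ (i, k) * A t g $$ (l, j) * x (t, k, l) else 0)"
        by (intro sum.cong) auto
      also have "\<dots> = (\<Sum>k<q. \<Sum>l<p. D t g $$ (i, k) * A t g $$ (l, j) * x (t, k, l))"
        using F that by simp
      finally show ?thesis using that by (simp add: act_def lin_def b_def I_def)
    qed
    have mx_act: "mx (act g x) t = D t g * mx x t * A t g + B t g" if "t \<in> F" "g \<in> carrier G" for g x t
      using that lin_mx[of g _ _ t x] act_eq[of t _ _ g x] carB[of g t] carA[of g t] carD[of g t]
      by (intro eq_matI) (auto simp: mx_def)
    have act_ext: "x = y" if "\<And>c. c \<notin> I \<Longrightarrow> x c = 0" "\<And>c. c \<notin> I \<Longrightarrow> y c = 0" "\<And>t. t \<in> F \<Longrightarrow> mx x t = mx y t" for x y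
    proof
      fix c show "x c = y c"
      proof (cases "c \<in> I")
        case True
        then obtain t i j where c: "c = (t, i, j)" "t \<in> F" "i < q" "j < p" by (auto simp: I_def)
        then show ?thesis using arg_cong[OF that(3)[OF c(2)], of "\<lambda>M. M $$ (i, j)"] by (simp add: mx_def)
      qed (use that in auto)
    qed
    have off: "act g x c = 0" if "c \<notin> I" for g x c using that by (auto simp: act_def)
    from bounded have "\<forall>t. \<exists>C. \<forall>g\<in>carrier G. (\<forall>i<q. \<forall>j<q. cmod (D t g $$ (i, j)) \<le> C) \<and>
        (\<forall>i<p. \<forall>j<p. cmod (A t g $$ (i, j)) \<le> C) \<and> (\<forall>i<q. \<forall>j<p. cmod (B t g $$ (i, j)) \<le> C)"
      by (rule allI)
    from choice[OF this] obtain C where "\<forall>t. \<forall>g\<in>carrier G. (\<forall>i<q. \<forall>j<q. cmod (D t g $$ (i, j)) \<le> C t) \<and>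
        (\<forall>i<p. \<forall>j<p. cmod (A t g $$ (i, j)) \<le> C t) \<and> (\<forall>i<q. \<forall>j<p. cmod (B t g $$ (i, j)) \<le> C t)"
      by (rule exE)
    note C = bspec[OF spec[OF this]]
    \<comment> \<open>A single bound for both the entries of \<open>K\<close>, which are products of
      two bounded entries, and those of \<open>b\<close>; this accounts for the two
      summands.\<close>
    define C' where "C' = (\<Sum>t\<in>F. \<bar>C t\<bar>) + (\<Sum>t\<in>F. \<bar>C t\<bar>) * (\<Sum>t\<in>F. \<bar>C t\<bar>)"
    have CF: "\<bar>C t\<bar> \<le> (\<Sum>t\<in>F. \<bar>C t\<bar>)" if "t \<in> F" for t
      using that F by (intro member_le_sum) auto
    have CF0: "0 \<le> (\<Sum>t\<in>F. \<bar>C t\<bar>)" by (simp add: sum_nonneg)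
    have Kb: "cmod (K g c d) \<le> C'" if g: "g \<in> carrier G" and "c \<in> I" "d \<in> I" for g c d
    proof -
      obtain t i j t' k l where cd: "c = (t, i, j)" "d = (t', k, l)" by (metis prod_cases3)
      show ?thesis
      proof (cases "t = t'")
        case True
        have "C t \<le> (\<Sum>t\<in>F. \<bar>C t\<bar>)"
          by (rule order_trans[OF abs_ge_self CF]) (use that cd in \<open>auto simp: I_def\<close>)
        moreover have "cmod (D t g $$ (i, k)) \<le> C t" "cmod (A t g $$ (l, j)) \<le> C t"
          using C[OF g, of t] that cd by (auto simp: I_def)
        ultimately have "cmod (D t g $$ (i, k)) \<le> (\<Sum>t\<in>F. \<bar>C t\<bar>)" "cmod (A t g $$ (l, j)) \<le> (\<Sum>t\<in>F. \<bar>C t\<bar>)"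
          by simp_all
        then have "cmod (D t g $$ (i, k) * A t g $$ (l, j)) \<le> (\<Sum>t\<in>F. \<bar>C t\<bar>) * (\<Sum>t\<in>F. \<bar>C t\<bar>)"
          unfolding norm_mult by (intro mult_mono) (auto simp: CF0)
        then have "cmod (D t g $$ (i, k) * A t g $$ (l, j)) \<le> C'"
          unfolding C'_def by (rule add_increasing[OF CF0])
        then show ?thesis using True cd by (simp add: K_def)
      next
        case False
        then show ?thesis using CF0 cd by (simp add: K_def C'_def)
      qed
    qed
    have bb: "cmod (b g c) \<le> C'" if g: "g \<in> carrier G" and "c \<in> I" for g c
    proof -
      obtain t i j where c: "c = (t, i, j)" by (metis prod_cases3)
      have "C t \<le> (\<Sum>t\<in>F. \<bar>C t\<bar>)"
        by (rule order_trans[OF abs_ge_self CF]) (use that c in \<open>auto simp: I_def\<close>)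
      moreover have "cmod (B t g $$ (i, j)) \<le> C t"
        using C[OF g, of t] that c by (auto simp: I_def)
      ultimately have "cmod (B t g $$ (i, j)) \<le> (\<Sum>t\<in>F. \<bar>C t\<bar>)" by simp
      also have "\<dots> \<le> C'" using CF0 by (simp add: C'_def)
      finally show ?thesis by (simp add: c b_def)
    qed
    have act_one: "act \<one>\<^bsub>G\<^esub> x = x" if "\<And>c. c \<notin> I \<Longrightarrow> x c = 0" for x
    proof (rule act_ext[OF off that])
      show "mx (act \<one>\<^bsub>G\<^esub> x) t = mx x t" if "t \<in> F" for t
        using that mx[of x t] by (simp add: mx_act one)
    qed auto
    have act_mult: "act (g \<otimes>\<^bsub>G\<^esub> h) x = act g (act h x)" if gh: "g \<in> carrier G" "h \<in> carrier G" for g h x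
    proof (rule act_ext[OF off off])
      fix t assume t: "t \<in> F"
      have c: "D t g \<in> carrier_mat q q" "D t h \<in> carrier_mat q q" "A t g \<in> carrier_mat p p" "A t h \<in> carrier_mat p p"
        "B t g \<in> carrier_mat q p" "B t h \<in> carrier_mat q p" "mx x t \<in> carrier_mat q p"
        using gh carD carA carB mx by auto
      have "D t g * (D t h * mx x t * A t h + B t h) * A t g + B t g =
          D t g * (D t h * mx x t * A t h) * A t g + (D t g * B t h * A t g + B t g)"
        using c by (simp add: mult_add_distrib_mat[of _ q q _ p] add_mult_distrib_mat[of _ q p _ _ p]
            assoc_add_mat[of _ q p] mult_carrier_mat[of _ q q _ p] mult_carrier_mat[of _ q p _ p])
      also have "D t g * (D t h * mx x t * A t h) * A t g = D t g * D t h * mx x t * (A t h * A t g)"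
        using assoc_mult_mat5[of "D t g" q q "D t h" q "mx x t" p "A t h" p "A t g" p] c by simp
      finally show "mx (act (g \<otimes>\<^bsub>G\<^esub> h) x) t = mx (act g (act h x)) t"
        using t gh by (simp add: mx_act mult)
    qed auto
    \<comment> \<open>The starting point is \<open>X0\<close> at every parameter, so that the
      component of its orbit at \<open>t\<close> is \<open>orb t\<close>.\<close>
    obtain x s where x: "\<And>g. g \<in> carrier G \<Longrightarrow> act g x = x"
      and s: "\<And>k::nat. s k \<in> mid_hull {act g (\<lambda>(t, i, j). X0 $$ (i, j)) | g. g \<in> carrier G}"
      and lim: "\<And>i. (\<lambda>k. s k i) \<longlonglongrightarrow> x i"
      using affine_fixed_point[where G = G and K = K and b = b and I = I and C = C' and ?x0.0 = "\<lambda>(t, i, j). X0 $$ (i, j)",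
          unfolded act_fold, OF \<open>group G\<close> finI Kb bb act_one act_mult] by blast
    have lin0: "act g (\<lambda>(t, i, j). X0 $$ (i, j)) (t, i, j) = orb t g $$ (i, j)"
      if "g \<in> carrier G" "t \<in> F" "i < q" "j < p" for g t i j
    proof -
      have "mx (\<lambda>(t, i, j). X0 $$ (i, j)) t = X0" using X0 by (intro eq_matI) (auto simp: mx_def)
      then show ?thesis using lin_mx[OF that(1,3,4), of t "\<lambda>(t, i, j). X0 $$ (i, j)"] that act_eq
        by (simp add: orb_def)
    qed
    have 1: "cmod (x (t, i, j) - w) \<le> e"
      if t: "t \<in> F" "i < q" "j < p" and e: "\<forall>g\<in>carrier G. cmod (orb t g $$ (i, j) - w) \<le> e" for t i j w e
    proof -
      have "cmod (y (t, i, j) - w) \<le> e" if "y \<in> mid_hull {act g (\<lambda>(t, i, j). X0 $$ (i, j)) | g. g \<in> carrier G}" for y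
        using that
      proof induction
        case (base y)
        then show ?case using lin0 t e by auto
      next
        case (mid y z)
        have "(y (t, i, j) + z (t, i, j)) / 2 - w = ((y (t, i, j) - w) + (z (t, i, j) - w)) / 2"
          by (simp add: field_simps)
        then have "cmod ((y (t, i, j) + z (t, i, j)) / 2 - w) = cmod ((y (t, i, j) - w) + (z (t, i, j) - w)) / 2"
          by (simp only: norm_divide norm_numeral)
        then have "cmod ((y (t, i, j) + z (t, i, j)) / 2 - w) \<le> (cmod (y (t, i, j) - w) + cmod (z (t, i, j) - w)) / 2"
          using norm_triangle_ineq[of "y (t, i, j) - w" "z (t, i, j) - w"] by argo
        then show ?case using mid.IH by argo
      qed
      then show ?thesis using s by (intro LIMSEQ_le_const2[OF tendsto_norm[OF tendsto_diff[OF lim tendsto_const]]]) auto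
    qed
    \<comment> \<open>This is where the joint treatment of the parameters pays off: the components
      at \<open>t\<close> and \<open>t'\<close> of one hull element are averaged with the same
      weights, so their difference is an average of the differences of the two orbits.\<close>
    have 2: "cmod (x (t, i, j) - x (t', i, j)) \<le> e"
      if t: "t \<in> F" "t' \<in> F" "i < q" "j < p" and
        e: "\<forall>g\<in>carrier G. cmod (orb t g $$ (i, j) - orb t' g $$ (i, j)) \<le> e" for t t' i j e
    proof -
      have "cmod (y (t, i, j) - y (t', i, j)) \<le> e"
        if "y \<in> mid_hull {act g (\<lambda>(t, i, j). X0 $$ (i, j)) | g. g \<in> carrier G}" for y
        using that
      proof induction
        case (base y)
        then show ?case using lin0 t e by auto
      next
        case (mid y z)
        have "(y (t, i, j) + z (t, i, j)) / 2 - (y (t', i, j) + z (t', i, j)) / 2 =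
            ((y (t, i, j) - y (t', i, j)) + (z (t, i, j) - z (t', i, j))) / 2"
          by (simp add: field_simps)
        then have "cmod ((y (t, i, j) + z (t, i, j)) / 2 - (y (t', i, j) + z (t', i, j)) / 2) =
            cmod ((y (t, i, j) - y (t', i, j)) + (z (t, i, j) - z (t', i, j))) / 2"
          by (simp only: norm_divide norm_numeral)
        then have "cmod ((y (t, i, j) + z (t, i, j)) / 2 - (y (t', i, j) + z (t', i, j)) / 2) \<le>
            (cmod (y (t, i, j) - y (t', i, j)) + cmod (z (t, i, j) - z (t', i, j))) / 2"
          using norm_triangle_ineq[of "y (t, i, j) - y (t', i, j)" "z (t, i, j) - z (t', i, j)"]
          by argo
        then show ?case using mid.IH by argo
      qed
      then show ?thesis using s by (intro LIMSEQ_le_const2[OF tendsto_norm[OF tendsto_diff[OF lim lim]]]) auto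
    qed
    have x0: "x c = 0" if "c \<notin> I" for c
      using x[OF one_closed] off[OF that] by metis
    have "x c \<in> S c" for c
    proof (cases c)
      case (fields t i j)
      then show ?thesis
        using 1[of t i j 0 "M t"] M[of _ i j t] x0[of c] by (cases "c \<in> I") (auto simp: I_def S_def)
    qed
    then have "x \<in> PiE UNIV S" by (auto simp: PiE_iff)
    moreover have "x \<in> Z F"
      unfolding Z_def using 1 2 act_eq x by (auto simp: fun_eq_iff) metis
    ultimately show ?thesis by blast
  qed
  \<comment> \<open>Finite intersection property: finitely many sets \<open>Z F\<close> contain the
    nonempty one that belongs to the union of the index sets.\<close>
  have "PiE UNIV S \<inter> (\<Inter>F\<in>{F. finite F}. Z F) \<noteq> {}"
  proof (rule compact_imp_fip_image[OF compact closed])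
    fix I' :: "'t set set" assume "finite I'" "I' \<subseteq> {F. finite F}"
    then have "finite (\<Union>I')" by auto
    moreover have "Z (\<Union>I') \<subseteq> (\<Inter>F\<in>I'. Z F)" unfolding Z_def by blast
    ultimately show "PiE UNIV S \<inter> (\<Inter>F\<in>I'. Z F) \<noteq> {}" using finite by blast
  qed
  then obtain x where x: "\<And>F. finite F \<Longrightarrow> x \<in> Z F" by auto
  show thesis
  proof (rule that[of "mx x"])
    show "D t g * mx x t * A t g + B t g = mx x t" if "g \<in> carrier G" for t g
      using x[of "{t}"] lin_mx[OF that, of _ _ t x] carA[OF that, of t] carB[OF that, of t] carD[OF that, of t]
      by (intro eq_matI) (auto simp: Z_def mx_def that)
    show "cmod (mx x t $$ (i, j) - mx x t' $$ (i, j)) \<le> e"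
      if "i < q" "j < p" "\<And>g. g \<in> carrier G \<Longrightarrow> cmod (orb t g $$ (i, j) - orb t' g $$ (i, j)) \<le> e" for t t' i j e
      using x[of "{t, t'}"] that by (simp add: Z_def mx_def)
    show "cmod (mx x t $$ (i, j) - y) \<le> e"
      if "i < q" "j < p" "\<And>g. g \<in> carrier G \<Longrightarrow> cmod (orb t g $$ (i, j) - y) \<le> e" for t i j y e
      using x[of "{t}"] that by (simp add: Z_def mx_def)
  qed (rule mx)
qed

lemma continuous_map_mult_complex [continuous_intros]:
  fixes f g :: "'a \<Rightarrow> complex"
  shows "continuous_map X euclidean f \<Longrightarrow> continuous_map X euclidean g \<Longrightarrow>
    continuous_map X euclidean (\<lambda>x. f x * g x)"
  by (simp add: continuous_map_atin tendsto_mult)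

lemma four_block_mat_eq_iff:
  assumes "A \<in> carrier_mat a b" "B \<in> carrier_mat a d" "C \<in> carrier_mat c b" "D \<in> carrier_mat c d"
    "A' \<in> carrier_mat a b" "B' \<in> carrier_mat a d" "C' \<in> carrier_mat c b" "D' \<in> carrier_mat c d"
  shows "four_block_mat A B C D = four_block_mat A' B' C' D' \<longleftrightarrow> A = A' \<and> B = B' \<and> C = C' \<and> D = D'"
proof
  assume eq: "four_block_mat A B C D = four_block_mat A' B' C' D'"
  have e: "four_block_mat A B C D $$ (i, j) = four_block_mat A' B' C' D' $$ (i, j)" for i j
    by (simp add: eq)
  have "A = A'"
    by (rule eq_matI) (use assms e in \<open>auto, smt (verit) carrier_matD index_mat_four_block(1) trans_less_add1\<close>)
  moreover have "B = B'"
  proof (rule eq_matI)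
    fix i j assume "i < dim_row B'" "j < dim_col B'"
    then show "B $$ (i, j) = B' $$ (i, j)" using assms e[of i "b + j"] by auto
  qed (use assms in auto)
  moreover have "C = C'"
  proof (rule eq_matI)
    fix i j assume "i < dim_row C'" "j < dim_col C'"
    then show "C $$ (i, j) = C' $$ (i, j)" using assms e[of "a + i" j] by auto
  qed (use assms in auto)
  moreover have "D = D'"
  proof (rule eq_matI)
    fix i j assume "i < dim_row D'" "j < dim_col D'"
    then show "D $$ (i, j) = D' $$ (i, j)" using assms e[of "a + i" "b + j"] by auto
  qed (use assms in auto)
  ultimately show "A = A' \<and> B = B' \<and> C = C' \<and> D = D'" by blast
qed simp

lemma obtain_blocks:
  assumes "M \<in> carrier_mat (a + c) (b + d)"
  obtains A B C D where "A \<in> carrier_mat a b" "B \<in> carrier_mat a d" "C \<in> carrier_mat c b" "D \<in> carrier_mat c d"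
    "M = four_block_mat A B C D"
  using split_block[of M a b _ _ _ _ c d] assms that by (metis carrier_matD prod_cases4)

lemma intertwine_diag_blocks:
  fixes u v u' v' p q r s :: "complex mat"
  assumes "u \<in> carrier_mat a a" "v \<in> carrier_mat b b" "u' \<in> carrier_mat a' a'" "v' \<in> carrier_mat b' b'"
    "p \<in> carrier_mat a' a" "q \<in> carrier_mat a' b" "r \<in> carrier_mat b' a" "s \<in> carrier_mat b' b"
  shows "four_block_mat p q r s * diag_block u v = diag_block u' v' * four_block_mat p q r s \<longleftrightarrow>
    p * u = u' * p \<and> q * v = u' * q \<and> r * u = v' * r \<and> s * v = v' * s"
proof -
  have 1: "four_block_mat p q r s * diag_block u v = four_block_mat (p * u) (q * v) (r * u) (s * v)"
    using assms by (subst mult_four_block_mat[of _ a' a _ b _ b' _ _ a _ b]) auto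
  have 2: "diag_block u' v' * four_block_mat p q r s = four_block_mat (u' * p) (u' * q) (v' * r) (v' * s)"
    using assms by (subst mult_four_block_mat[of _ a' a' _ b' _ b' _ _ a _ b]) auto
  show ?thesis unfolding 1 2 using assms by (intro four_block_mat_eq_iff[of _ a' a _ b _ b']) auto
qed

section \<open>Intertwiners and representations of compact groups\<close>

text \<open>No homomorphism condition and an arbitrary set \<open>S\<close>: the same notion then
  compares two representations of a group and their restrictions to a subgroup.\<close>

definition rep_equiv :: "'g set \<Rightarrow> nat \<Rightarrow> ('g \<Rightarrow> complex mat) \<Rightarrow> ('g \<Rightarrow> complex mat) \<Rightarrow> bool" where
  "rep_equiv S n v w \<longleftrightarrow> (\<exists>P\<in>carrier_mat n n. invertible_mat P \<and> (\<forall>g\<in>S. P * v g = w g * P))"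

lemma rep_equiv_mono: "rep_equiv S n v w \<Longrightarrow> S' \<subseteq> S \<Longrightarrow> rep_equiv S' n v w"
  unfolding rep_equiv_def by blast

lemma rep_equiv_eq:
  assumes "\<And>g. g \<in> S \<Longrightarrow> v g \<in> carrier_mat n n" "\<And>g. g \<in> S \<Longrightarrow> v g = w g"
  shows "rep_equiv S n v w"
  unfolding rep_equiv_def
proof (intro bexI conjI ballI)
  fix g assume "g \<in> S"
  then have "v g \<in> carrier_mat n n" "v g = w g" using assms by auto
  then show "1\<^sub>m n * v g = w g * 1\<^sub>m n" by simp
qed auto

lemma rep_equiv_sym:
  assumes v: "\<And>g. g \<in> S \<Longrightarrow> v g \<in> carrier_mat n n" and w: "\<And>g. g \<in> S \<Longrightarrow> w g \<in> carrier_mat n n"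
    and "rep_equiv S n v w"
  shows "rep_equiv S n w v"
proof -
  obtain P where P: "P \<in> carrier_mat n n" "invertible_mat P" "\<And>g. g \<in> S \<Longrightarrow> P * v g = w g * P"
    using assms(3) unfolding rep_equiv_def by blast
  obtain Q where Q: "Q \<in> carrier_mat n n" "P * Q = 1\<^sub>m n" "Q * P = 1\<^sub>m n" using P invertible_matE by metis
  have "Q * w g = v g * Q" if g: "g \<in> S" for g
  proof -
    have "Q * w g = Q * w g * (P * Q)" using Q w[OF g] by simp
    also have "\<dots> = Q * (w g * P) * Q"
      using P(1) Q(1) w[OF g] by (simp add: assoc_mult_mat[of _ n n _ n _ n] mult_carrier_mat[of _ n n _ n])
    also have "\<dots> = (Q * P) * v g * Q"
      unfolding P(3)[OF g, symmetric]
      using P(1) Q(1) v[OF g] by (simp add: assoc_mult_mat[of _ n n _ n _ n] mult_carrier_mat[of _ n n _ n])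
    also have "\<dots> = v g * Q" using Q v[OF g] by simp
    finally show ?thesis .
  qed
  then show ?thesis unfolding rep_equiv_def using Q P by (intro bexI[of _ Q]) (auto intro: invertible_matI)
qed

lemma rep_equiv_trans:
  assumes u: "\<And>g. g \<in> S \<Longrightarrow> u g \<in> carrier_mat n n" and v: "\<And>g. g \<in> S \<Longrightarrow> v g \<in> carrier_mat n n"
    and w: "\<And>g. g \<in> S \<Longrightarrow> w g \<in> carrier_mat n n"
    and "rep_equiv S n u v" "rep_equiv S n v w"
  shows "rep_equiv S n u w"
proof -
  obtain P where P: "P \<in> carrier_mat n n" "invertible_mat P" "\<And>g. g \<in> S \<Longrightarrow> P * u g = v g * P"
    using assms(4) unfolding rep_equiv_def by blast
  obtain Q where Q: "Q \<in> carrier_mat n n" "invertible_mat Q" "\<And>g. g \<in> S \<Longrightarrow> Q * v g = w g * Q"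
    using assms(5) unfolding rep_equiv_def by blast
  have "Q * P * u g = w g * (Q * P)" if g: "g \<in> S" for g
  proof -
    have "Q * P * u g = Q * (v g * P)" using P(1) Q(1) u[OF g] P(3)[OF g] by simp
    also have "\<dots> = w g * Q * P" using P(1) Q(1) v[OF g] w[OF g] by (simp flip: Q(3)[OF g])
    finally show ?thesis using P(1) Q(1) w[OF g] by simp
  qed
  then show ?thesis unfolding rep_equiv_def using P Q
    by (intro bexI[of _ "Q * P"]) (auto intro!: invertible_mat_times)
qed

lemma rep_sum_eq: "rep_sum v w g = diag_block (v g) (w g)"
  by (simp add: rep_sum_def)

lemma rep_equiv_sum:
  assumes c: "\<And>g. g \<in> S \<Longrightarrow> v g \<in> carrier_mat a a" "\<And>g. g \<in> S \<Longrightarrow> v' g \<in> carrier_mat a a"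
    "\<And>g. g \<in> S \<Longrightarrow> w g \<in> carrier_mat b b" "\<And>g. g \<in> S \<Longrightarrow> w' g \<in> carrier_mat b b"
    and "rep_equiv S a v v'" "rep_equiv S b w w'"
  shows "rep_equiv S (a + b) (rep_sum v w) (rep_sum v' w')"
proof -
  obtain P where P: "P \<in> carrier_mat a a" "invertible_mat P" "\<And>g. g \<in> S \<Longrightarrow> P * v g = v' g * P"
    using assms(5) unfolding rep_equiv_def by blast
  obtain Q where Q: "Q \<in> carrier_mat b b" "invertible_mat Q" "\<And>g. g \<in> S \<Longrightarrow> Q * w g = w' g * Q"
    using assms(6) unfolding rep_equiv_def by blast
  have "diag_block P Q * rep_sum v w g = rep_sum v' w' g * diag_block P Q" if "g \<in> S" for g
  proof -
    have "diag_block P Q * diag_block (v g) (w g) = diag_block (P * v g) (Q * w g)"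
      using P(1) Q(1) c[OF that] by (intro diag_block_times)
    moreover have "diag_block (v' g) (w' g) * diag_block P Q = diag_block (v' g * P) (w' g * Q)"
      using P(1) Q(1) c[OF that] by (intro diag_block_times)
    ultimately show ?thesis unfolding rep_sum_eq P(3)[OF that] Q(3)[OF that] by metis
  qed
  then show ?thesis unfolding rep_equiv_def using P Q
    using invertible_diag_block[OF P(1) Q(1) P(2) Q(2)] by (intro bexI[of _ "diag_block P Q"]) auto
qed

lemma rep_equiv_sum_comm:
  assumes "\<And>g. g \<in> S \<Longrightarrow> v g \<in> carrier_mat a a" "\<And>g. g \<in> S \<Longrightarrow> w g \<in> carrier_mat b b"
  shows "rep_equiv S (a + b) (rep_sum v w) (rep_sum w v)"
proof -
  define P :: "complex mat" where "P = four_block_mat (0\<^sub>m b a) (1\<^sub>m b) (1\<^sub>m a) (0\<^sub>m a b)"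
  have P: "P \<in> carrier_mat (a + b) (a + b)"
    unfolding P_def by (metis add.commute four_block_carrier_mat zero_carrier_mat)
  define Q :: "complex mat" where "Q = four_block_mat (0\<^sub>m a b) (1\<^sub>m a) (1\<^sub>m b) (0\<^sub>m b a)"
  have Q: "Q \<in> carrier_mat (a + b) (a + b)"
    unfolding Q_def by (metis add.commute four_block_carrier_mat zero_carrier_mat)
  have "Q * P = four_block_mat (1\<^sub>m a) (0\<^sub>m a b) (0\<^sub>m b a) (1\<^sub>m b)"
    unfolding P_def Q_def by (subst mult_four_block_mat[of _ a b _ a _ b _ _ a _ b]) auto
  then have "Q * P = 1\<^sub>m (a + b)" by simp
  then have "invertible_mat P" using P Q mat_mult_left_right_inverse[OF Q P] by (intro invertible_matI)
  moreover have "P * rep_sum v w g = rep_sum w v g * P" if "g \<in> S" for g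
    unfolding rep_sum_eq P_def using assms[OF that]
    by (subst intertwine_diag_blocks[of _ a _ b _ b _ a]) auto
  ultimately show ?thesis unfolding rep_equiv_def using P by blast
qed

lemma rep_sum_assoc: "rep_sum (rep_sum u v) w = rep_sum u (rep_sum v w)"
  unfolding rep_sum_def by (rule ext) (rule assoc_four_block_mat[symmetric])

text \<open>Cancellation by a Schur complement. An isomorphism \<open>P\<close> is a block matrix of
  intertwiners. If its block \<open>p\<close> on the common summand is invertible, then the Schur
  complement of \<open>p\<close> is invertible and intertwines the remaining summands; a small
  change of \<open>P\<close> makes \<open>p\<close> invertible.\<close>

lemma rep_equiv_cancel:
  assumes u: "\<And>g. g \<in> S \<Longrightarrow> u g \<in> carrier_mat m m" and v: "\<And>g. g \<in> S \<Longrightarrow> v g \<in> carrier_mat a a"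
    and w: "\<And>g. g \<in> S \<Longrightarrow> w g \<in> carrier_mat a a"
    and eq: "rep_equiv S (m + a) (rep_sum u v) (rep_sum u w)"
  shows "rep_equiv S a v w"
proof -
  obtain P where P: "P \<in> carrier_mat (m + a) (m + a)" "invertible_mat P"
    "\<And>g. g \<in> S \<Longrightarrow> P * rep_sum u v g = rep_sum u w g * P"
    using eq unfolding rep_equiv_def by blast
  obtain p q r s where c: "p \<in> carrier_mat m m" "q \<in> carrier_mat m a" "r \<in> carrier_mat a m" "s \<in> carrier_mat a a"
    and Peq: "P = four_block_mat p q r s"
    using obtain_blocks[OF P(1)] by metis
  have tw: "p * u g = u g * p \<and> q * v g = u g * q \<and> r * u g = w g * r \<and> s * v g = w g * s" if "g \<in> S" for g
    using P(3)[OF that] u[OF that] v[OF that] w[OF that] c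
    unfolding Peq rep_sum_eq by (subst (asm) intertwine_diag_blocks[of _ m _ a _ m _ a]) auto
  \<comment> \<open>The projection onto the common summand intertwines the two sums, so every
    \<open>P + z E\<close> is again an intertwiner, and only its corner block differs from that of
    \<open>P\<close>.\<close>
  define E :: "complex mat" where "E = diag_block (1\<^sub>m m) (0\<^sub>m a a)"
  have E: "E \<in> carrier_mat (m + a) (m + a)" unfolding E_def by simp
  have fin1: "finite {z. \<not> invertible_mat (P + z \<cdot>\<^sub>m E)}"
    by (rule finite_singular_pencil[OF P(1) E P(2)])
  \<comment> \<open>For nonzero \<open>z\<close>, the corner \<open>p + z\<close> is
    \<open>z\<close> times \<open>1 + p / z\<close>. Its singular parameters are thus inverses of
    those of this pencil, which explains the image under \<open>inverse\<close> below.\<close>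
  have "finite {z. \<not> invertible_mat (1\<^sub>m m + z \<cdot>\<^sub>m p)}"
    using c by (intro finite_singular_pencil) auto
  then have "finite (inverse ` {z. \<not> invertible_mat (1\<^sub>m m + z \<cdot>\<^sub>m p)})" by simp
  with fin1 have "finite ({z. \<not> invertible_mat (P + z \<cdot>\<^sub>m E)} \<union> inverse ` {z. \<not> invertible_mat (1\<^sub>m m + z \<cdot>\<^sub>m p)} \<union> {0})"
    by simp
  from ex_new_if_finite[OF infinite_UNIV_char_0 this] obtain z where
    "z \<notin> {z. \<not> invertible_mat (P + z \<cdot>\<^sub>m E)} \<union> inverse ` {z. \<not> invertible_mat (1\<^sub>m m + z \<cdot>\<^sub>m p)} \<union> {0}"
    by (rule exE)
  then have z: "invertible_mat (P + z \<cdot>\<^sub>m E)" "z \<notin> inverse ` {z. \<not> invertible_mat (1\<^sub>m m + z \<cdot>\<^sub>m p)}" "z \<noteq> 0"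
    by simp_all
  define p' where "p' = p + z \<cdot>\<^sub>m 1\<^sub>m m"
  have cp': "p' \<in> carrier_mat m m" using c by (simp add: p'_def)
  have "invertible_mat (1\<^sub>m m + inverse z \<cdot>\<^sub>m p)"
    using z(2) by (metis (mono_tags, lifting) image_eqI inverse_inverse_eq mem_Collect_eq)
  then have "Determinant.det (1\<^sub>m m + inverse z \<cdot>\<^sub>m p) \<noteq> 0"
    using c invertible_mat_iff_det[of "1\<^sub>m m + inverse z \<cdot>\<^sub>m p" m] by auto
  moreover have "p' = z \<cdot>\<^sub>m (1\<^sub>m m + inverse z \<cdot>\<^sub>m p)"
    using c z(3) by (intro eq_matI) (auto simp: p'_def field_simps)
  ultimately have "invertible_mat p'"
    using z(3) c invertible_mat_iff_det[OF cp'] by (auto simp: det_smult)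
  then obtain p'' where p'': "p'' \<in> carrier_mat m m" "p' * p'' = 1\<^sub>m m" "p'' * p' = 1\<^sub>m m"
    using cp' invertible_matE by metis
  have Pz: "P + z \<cdot>\<^sub>m E = four_block_mat p' q r s"
    unfolding Peq E_def p'_def using c by (intro eq_matI) auto
  \<comment> \<open>The Schur complement, isolated by the row operation \<open>L\<close>. As it is
    assembled from intertwiners and the inverse of the intertwiner \<open>p'\<close>, it intertwines
    \<open>v\<close> with \<open>w\<close>.\<close>
  define X where "X = s + - (r * p'' * q)"
  define L where "L = four_block_mat (1\<^sub>m m) (0\<^sub>m m a) (- (r * p'')) (1\<^sub>m a)"
  have cX: "X \<in> carrier_mat a a" "L \<in> carrier_mat (m + a) (m + a)" "- (r * p'') \<in> carrier_mat a m"
    using c p'' by (auto simp: X_def L_def)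
  have rp: "- (r * p'') * p' = - r"
    using c p'' cp' by simp
  have "L * (P + z \<cdot>\<^sub>m E) = four_block_mat p' q (0\<^sub>m a m) X"
    unfolding Pz L_def using c p'' cp' cX rp
    by (subst mult_four_block_mat[of _ m m _ a _ a _ _ m _ a])
      (auto intro!: cong_four_block_mat simp: X_def comm_add_mat[of _ a a])
  then have "invertible_mat (four_block_mat p' q (0\<^sub>m a m) X)"
    using invertible_mat_times[of L "P + z \<cdot>\<^sub>m E" "m + a"] z(1) cX P(1) E
      invertible_lower_unitriangular[OF cX(3)] unfolding L_def by auto
  then have "Determinant.det (four_block_mat p' q (0\<^sub>m a m) X) \<noteq> 0"
    using invertible_mat_iff_det[of "four_block_mat p' q (0\<^sub>m a m) X" "m + a"] cp' cX by auto
  then have inv: "invertible_mat X"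
    using det_four_block_mat_lower_left_zero[of p' m q a "0\<^sub>m a m" X] cp' cX c invertible_mat_iff_det[OF cX(1)] by auto
  have "X * v g = w g * X" if g: "g \<in> S" for g
  proof -
    note tw = tw[OF g] and cc = u[OF g] v[OF g] w[OF g]
    have "u g * (z \<cdot>\<^sub>m 1\<^sub>m m) = z \<cdot>\<^sub>m u g"
      using cc mult_smult_distrib[of "u g" m m "1\<^sub>m m" m z] by simp
    then have up: "p' * u g = u g * p'"
      using c cc tw by (simp add: p'_def add_mult_distrib_mat[of _ m m] mult_add_distrib_mat[of _ m m]
          smult_carrier_mat mult_smult_assoc_mat[of _ m m] mult_smult_distrib[of _ m m])
    have "p'' * u g = p'' * (u g * p') * p''"
      using p'' cp' cc by (simp add: assoc_mult_mat[of _ m m _ m _ m] mult_carrier_mat[of _ m m _ m])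
    also have "\<dots> = (p'' * p') * (u g * p'')"
      unfolding up[symmetric]
      using p''(1) cp' cc by (simp add: assoc_mult_mat[of _ m m _ m _ m] mult_carrier_mat[of _ m m _ m])
    finally have up': "p'' * u g = u g * p''" using p'' cc by simp
    have "r * p'' * q * v g = r * p'' * (u g * q)"
      using c p'' cc tw assoc_mult_mat[of "r * p''" a m q a "v g" a] by auto
    also have "\<dots> = r * (p'' * u g) * q"
      using c p'' cc assoc_mult_mat[of "r * p''" a m "u g" m q a] assoc_mult_mat[of r a m p'' m "u g" m] by auto
    also have "\<dots> = (r * u g) * p'' * q"
      unfolding up' using c p'' cc assoc_mult_mat[of r a m "u g" m p'' m] by auto
    also have "\<dots> = w g * (r * p'' * q)"
      using c p'' cc tw assoc_mult_mat[of "w g" a a r m p'' m] assoc_mult_mat[of "w g" a a "r * p''" m q a] by auto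
    finally have "r * p'' * q * v g = w g * (r * p'' * q)" .
    moreover have "X * v g = s * v g + - (r * p'' * q * v g)"
      unfolding X_def using c p'' cc
      by (subst add_mult_distrib_mat[of _ a a _ _ a]) auto
    moreover have "w g * X = w g * s + - (w g * (r * p'' * q))"
      unfolding X_def using c p'' cc
      by (subst mult_add_distrib_mat[of _ a a _ a]) auto
    ultimately show ?thesis using tw by metis
  qed
  then show ?thesis unfolding rep_equiv_def using cX inv by blast
qed

section \<open>Continuous matrix functions\<close>

definition mat_continuous :: "'a topology \<Rightarrow> nat \<Rightarrow> nat \<Rightarrow> ('a \<Rightarrow> complex mat) \<Rightarrow> bool" where
  "mat_continuous X q p f \<longleftrightarrow> (\<forall>x\<in>topspace X. f x \<in> carrier_mat q p) \<and>
     (\<forall>i<q. \<forall>j<p. continuous_map X euclidean (\<lambda>x. f x $$ (i, j)))"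

lemma mat_continuous_carrier: "mat_continuous X q p f \<Longrightarrow> x \<in> topspace X \<Longrightarrow> f x \<in> carrier_mat q p"
  by (simp add: mat_continuous_def)

lemma mat_continuous_entry:
  "mat_continuous X q p f \<Longrightarrow> i < q \<Longrightarrow> j < p \<Longrightarrow> continuous_map X euclidean (\<lambda>x. f x $$ (i, j))"
  by (simp add: mat_continuous_def)

lemma mat_continuousI:
  assumes "\<And>x. x \<in> topspace X \<Longrightarrow> f x \<in> carrier_mat q p"
    and "\<And>i j. i < q \<Longrightarrow> j < p \<Longrightarrow> continuous_map X euclidean (F i j)"
    and "\<And>i j x. i < q \<Longrightarrow> j < p \<Longrightarrow> x \<in> topspace X \<Longrightarrow> f x $$ (i, j) = F i j x"
  shows "mat_continuous X q p f"
  unfolding mat_continuous_def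
proof (intro conjI ballI allI impI assms(1))
  fix i j assume "i < q" "j < p"
  then show "continuous_map X euclidean (\<lambda>x. f x $$ (i, j))"
    using assms(2)[of i j] assms(3)[of i j] by (auto intro: continuous_map_eq)
qed

lemma mat_continuous_cong:
  "mat_continuous X q p f \<Longrightarrow> (\<And>x. x \<in> topspace X \<Longrightarrow> f x = h x) \<Longrightarrow> mat_continuous X q p h"
  by (rule mat_continuousI[where F = "\<lambda>i j x. f x $$ (i, j)"]) (auto simp: mat_continuous_def)

lemma mat_continuous_const: "A \<in> carrier_mat q p \<Longrightarrow> mat_continuous X q p (\<lambda>x. A)"
  by (simp add: mat_continuous_def)

lemma mat_continuous_compose:
  assumes "mat_continuous Y q p f" "continuous_map X Y \<phi>"
  shows "mat_continuous X q p (\<lambda>x. f (\<phi> x))"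
proof (rule mat_continuousI[OF _ _ refl])
  show "f (\<phi> x) \<in> carrier_mat q p" if "x \<in> topspace X" for x
    using assms that unfolding mat_continuous_def continuous_map_def by blast
  show "continuous_map X euclidean (\<lambda>x. f (\<phi> x) $$ (i, j))" if "i < q" "j < p" for i j
    using continuous_map_compose[OF assms(2) mat_continuous_entry[OF assms(1) that]] by (simp add: o_def)
qed

lemma mat_continuous_subtopology:
  "mat_continuous X q p f \<Longrightarrow> mat_continuous (subtopology X S) q p f"
  unfolding mat_continuous_def by (auto intro: continuous_map_from_subtopology)

lemma mat_continuous_mult:
  assumes f: "mat_continuous X q k f" and h: "mat_continuous X k p h"
  shows "mat_continuous X q p (\<lambda>x. f x * h x)"
proof (rule mat_continuousI[where F = "\<lambda>i j x. \<Sum>l<k. f x $$ (i, l) * h x $$ (l, j)"])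
  show "continuous_map X euclidean (\<lambda>x. \<Sum>l<k. f x $$ (i, l) * h x $$ (l, j))" if "i < q" "j < p" for i j
    using f h that unfolding mat_continuous_def by (intro continuous_intros) auto
  show "(f x * h x) $$ (i, j) = (\<Sum>l<k. f x $$ (i, l) * h x $$ (l, j))"
    if "i < q" "j < p" "x \<in> topspace X" for i j x
    using mat_continuous_carrier[OF f that(3)] mat_continuous_carrier[OF h that(3)] that
    by (simp add: scalar_prod_def lessThan_atLeast0)
qed (use f h in \<open>auto simp: mat_continuous_def intro!: mult_carrier_mat\<close>)

lemma mat_continuous_add:
  assumes f: "mat_continuous X q p f" and h: "mat_continuous X q p h"
  shows "mat_continuous X q p (\<lambda>x. f x + h x)"
proof (rule mat_continuousI[where F = "\<lambda>i j x. f x $$ (i, j) + h x $$ (i, j)"])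
  show "continuous_map X euclidean (\<lambda>x. f x $$ (i, j) + h x $$ (i, j))" if "i < q" "j < p" for i j
    using f h that unfolding mat_continuous_def by (intro continuous_intros) auto
  show "(f x + h x) $$ (i, j) = f x $$ (i, j) + h x $$ (i, j)" if "i < q" "j < p" "x \<in> topspace X" for i j x
    using mat_continuous_carrier[OF f that(3)] mat_continuous_carrier[OF h that(3)] that by simp
qed (use f h in \<open>auto simp: mat_continuous_def\<close>)

lemma mat_continuous_smult:
  assumes c: "continuous_map X euclidean c" and f: "mat_continuous X q p f"
  shows "mat_continuous X q p (\<lambda>x. c x \<cdot>\<^sub>m f x)"
proof (rule mat_continuousI[where F = "\<lambda>i j x. c x * f x $$ (i, j)"])
  show "continuous_map X euclidean (\<lambda>x. c x * f x $$ (i, j))" if "i < q" "j < p" for i j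
    using c f that unfolding mat_continuous_def by (intro continuous_intros) auto
  show "(c x \<cdot>\<^sub>m f x) $$ (i, j) = c x * f x $$ (i, j)" if "i < q" "j < p" "x \<in> topspace X" for i j x
    using mat_continuous_carrier[OF f that(3)] that by simp
qed (use f in \<open>auto simp: mat_continuous_def\<close>)

lemma mat_continuous_diag_block:
  assumes f: "mat_continuous X a b f" and h: "mat_continuous X c d h"
  shows "mat_continuous X (a + c) (b + d) (\<lambda>x. diag_block (f x) (h x))"
proof (rule mat_continuousI[where F = "\<lambda>i j x. if i < a then if j < b then f x $$ (i, j) else 0
    else if j < b then 0 else h x $$ (i - a, j - b)"])
  fix i j assume ij: "i < a + c" "j < b + d"
  show "continuous_map X euclidean (\<lambda>x. if i < a then if j < b then f x $$ (i, j) else 0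
    else if j < b then 0 else h x $$ (i - a, j - b))"
    using f h ij unfolding mat_continuous_def by (cases "i < a"; cases "j < b") auto
  show "diag_block (f x) (h x) $$ (i, j) = (if i < a then if j < b then f x $$ (i, j) else 0
    else if j < b then 0 else h x $$ (i - a, j - b))" if "x \<in> topspace X" for x
    using mat_continuous_carrier[OF f that] mat_continuous_carrier[OF h that] ij by auto
qed (use f h in \<open>auto simp: mat_continuous_def\<close>)

lemma continuous_map_det:
  assumes f: "mat_continuous X n n f"
  shows "continuous_map X euclidean (\<lambda>x. Determinant.det (f x))"
proof (rule continuous_map_eq)
  have prod: "continuous_map X euclidean (\<lambda>x. \<Prod>i\<in>I. F i x)"
    if "finite I" "\<And>i. i \<in> I \<Longrightarrow> continuous_map X euclidean (F i)" for I :: "nat set" and F :: "nat \<Rightarrow> _ \<Rightarrow> complex"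
    using that by (induction I) (auto intro!: continuous_intros)
  show "continuous_map X euclidean (\<lambda>x. \<Sum>p | p permutes {0..<n}. signof p * (\<Prod>i\<in>{0..<n}. f x $$ (i, p i)))"
    using f unfolding mat_continuous_def
    by (intro continuous_intros prod) (auto simp: finite_permutations permutes_in_image)
  show "(\<Sum>p | p permutes {0..<n}. signof p * (\<Prod>i\<in>{0..<n}. f x $$ (i, p i))) = Determinant.det (f x)"
    if "x \<in> topspace X" for x
    using det_def'[OF mat_continuous_carrier[OF f that]] by simp
qed

text \<open>Cramer's rule: the entries of the inverse are cofactors divided by the determinant,
  hence continuous.\<close>

lemma mat_continuous_inverse:
  assumes f: "mat_continuous X n n f" and inv: "\<And>x. x \<in> topspace X \<Longrightarrow> invertible_mat (f x)"
  obtains h where "mat_continuous X n n h" "\<And>x. x \<in> topspace X \<Longrightarrow> f x * h x = 1\<^sub>m n"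
    "\<And>x. x \<in> topspace X \<Longrightarrow> h x * f x = 1\<^sub>m n"
proof
  define h where "h x = inverse (Determinant.det (f x)) \<cdot>\<^sub>m adj_mat (f x)" for x
  have car: "f x \<in> carrier_mat n n" if "x \<in> topspace X" for x using mat_continuous_carrier[OF f that] .
  have det: "Determinant.det (f x) \<noteq> 0" if "x \<in> topspace X" for x
    using inv[OF that] invertible_mat_iff_det[OF car[OF that]] by simp
  have del: "mat_continuous X (n - 1) (n - 1) (\<lambda>x. mat_delete (f x) k l)" if "k < n" "l < n" for k l
  proof (rule mat_continuousI[where F = "\<lambda>i j x. f x $$ (if i < k then i else Suc i, if j < l then j else Suc j)"])
    show "continuous_map X euclidean (\<lambda>x. f x $$ (if i < k then i else Suc i, if j < l then j else Suc j))"
      if "i < n - 1" "j < n - 1" for i j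
      using f that unfolding mat_continuous_def by auto
    show "mat_delete (f x) k l $$ (i, j) = f x $$ (if i < k then i else Suc i, if j < l then j else Suc j)"
      if "i < n - 1" "j < n - 1" "x \<in> topspace X" for i j x
      using car[OF that(3)] that by (simp add: mat_delete_def)
    show "mat_delete (f x) k l \<in> carrier_mat (n - 1) (n - 1)" if "x \<in> topspace X" for x
      using carrier_matD[OF car[OF that]] by (intro carrier_matI) (simp_all add: mat_delete_def)
  qed
  have "mat_continuous X n n (\<lambda>x. adj_mat (f x))"
  proof (rule mat_continuousI[where F = "\<lambda>i j x. (-1) ^ (j + i) * Determinant.det (mat_delete (f x) j i)"])
    show "continuous_map X euclidean (\<lambda>x. (-1) ^ (j + i) * Determinant.det (mat_delete (f x) j i))"
      if "i < n" "j < n" for i j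
      using del[of j i] that by (intro continuous_intros continuous_map_det) auto
    show "adj_mat (f x) $$ (i, j) = (-1) ^ (j + i) * Determinant.det (mat_delete (f x) j i)"
      if "i < n" "j < n" "x \<in> topspace X" for i j x
      using car[OF that(3)] that by (simp add: adj_mat_def cofactor_def)
  qed (use car adj_mat in auto)
  moreover have "continuous_map X euclidean (\<lambda>x. inverse (Determinant.det (f x)))"
    using continuous_map_det[OF f] det by (auto simp: continuous_map_atin intro!: tendsto_inverse)
  ultimately show "mat_continuous X n n h" unfolding h_def by (intro mat_continuous_smult)
  show "f x * h x = 1\<^sub>m n" if "x \<in> topspace X" for x
    using adj_mat[OF car[OF that]] det[OF that] car[OF that]
      mult_smult_distrib[OF car[OF that] adj_mat(1)[OF car[OF that]]]
    by (auto simp: h_def intro!: eq_matI)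
  show "h x * f x = 1\<^sub>m n" if "x \<in> topspace X" for x
    using adj_mat[OF car[OF that]] det[OF that] car[OF that]
      mult_smult_assoc_mat[OF adj_mat(1)[OF car[OF that]] car[OF that]]
    by (auto simp: h_def intro!: eq_matI)
qed

text \<open>Kept apart from Lie groups so that the results on representations apply both to
  \<open>G\<close> and to its subgroup \<open>H\<close> of elements acting trivially on the circle,
  with the subspace topology.\<close>

locale compact_group = group G for G (structure) +
  fixes T :: "'a topology"
  assumes topspace_eq: "topspace T = carrier G"
    and compact: "compact_space T"
    and continuous_inv: "continuous_map T T (\<lambda>x. inv x)"
begin

abbreviation rep :: "nat \<Rightarrow> ('a \<Rightarrow> complex mat) \<Rightarrow> bool" where
  "rep n r \<equiv> is_rep G T n r"

lemma rep_iff: "rep n r \<longleftrightarrow> mat_continuous T n n r \<and> r \<one> = 1\<^sub>m n \<and>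
    (\<forall>g\<in>carrier G. \<forall>h\<in>carrier G. r (g \<otimes> h) = r g * r h)"
  unfolding is_rep_def mat_continuous_def topspace_eq by blast

lemma rep_continuous: "rep n r \<Longrightarrow> mat_continuous T n n r"
  by (simp add: rep_iff)

lemma rep_carrier: "rep n r \<Longrightarrow> g \<in> carrier G \<Longrightarrow> r g \<in> carrier_mat n n"
  by (simp add: is_rep_def)

lemma rep_one: "rep n r \<Longrightarrow> r \<one> = 1\<^sub>m n"
  by (simp add: is_rep_def)

lemma rep_mult: "rep n r \<Longrightarrow> g \<in> carrier G \<Longrightarrow> h \<in> carrier G \<Longrightarrow> r (g \<otimes> h) = r g * r h"
  by (simp add: is_rep_def)

lemma rep_inv: "rep n r \<Longrightarrow> g \<in> carrier G \<Longrightarrow> r g * r (inv g) = 1\<^sub>m n"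
  "rep n r \<Longrightarrow> g \<in> carrier G \<Longrightarrow> r (inv g) * r g = 1\<^sub>m n"
  by (simp_all add: rep_one flip: rep_mult)

lemma rep_cong: "rep n r \<Longrightarrow> (\<And>g. g \<in> carrier G \<Longrightarrow> r g = s g) \<Longrightarrow> rep n s"
  unfolding rep_iff using mat_continuous_cong[of T n n r s] by (simp add: topspace_eq)

lemma rep_sum:
  assumes v: "rep a v" and w: "rep b w"
  shows "rep (a + b) (rep_sum v w)"
  unfolding rep_iff[of "a + b"]
proof (intro conjI ballI)
  show "mat_continuous T (a + b) (a + b) (rep_sum v w)"
    unfolding rep_sum_def by (intro mat_continuous_diag_block rep_continuous v w)
  show "rep_sum v w \<one> = 1\<^sub>m (a + b)" by (simp add: rep_sum_eq rep_one[OF v] rep_one[OF w])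
  fix g h assume g: "g \<in> carrier G" and h: "h \<in> carrier G"
  show "rep_sum v w (g \<otimes> h) = rep_sum v w g * rep_sum v w h"
    unfolding rep_sum_eq rep_mult[OF v g h] rep_mult[OF w g h]
    by (rule diag_block_times[symmetric]) (use v w g h rep_carrier in blast)+
qed

lemma rep_triv: "rep n (triv_rep n)"
  by (simp add: rep_iff triv_rep_def mat_continuous_const)

lemma rep_conj:
  assumes r: "rep n r" and P: "P \<in> carrier_mat n n" "Q \<in> carrier_mat n n" "P * Q = 1\<^sub>m n" "Q * P = 1\<^sub>m n"
  shows "rep n (\<lambda>g. P * r g * Q)"
  unfolding rep_iff
proof (intro conjI ballI)
  show "mat_continuous T n n (\<lambda>g. P * r g * Q)"
    using P rep_continuous[OF r] by (intro mat_continuous_mult mat_continuous_const)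
  show "P * r \<one> * Q = 1\<^sub>m n" using P by (simp add: rep_one[OF r])
  fix g h assume g: "g \<in> carrier G" and h: "h \<in> carrier G"
  note c = rep_carrier[OF r g] rep_carrier[OF r h]
  have "P * r g * Q * (P * r h * Q) = P * r g * (Q * P) * (r h * Q)"
    using c P(1,2) by (simp add: assoc_mult_mat[of _ n n _ n _ n] mult_carrier_mat[of _ n n _ n])
  then show "P * r (g \<otimes> h) * Q = P * r g * Q * (P * r h * Q)"
    using c P by (simp add: rep_mult[OF r g h] assoc_mult_mat[of _ n n _ n _ n] mult_carrier_mat[of _ n n _ n])
qed

lemma rep_equiv_conj:
  assumes r: "rep n r" and P: "P \<in> carrier_mat n n" "Q \<in> carrier_mat n n" "Q * P = 1\<^sub>m n"
  shows "rep_equiv (carrier G) n r (\<lambda>g. P * r g * Q)"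
  unfolding rep_equiv_def
proof (intro bexI[OF _ P(1)] conjI ballI)
  show "invertible_mat P" using P mat_mult_left_right_inverse[OF P(2,1,3)] by (intro invertible_matI)
  fix g assume g: "g \<in> carrier G"
  then show "P * r g = P * r g * Q * P"
    using P rep_carrier[OF r g] by (simp add: assoc_mult_mat[of _ n n _ n _ n] mult_carrier_mat[of _ n n _ n])
qed

text \<open>Conjugation carries over continuity as well as multiplicativity, so \<open>s\<close> is
  only asked to have matrices of the right size as values.\<close>

lemma rep_transport:
  assumes r: "rep n r" and s: "\<And>g. g \<in> carrier G \<Longrightarrow> s g \<in> carrier_mat n n"
    and "rep_equiv (carrier G) n r s"
  shows "rep n s"
proof -
  obtain P where P: "P \<in> carrier_mat n n" "invertible_mat P" "\<And>g. g \<in> carrier G \<Longrightarrow> P * r g = s g * P"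
    using assms(3) unfolding rep_equiv_def by blast
  obtain Q where Q: "Q \<in> carrier_mat n n" "P * Q = 1\<^sub>m n" "Q * P = 1\<^sub>m n" using P invertible_matE by metis
  have "P * r g * Q = s g" if "g \<in> carrier G" for g
    using P(1) P(3)[OF that] Q s[OF that] by (simp add: assoc_mult_mat[of _ n n _ n _ n])
  then show ?thesis using rep_cong[OF rep_conj[OF r P(1) Q]] by blast
qed

lemma bounded_entries:
  assumes f: "mat_continuous T q p f"
  shows "\<exists>C. \<forall>g\<in>carrier G. \<forall>i<q. \<forall>j<p. cmod (f g $$ (i, j)) \<le> C"
proof -
  have "\<exists>C. \<forall>g\<in>carrier G. cmod (f g $$ (i, j)) \<le> C" if "i < q" "j < p" for i j
  proof -
    have "compactin T (topspace T)" using compact by (simp add: compact_space_def)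
    from image_compactin[OF this mat_continuous_entry[OF f that]]
    have "bounded ((\<lambda>g. f g $$ (i, j)) ` carrier G)"
      by (simp add: topspace_eq compact_imp_bounded)
    then show ?thesis unfolding bounded_iff by blast
  qed
  then obtain C where C: "\<And>i j g. i < q \<Longrightarrow> j < p \<Longrightarrow> g \<in> carrier G \<Longrightarrow> cmod (f g $$ (i, j)) \<le> C i j"
    by metis
  have "cmod (f g $$ (i, j)) \<le> (\<Sum>i<q. \<Sum>j<p. \<bar>C i j\<bar>)" if "i < q" "j < p" "g \<in> carrier G" for i j g
  proof -
    have "cmod (f g $$ (i, j)) \<le> \<bar>C i j\<bar>" using C[OF that] by simp
    also have "\<dots> \<le> (\<Sum>j<p. \<bar>C i j\<bar>)" using that by (intro member_le_sum) auto
    also have "\<dots> \<le> (\<Sum>i<q. \<Sum>j<p. \<bar>C i j\<bar>)"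
      using that by (intro member_le_sum[of i "{..<q}" "\<lambda>i. \<Sum>j<p. \<bar>C i j\<bar>"]) (auto simp: sum_nonneg)
    finally show ?thesis .
  qed
  then show ?thesis by blast
qed

lemma mat_continuous_rep_inv: "rep n r \<Longrightarrow> mat_continuous T n n (\<lambda>g. r (inv g))"
  by (rule mat_continuous_compose[OF rep_continuous continuous_inv])

text \<open>The vanishing of the first cohomology of a compact group with coefficients in the linear
  maps from \<open>y\<close> to \<open>x\<close>: a solution \<open>X\<close> is exactly a fixed
  point of a bounded affine action.\<close>

lemma cocycle_is_coboundary:
  assumes x: "rep q x" and y: "rep p y" and c: "mat_continuous T q p c"
    and cocycle: "\<And>g h. g \<in> carrier G \<Longrightarrow> h \<in> carrier G \<Longrightarrow> c (g \<otimes> h) = c g * y h + x g * c h"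
  obtains X where "X \<in> carrier_mat q p" "\<And>g. g \<in> carrier G \<Longrightarrow> X * y g + c g = x g * X"
proof -
  have cc: "c g \<in> carrier_mat q p" if "g \<in> carrier G" for g
    using mat_continuous_carrier[OF c] that by (simp add: topspace_eq)
  \<comment> \<open>The translation part of the action, obtained by solving the required identity
    for \<open>X\<close> after multiplication by the inverse of \<open>y g\<close> on the
    right.\<close>
  define B where "B g = - 1 \<cdot>\<^sub>m (c g * y (inv g))" for g
  have B: "mat_continuous T q p B"
    unfolding B_def using c mat_continuous_rep_inv[OF y] by (intro mat_continuous_smult mat_continuous_mult) auto
  have Beq: "B g = - (c g * y (inv g))" if "g \<in> carrier G" for g
    using that cc[OF that] rep_carrier[OF y, of "inv g"] by (intro eq_matI) (auto simp: B_def)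
  have c1: "c \<one> = 0\<^sub>m q p"
  proof -
    have "c \<one> = c \<one> + c \<one>" using cocycle[of \<one> \<one>] cc[of \<one>] by (simp add: rep_one[OF x] rep_one[OF y])
    then have "c \<one> $$ (i, j) = c \<one> $$ (i, j) + c \<one> $$ (i, j)" if "i < q" "j < p" for i j
      using that cc[of \<one>] by (metis carrier_matD index_add_mat(1) one_closed)
    then show ?thesis using cc[of \<one>] by (intro eq_matI) auto
  qed
  \<comment> \<open>Nothing varies here, so the parameter type is \<open>unit\<close>.\<close>
  obtain X where X: "\<And>t::unit. X t \<in> carrier_mat q p"
    "\<And>t g. g \<in> carrier G \<Longrightarrow> x g * X t * y (inv g) + B g = X t"
  proof (rule equivariant_family[where G = G and D = "\<lambda>t::unit. x" and A = "\<lambda>t g. y (inv g)" and B = "\<lambda>t. B"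
        and q = q and p = p and ?X0.0 = "0\<^sub>m q p"])
    show "\<exists>C. \<forall>g\<in>carrier G. (\<forall>i<q. \<forall>j<q. cmod (x g $$ (i, j)) \<le> C) \<and>
        (\<forall>i<p. \<forall>j<p. cmod (y (inv g) $$ (i, j)) \<le> C) \<and> (\<forall>i<q. \<forall>j<p. cmod (B g $$ (i, j)) \<le> C)" for t
    proof -
      obtain C1 where "\<forall>g\<in>carrier G. \<forall>i<q. \<forall>j<q. cmod (x g $$ (i, j)) \<le> C1"
        using bounded_entries[OF rep_continuous[OF x]] by blast
      moreover obtain C2 where "\<forall>g\<in>carrier G. \<forall>i<p. \<forall>j<p. cmod (y (inv g) $$ (i, j)) \<le> C2"
        using bounded_entries[OF mat_continuous_rep_inv[OF y]] by blast
      moreover obtain C3 where "\<forall>g\<in>carrier G. \<forall>i<q. \<forall>j<p. cmod (B g $$ (i, j)) \<le> C3"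
        using bounded_entries[OF B] by blast
      ultimately show ?thesis
        by (intro exI[of _ "max C1 (max C2 C3)"]) (auto simp: le_max_iff_disj)
    qed
    show "B (g \<otimes> h) = x g * B h * y (inv g) + B g" if g: "g \<in> carrier G" and h: "h \<in> carrier G" for g h
    proof -
      note car = cc[OF g] cc[OF h] rep_carrier[OF x g] rep_carrier[OF y h]
        rep_carrier[OF y, of "inv g"] rep_carrier[OF y, of "inv h"]
      have yi: "y (inv (g \<otimes> h)) = y (inv h) * y (inv g)" using g h by (simp add: inv_mult_group rep_mult[OF y])
      have 1: "c g * y h * (y (inv h) * y (inv g)) = c g * y (inv g)"
      proof -
        have "c g * y h * (y (inv h) * y (inv g)) = c g * (y h * y (inv h)) * y (inv g)"
          using g h car by (simp add: assoc_mult_mat[of _ q p _ p _ p] assoc_mult_mat[of _ p p _ p _ p] mult_carrier_mat[of _ p p _ p])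
        then show ?thesis using g h car by (simp add: rep_inv[OF y])
      qed
      have 2: "x g * c h * (y (inv h) * y (inv g)) = x g * (c h * y (inv h)) * y (inv g)"
        using g h car by (simp add: assoc_mult_mat[of _ q q _ p _ p] assoc_mult_mat[of _ q p _ p _ p]
            mult_carrier_mat[of _ q p _ p] mult_carrier_mat[of _ p p _ p])
      have "c (g \<otimes> h) * y (inv (g \<otimes> h)) = c g * y (inv g) + x g * (c h * y (inv h)) * y (inv g)"
        unfolding cocycle[OF g h] yi using g h car
        by (subst add_mult_distrib_mat[of _ q p _ _ p]) (auto simp only: 1 2 inv_closed intro!: mult_carrier_mat)
      moreover have "x g * - (c h * y (inv h)) * y (inv g) = - (x g * (c h * y (inv h)) * y (inv g))"
        using g h car by simp
      ultimately show ?thesis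
        using g h car mult_carrier_mat[OF car(1), of "y (inv g)" p]
          mult_carrier_mat[OF mult_carrier_mat[OF car(3) mult_carrier_mat[OF car(2), of "y (inv h)" p]], of "y (inv g)" p]
        by (auto simp: Beq intro!: eq_matI)
    qed
    show "B \<one> = 0\<^sub>m q p" using rep_carrier[OF y, of \<one>] by (auto simp: Beq c1 intro!: eq_matI)
  next
    fix X :: "unit \<Rightarrow> complex mat"
    assume "\<And>t. X t \<in> carrier_mat q p" "\<And>t g. g \<in> carrier G \<Longrightarrow> x g * X t * y (inv g) + B g = X t"
    then show thesis by (rule that)
  qed (auto simp: rep_carrier[OF x] rep_carrier[OF y] rep_one[OF x] rep_one[OF y] rep_mult[OF x] rep_mult[OF y]
      inv_mult_group mat_continuous_carrier[OF B] topspace_eq is_group)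
  have "X () * y g + c g = x g * X ()" if g: "g \<in> carrier G" for g
  proof -
    note car = cc[OF g] rep_carrier[OF x g] rep_carrier[OF y g] rep_carrier[OF y inv_closed[OF g]] X(1)[of "()"]
    have "X () * y g = (x g * X () * y (inv g) + - (c g * y (inv g))) * y g"
      using X(2)[OF g, of "()"] by (simp add: Beq[OF g])
    also have "\<dots> = x g * X () * y (inv g) * y g + - (c g * y (inv g) * y g)"
      using car by (subst add_mult_distrib_mat[of _ q p _ _ p]) (auto intro!: mult_carrier_mat)
    also have "\<dots> = x g * X () + - c g"
    proof -
      have "x g * X () * y (inv g) * y g = x g * X () * (y (inv g) * y g)"
        by (rule assoc_mult_mat[of _ q p _ p _ p]) (use car in auto)
      moreover have "c g * y (inv g) * y g = c g * (y (inv g) * y g)"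
        by (rule assoc_mult_mat[of _ q p _ p _ p]) (use car in auto)
      ultimately show ?thesis using car g by (simp add: rep_inv[OF y])
    qed
    finally show ?thesis using car mult_carrier_mat[OF car(2,5)] by (intro eq_matI) auto
  qed
  then show thesis using that X(1) by blast
qed

end

section \<open>Invariant subspaces and complete reducibility\<close>

definition submat :: "nat \<Rightarrow> nat \<Rightarrow> nat \<Rightarrow> nat \<Rightarrow> complex mat \<Rightarrow> complex mat" where
  "submat r c a b M = mat a b (\<lambda>(i, j). M $$ (r + i, c + j))"

lemma submat_carrier [simp]: "submat r c a b M \<in> carrier_mat a b"
  by (simp add: submat_def)

lemma four_block_submat:
  assumes "M \<in> carrier_mat (a + c) (b + d)"
  shows "M = four_block_mat (submat 0 0 a b M) (submat 0 b a d M) (submat a 0 c b M) (submat a b c d M)"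
  using assms by (intro eq_matI) (auto simp: submat_def)

lemma mat_continuous_submat:
  assumes f: "mat_continuous X q p f" and "r + a \<le> q" "c + b \<le> p"
  shows "mat_continuous X a b (\<lambda>x. submat r c a b (f x))"
  by (rule mat_continuousI[where F = "\<lambda>i j x. f x $$ (r + i, c + j)"])
    (use assms in \<open>auto simp: mat_continuous_def submat_def\<close>)

context compact_group
begin

lemma rep_equiv_refl: "rep n v \<Longrightarrow> rep_equiv (carrier G) n v v"
  using rep_carrier[of n v] by (intro rep_equiv_eq) auto

lemma rep_equiv_symD: "rep n v \<Longrightarrow> rep n w \<Longrightarrow> rep_equiv (carrier G) n v w \<Longrightarrow> rep_equiv (carrier G) n w v"
  using rep_equiv_sym[of "carrier G" v n w] rep_carrier by blast

lemma rep_equiv_transD: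
  assumes "rep n u" "rep n v" "rep n w" "rep_equiv (carrier G) n u v" "rep_equiv (carrier G) n v w"
  shows "rep_equiv (carrier G) n u w"
  by (rule rep_equiv_trans[OF rep_carrier[OF assms(1)] rep_carrier[OF assms(2)] rep_carrier[OF assms(3)] assms(4,5)])

lemma rep_submat:
  assumes v: "rep N v" and "r + a \<le> N"
    and "\<And>g h. g \<in> carrier G \<Longrightarrow> h \<in> carrier G \<Longrightarrow>
      submat r r a a (v (g \<otimes> h)) = submat r r a a (v g) * submat r r a a (v h)"
  shows "rep a (\<lambda>g. submat r r a a (v g))"
  unfolding rep_iff
proof (intro conjI)
  show "submat r r a a (v \<one>) = 1\<^sub>m a"
    using assms(2) by (auto simp: rep_one[OF v] submat_def intro!: eq_matI)
qed (use assms mat_continuous_submat[OF rep_continuous[OF v]] in auto)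

text \<open>Multiplicativity of the block triangular \<open>v\<close> says that the diagonal blocks
  are representations and that the remaining block is a cocycle. Writing it as a coboundary of
  \<open>X\<close> yields a unitriangular change of basis that removes it.\<close>

lemma rep_lower_blocks:
  assumes v: "rep (p + q) v"
    and zero: "\<And>g. g \<in> carrier G \<Longrightarrow> submat 0 p p q (v g) = 0\<^sub>m p q"
  defines "a \<equiv> \<lambda>g. submat 0 0 p p (v g)" and "d \<equiv> \<lambda>g. submat p p q q (v g)"
  shows "rep p a" "rep q d" "rep_equiv (carrier G) (p + q) v (rep_sum a d)"
proof -
  define c where "c g = submat p 0 q p (v g)" for g
  have car: "a g \<in> carrier_mat p p" "c g \<in> carrier_mat q p" "d g \<in> carrier_mat q q" for g
    by (simp_all add: a_def c_def d_def)
  have block: "v g = four_block_mat (a g) (0\<^sub>m p q) (c g) (d g)" if "g \<in> carrier G" for g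
    using four_block_submat[OF rep_carrier[OF v that]] by (simp add: a_def c_def d_def zero[OF that])
  have prod: "a (g \<otimes> h) = a g * a h \<and> 0\<^sub>m p q = 0\<^sub>m p q \<and> c (g \<otimes> h) = c g * a h + d g * c h \<and> d (g \<otimes> h) = d g * d h"
    if g: "g \<in> carrier G" and h: "h \<in> carrier G" for g h
  proof -
    have "four_block_mat (a (g \<otimes> h)) (0\<^sub>m p q) (c (g \<otimes> h)) (d (g \<otimes> h)) = v g * v h"
      using g h by (simp add: block[symmetric] rep_mult[OF v])
    also have "\<dots> = four_block_mat (a g * a h) (0\<^sub>m p q) (c g * a h + d g * c h) (d g * d h)"
      unfolding block[OF g] block[OF h] using car[of g] car[of h]
      by (subst mult_four_block_mat[of _ p p _ q _ q _ _ p _ q]) (auto intro!: cong_four_block_mat)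
    finally show ?thesis
      by (subst (asm) four_block_mat_eq_iff[of _ p p _ q _ q])
        (use car[of g] car[of h] car[of "g \<otimes> h"] in \<open>auto intro!: add_carrier_mat mult_carrier_mat\<close>)
  qed
  show a: "rep p a" unfolding a_def by (rule rep_submat[OF v]) (use prod in \<open>auto simp: a_def\<close>)
  show d: "rep q d" unfolding d_def by (rule rep_submat[OF v]) (use prod in \<open>auto simp: d_def\<close>)
  have "mat_continuous T q p c"
    unfolding c_def using rep_continuous[OF v] by (rule mat_continuous_submat) auto
  then obtain X where X: "X \<in> carrier_mat q p" "\<And>g. g \<in> carrier G \<Longrightarrow> X * a g + c g = d g * X"
    using cocycle_is_coboundary[OF d a, of c] prod by metis
  define P where "P = four_block_mat (1\<^sub>m p) (0\<^sub>m p q) X (1\<^sub>m q)"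
  have "P * v g = rep_sum a d g * P" if g: "g \<in> carrier G" for g
  proof -
    have "P * v g = four_block_mat (a g) (0\<^sub>m p q) (X * a g + c g) (d g)"
      unfolding P_def block[OF g] using X(1) car[of g]
      by (subst mult_four_block_mat[of _ p p _ q _ q _ _ p _ q]) (auto intro!: cong_four_block_mat)
    moreover have "rep_sum a d g * P = four_block_mat (a g) (0\<^sub>m p q) (d g * X) (d g)"
      unfolding P_def rep_sum_eq using X(1) car[of g]
      by (subst mult_four_block_mat[of _ p p _ q _ q _ _ p _ q]) (auto intro!: cong_four_block_mat)
    ultimately show ?thesis using X(2)[OF g] by simp
  qed
  moreover have "P \<in> carrier_mat (p + q) (p + q)" "invertible_mat P"
    unfolding P_def using X by (auto intro: invertible_lower_unitriangular)
  ultimately show "rep_equiv (carrier G) (p + q) v (rep_sum a d)" unfolding rep_equiv_def by blast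
qed

text \<open>The transposed situation. Both versions occur together in \<open>common_summand\<close>,
  where a kernel gives the lower and an image the upper triangular form.\<close>

lemma rep_upper_blocks:
  assumes v: "rep (p + q) v"
    and zero: "\<And>g. g \<in> carrier G \<Longrightarrow> submat p 0 q p (v g) = 0\<^sub>m q p"
  defines "a \<equiv> \<lambda>g. submat 0 0 p p (v g)" and "d \<equiv> \<lambda>g. submat p p q q (v g)"
  shows "rep p a" "rep q d" "rep_equiv (carrier G) (p + q) v (rep_sum a d)"
proof -
  define c where "c g = submat 0 p p q (v g)" for g
  have car: "a g \<in> carrier_mat p p" "c g \<in> carrier_mat p q" "d g \<in> carrier_mat q q" for g
    by (simp_all add: a_def c_def d_def)
  have block: "v g = four_block_mat (a g) (c g) (0\<^sub>m q p) (d g)" if "g \<in> carrier G" for g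
    using four_block_submat[OF rep_carrier[OF v that]] by (simp add: a_def c_def d_def zero[OF that])
  have prod: "a (g \<otimes> h) = a g * a h \<and> c (g \<otimes> h) = a g * c h + c g * d h \<and> 0\<^sub>m q p = 0\<^sub>m q p \<and> d (g \<otimes> h) = d g * d h"
    if g: "g \<in> carrier G" and h: "h \<in> carrier G" for g h
  proof -
    have "four_block_mat (a (g \<otimes> h)) (c (g \<otimes> h)) (0\<^sub>m q p) (d (g \<otimes> h)) = v g * v h"
      using g h by (simp add: block[symmetric] rep_mult[OF v])
    also have "\<dots> = four_block_mat (a g * a h) (a g * c h + c g * d h) (0\<^sub>m q p) (d g * d h)"
      unfolding block[OF g] block[OF h] using car[of g] car[of h]
      by (subst mult_four_block_mat[of _ p p _ q _ q _ _ p _ q]) (auto intro!: cong_four_block_mat)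
    finally show ?thesis
      by (subst (asm) four_block_mat_eq_iff[of _ p p _ q _ q])
        (use car[of g] car[of h] car[of "g \<otimes> h"] in \<open>auto intro!: add_carrier_mat mult_carrier_mat\<close>)
  qed
  show a: "rep p a" unfolding a_def by (rule rep_submat[OF v]) (use prod in \<open>auto simp: a_def\<close>)
  show d: "rep q d" unfolding d_def by (rule rep_submat[OF v]) (use prod in \<open>auto simp: d_def\<close>)
  have "mat_continuous T p q c"
    unfolding c_def using rep_continuous[OF v] by (rule mat_continuous_submat) auto
  moreover have "c (g \<otimes> h) = c g * d h + a g * c h" if "g \<in> carrier G" "h \<in> carrier G" for g h
    using prod[OF that] car[of g] car[of h] comm_add_mat[of "a g * c h" p q "c g * d h"] by auto
  ultimately obtain X where X: "X \<in> carrier_mat p q" "\<And>g. g \<in> carrier G \<Longrightarrow> X * d g + c g = a g * X"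
    using cocycle_is_coboundary[OF a d, of c] by metis
  define P where "P = four_block_mat (1\<^sub>m p) X (0\<^sub>m q p) (1\<^sub>m q)"
  have "P * v g = rep_sum a d g * P" if g: "g \<in> carrier G" for g
  proof -
    have "P * v g = four_block_mat (a g) (X * d g + c g) (0\<^sub>m q p) (d g)"
      unfolding P_def block[OF g] using X(1) car[of g] comm_add_mat[of "X * d g" p q "c g"]
      by (subst mult_four_block_mat[of _ p p _ q _ q _ _ p _ q]) (auto intro!: cong_four_block_mat)
    moreover have "rep_sum a d g * P = four_block_mat (a g) (a g * X) (0\<^sub>m q p) (d g)"
      unfolding P_def rep_sum_eq using X(1) car[of g]
      by (subst mult_four_block_mat[of _ p p _ q _ q _ _ p _ q]) (auto intro!: cong_four_block_mat)
    ultimately show ?thesis using X(2)[OF g] by simp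
  qed
  moreover have "P \<in> carrier_mat (p + q) (p + q)" "invertible_mat P"
    unfolding P_def using X by (auto intro: invertible_upper_unitriangular)
  ultimately show "rep_equiv (carrier G) (p + q) v (rep_sum a d)" unfolding rep_equiv_def by blast
qed

text \<open>The common summand is the image of \<open>\<phi>\<close>, of degree equal to its rank.
  In bases adapted to the rank normal form, the kernel of \<open>\<phi>\<close> in \<open>v\<close>
  and its image in \<open>w\<close> are spanned by basis vectors; complete reducibility splits both
  representations, and the two blocks of size \<open>k\<close> coincide.\<close>

lemma common_summand:
  assumes v: "rep n v" and w: "rep m w" and \<phi>: "\<phi> \<in> carrier_mat m n" "\<phi> \<noteq> 0\<^sub>m m n"
    and tw: "\<And>g. g \<in> carrier G \<Longrightarrow> \<phi> * v g = w g * \<phi>"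
  obtains k u v' w' where "0 < k" "k \<le> n" "k \<le> m" "rep k u" "rep (n - k) v'" "rep (m - k) w'"
    "rep_equiv (carrier G) n v (rep_sum u v')" "rep_equiv (carrier G) m w (rep_sum u w')"
proof -
  obtain P Q k where PQ: "P \<in> carrier_mat m m" "Q \<in> carrier_mat n n" "invertible_mat P" "invertible_mat Q"
    and k: "k \<le> m" "k \<le> n" "P * \<phi> * Q = diag_block (1\<^sub>m k) (0\<^sub>m (m - k) (n - k))" "k > 0"
    using rank_normal_form[OF \<phi>(1)] \<phi>(2) by metis
  obtain P' where P': "P' \<in> carrier_mat m m" "P * P' = 1\<^sub>m m" "P' * P = 1\<^sub>m m" using PQ invertible_matE by metis
  obtain Q' where Q': "Q' \<in> carrier_mat n n" "Q * Q' = 1\<^sub>m n" "Q' * Q = 1\<^sub>m n" using PQ invertible_matE by metis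
  define v1 where "v1 g = Q' * v g * Q" for g
  define w1 where "w1 g = P * w g * P'" for g
  \<comment> \<open>The matrix of \<open>\<phi>\<close> in the new bases, in which \<open>v\<close>
    and \<open>w\<close> become \<open>v1\<close> and \<open>w1\<close>.\<close>
  define J where "J = diag_block (1\<^sub>m k) (0\<^sub>m (m - k) (n - k) :: complex mat)"
  have v1: "rep n v1" unfolding v1_def[abs_def] using rep_conj[OF v Q'(1) PQ(2) Q'(3,2)] .
  have w1: "rep m w1" unfolding w1_def[abs_def] using rep_conj[OF w PQ(1) P'(1,2,3)] .
  have ev: "rep_equiv (carrier G) n v v1" unfolding v1_def[abs_def] using rep_equiv_conj[OF v Q'(1) PQ(2) Q'(2)] .
  have ew: "rep_equiv (carrier G) m w w1" unfolding w1_def[abs_def] using rep_equiv_conj[OF w PQ(1) P'(1,3)] .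
  have J: "J * v1 g = w1 g * J" if g: "g \<in> carrier G" for g
  proof -
    note c = rep_carrier[OF v g] rep_carrier[OF w g] PQ(1,2) P'(1) Q'(1) \<phi>(1)
    have "J * v1 g = P * \<phi> * Q * (Q' * v g) * Q"
      unfolding J_def k(3)[symmetric] v1_def using c
      by (intro assoc_mult_mat[symmetric, of _ m n _ n _ n]) auto
    also have "P * \<phi> * Q * (Q' * v g) = P * \<phi> * (Q * Q') * v g"
      using assoc_mult_mat5[of "P * \<phi>" m n Q n "1\<^sub>m n" n Q' n "v g" n] assoc_mult_mat[of "P * \<phi>" m n "Q * Q'" n "v g" n]
        assoc_mult_mat[of "Q" n n Q' n "v g" n] assoc_mult_mat[of "P * \<phi>" m n Q n "Q' * v g" n] c by auto
    also have "\<dots> = P * (\<phi> * v g)"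
      using c Q' assoc_mult_mat[of P m m \<phi> n "v g" n] by auto
    also have "\<dots> = P * w g * (P' * P) * \<phi>"
      using c P' tw[OF g] assoc_mult_mat[of P m m "w g" m \<phi> n] by auto
    also have "\<dots> * Q = w1 g * J"
      unfolding J_def k(3)[symmetric] w1_def
    proof -
      have 1: "P * w g * (P' * P) = P * w g * P' * P"
        by (rule assoc_mult_mat[symmetric, of _ m m _ m _ m]) (use c in auto)
      have 2: "P * w g * P' * P * \<phi> = P * w g * P' * (P * \<phi>)"
        by (rule assoc_mult_mat[of _ m m _ m _ n]) (use c in auto)
      have 3: "P * w g * P' * (P * \<phi>) * Q = P * w g * P' * (P * \<phi> * Q)"
        by (rule assoc_mult_mat[of _ m m _ n _ n]) (use c in auto)
      show "P * w g * (P' * P) * \<phi> * Q = P * w g * P' * (P * \<phi> * Q)" unfolding 1 2 3 ..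
    qed
    finally show ?thesis .
  qed
  define b where "b g = submat 0 k k (n - k) (v1 g)" for g
  \<comment> \<open>Read off from \<open>J * v1 g = w1 g * J\<close>: the left side has zero lower
    blocks, the right side zero right blocks, and the upper left blocks are those of
    \<open>v1 g\<close> and \<open>w1 g\<close>.\<close>
  have blocks: "submat 0 0 k k (v1 g) = submat 0 0 k k (w1 g) \<and> submat 0 k k (n - k) (v1 g) = 0\<^sub>m k (n - k) \<and>
      0\<^sub>m (m - k) k = submat k 0 (m - k) k (w1 g) \<and> 0\<^sub>m (m - k) (n - k) = 0\<^sub>m (m - k) (n - k)"
    if g: "g \<in> carrier G" for g
  proof -
    have bv: "v1 g = four_block_mat (submat 0 0 k k (v1 g)) (submat 0 k k (n - k) (v1 g))
        (submat k 0 (n - k) k (v1 g)) (submat k k (n - k) (n - k) (v1 g))"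
      using rep_carrier[OF v1 g] k by (intro four_block_submat) auto
    have bw: "w1 g = four_block_mat (submat 0 0 k k (w1 g)) (submat 0 k k (m - k) (w1 g))
        (submat k 0 (m - k) k (w1 g)) (submat k k (m - k) (m - k) (w1 g))"
      using rep_carrier[OF w1 g] k by (intro four_block_submat) auto
    note sc = submat_carrier[of 0 0 k k] submat_carrier[of 0 k k "n - k"] submat_carrier[of k 0 "n - k" k]
      submat_carrier[of k k "n - k" "n - k"] submat_carrier[of 0 k k "m - k"] submat_carrier[of k 0 "m - k" k]
      submat_carrier[of k k "m - k" "m - k"]
    have 1: "J * v1 g = four_block_mat (submat 0 0 k k (v1 g)) (submat 0 k k (n - k) (v1 g)) (0\<^sub>m (m - k) k) (0\<^sub>m (m - k) (n - k))"
      unfolding J_def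
      by (subst bv, subst mult_four_block_mat[of _ k k _ "n - k" _ "m - k" _ _ k _ "n - k"])
        (use sc[of "v1 g"] in \<open>auto simp del: submat_carrier intro!: cong_four_block_mat\<close>)
    have 2: "w1 g * J = four_block_mat (submat 0 0 k k (w1 g)) (0\<^sub>m k (n - k)) (submat k 0 (m - k) k (w1 g)) (0\<^sub>m (m - k) (n - k))"
      unfolding J_def
      by (subst bw, subst mult_four_block_mat[of _ k k _ "m - k" _ "m - k" _ _ k _ "n - k"])
        (use sc[of "w1 g"] in \<open>auto simp del: submat_carrier intro!: cong_four_block_mat\<close>)
    show ?thesis using J[OF g] unfolding 1 2
      by (subst (asm) four_block_mat_eq_iff[of _ k k _ "n - k" _ "m - k"]) auto
  qed
  have nm: "k + (n - k) = n" "k + (m - k) = m" using k by auto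
  have v1': "rep (k + (n - k)) v1" and w1': "rep (k + (m - k)) w1" using v1 w1 nm by simp_all
  note lower = rep_lower_blocks[OF v1'] and upper = rep_upper_blocks[OF w1']
  have zv: "\<And>g. g \<in> carrier G \<Longrightarrow> submat 0 k k (n - k) (v1 g) = 0\<^sub>m k (n - k)"
    and zw: "\<And>g. g \<in> carrier G \<Longrightarrow> submat k 0 (m - k) k (w1 g) = 0\<^sub>m (m - k) k"
    using blocks by metis+
  let ?u = "\<lambda>g. submat 0 0 k k (v1 g)" and ?v = "\<lambda>g. submat k k (n - k) (n - k) (v1 g)"
    and ?w = "\<lambda>g. submat k k (m - k) (m - k) (w1 g)"
  have u: "rep k ?u" and v': "rep (n - k) ?v" and w': "rep (m - k) ?w"
    using lower(1,2)[OF zv] upper(2)[OF zw] by auto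
  have "rep_equiv (carrier G) n v1 (rep_sum ?u ?v)" using lower(3)[OF zv] nm by simp
  moreover have "rep n (rep_sum ?u ?v)" "rep m (rep_sum ?u ?w)"
    using rep_sum[OF u v'] rep_sum[OF u w'] nm by simp_all
  note uvw = this
  ultimately have 1: "rep_equiv (carrier G) n v (rep_sum ?u ?v)"
    using rep_equiv_transD[OF v v1 uvw(1) ev] by blast
  have "rep_sum (\<lambda>g. submat 0 0 k k (w1 g)) ?w g = rep_sum ?u ?w g" if "g \<in> carrier G" for g
    using blocks[OF that] by (simp add: rep_sum_eq)
  moreover have "rep_equiv (carrier G) m w1 (rep_sum (\<lambda>g. submat 0 0 k k (w1 g)) ?w)"
    using upper(3)[OF zw] nm by simp
  ultimately have "rep_equiv (carrier G) m w1 (rep_sum ?u ?w)" unfolding rep_equiv_def by auto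
  then have 2: "rep_equiv (carrier G) m w (rep_sum ?u ?w)"
    using rep_equiv_transD[OF w w1 uvw(2) ew] by blast
  show thesis using that[OF k(4) k(2,1) u v' w' 1 2] .
qed

end

section \<open>Common summands and the subgroup of index two\<close>

context compact_group
begin

lemma rep_degree_unique: "rep n r \<Longrightarrow> rep m r \<Longrightarrow> n = m"
  using rep_one[of n r] rep_one[of m r] by (metis index_one_mat(2))

lemma rep_sum_triv_left: "rep n v \<Longrightarrow> g \<in> carrier G \<Longrightarrow> rep_sum (triv_rep 0) v g = v g"
  using rep_carrier[of n v g] by (auto simp: rep_sum_eq triv_rep_def intro!: eq_matI)

text \<open>The vanishing of the space of equivariant maps from \<open>v\<close> to
  \<open>w\<close>; it plays the part of having no irreducible constituent in common.\<close>

definition intertwiners_trivial :: "nat \<Rightarrow> nat \<Rightarrow> ('a \<Rightarrow> complex mat) \<Rightarrow> ('a \<Rightarrow> complex mat) \<Rightarrow> bool" where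
  "intertwiners_trivial n m v w \<longleftrightarrow>
     (\<forall>\<phi>\<in>carrier_mat m n. (\<forall>g\<in>carrier G. \<phi> * v g = w g * \<phi>) \<longrightarrow> \<phi> = 0\<^sub>m m n)"

text \<open>Induction on the degree of \<open>v\<close>: as long as a nonzero intertwiner exists,
  its image splits off both sides and has positive degree.\<close>

lemma maximal_common_summand:
  assumes "rep n v" "rep m w"
  shows "\<exists>k a b u v' w'. n = k + a \<and> m = k + b \<and> rep k u \<and> rep a v' \<and> rep b w' \<and>
    rep_equiv (carrier G) n v (rep_sum u v') \<and> rep_equiv (carrier G) m w (rep_sum u w') \<and>
    intertwiners_trivial a b v' w'"
  using assms
proof (induction n arbitrary: v m w rule: less_induct)
  case (less n)
  note v = less.prems(1) and w = less.prems(2)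
  show ?case
  proof (cases "intertwiners_trivial n m v w")
    case True
    have "rep_equiv (carrier G) n v (rep_sum (triv_rep 0) v)"
      using rep_carrier[OF v] rep_sum_triv_left[OF v] by (intro rep_equiv_eq) auto
    moreover have "rep_equiv (carrier G) m w (rep_sum (triv_rep 0) w)"
      using rep_carrier[OF w] rep_sum_triv_left[OF w] by (intro rep_equiv_eq) auto
    ultimately show ?thesis using v w True rep_triv[of 0]
      by (intro exI[of _ 0] exI[of _ n] exI[of _ m] exI[of _ "triv_rep 0"] exI[of _ v] exI[of _ w]) auto
  next
    case False
    then obtain \<phi> where "\<phi> \<in> carrier_mat m n" "\<phi> \<noteq> 0\<^sub>m m n" "\<And>g. g \<in> carrier G \<Longrightarrow> \<phi> * v g = w g * \<phi>"
      unfolding intertwiners_trivial_def by blast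
    from common_summand[OF v w this] obtain k u v1 w1 where k: "0 < k" "k \<le> n" "k \<le> m" and
      r: "rep k u" "rep (n - k) v1" "rep (m - k) w1"
      and e: "rep_equiv (carrier G) n v (rep_sum u v1)" "rep_equiv (carrier G) m w (rep_sum u w1)"
      by metis
    have "n - k < n" using k by simp
    from less.IH[OF this r(2,3)] obtain l a b u' v' w' where
      l: "n - k = l + a" "m - k = l + b" and r': "rep l u'" "rep a v'" "rep b w'"
      and e': "rep_equiv (carrier G) (n - k) v1 (rep_sum u' v')" "rep_equiv (carrier G) (m - k) w1 (rep_sum u' w')"
      and triv: "intertwiners_trivial a b v' w'"
      by blast
    have nm: "n = k + (l + a)" "m = k + (l + b)" using l k by auto
    have step: "rep_equiv (carrier G) (k + (l + a)) v (rep_sum (rep_sum u u') v')"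
      if "rep (k + (l + a)) v" "rep (l + a) v1" "rep a v'" "rep_equiv (carrier G) (k + (l + a)) v (rep_sum u v1)"
        "rep_equiv (carrier G) (l + a) v1 (rep_sum u' v')" for a v v1 v'
    proof -
      have "rep_equiv (carrier G) (k + (l + a)) (rep_sum u v1) (rep_sum u (rep_sum u' v'))"
        by (rule rep_equiv_sum[OF rep_carrier[OF r(1)] rep_carrier[OF r(1)] rep_carrier[OF that(2)]
          rep_carrier[OF rep_sum[OF r'(1) that(3)]] rep_equiv_refl[OF r(1)] that(5)])
      from rep_equiv_transD[OF that(1) rep_sum[OF r(1) that(2)] rep_sum[OF r(1) rep_sum[OF r'(1) that(3)]] that(4) this]
      show ?thesis by (simp add: rep_sum_assoc)
    qed
    have "rep_equiv (carrier G) n v (rep_sum (rep_sum u u') v')"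
      unfolding nm(1) by (rule step[of a v v1 v']) (use v r e e' r' l nm in auto)
    moreover have "rep_equiv (carrier G) m w (rep_sum (rep_sum u u') w')"
      unfolding nm(2) by (rule step[of b w w1 w']) (use w r e e' r' l nm in auto)
    ultimately show ?thesis
      using rep_sum[OF r(1) r'(1)] r' triv nm
      by (intro exI[of _ "k + l"] exI[of _ a] exI[of _ b] exI[of _ "rep_sum u u'"] exI[of _ v'] exI[of _ w']) auto
  qed
qed

text \<open>
  On the maximal part without common summands, an isomorphism over the index-two subgroup has vanishing
  equivariant part, so it is anti-equivariant.
\<close>

lemma rep_equiv_index_two:
  fixes sg :: "'a \<Rightarrow> complex"
  assumes v: "rep n v" and w: "rep n w"
    and sg: "\<And>g. g \<in> carrier G \<Longrightarrow> sg g = 1 \<or> sg g = -1"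
    and sm: "\<And>g h. g \<in> carrier G \<Longrightarrow> h \<in> carrier G \<Longrightarrow> sg (g \<otimes> h) = sg g * sg h"
    and g0: "g0 \<in> carrier G" "sg g0 = -1"
    and eqH: "rep_equiv {g \<in> carrier G. sg g = 1} n v w"
  shows "\<exists>k a u s. n = k + a \<and> rep k u \<and> rep a s \<and> rep a (\<lambda>g. sg g \<cdot>\<^sub>m s g) \<and>
    rep_equiv (carrier G) n v (rep_sum u s) \<and> rep_equiv (carrier G) n w (rep_sum u (\<lambda>g. sg g \<cdot>\<^sub>m s g))"
proof -
  let ?H = "{g \<in> carrier G. sg g = 1}"
  obtain k a b u s t where n: "n = k + a" "n = k + b" and r: "rep k u" "rep a s" "rep b t"
    and e: "rep_equiv (carrier G) n v (rep_sum u s)" "rep_equiv (carrier G) n w (rep_sum u t)"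
    and triv: "intertwiners_trivial a b s t"
    using maximal_common_summand[OF v w] by blast
  have b: "b = a" using n by simp
  note t = r(3)[unfolded b]
  have cs: "s g \<in> carrier_mat a a" "t g \<in> carrier_mat a a" if "g \<in> carrier G" for g
    using rep_carrier[OF r(2) that] rep_carrier[OF t that] .
  have us: "rep n (rep_sum u s)" and ut: "rep n (rep_sum u t)"
    using rep_sum[OF r(1,2)] rep_sum[OF r(1) t] n by simp_all
  have H: "?H \<subseteq> carrier G" by auto
  have cH: "\<And>g. g \<in> ?H \<Longrightarrow> v g \<in> carrier_mat n n" "\<And>g. g \<in> ?H \<Longrightarrow> w g \<in> carrier_mat n n"
    "\<And>g. g \<in> ?H \<Longrightarrow> rep_sum u s g \<in> carrier_mat n n" "\<And>g. g \<in> ?H \<Longrightarrow> rep_sum u t g \<in> carrier_mat n n"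
    using rep_carrier[OF v] rep_carrier[OF w] rep_carrier[OF us] rep_carrier[OF ut] by auto
  \<comment> \<open>Over the subgroup, both sums are isomorphic, and cancellation of
    \<open>u\<close> leaves an isomorphism between the parts \<open>s\<close> and \<open>t\<close>
    that have no nonzero intertwiner over the whole group.\<close>
  have "rep_equiv ?H n (rep_sum u s) w"
    using rep_equiv_trans[OF cH(3,1,2) rep_equiv_sym[OF cH(1,3) rep_equiv_mono[OF e(1) H]] eqH] .
  from rep_equiv_trans[OF cH(3,2,4) this rep_equiv_mono[OF e(2) H]]
  have "rep_equiv ?H (k + a) (rep_sum u s) (rep_sum u t)" using n by simp
  from rep_equiv_cancel[OF _ _ _ this] have "rep_equiv ?H a s t"
    using rep_carrier[OF r(1)] cs by auto
  then obtain \<phi> where \<phi>: "\<phi> \<in> carrier_mat a a" "invertible_mat \<phi>" "\<And>g. g \<in> ?H \<Longrightarrow> \<phi> * s g = t g * \<phi>"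
    unfolding rep_equiv_def by blast
  note ac = assoc_mult_mat[of _ a a _ a _ a] mult_carrier_mat[of _ a a _ a]
  have sg1: "sg \<one> = 1" using sm[of \<one> \<one>] sg[of \<one>] by auto
  have sgi: "sg (inv g0) = -1"
    using sm[of g0 "inv g0"] g0 sg1 sg[of "inv g0"] by auto
  \<comment> \<open>The translate of \<open>\<phi>\<close> by \<open>g0\<close>. As
    \<open>?H\<close> is normal of index two, \<open>\<psi>\<close> is again equivariant over
    \<open>?H\<close>, and \<open>\<phi> + \<psi>\<close> is the transfer of \<open>\<phi>\<close>,
    equivariant over the whole group.\<close>
  define \<psi> where "\<psi> = t g0 * \<phi> * s (inv g0)"
  have c\<psi>: "\<psi> \<in> carrier_mat a a" unfolding \<psi>_def using \<phi> cs[OF g0(1)] cs[of "inv g0"] g0 by (simp add: ac)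
  define tw where "tw g \<longleftrightarrow> (\<phi> + \<psi>) * s g = t g * (\<phi> + \<psi>)" for g
  have cp: "\<phi> + \<psi> \<in> carrier_mat a a" using \<phi> c\<psi> by simp
  have twH: "tw h" if h: "h \<in> ?H" for h
  proof -
    have hc: "h \<in> carrier G" using h by simp
    define h' where "h' = inv g0 \<otimes> h \<otimes> g0"
    have h': "h' \<in> ?H" using h g0 sgi by (simp add: h'_def sm)
    then have h'c: "h' \<in> carrier G" by simp
    have comm: "inv g0 \<otimes> h = h' \<otimes> inv g0" "g0 \<otimes> h' = h \<otimes> g0"
      using g0 hc by (simp_all add: h'_def m_assoc) (simp_all flip: m_assoc)
    note c = cs[OF g0(1)] cs[OF inv_closed[OF g0(1)]] cs[OF hc] cs[OF h'c] \<phi>(1)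
    have "\<psi> * s h = t g0 * \<phi> * (s (inv g0) * s h)"
      unfolding \<psi>_def using c by (simp add: ac)
    also have "s (inv g0) * s h = s h' * s (inv g0)"
      using comm(1) g0 hc h'c by (simp flip: rep_mult[OF r(2)])
    also have "t g0 * \<phi> * (s h' * s (inv g0)) = t g0 * (\<phi> * s h') * s (inv g0)"
      using c by (simp add: ac)
    also have "\<dots> = (t g0 * t h') * (\<phi> * s (inv g0))"
      unfolding \<phi>(3)[OF h'] using c by (simp add: ac)
    also have "t g0 * t h' = t h * t g0"
      using comm(2) g0 hc h'c by (simp flip: rep_mult[OF t])
    also have "t h * t g0 * (\<phi> * s (inv g0)) = t h * \<psi>"
      unfolding \<psi>_def using c by (simp add: ac)
    finally have "\<psi> * s h = t h * \<psi>" .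
    then show ?thesis unfolding tw_def using \<phi>(3)[OF h] \<phi>(1) c\<psi> cs[OF hc]
      by (simp add: add_mult_distrib_mat[of _ a a] mult_add_distrib_mat[of _ a a])
  qed
  have tw0: "tw g0"
  proof -
    note c = cs[OF g0(1)] cs[OF inv_closed[OF g0(1)]] cs[of "g0 \<otimes> g0"] \<phi>(1)
    have gg: "g0 \<otimes> g0 \<in> ?H" using g0 by (simp add: sm)
    have 1: "\<psi> * s g0 = t g0 * \<phi>"
    proof -
      have "\<psi> * s g0 = t g0 * \<phi> * (s (inv g0) * s g0)" unfolding \<psi>_def using c by (simp add: ac)
      then show ?thesis using c g0 by (simp add: rep_inv[OF r(2)])
    qed
    \<comment> \<open>The square of \<open>g0\<close> lies in \<open>?H\<close>, so translating
      twice returns to \<open>\<phi>\<close>.\<close>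
    have 2: "t g0 * \<psi> = \<phi> * s g0"
    proof -
      have "t g0 * \<psi> = t (g0 \<otimes> g0) * \<phi> * s (inv g0)"
        unfolding \<psi>_def rep_mult[OF t g0(1) g0(1)] using c by (simp add: ac)
      also have "\<dots> = \<phi> * s (g0 \<otimes> g0) * s (inv g0)" using \<phi>(3)[OF gg] by simp
      also have "\<dots> = \<phi> * s g0 * (s g0 * s (inv g0))"
        unfolding rep_mult[OF r(2) g0(1) g0(1)] using c by (simp add: ac)
      also have "\<dots> = \<phi> * s g0" using c g0 by (simp add: rep_inv[OF r(2)])
      finally show ?thesis .
    qed
    have "(\<phi> + \<psi>) * s g0 = \<phi> * s g0 + t g0 * \<phi>"
      using \<phi>(1) c\<psi> c 1 by (simp add: add_mult_distrib_mat[of _ a a])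
    also have "\<dots> = t g0 * \<phi> + \<phi> * s g0" using \<phi>(1) c by (intro comm_add_mat[of _ a a]) auto
    also have "\<dots> = t g0 * (\<phi> + \<psi>)"
      using \<phi>(1) c\<psi> c 2 by (simp add: mult_add_distrib_mat[of _ a a])
    finally show ?thesis unfolding tw_def .
  qed
  have decomp: "g = g0 \<otimes> (inv g0 \<otimes> g) \<and> inv g0 \<otimes> g \<in> ?H" if "g \<in> carrier G" "sg g \<noteq> 1" for g
    using that g0 sg[of g] sgi by (auto simp: sm simp flip: m_assoc)
  have "tw g" if g: "g \<in> carrier G" for g
  proof (cases "sg g = 1")
    case True
    then show ?thesis using twH g by simp
  next
    case False
    then obtain h where h: "g = g0 \<otimes> h" "h \<in> ?H" using decomp[OF g] by blast
    then have hc: "h \<in> carrier G" by simp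
    note c = cs[OF g0(1)] cs[OF hc] cp
    have "(\<phi> + \<psi>) * s g = ((\<phi> + \<psi>) * s g0) * s h"
      unfolding h(1) rep_mult[OF r(2) g0(1) hc] using c by (simp add: ac)
    also have "\<dots> = t g0 * ((\<phi> + \<psi>) * s h)" using tw0 c unfolding tw_def by (simp add: ac)
    also have "\<dots> = t g0 * (t h * (\<phi> + \<psi>))" using twH[OF h(2)] unfolding tw_def by simp
    also have "\<dots> = t g * (\<phi> + \<psi>)"
      unfolding h(1) rep_mult[OF t g0(1) hc] using c by (simp add: ac)
    finally show ?thesis unfolding tw_def .
  qed
  \<comment> \<open>There are no nonzero intertwiners from \<open>s\<close> to \<open>t\<close>, so
    the transfer vanishes. Hence \<open>\<phi>\<close> changes sign under \<open>g0\<close>, and it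
    is an isomorphism from the sign twist of \<open>s\<close> onto \<open>t\<close>.\<close>
  then have zero: "\<phi> + \<psi> = 0\<^sub>m a a"
    using triv cp unfolding intertwiners_trivial_def b tw_def by blast
  have anti: "t g0 * \<phi> = - (\<phi> * s g0)"
  proof -
    note c = cs[OF g0(1)] cs[OF inv_closed[OF g0(1)]] \<phi>(1)
    have "\<psi> = - \<phi>"
    proof (rule eq_matI)
      fix i j assume ij: "i < dim_row (- \<phi>)" "j < dim_col (- \<phi>)"
      then have "(\<phi> + \<psi>) $$ (i, j) = 0" using zero \<phi>(1) by simp
      then show "\<psi> $$ (i, j) = (- \<phi>) $$ (i, j)" using ij \<phi>(1) c\<psi> by (simp add: add_eq_0_iff)
    qed (use \<phi>(1) c\<psi> in auto)
    have "t g0 * \<phi> = t g0 * \<phi> * (s (inv g0) * s g0)" using c g0 by (simp add: rep_inv[OF r(2)])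
    also have "\<dots> = \<psi> * s g0" unfolding \<psi>_def using c by (simp add: ac)
    finally show ?thesis using \<open>\<psi> = - \<phi>\<close> c by simp
  qed
  have key: "\<phi> * (sg g \<cdot>\<^sub>m s g) = t g * \<phi>" if g: "g \<in> carrier G" for g
  proof (cases "sg g = 1")
    case True
    moreover have "1 \<cdot>\<^sub>m s g = s g" by (intro eq_matI) auto
    ultimately show ?thesis using \<phi>(3) g by simp
  next
    case False
    then obtain h where h: "g = g0 \<otimes> h" "h \<in> ?H" using decomp[OF g] by blast
    then have hc: "h \<in> carrier G" by simp
    note c = cs[OF g0(1)] cs[OF hc] cs[OF g] \<phi>(1)
    have "t g * \<phi> = t g0 * (t h * \<phi>)" unfolding h(1) rep_mult[OF t g0(1) hc] using c by (simp add: ac)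
    also have "\<dots> = t g0 * \<phi> * s h" using c by (simp add: ac flip: \<phi>(3)[OF h(2)])
    also have "\<dots> = - (\<phi> * s g0 * s h)" unfolding anti using c by simp
    also have "\<phi> * s g0 * s h = \<phi> * s g" unfolding h(1) rep_mult[OF r(2) g0(1) hc] using c by (simp add: ac)
    also have "- (\<phi> * s g) = \<phi> * (sg g \<cdot>\<^sub>m s g)"
    proof -
      have "sg g = -1" using False sg[OF g] by simp
      then have "sg g \<cdot>\<^sub>m s g = - s g" by (intro eq_matI) auto
      then show ?thesis using c by simp
    qed
    finally show ?thesis ..
  qed
  have cx: "sg g \<cdot>\<^sub>m s g \<in> carrier_mat a a" if "g \<in> carrier G" for g using cs[OF that] by simp
  have e1: "rep_equiv (carrier G) a (\<lambda>g. sg g \<cdot>\<^sub>m s g) t"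
    unfolding rep_equiv_def using \<phi>(1,2) key by blast
  have e2: "rep_equiv (carrier G) a t (\<lambda>g. sg g \<cdot>\<^sub>m s g)"
    by (rule rep_equiv_sym[OF cx cs(2) e1])
  have x: "rep a (\<lambda>g. sg g \<cdot>\<^sub>m s g)" by (rule rep_transport[OF t cx e2])
  have "rep_equiv (carrier G) (k + a) (rep_sum u t) (rep_sum u (\<lambda>g. sg g \<cdot>\<^sub>m s g))"
    by (rule rep_equiv_sum[OF rep_carrier[OF r(1)] rep_carrier[OF r(1)] cs(2) cx rep_equiv_refl[OF r(1)] e2])
  then have "rep_equiv (carrier G) n w (rep_sum u (\<lambda>g. sg g \<cdot>\<^sub>m s g))"
    using rep_equiv_transD[OF w ut _ e(2)] rep_sum[OF r(1) x] n by simp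
  then show ?thesis using n r x e(1) by blast
qed

end

section \<open>Grothendieck groups and the representation ring\<close>

text \<open>Closure and the two distributive laws are what makes the product of formal differences
  independent of representatives.\<close>

locale presemiring = abelian_monoid S for S (structure) +
  assumes m_closed: "x \<in> carrier S \<Longrightarrow> y \<in> carrier S \<Longrightarrow> x \<otimes> y \<in> carrier S"
    and l_distr: "x \<in> carrier S \<Longrightarrow> y \<in> carrier S \<Longrightarrow> z \<in> carrier S \<Longrightarrow> (x \<oplus> y) \<otimes> z = x \<otimes> z \<oplus> y \<otimes> z"
    and r_distr: "x \<in> carrier S \<Longrightarrow> y \<in> carrier S \<Longrightarrow> z \<in> carrier S \<Longrightarrow> z \<otimes> (x \<oplus> y) = z \<otimes> x \<oplus> z \<otimes> y"

context abelian_monoid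
begin

lemma equiv_groth_rel: "equiv (carrier G \<times> carrier G) (groth_rel G)"
proof (rule equivI)
  show "groth_rel G \<subseteq> (carrier G \<times> carrier G) \<times> (carrier G \<times> carrier G)"
    unfolding groth_rel_def by auto
  show "refl_on (carrier G \<times> carrier G) (groth_rel G)"
    unfolding refl_on_def groth_rel_def by auto
  show "sym (groth_rel G)"
    unfolding groth_rel_def by (rule symI) (clarsimp, metis)
  show "trans (groth_rel G)"
  proof (rule transI)
    fix x y z assume "(x, y) \<in> groth_rel G" "(y, z) \<in> groth_rel G"
    then obtain a b c d e f k l where eq: "x = (a, b)" "y = (c, d)" "z = (e, f)" and
      c: "a \<in> carrier G" "b \<in> carrier G" "c \<in> carrier G" "d \<in> carrier G" "e \<in> carrier G" "f \<in> carrier G"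
      "k \<in> carrier G" "l \<in> carrier G" and
      kl: "a \<oplus> d \<oplus> k = c \<oplus> b \<oplus> k" "c \<oplus> f \<oplus> l = e \<oplus> d \<oplus> l"
      unfolding groth_rel_def by auto
    \<comment> \<open>The stabilizer for the composite contains the middle pair \<open>c\<close>,
      \<open>d\<close> besides the two given stabilizers, since the middle pair cannot be
      cancelled.\<close>
    have "a \<oplus> f \<oplus> (c \<oplus> d \<oplus> k \<oplus> l) = (a \<oplus> d \<oplus> k) \<oplus> (c \<oplus> f \<oplus> l)"
      using c by (simp add: a_ac)
    also have "\<dots> = e \<oplus> b \<oplus> (c \<oplus> d \<oplus> k \<oplus> l)"
      unfolding kl using c by (simp add: a_ac)
    finally show "(x, z) \<in> groth_rel G"
      unfolding groth_rel_def eq using c by (auto intro!: bexI[of _ "c \<oplus> d \<oplus> k \<oplus> l"])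
  qed
qed

lemma groth_diff_eq_iff:
  assumes "a \<in> carrier G" "b \<in> carrier G" "c \<in> carrier G" "d \<in> carrier G"
  shows "groth_diff G a b = groth_diff G c d \<longleftrightarrow> (\<exists>k\<in>carrier G. a \<oplus> d \<oplus> k = c \<oplus> b \<oplus> k)"
proof -
  have "groth_diff G a b = groth_diff G c d \<longleftrightarrow> ((a, b), (c, d)) \<in> groth_rel G"
    unfolding groth_diff_def using assms by (intro eq_equiv_class_iff[OF equiv_groth_rel]) auto
  then show ?thesis using assms by (simp add: groth_rel_def)
qed

lemma groth_diff_eqI:
  assumes "a \<in> carrier G" "b \<in> carrier G" "c \<in> carrier G" "d \<in> carrier G" "a \<oplus> d = c \<oplus> b"
  shows "groth_diff G a b = groth_diff G c d"
  using assms by (auto simp: groth_diff_eq_iff intro: bexI[of _ \<zero>])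

text \<open>Operations on Grothendieck rings are defined as unions over all representatives. Such a
  union collapses to a single value when \<open>F\<close> is constant on the class, which is
  nonempty.\<close>

lemma UN_groth_diff:
  assumes ab: "a \<in> carrier G" "b \<in> carrier G"
    and F: "\<And>c d. c \<in> carrier G \<Longrightarrow> d \<in> carrier G \<Longrightarrow> groth_diff G c d = groth_diff G a b \<Longrightarrow> F c d = X"
  shows "(\<Union>(c, d)\<in>groth_diff G a b. F c d) = X"
proof -
  have mem: "(a, b) \<in> groth_diff G a b"
    unfolding groth_diff_def using ab by (intro equiv_class_self[OF equiv_groth_rel]) auto
  have "F c d = X" if "(c, d) \<in> groth_diff G a b" for c d
  proof (rule F)
    show "c \<in> carrier G" "d \<in> carrier G" using that by (auto simp: groth_diff_def groth_rel_def)
    show "groth_diff G c d = groth_diff G a b"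
      using that equiv_class_eq[OF equiv_groth_rel, of "(a, b)" "(c, d)"] by (simp add: groth_diff_def)
  qed
  then show ?thesis using mem by fastforce
qed

lemma groth_carrier: "carrier (groth_ring G) = {groth_diff G a b | a b. a \<in> carrier G \<and> b \<in> carrier G}"
  unfolding groth_ring_def groth_diff_def quotient_def by auto

lemma groth_diff_mem: "a \<in> carrier G \<Longrightarrow> b \<in> carrier G \<Longrightarrow> groth_diff G a b \<in> carrier (groth_ring G)"
  unfolding groth_carrier by blast

lemma groth_carrierE:
  assumes "x \<in> carrier (groth_ring G)"
  obtains a b where "a \<in> carrier G" "b \<in> carrier G" "x = groth_diff G a b"
  using assms groth_carrier by auto

lemma groth_zero: "\<zero>\<^bsub>groth_ring G\<^esub> = groth_diff G \<zero> \<zero>"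
  by (simp add: groth_ring_def)

lemma groth_diff_eq_zero_iff:
  assumes "a \<in> carrier G" "b \<in> carrier G"
  shows "groth_diff G a b = \<zero>\<^bsub>groth_ring G\<^esub> \<longleftrightarrow> (\<exists>k\<in>carrier G. a \<oplus> k = b \<oplus> k)"
  unfolding groth_zero using assms by (simp add: groth_diff_eq_iff)

lemma groth_add:
  assumes c: "a \<in> carrier G" "b \<in> carrier G" "c \<in> carrier G" "d \<in> carrier G"
  shows "groth_diff G a b \<oplus>\<^bsub>groth_ring G\<^esub> groth_diff G c d = groth_diff G (a \<oplus> c) (b \<oplus> d)"
proof -
  have "groth_diff G (a' \<oplus> c') (b' \<oplus> d') = groth_diff G (a \<oplus> c) (b \<oplus> d)"
    if c': "a' \<in> carrier G" "b' \<in> carrier G" "c' \<in> carrier G" "d' \<in> carrier G"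
      and eq: "groth_diff G a' b' = groth_diff G a b" "groth_diff G c' d' = groth_diff G c d" for a' b' c' d'
  proof -
    obtain k l where kl: "k \<in> carrier G" "l \<in> carrier G" "a' \<oplus> b \<oplus> k = a \<oplus> b' \<oplus> k" "c' \<oplus> d \<oplus> l = c \<oplus> d' \<oplus> l"
      using eq c c' by (auto simp: groth_diff_eq_iff)
    have "(a' \<oplus> c') \<oplus> (b \<oplus> d) \<oplus> (k \<oplus> l) = (a' \<oplus> b \<oplus> k) \<oplus> (c' \<oplus> d \<oplus> l)"
      using c c' kl(1,2) by (simp add: a_ac)
    also have "\<dots> = (a \<oplus> c) \<oplus> (b' \<oplus> d') \<oplus> (k \<oplus> l)"
      unfolding kl(3,4) using c c' kl(1,2) by (simp add: a_ac)
    finally show ?thesis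
      using c c' kl(1,2) by (subst groth_diff_eq_iff) (auto intro!: bexI[of _ "k \<oplus> l"])
  qed
  then show ?thesis
    unfolding groth_ring_def by (simp, intro UN_groth_diff c) blast
qed

lemma groth_abelian_group: "abelian_group (groth_ring G)"
proof (rule abelian_groupI)
  fix x y z
  assume x: "x \<in> carrier (groth_ring G)" and y: "y \<in> carrier (groth_ring G)"
  obtain a b where ab: "a \<in> carrier G" "b \<in> carrier G" "x = groth_diff G a b" by (rule groth_carrierE[OF x])
  obtain c d where cd: "c \<in> carrier G" "d \<in> carrier G" "y = groth_diff G c d" by (rule groth_carrierE[OF y])
  show "x \<oplus>\<^bsub>groth_ring G\<^esub> y \<in> carrier (groth_ring G)" using ab cd by (simp add: groth_add groth_diff_mem)
  show "x \<oplus>\<^bsub>groth_ring G\<^esub> y = y \<oplus>\<^bsub>groth_ring G\<^esub> x" using ab cd by (simp add: groth_add a_comm)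
  show "\<zero>\<^bsub>groth_ring G\<^esub> \<oplus>\<^bsub>groth_ring G\<^esub> x = x" using ab by (simp add: groth_add groth_zero)
  show "\<exists>y\<in>carrier (groth_ring G). y \<oplus>\<^bsub>groth_ring G\<^esub> x = \<zero>\<^bsub>groth_ring G\<^esub>"
  proof
    show "groth_diff G b a \<oplus>\<^bsub>groth_ring G\<^esub> x = \<zero>\<^bsub>groth_ring G\<^esub>"
      unfolding ab(3) groth_zero groth_add[OF ab(2,1,1,2)] using ab by (intro groth_diff_eqI) (auto simp: a_comm)
  qed (rule groth_diff_mem[OF ab(2,1)])
  assume z: "z \<in> carrier (groth_ring G)"
  obtain e f where ef: "e \<in> carrier G" "f \<in> carrier G" "z = groth_diff G e f" by (rule groth_carrierE[OF z])
  show "x \<oplus>\<^bsub>groth_ring G\<^esub> y \<oplus>\<^bsub>groth_ring G\<^esub> z = x \<oplus>\<^bsub>groth_ring G\<^esub> (y \<oplus>\<^bsub>groth_ring G\<^esub> z)"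
    using ab cd ef by (simp add: groth_add a_assoc)
qed (simp add: groth_zero groth_diff_mem)

lemma groth_minus:
  assumes c: "a \<in> carrier G" "b \<in> carrier G" "c \<in> carrier G" "d \<in> carrier G"
  shows "groth_diff G a b \<ominus>\<^bsub>groth_ring G\<^esub> groth_diff G c d = groth_diff G (a \<oplus> d) (b \<oplus> c)"
proof -
  interpret g: abelian_group "groth_ring G" by (rule groth_abelian_group)
  have mem: "groth_diff G c d \<in> carrier (groth_ring G)" "groth_diff G d c \<in> carrier (groth_ring G)"
    using c by (simp_all add: groth_diff_mem)
  have "groth_diff G d c \<oplus>\<^bsub>groth_ring G\<^esub> groth_diff G c d = \<zero>\<^bsub>groth_ring G\<^esub>"
    unfolding groth_zero groth_add[OF c(4,3,3,4)] using c by (intro groth_diff_eqI) (auto simp: a_comm)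
  then have "\<ominus>\<^bsub>groth_ring G\<^esub> groth_diff G c d = groth_diff G d c"
    using mem by (intro g.minus_equality)
  then show ?thesis using c by (simp add: a_minus_def groth_add)
qed

lemma groth_nat_pow:
  assumes c: "a \<in> carrier G" "b \<in> carrier G"
  shows "[(m::nat)] \<cdot>\<^bsub>groth_ring G\<^esub> groth_diff G a b = groth_diff G ([m] \<cdot> a) ([m] \<cdot> b)"
proof -
  interpret g: abelian_group "groth_ring G" by (rule groth_abelian_group)
  show ?thesis
    using c by (induction m) (simp_all add: groth_zero groth_add add.nat_pow_Suc g.add.nat_pow_Suc)
qed

lemma groth_map_diff:
  assumes S': "abelian_monoid S'" and f: "\<And>x. x \<in> carrier G \<Longrightarrow> f x \<in> carrier S'"
    and add: "\<And>x y. x \<in> carrier G \<Longrightarrow> y \<in> carrier G \<Longrightarrow> f (x \<oplus> y) = f x \<oplus>\<^bsub>S'\<^esub> f y"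
    and ab: "a \<in> carrier G" "b \<in> carrier G"
  shows "groth_map S' f (groth_diff G a b) = groth_diff S' (f a) (f b)"
  unfolding groth_map_def
proof (rule UN_groth_diff[OF ab])
  interpret S': abelian_monoid S' by fact
  fix c d assume cd: "c \<in> carrier G" "d \<in> carrier G" and "groth_diff G c d = groth_diff G a b"
  then obtain k where k: "k \<in> carrier G" "c \<oplus> b \<oplus> k = a \<oplus> d \<oplus> k"
    using ab by (auto simp: groth_diff_eq_iff)
  from arg_cong[OF k(2), of f] have "f c \<oplus>\<^bsub>S'\<^esub> f b \<oplus>\<^bsub>S'\<^esub> f k = f a \<oplus>\<^bsub>S'\<^esub> f d \<oplus>\<^bsub>S'\<^esub> f k"
    using ab cd k(1) by (simp add: add)
  then show "groth_diff S' (f c) (f d) = groth_diff S' (f a) (f b)"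
    using ab cd k(1) f by (subst S'.groth_diff_eq_iff) auto
qed

end

context presemiring
begin

text \<open>Independence of representatives is checked for one factor at a time. A stabilizer
  \<open>k\<close> for one factor is multiplied by both members of the other pair to give a
  stabilizer for the product.\<close>

lemma groth_mult:
  assumes c: "a \<in> carrier S" "b \<in> carrier S" "c \<in> carrier S" "d \<in> carrier S"
  shows "groth_diff S a b \<otimes>\<^bsub>groth_ring S\<^esub> groth_diff S c d =
    groth_diff S (a \<otimes> c \<oplus> b \<otimes> d) (a \<otimes> d \<oplus> b \<otimes> c)"
proof -
  have l: "groth_diff S (a' \<otimes> c \<oplus> b' \<otimes> d) (a' \<otimes> d \<oplus> b' \<otimes> c) = groth_diff S (a \<otimes> c \<oplus> b \<otimes> d) (a \<otimes> d \<oplus> b \<otimes> c)"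
    if c': "a' \<in> carrier S" "b' \<in> carrier S" "c \<in> carrier S" "d \<in> carrier S"
      and eq: "groth_diff S a' b' = groth_diff S a b" for a' b' c d
  proof -
    obtain k where k: "k \<in> carrier S" "a' \<oplus> b \<oplus> k = a \<oplus> b' \<oplus> k"
      using eq c c' by (auto simp: groth_diff_eq_iff)
    have "(a' \<otimes> c \<oplus> b' \<otimes> d) \<oplus> (a \<otimes> d \<oplus> b \<otimes> c) \<oplus> (k \<otimes> c \<oplus> k \<otimes> d) = (a' \<oplus> b \<oplus> k) \<otimes> c \<oplus> (a \<oplus> b' \<oplus> k) \<otimes> d"
      using c c' k(1) by (simp add: l_distr m_closed a_ac)
    also have "\<dots> = (a \<oplus> b' \<oplus> k) \<otimes> c \<oplus> (a' \<oplus> b \<oplus> k) \<otimes> d" unfolding k(2) ..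
    also have "\<dots> = (a \<otimes> c \<oplus> b \<otimes> d) \<oplus> (a' \<otimes> d \<oplus> b' \<otimes> c) \<oplus> (k \<otimes> c \<oplus> k \<otimes> d)"
      using c c' k(1) by (simp add: l_distr m_closed a_ac)
    finally show ?thesis
      using c c' k(1) by (subst groth_diff_eq_iff) (auto intro!: bexI[of _ "k \<otimes> c \<oplus> k \<otimes> d"] m_closed)
  qed
  have r: "groth_diff S (a \<otimes> c' \<oplus> b \<otimes> d') (a \<otimes> d' \<oplus> b \<otimes> c') = groth_diff S (a \<otimes> c \<oplus> b \<otimes> d) (a \<otimes> d \<oplus> b \<otimes> c)"
    if c': "c' \<in> carrier S" "d' \<in> carrier S" and eq: "groth_diff S c' d' = groth_diff S c d" for c' d'
  proof -
    obtain k where k: "k \<in> carrier S" "c' \<oplus> d \<oplus> k = c \<oplus> d' \<oplus> k"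
      using eq c c' by (auto simp: groth_diff_eq_iff)
    have "(a \<otimes> c' \<oplus> b \<otimes> d') \<oplus> (a \<otimes> d \<oplus> b \<otimes> c) \<oplus> (a \<otimes> k \<oplus> b \<otimes> k) = a \<otimes> (c' \<oplus> d \<oplus> k) \<oplus> b \<otimes> (c \<oplus> d' \<oplus> k)"
      using c c' k(1) by (simp add: r_distr m_closed a_ac)
    also have "\<dots> = a \<otimes> (c \<oplus> d' \<oplus> k) \<oplus> b \<otimes> (c' \<oplus> d \<oplus> k)" unfolding k(2) ..
    also have "\<dots> = (a \<otimes> c \<oplus> b \<otimes> d) \<oplus> (a \<otimes> d' \<oplus> b \<otimes> c') \<oplus> (a \<otimes> k \<oplus> b \<otimes> k)"
      using c c' k(1) by (simp add: r_distr m_closed a_ac)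
    finally show ?thesis
      using c c' k(1) by (subst groth_diff_eq_iff) (auto intro!: bexI[of _ "a \<otimes> k \<oplus> b \<otimes> k"] m_closed)
  qed
  show ?thesis
    unfolding groth_ring_def by (simp, intro UN_groth_diff c) (simp add: l r)
qed

end

section \<open>Kronecker products\<close>

lemma sum_div_mod:
  fixes f :: "nat \<Rightarrow> nat \<Rightarrow> 'a :: comm_monoid_add"
  shows "(\<Sum>k<n * m. f (k div m) (k mod m)) = (\<Sum>i<n. \<Sum>j<m. f i j)"
proof (cases "m = 0")
  case False
  have "(\<Sum>k<n * m. f (k div m) (k mod m)) = (\<Sum>i<n. \<Sum>k\<in>{i * m..<i * m + m}. f (k div m) (k mod m))"
    by (rule sum.nat_group[symmetric])
  also have "\<dots> = (\<Sum>i<n. \<Sum>j<m. f i j)"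
  proof (rule sum.cong[OF refl])
    fix i
    have "(\<Sum>k\<in>{i * m..<i * m + m}. f (k div m) (k mod m)) = (\<Sum>j\<in>{0..<m}. f ((j + i * m) div m) ((j + i * m) mod m))"
      using sum.shift_bounds_nat_ivl[of "\<lambda>k. f (k div m) (k mod m)" 0 "i * m" m] by (simp add: add.commute)
    also have "\<dots> = (\<Sum>j<m. f i j)" using False by (intro sum.cong) auto
    finally show "(\<Sum>k\<in>{i * m..<i * m + m}. f (k div m) (k mod m)) = (\<Sum>j<m. f i j)" .
  qed
  finally show ?thesis .
qed simp

lemma div_mod_less: "i < a * (c::nat) \<Longrightarrow> i div c < a \<and> i mod c < c"
  by (cases "c = 0") (auto simp: less_mult_imp_div_less)

lemma kron_mat_carrier:
  "A \<in> carrier_mat a b \<Longrightarrow> B \<in> carrier_mat c d \<Longrightarrow> kron_mat A B \<in> carrier_mat (a * c) (b * d)"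
  by (simp add: kron_mat_def)

lemma kron_mat_entry:
  "A \<in> carrier_mat a b \<Longrightarrow> B \<in> carrier_mat c d \<Longrightarrow> i < a * c \<Longrightarrow> j < b * d \<Longrightarrow>
    kron_mat A B $$ (i, j) = A $$ (i div c, j div d) * B $$ (i mod c, j mod d)"
  by (simp add: kron_mat_def)

lemma kron_mat_times:
  assumes A: "A \<in> carrier_mat a b" and B: "B \<in> carrier_mat c d" and A': "A' \<in> carrier_mat b e" and B': "B' \<in> carrier_mat d f"
  shows "kron_mat A B * kron_mat A' B' = kron_mat (A * A') (B * B')"
proof (rule eq_matI)
  have c: "A * A' \<in> carrier_mat a e" "B * B' \<in> carrier_mat c f" using assms by auto
  fix i j assume "i < dim_row (kron_mat (A * A') (B * B'))" "j < dim_col (kron_mat (A * A') (B * B'))"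
  then have ij: "i < a * c" "j < e * f" using kron_mat_carrier[OF c] by auto
  have im: "i div c < a" "i mod c < c" "j div f < e" "j mod f < f" using div_mod_less ij by blast+
  have "(kron_mat A B * kron_mat A' B') $$ (i, j) = (\<Sum>k<b * d. kron_mat A B $$ (i, k) * kron_mat A' B' $$ (k, j))"
    using kron_mat_carrier[OF A B] kron_mat_carrier[OF A' B'] ij by (simp add: scalar_prod_def lessThan_atLeast0)
  also have "\<dots> = (\<Sum>k<b * d. (\<lambda>k l. (A $$ (i div c, k) * B $$ (i mod c, l)) * (A' $$ (k, j div f) * B' $$ (l, j mod f))) (k div d) (k mod d))"
    using assms ij by (intro sum.cong) (simp_all add: kron_mat_entry)
  also have "\<dots> = (\<Sum>k<b. \<Sum>l<d. (A $$ (i div c, k) * B $$ (i mod c, l)) * (A' $$ (k, j div f) * B' $$ (l, j mod f)))"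
    by (rule sum_div_mod)
  also have "\<dots> = (\<Sum>k<b. A $$ (i div c, k) * A' $$ (k, j div f)) * (\<Sum>l<d. B $$ (i mod c, l) * B' $$ (l, j mod f))"
    by (simp add: sum_product mult.assoc mult.left_commute)
  also have "\<dots> = kron_mat (A * A') (B * B') $$ (i, j)"
    using assms im ij by (simp add: kron_mat_entry[OF c] scalar_prod_def lessThan_atLeast0)
  finally show "(kron_mat A B * kron_mat A' B') $$ (i, j) = kron_mat (A * A') (B * B') $$ (i, j)" .
qed (use kron_mat_carrier[OF A B] kron_mat_carrier[OF A' B'] kron_mat_carrier[of "A * A'" a e "B * B'" c f] assms in auto)

lemma kron_mat_one: "kron_mat (1\<^sub>m a) (1\<^sub>m b) = 1\<^sub>m (a * b)"
proof (rule eq_matI)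
  fix i j assume "i < dim_row (1\<^sub>m (a * b))" "j < dim_col (1\<^sub>m (a * b))"
  then have ij: "i < a * b" "j < a * b" by auto
  have "i = j \<longleftrightarrow> i div b = j div b \<and> i mod b = j mod b" by (metis div_mult_mod_eq)
  then show "kron_mat (1\<^sub>m a) (1\<^sub>m b) $$ (i, j) = 1\<^sub>m (a * b) $$ (i, j)"
    using ij div_mod_less[OF ij(1)] div_mod_less[OF ij(2)]
    by (simp add: kron_mat_entry[of _ a a _ b b])
qed (auto simp: kron_mat_def)

lemma invertible_kron_mat:
  assumes "A \<in> carrier_mat a a" "B \<in> carrier_mat b b" "invertible_mat A" "invertible_mat B"
  shows "invertible_mat (kron_mat A B)"
proof -
  obtain A' where A': "A' \<in> carrier_mat a a" "A * A' = 1\<^sub>m a" using assms invertible_matE by metis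
  obtain B' where B': "B' \<in> carrier_mat b b" "B * B' = 1\<^sub>m b" using assms invertible_matE by metis
  have "kron_mat A B * kron_mat A' B' = 1\<^sub>m (a * b)"
    unfolding kron_mat_times[OF assms(1,2) A'(1) B'(1)] A' B' by (rule kron_mat_one)
  then show ?thesis using assms A' B' by (intro invertible_matI[OF kron_mat_carrier kron_mat_carrier])
qed

text \<open>In the lexicographic order the left index varies slowest, so the rows from
  \<open>A\<close> still precede those from \<open>B\<close> after tensoring. This gives an equality
  rather than a conjugacy; the other distributive law will follow from commutativity.\<close>

lemma kron_mat_diag_block:
  assumes A: "A \<in> carrier_mat a a" and B: "B \<in> carrier_mat b b" and C: "C \<in> carrier_mat c c"
  shows "kron_mat (diag_block A B) C = diag_block (kron_mat A C) (kron_mat B C)"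
proof (rule eq_matI)
  have AB: "diag_block A B \<in> carrier_mat (a + b) (a + b)" using A B by simp
  have K: "kron_mat A C \<in> carrier_mat (a * c) (a * c)" "kron_mat B C \<in> carrier_mat (b * c) (b * c)"
    using assms by (simp_all add: kron_mat_carrier)
  fix i j assume "i < dim_row (diag_block (kron_mat A C) (kron_mat B C))" "j < dim_col (diag_block (kron_mat A C) (kron_mat B C))"
  then have ij: "i < a * c + b * c" "j < a * c + b * c" using K by auto
  then have c0: "c > 0" by (cases c) auto
  have ij': "i < (a + b) * c" "j < (a + b) * c" using ij by (auto simp: add_mult_distrib)
  have iff: "k div c < a \<longleftrightarrow> k < a * c" for k using c0 by (simp add: div_less_iff_less_mult)
  have sub: "(k - a * c) div c = k div c - a" "(k - a * c) mod c = k mod c" if k: "\<not> k < a * c" for k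
  proof -
    obtain l where "k = a * c + l" using k le_Suc_ex[of "a * c" k] by (auto simp: not_less)
    then show "(k - a * c) div c = k div c - a" "(k - a * c) mod c = k mod c" using c0 by simp_all
  qed
  have d: "k div c < a + b" if "k < a * c + b * c" for k
    using that div_mod_less[of k "a + b" c] by (simp add: add_mult_distrib)
  have m: "k div c - a < b" if "\<not> k < a * c" "k < a * c + b * c" for k
    using d[OF that(2)] iff[of k] that(1) by linarith
  have l: "k - a * c < b * c" if "\<not> k < a * c" "k < a * c + b * c" for k
    using that by (simp add: less_diff_conv2 add.commute)
  have L: "kron_mat (diag_block A B) C $$ (i, j) =
      (if i < a * c then if j < a * c then A $$ (i div c, j div c) else 0
       else if j < a * c then 0 else B $$ (i div c - a, j div c - a)) * C $$ (i mod c, j mod c)"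
  proof -
    have "diag_block A B $$ (i div c, j div c) = (if i < a * c then if j < a * c then A $$ (i div c, j div c) else 0
       else if j < a * c then 0 else B $$ (i div c - a, j div c - a))"
      using A B d[OF ij(1)] d[OF ij(2)] m[of i] m[of j] ij by (simp add: iff)
    then show ?thesis by (simp only: kron_mat_entry[OF AB C ij'])
  qed
  have R: "diag_block (kron_mat A C) (kron_mat B C) $$ (i, j) =
      (if i < a * c then if j < a * c then kron_mat A C $$ (i, j) else 0
       else if j < a * c then 0 else kron_mat B C $$ (i - a * c, j - a * c))"
    using K ij by simp
  show "kron_mat (diag_block A B) C $$ (i, j) = diag_block (kron_mat A C) (kron_mat B C) $$ (i, j)"
    unfolding L R using ij l[of i] l[of j] sub[of i] sub[of j]
    by (simp add: kron_mat_entry[OF A C] kron_mat_entry[OF B C])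
qed (use A B C in \<open>auto simp: kron_mat_def add_mult_distrib\<close>)

text \<open>Exchanging the two factors permutes the lexicographically ordered basis.\<close>

lemma kron_mat_commute:
  fixes a b :: nat
  defines "\<sigma> \<equiv> \<lambda>i. (i mod a) * b + i div a" and "\<tau> \<equiv> \<lambda>i. (i mod b) * a + i div b"
  assumes A: "A \<in> carrier_mat a a" and B: "B \<in> carrier_mat b b"
  shows "perm_mat (a * b) \<sigma> * kron_mat A B = kron_mat B A * perm_mat (a * b) \<sigma>"
    and "invertible_mat (perm_mat (a * b) \<sigma>)"
proof -
  have \<sigma>: "\<sigma> i < a * b \<and> \<tau> (\<sigma> i) = i" "\<sigma> i div b = i mod a" "\<sigma> i mod b = i div a" if "i < a * b" for i
  proof -
    have i: "i div a < b" "i mod a < a" using div_mod_less[of i b a] that by (simp_all add: mult.commute)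
    have "i mod a * b + i div a < i mod a * b + b" using i by simp
    also have "\<dots> \<le> a * b" using i(2) by (metis Suc_leI add.commute mult_Suc mult_le_mono1)
    finally have "\<sigma> i < a * b" by (simp add: \<sigma>_def)
    moreover have 1: "\<sigma> i div b = i mod a" "\<sigma> i mod b = i div a" using i by (auto simp: \<sigma>_def)
    ultimately show "\<sigma> i < a * b \<and> \<tau> (\<sigma> i) = i" "\<sigma> i div b = i mod a" "\<sigma> i mod b = i div a"
      by (auto simp: \<tau>_def)
  qed
  have \<tau>: "\<tau> i < a * b \<and> \<sigma> (\<tau> i) = i" if "i < a * b" for i
  proof -
    have i: "i div b < a" "i mod b < b" using div_mod_less[of i a b] that by simp_all
    have "i mod b * a + i div b < i mod b * a + a" using i by simp
    also have "\<dots> \<le> b * a" using i(2) by (metis Suc_leI add.commute mult_Suc mult_le_mono1)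
    finally have "\<tau> i < a * b" by (simp add: \<tau>_def mult.commute)
    moreover have "\<tau> i div a = i mod b" "\<tau> i mod a = i div b" using i by (auto simp: \<tau>_def)
    ultimately show ?thesis by (auto simp: \<sigma>_def)
  qed
  have K: "kron_mat A B \<in> carrier_mat (a * b) (a * b)" using kron_mat_carrier[OF A B] .
  have K': "kron_mat B A \<in> carrier_mat (a * b) (a * b)" using kron_mat_carrier[OF B A] by (simp add: mult.commute)
  have "perm_mat (a * b) \<sigma> * kron_mat A B = mat (a * b) (a * b) (\<lambda>(i, j). kron_mat A B $$ (\<sigma> i, j))"
    using \<sigma> by (intro perm_mat_mult_left[OF K]) auto
  also have "\<dots> = mat (a * b) (a * b) (\<lambda>(i, j). kron_mat B A $$ (i, \<tau> j))"
  proof (rule cong_mat)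
    fix i j assume ij: "i < a * b" "j < a * b"
    have "\<tau> j div a = j mod b" "\<tau> j mod a = j div b"
      using div_mod_less[OF ij(2)] by (auto simp: \<tau>_def)
    then show "(case (i, j) of (i, j) \<Rightarrow> kron_mat A B $$ (\<sigma> i, j)) = (case (i, j) of (i, j) \<Rightarrow> kron_mat B A $$ (i, \<tau> j))"
      using ij \<sigma>[OF ij(1)] \<tau>[OF ij(2)] kron_mat_entry[OF A B, of "\<sigma> i" j] kron_mat_entry[OF B A, of i "\<tau> j"]
      by (simp add: mult.commute)
  qed auto
  also have "\<dots> = kron_mat B A * perm_mat (a * b) \<sigma>"
    using \<sigma> \<tau> by (intro perm_mat_mult_right[OF K', symmetric]) auto
  finally show "perm_mat (a * b) \<sigma> * kron_mat A B = kron_mat B A * perm_mat (a * b) \<sigma>" .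
  show "invertible_mat (perm_mat (a * b) \<sigma>)" using \<sigma>(1) \<tau> by (intro invertible_perm_mat)
qed

lemma mat_continuous_kron:
  assumes f: "mat_continuous X a b f" and h: "mat_continuous X c d h"
  shows "mat_continuous X (a * c) (b * d) (\<lambda>x. kron_mat (f x) (h x))"
proof (rule mat_continuousI[where F = "\<lambda>i j x. f x $$ (i div c, j div d) * h x $$ (i mod c, j mod d)"])
  show "continuous_map X euclidean (\<lambda>x. f x $$ (i div c, j div d) * h x $$ (i mod c, j mod d))"
    if "i < a * c" "j < b * d" for i j
    using div_mod_less[OF that(1)] div_mod_less[OF that(2)] f h
    by (intro continuous_intros mat_continuous_entry) auto
qed (use mat_continuous_carrier[OF f] mat_continuous_carrier[OF h] kron_mat_entry kron_mat_carrier in blast)+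

lemma rep_equiv_tensor:
  assumes c: "\<And>g. g \<in> S \<Longrightarrow> v g \<in> carrier_mat a a" "\<And>g. g \<in> S \<Longrightarrow> v' g \<in> carrier_mat a a"
    "\<And>g. g \<in> S \<Longrightarrow> w g \<in> carrier_mat b b" "\<And>g. g \<in> S \<Longrightarrow> w' g \<in> carrier_mat b b"
    and "rep_equiv S a v v'" "rep_equiv S b w w'"
  shows "rep_equiv S (a * b) (rep_tensor v w) (rep_tensor v' w')"
proof -
  obtain P where P: "P \<in> carrier_mat a a" "invertible_mat P" "\<And>g. g \<in> S \<Longrightarrow> P * v g = v' g * P"
    using assms(5) unfolding rep_equiv_def by blast
  obtain Q where Q: "Q \<in> carrier_mat b b" "invertible_mat Q" "\<And>g. g \<in> S \<Longrightarrow> Q * w g = w' g * Q"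
    using assms(6) unfolding rep_equiv_def by blast
  have "kron_mat P Q * rep_tensor v w g = rep_tensor v' w' g * kron_mat P Q" if "g \<in> S" for g
    unfolding rep_tensor_def kron_mat_times[OF P(1) Q(1) c(1)[OF that] c(3)[OF that]]
      kron_mat_times[OF c(2)[OF that] c(4)[OF that] P(1) Q(1)] P(3)[OF that] Q(3)[OF that] ..
  then show ?thesis unfolding rep_equiv_def
    using kron_mat_carrier[OF P(1) Q(1)] invertible_kron_mat[OF P(1) Q(1) P(2) Q(2)] by blast
qed

context compact_group
begin

lemma rep_tensor:
  assumes v: "rep a v" and w: "rep b w"
  shows "rep (a * b) (rep_tensor v w)"
  unfolding rep_iff[of "a * b"] rep_tensor_def
proof (intro conjI ballI)
  show "mat_continuous T (a * b) (a * b) (\<lambda>g. kron_mat (v g) (w g))"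
    by (intro mat_continuous_kron rep_continuous v w)
  show "kron_mat (v \<one>) (w \<one>) = 1\<^sub>m (a * b)" by (simp add: rep_one[OF v] rep_one[OF w] kron_mat_one)
  fix g h assume g: "g \<in> carrier G" and h: "h \<in> carrier G"
  show "kron_mat (v (g \<otimes> h)) (w (g \<otimes> h)) = kron_mat (v g) (w g) * kron_mat (v h) (w h)"
    unfolding rep_mult[OF v g h] rep_mult[OF w g h]
    by (rule kron_mat_times[symmetric]) (use v w g h rep_carrier in blast)+
qed

lemma rep_equiv_tensor_comm:
  assumes "rep a v" "rep b w"
  shows "rep_equiv (carrier G) (a * b) (rep_tensor v w) (rep_tensor w v)"
  unfolding rep_equiv_def rep_tensor_def
  using kron_mat_commute(1)[OF rep_carrier[OF assms(1)] rep_carrier[OF assms(2)]]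
    kron_mat_commute(2)[OF rep_carrier[OF assms(1) one_closed] rep_carrier[OF assms(2) one_closed]]
  by (intro bexI[of _ "perm_mat (a * b) (\<lambda>i. (i mod a) * b + i div a)"] conjI ballI) auto

lemma rep_tensor_sum_left:
  assumes "rep a u" "rep b v" "rep c w" "g \<in> carrier G"
  shows "rep_tensor (rep_sum u v) w g = rep_sum (rep_tensor u w) (rep_tensor v w) g"
  unfolding rep_tensor_def rep_sum_eq
  by (rule kron_mat_diag_block) (use assms rep_carrier in blast)+

section \<open>The semiring of representation classes\<close>

abbreviation Rep :: "('a \<Rightarrow> complex mat) set ring" where
  "Rep \<equiv> rep_semiring G T"

abbreviation cls :: "('a \<Rightarrow> complex mat) \<Rightarrow> ('a \<Rightarrow> complex mat) set" where
  "cls \<equiv> rep_class G T"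

lemma rep_iso_iff: "rep n r \<Longrightarrow> rep_iso G T r s \<longleftrightarrow> rep n s \<and> rep_equiv (carrier G) n r s"
  unfolding rep_iso_def rep_equiv_def using rep_degree_unique by blast

lemma mem_cls_iff: "rep n r \<Longrightarrow> s \<in> cls r \<longleftrightarrow> rep n s \<and> rep_equiv (carrier G) n r s"
  by (simp add: rep_class_def rep_iso_iff)

lemma cls_self: "rep n r \<Longrightarrow> r \<in> cls r"
  by (simp add: mem_cls_iff rep_equiv_refl)

lemma cls_eq_iff: "rep n r \<Longrightarrow> rep m s \<Longrightarrow> cls r = cls s \<longleftrightarrow> n = m \<and> rep_equiv (carrier G) n r s"
proof
  assume r: "rep n r" and s: "rep m s"
  show "n = m \<and> rep_equiv (carrier G) n r s" if "cls r = cls s"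
    using cls_self[OF s] mem_cls_iff[OF r] rep_degree_unique[OF s] that by auto
  show "cls r = cls s" if nm: "n = m \<and> rep_equiv (carrier G) n r s"
  proof -
    have s': "rep n s" and e: "rep_equiv (carrier G) n r s" using nm s by auto
    note e' = rep_equiv_symD[OF r s' e]
    show ?thesis
    proof (rule Set.set_eqI)
      fix t show "t \<in> cls r \<longleftrightarrow> t \<in> cls s"
        unfolding mem_cls_iff[OF r] mem_cls_iff[OF s']
        using rep_equiv_transD[OF r s' _ e] rep_equiv_transD[OF s' r _ e'] by blast
    qed
  qed
qed

lemma cls_eqI: "rep n r \<Longrightarrow> rep n s \<Longrightarrow> rep_equiv (carrier G) n r s \<Longrightarrow> cls r = cls s"
  by (simp add: cls_eq_iff)

lemma cls_cong: "rep n r \<Longrightarrow> (\<And>g. g \<in> carrier G \<Longrightarrow> r g = s g) \<Longrightarrow> cls r = cls s"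
  using rep_cong[of n r s] rep_carrier[of n r] by (intro cls_eqI[of n] rep_equiv_eq) auto

lemma Rep_carrier: "carrier Rep = {cls r | r n. rep n r}"
  by (simp add: rep_semiring_def)

lemma Rep_carrierE:
  assumes "c \<in> carrier Rep" obtains r n where "rep n r" "c = cls r"
  using assms Rep_carrier by auto

lemma cls_mem: "rep n r \<Longrightarrow> cls r \<in> carrier Rep"
  by (auto simp: Rep_carrier)

lemma UN_cls:
  assumes "rep n r" "\<And>s. rep n s \<Longrightarrow> rep_equiv (carrier G) n r s \<Longrightarrow> F s = X"
  shows "(\<Union>s\<in>cls r. F s) = X"
  using assms cls_self[OF assms(1)] mem_cls_iff[OF assms(1)] by auto

lemma Rep_add:
  assumes r: "rep n r" and s: "rep m s"
  shows "cls r \<oplus>\<^bsub>Rep\<^esub> cls s = cls (rep_sum r s)"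
proof -
  have eq: "cls (rep_sum r' s') = cls (rep_sum r s)"
    if "rep n r'" "rep_equiv (carrier G) n r r'" "rep m s'" "rep_equiv (carrier G) m s s'" for r' s'
  proof -
    have "rep_equiv (carrier G) (n + m) (rep_sum r s) (rep_sum r' s')"
      by (rule rep_equiv_sum) (use that r s rep_carrier in blast)+
    then show ?thesis
      by (rule cls_eqI[OF rep_sum[OF r s] rep_sum[OF that(1,3)], symmetric])
  qed
  have "(\<Union>r'\<in>cls r. \<Union>s'\<in>cls s. cls (rep_sum r' s')) = cls (rep_sum r s)"
    by (rule UN_cls[OF r], rule UN_cls[OF s], rule eq)
  then show ?thesis by (simp add: rep_semiring_def)
qed

lemma Rep_mult:
  assumes r: "rep n r" and s: "rep m s"
  shows "cls r \<otimes>\<^bsub>Rep\<^esub> cls s = cls (rep_tensor r s)"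
proof -
  have eq: "cls (rep_tensor r' s') = cls (rep_tensor r s)"
    if "rep n r'" "rep_equiv (carrier G) n r r'" "rep m s'" "rep_equiv (carrier G) m s s'" for r' s'
  proof -
    have "rep_equiv (carrier G) (n * m) (rep_tensor r s) (rep_tensor r' s')"
      by (rule rep_equiv_tensor) (use that r s rep_carrier in blast)+
    then show ?thesis
      by (rule cls_eqI[OF rep_tensor[OF r s] rep_tensor[OF that(1,3)], symmetric])
  qed
  have "(\<Union>r'\<in>cls r. \<Union>s'\<in>cls s. cls (rep_tensor r' s')) = cls (rep_tensor r s)"
    by (rule UN_cls[OF r], rule UN_cls[OF s], rule eq)
  then show ?thesis by (simp add: rep_semiring_def)
qed

lemma Rep_zero: "\<zero>\<^bsub>Rep\<^esub> = cls (triv_rep 0)"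
  by (simp add: rep_semiring_def)

lemma Rep_mult_commute:
  assumes "c \<in> carrier Rep" "d \<in> carrier Rep"
  shows "c \<otimes>\<^bsub>Rep\<^esub> d = d \<otimes>\<^bsub>Rep\<^esub> c"
proof -
  obtain r n where r: "rep n r" "c = cls r" using assms(1) by (rule Rep_carrierE)
  obtain s m where s: "rep m s" "d = cls s" using assms(2) by (rule Rep_carrierE)
  have "cls (rep_tensor r s) = cls (rep_tensor s r)"
    using rep_tensor[OF s(1) r(1)]
    by (intro cls_eqI[OF rep_tensor[OF r(1) s(1)] _ rep_equiv_tensor_comm[OF r(1) s(1)]]) (simp add: mult.commute)
  then show ?thesis unfolding r s by (simp add: Rep_mult[OF r(1) s(1)] Rep_mult[OF s(1) r(1)])
qed

lemma presemiring_Rep: "presemiring Rep"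
proof -
  have "abelian_monoid Rep"
  proof (rule abelian_monoidI)
    fix x y z assume x: "x \<in> carrier Rep" and y: "y \<in> carrier Rep"
    obtain r n where r: "rep n r" "x = cls r" using x by (rule Rep_carrierE)
    obtain s m where s: "rep m s" "y = cls s" using y by (rule Rep_carrierE)
    show "x \<oplus>\<^bsub>Rep\<^esub> y \<in> carrier Rep" unfolding r s Rep_add[OF r(1) s(1)] by (rule cls_mem[OF rep_sum[OF r(1) s(1)]])
    have "rep (n + m) (rep_sum s r)" using rep_sum[OF s(1) r(1)] by (simp add: add.commute)
    then show "x \<oplus>\<^bsub>Rep\<^esub> y = y \<oplus>\<^bsub>Rep\<^esub> x"
      unfolding r s Rep_add[OF r(1) s(1)] Rep_add[OF s(1) r(1)]
      by (intro cls_eqI[OF rep_sum[OF r(1) s(1)] _ rep_equiv_sum_comm]) (use rep_carrier r s in blast)+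
    show "\<zero>\<^bsub>Rep\<^esub> \<oplus>\<^bsub>Rep\<^esub> x = x"
      unfolding r Rep_zero Rep_add[OF rep_triv r(1)]
      using rep_sum[OF rep_triv[of 0] r(1)] by (intro cls_cong rep_sum_triv_left[OF r(1)]) simp_all
    assume z: "z \<in> carrier Rep"
    obtain t k where t: "rep k t" "z = cls t" using z by (rule Rep_carrierE)
    show "x \<oplus>\<^bsub>Rep\<^esub> y \<oplus>\<^bsub>Rep\<^esub> z = x \<oplus>\<^bsub>Rep\<^esub> (y \<oplus>\<^bsub>Rep\<^esub> z)"
      unfolding r s t Rep_add[OF r(1) s(1)] Rep_add[OF s(1) t(1)] Rep_add[OF rep_sum[OF r(1) s(1)] t(1)]
        Rep_add[OF r(1) rep_sum[OF s(1) t(1)]] rep_sum_assoc ..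
  next
    show "\<zero>\<^bsub>Rep\<^esub> \<in> carrier Rep" unfolding Rep_zero by (rule cls_mem[OF rep_triv])
  qed
  then interpret abelian_monoid Rep .
  have closed: "x \<otimes>\<^bsub>Rep\<^esub> y \<in> carrier Rep" if x: "x \<in> carrier Rep" and y: "y \<in> carrier Rep" for x y
  proof -
    obtain r n where r: "rep n r" "x = cls r" using x by (rule Rep_carrierE)
    obtain s m where s: "rep m s" "y = cls s" using y by (rule Rep_carrierE)
    show ?thesis unfolding r s Rep_mult[OF r(1) s(1)] by (rule cls_mem[OF rep_tensor[OF r(1) s(1)]])
  qed
  have distr: "(x \<oplus>\<^bsub>Rep\<^esub> y) \<otimes>\<^bsub>Rep\<^esub> z = x \<otimes>\<^bsub>Rep\<^esub> z \<oplus>\<^bsub>Rep\<^esub> y \<otimes>\<^bsub>Rep\<^esub> z"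
    if x: "x \<in> carrier Rep" and y: "y \<in> carrier Rep" and z: "z \<in> carrier Rep" for x y z
  proof -
    obtain r n where r: "rep n r" "x = cls r" using x by (rule Rep_carrierE)
    obtain s m where s: "rep m s" "y = cls s" using y by (rule Rep_carrierE)
    obtain t k where t: "rep k t" "z = cls t" using z by (rule Rep_carrierE)
    show ?thesis
      unfolding r s t Rep_add[OF r(1) s(1)] Rep_mult[OF r(1) t(1)] Rep_mult[OF s(1) t(1)]
        Rep_mult[OF rep_sum[OF r(1) s(1)] t(1)] Rep_add[OF rep_tensor[OF r(1) t(1)] rep_tensor[OF s(1) t(1)]]
      by (rule cls_cong[OF rep_tensor[OF rep_sum[OF r(1) s(1)] t(1)] rep_tensor_sum_left[OF r(1) s(1) t(1)]])
  qed
  show ?thesis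
  proof unfold_locales
    fix x y z assume c: "x \<in> carrier Rep" "y \<in> carrier Rep" "z \<in> carrier Rep"
    show "z \<otimes>\<^bsub>Rep\<^esub> (x \<oplus>\<^bsub>Rep\<^esub> y) = z \<otimes>\<^bsub>Rep\<^esub> x \<oplus>\<^bsub>Rep\<^esub> z \<otimes>\<^bsub>Rep\<^esub> y"
      using distr[OF c] Rep_mult_commute c by simp
  qed (use closed distr in blast)+
qed

sublocale Rep: presemiring Rep by (rule presemiring_Rep)

text \<open>From \<open>rep_equiv_cancel\<close>, with the degrees equal because degrees add. It
  lets equality of formal differences of representations be tested without a stabilizer.\<close>

lemma Rep_cancel:
  assumes c: "x \<in> carrier Rep" "y \<in> carrier Rep" "z \<in> carrier Rep" and eq: "z \<oplus>\<^bsub>Rep\<^esub> x = z \<oplus>\<^bsub>Rep\<^esub> y"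
  shows "x = y"
proof -
  obtain r n where r: "rep n r" "x = cls r" using c(1) by (rule Rep_carrierE)
  obtain s m where s: "rep m s" "y = cls s" using c(2) by (rule Rep_carrierE)
  obtain t k where t: "rep k t" "z = cls t" using c(3) by (rule Rep_carrierE)
  have "k + n = k + m \<and> rep_equiv (carrier G) (k + n) (rep_sum t r) (rep_sum t s)"
    using eq unfolding r s t Rep_add[OF t(1) r(1)] Rep_add[OF t(1) s(1)]
    by (subst (asm) cls_eq_iff[OF rep_sum[OF t(1) r(1)] rep_sum[OF t(1) s(1)]])
  then have "m = n" "rep_equiv (carrier G) (k + n) (rep_sum t r) (rep_sum t s)" by auto
  then show ?thesis
    using rep_equiv_cancel[OF rep_carrier[OF t(1)] rep_carrier[OF r(1)] rep_carrier[OF s(1)[unfolded \<open>m = n\<close>]]]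
      r s by (auto simp: cls_eq_iff)
qed

lemma Rep_groth_diff_eq_iff:
  assumes "a \<in> carrier Rep" "b \<in> carrier Rep" "c \<in> carrier Rep" "d \<in> carrier Rep"
  shows "groth_diff Rep a b = groth_diff Rep c d \<longleftrightarrow> a \<oplus>\<^bsub>Rep\<^esub> d = c \<oplus>\<^bsub>Rep\<^esub> b"
  using assms Rep_cancel[of "a \<oplus>\<^bsub>Rep\<^esub> d" "c \<oplus>\<^bsub>Rep\<^esub> b"]
  by (auto simp: Rep.groth_diff_eq_iff Rep.a_comm intro: bexI[of _ "\<zero>\<^bsub>Rep\<^esub>"])

primrec rep_multiple :: "nat \<Rightarrow> ('a \<Rightarrow> complex mat) \<Rightarrow> 'a \<Rightarrow> complex mat" where
  "rep_multiple 0 r = triv_rep 0"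
| "rep_multiple (Suc k) r = rep_sum (rep_multiple k r) r"

lemma rep_rep_multiple: "rep n r \<Longrightarrow> rep (k * n) (rep_multiple k r)"
proof (induction k)
  case (Suc k)
  then show ?case using rep_sum[of "k * n" "rep_multiple k r" n r] by (simp add: add.commute)
qed (simp add: rep_triv)

lemma Rep_nat_pow: "rep n r \<Longrightarrow> [k] \<cdot>\<^bsub>Rep\<^esub> cls r = cls (rep_multiple k r)" for k :: nat
  by (induction k) (simp_all add: Rep_zero Rep_add[OF rep_rep_multiple] Rep.add.nat_pow_Suc)

lemma intertwiners_trivial_sum_left:
  assumes "intertwiners_trivial a m u w" "intertwiners_trivial b m v w" and r: "rep a u" "rep b v" "rep m w"
  shows "intertwiners_trivial (a + b) m (rep_sum u v) w"
  unfolding intertwiners_trivial_def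
proof (intro ballI impI)
  fix \<phi> assume \<phi>: "\<phi> \<in> carrier_mat m (a + b)" "\<forall>g\<in>carrier G. \<phi> * rep_sum u v g = w g * \<phi>"
  \<comment> \<open>The matrix is regarded as having a second row of blocks of height zero, so that
    the description of intertwiners between sums of two applies with the second target
    empty.\<close>
  obtain p q p' q' where c: "p \<in> carrier_mat m a" "q \<in> carrier_mat m b" "p' \<in> carrier_mat 0 a" "q' \<in> carrier_mat 0 b"
    and \<phi>eq: "\<phi> = four_block_mat p q p' q'"
  proof (rule obtain_blocks[of \<phi> m 0 a b])
    show "\<phi> \<in> carrier_mat (m + 0) (a + b)" using \<phi>(1) by simp
  qed (rule that)
  have "p * u g = w g * p \<and> q * v g = w g * q" if g: "g \<in> carrier G" for g
  proof -
    have "diag_block (w g) (0\<^sub>m 0 0) = w g" using rep_carrier[OF r(3) g] by (auto intro!: eq_matI)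
    then show ?thesis
      using \<phi>(2) g intertwine_diag_blocks[OF rep_carrier[OF r(1) g] rep_carrier[OF r(2) g] rep_carrier[OF r(3) g]
          zero_carrier_mat[of 0 0] c] unfolding \<phi>eq rep_sum_eq by auto
  qed
  then have "p = 0\<^sub>m m a" "q = 0\<^sub>m m b" using assms(1,2) c unfolding intertwiners_trivial_def by blast+
  then show "\<phi> = 0\<^sub>m m (a + b)" unfolding \<phi>eq using c by (auto intro!: eq_matI)
qed

lemma intertwiners_trivial_sum_right:
  assumes "intertwiners_trivial m a w u" "intertwiners_trivial m b w v" and r: "rep a u" "rep b v" "rep m w"
  shows "intertwiners_trivial m (a + b) w (rep_sum u v)"
  unfolding intertwiners_trivial_def
proof (intro ballI impI)
  fix \<phi> assume \<phi>: "\<phi> \<in> carrier_mat (a + b) m" "\<forall>g\<in>carrier G. \<phi> * w g = rep_sum u v g * \<phi>"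
  obtain p q p' q' where c: "p \<in> carrier_mat a m" "q \<in> carrier_mat a 0" "p' \<in> carrier_mat b m" "q' \<in> carrier_mat b 0"
    and \<phi>eq: "\<phi> = four_block_mat p q p' q'"
  proof (rule obtain_blocks[of \<phi> a b m 0])
    show "\<phi> \<in> carrier_mat (a + b) (m + 0)" using \<phi>(1) by simp
  qed (rule that)
  have "p * w g = u g * p \<and> p' * w g = v g * p'" if g: "g \<in> carrier G" for g
  proof -
    have "diag_block (w g) (0\<^sub>m 0 0) = w g" using rep_carrier[OF r(3) g] by (auto intro!: eq_matI)
    then show ?thesis
      using \<phi>(2) g intertwine_diag_blocks[OF rep_carrier[OF r(3) g] zero_carrier_mat[of 0 0] rep_carrier[OF r(1) g]
          rep_carrier[OF r(2) g] c] unfolding \<phi>eq rep_sum_eq by auto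
  qed
  then have "p = 0\<^sub>m a m" "p' = 0\<^sub>m b m" using assms(1,2) c unfolding intertwiners_trivial_def by blast+
  then show "\<phi> = 0\<^sub>m (a + b) m" unfolding \<phi>eq using c by (auto intro!: eq_matI)
qed

lemma intertwiners_trivial_multiple:
  assumes "intertwiners_trivial n m v w" and r: "rep n v" "rep m w"
  shows "intertwiners_trivial (k * n) (l * m) (rep_multiple k v) (rep_multiple l w)"
proof -
  have "intertwiners_trivial (k * n) m (rep_multiple k v) w"
  proof (induction k)
    case (Suc k)
    then show ?case
      using intertwiners_trivial_sum_left[OF Suc assms(1) rep_rep_multiple[OF r(1)] r] by (simp add: add.commute)
  qed (auto simp: intertwiners_trivial_def intro!: eq_matI)
  note left = this
  show ?thesis
  proof (induction l)
    case (Suc l)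
    then show ?case
      using intertwiners_trivial_sum_right[OF Suc left rep_rep_multiple[OF r(2)] r(2) rep_rep_multiple[OF r(1)]]
      by (simp add: add.commute)
  qed (auto simp: intertwiners_trivial_def intro!: eq_matI)
qed

text \<open>After cancelling a maximal common summand, the remaining parts \<open>v\<close> and
  \<open>w\<close> have no nonzero intertwiner, and neither do their multiples. An isomorphism
  between the multiples is then a zero matrix, which forces degree zero.\<close>

lemma Rep_torsion_free:
  fixes k :: nat
  assumes x: "x \<in> carrier Rep" and y: "y \<in> carrier Rep" and k: "k > 0" and eq: "[k] \<cdot>\<^bsub>Rep\<^esub> x = [k] \<cdot>\<^bsub>Rep\<^esub> y"
  shows "x = y"
proof -
  obtain r n where r: "rep n r" "x = cls r" using x by (rule Rep_carrierE)
  obtain s m where s: "rep m s" "y = cls s" using y by (rule Rep_carrierE)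
  obtain d a b u v w where nm: "n = d + a" "m = d + b" and rep: "rep d u" "rep a v" "rep b w" and
    e: "rep_equiv (carrier G) n r (rep_sum u v)" "rep_equiv (carrier G) m s (rep_sum u w)" and
    triv: "intertwiners_trivial a b v w"
    using maximal_common_summand[OF r(1) s(1)] by blast
  have xy: "x = cls u \<oplus>\<^bsub>Rep\<^esub> cls v" "y = cls u \<oplus>\<^bsub>Rep\<^esub> cls w"
    unfolding r(2) s(2) Rep_add[OF rep(1,2)] Rep_add[OF rep(1,3)]
    using cls_eqI[OF r(1) _ e(1)] cls_eqI[OF s(1) _ e(2)] rep_sum[OF rep(1,2)] rep_sum[OF rep(1,3)] nm by auto
  have uvw: "cls u \<in> carrier Rep" "cls v \<in> carrier Rep" "cls w \<in> carrier Rep" using rep by (auto intro: cls_mem)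
  have "[k] \<cdot>\<^bsub>Rep\<^esub> cls u \<oplus>\<^bsub>Rep\<^esub> [k] \<cdot>\<^bsub>Rep\<^esub> cls v = [k] \<cdot>\<^bsub>Rep\<^esub> cls u \<oplus>\<^bsub>Rep\<^esub> [k] \<cdot>\<^bsub>Rep\<^esub> cls w"
    using eq uvw unfolding xy by (simp add: Rep.add.nat_pow_distrib)
  then have "[k] \<cdot>\<^bsub>Rep\<^esub> cls v = [k] \<cdot>\<^bsub>Rep\<^esub> cls w" 
    by (rule Rep_cancel[rotated 3]) (use uvw in simp_all)
  then have "k * a = k * b \<and> rep_equiv (carrier G) (k * a) (rep_multiple k v) (rep_multiple k w)"
    unfolding Rep_nat_pow[OF rep(2)] Rep_nat_pow[OF rep(3)]
      cls_eq_iff[OF rep_rep_multiple[OF rep(2)] rep_rep_multiple[OF rep(3)]] .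
  then obtain P where P: "P \<in> carrier_mat (k * b) (k * a)" "invertible_mat P" "k * a = k * b"
    "\<forall>g\<in>carrier G. P * rep_multiple k v g = rep_multiple k w g * P"
    unfolding rep_equiv_def by auto
  \<comment> \<open>An intertwiner between the multiples vanishes; being invertible too, it must be
    an empty matrix.\<close>
  have z: "P = 0\<^sub>m (k * b) (k * a)"
    using intertwiners_trivial_multiple[OF triv rep(2,3), of k k] P unfolding intertwiners_trivial_def by blast
  have "invertible_mat (0\<^sub>m (k * a) (k * a) :: complex mat)" using P(2,3) z by metis
  from invertible_matE[OF this zero_carrier_mat] obtain Q :: "complex mat" where Q: "Q \<in> carrier_mat (k * a) (k * a)" "0\<^sub>m (k * a) (k * a) * Q = 1\<^sub>m (k * a)"
    by metis
  have "k * a = 0"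
  proof (rule ccontr)
    assume "k * a \<noteq> 0"
    then show False using Q(1) arg_cong[OF Q(2), of "\<lambda>M. M $$ (0, 0)"] by auto
  qed
  then have "a = 0" "b = 0" using k P(3) by auto
  then have "v g = w g" if "g \<in> carrier G" for g
    using rep_carrier[OF rep(2) that] rep_carrier[OF rep(3) that] by (auto intro!: eq_matI)
  then have "cls v = cls w" by (intro cls_cong[OF rep(2)])
  then show ?thesis unfolding xy by simp
qed

end

section \<open>Equivariant vector bundles and cocycles\<close>

lemma topspace_complex_space: "topspace (complex_space n) = {v. \<forall>i\<ge>n. v i = 0}"
  by (simp add: complex_space_def)

lemma continuous_map_into_complex_space:
  assumes "\<And>i. i < n \<Longrightarrow> continuous_map Z euclidean (\<lambda>z. f z i)"
    and "\<And>z i. z \<in> topspace Z \<Longrightarrow> n \<le> i \<Longrightarrow> f z i = 0"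
  shows "continuous_map Z (complex_space n) f"
proof -
  have "continuous_map Z euclidean (\<lambda>z. f z i)" for i
  proof (cases "i < n")
    case False
    then have "0 = f z i" if "z \<in> topspace Z" for z using assms(2)[OF that, of i] by simp
    then show ?thesis by (rule continuous_map_eq[of Z euclidean "\<lambda>z. 0", rotated]) simp_all
  qed (rule assms(1))
  then have "continuous_map Z (product_topology (\<lambda>i. euclidean) UNIV) f"
    by (simp add: continuous_map_componentwise_UNIV)
  moreover have "f z \<in> {v. \<forall>i\<ge>n. v i = 0}" if "z \<in> topspace Z" for z
    using assms(2)[OF that] by simp
  ultimately show ?thesis
    unfolding complex_space_def by (intro continuous_map_into_subtopology) auto
qed

lemma continuous_map_coordinate:
  assumes "continuous_map Z (complex_space n) f"
  shows "continuous_map Z euclidean (\<lambda>z. f z i)"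
proof -
  have "continuous_map Z (product_topology (\<lambda>i. euclidean) UNIV) f"
    using assms unfolding complex_space_def by (rule continuous_map_into_fulltopology)
  then show ?thesis by (simp add: continuous_map_componentwise_UNIV)
qed

lemma complex_space_closed:
  "v \<in> topspace (complex_space n) \<Longrightarrow> w \<in> topspace (complex_space n) \<Longrightarrow> (\<lambda>i. v i + w i) \<in> topspace (complex_space n)"
  "v \<in> topspace (complex_space n) \<Longrightarrow> (\<lambda>i. c * v i) \<in> topspace (complex_space n)"
  by (auto simp: topspace_complex_space)

definition unit_coord :: "nat \<Rightarrow> nat \<Rightarrow> complex" where
  "unit_coord j = (\<lambda>i. if i = j then 1 else 0)"

lemma unit_coord_mem: "j < n \<Longrightarrow> unit_coord j \<in> topspace (complex_space n)"
  by (auto simp: unit_coord_def topspace_complex_space)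

lemma mat_act_mem: "A \<in> carrier_mat m n \<Longrightarrow> mat_act A v \<in> topspace (complex_space m)"
  by (auto simp: mat_act_def topspace_complex_space)

lemma mat_act_add: "mat_act A (\<lambda>i. v i + w i) = (\<lambda>i. mat_act A v i + mat_act A w i)"
  by (rule ext) (simp add: mat_act_def distrib_left sum.distrib)

lemma mat_act_scale: "mat_act A (\<lambda>i. c * v i) = (\<lambda>i. c * mat_act A v i)"
  by (rule ext) (simp add: mat_act_def sum_distrib_left mult.left_commute)

lemma mat_act_mult:
  assumes "A \<in> carrier_mat m k" "B \<in> carrier_mat k n"
  shows "mat_act (A * B) v = mat_act A (mat_act B v)"
proof
  fix i
  show "mat_act (A * B) v i = mat_act A (mat_act B v) i"
  proof (cases "i < m")
    case True
    have "mat_act (A * B) v i = (\<Sum>j<n. (\<Sum>l<k. A $$ (i, l) * B $$ (l, j)) * v j)"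
      using assms True by (simp add: mat_act_def scalar_prod_def lessThan_atLeast0)
    also have "\<dots> = (\<Sum>l<k. A $$ (i, l) * (\<Sum>j<n. B $$ (l, j) * v j))"
      unfolding sum_distrib_left sum_distrib_right by (subst sum.swap) (simp add: mult.assoc)
    also have "\<dots> = mat_act A (mat_act B v) i" using assms True by (simp add: mat_act_def)
    finally show ?thesis .
  qed (use assms in \<open>simp add: mat_act_def\<close>)
qed

lemma mat_act_one:
  assumes "v \<in> topspace (complex_space n)"
  shows "mat_act (1\<^sub>m n) v = v"
proof
  fix i
  have "(\<Sum>j<n. 1\<^sub>m n $$ (i, j) * v j) = v i" if "i < n"
  proof -
    have "(\<Sum>j<n. 1\<^sub>m n $$ (i, j) * v j) = (\<Sum>j<n. if j = i then v j else 0)"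
      using that by (intro sum.cong) auto
    then show ?thesis using that by simp
  qed
  then show "mat_act (1\<^sub>m n) v i = v i"
    using assms by (auto simp: mat_act_def topspace_complex_space)
qed

lemma mat_act_unit:
  assumes "A \<in> carrier_mat m n" "i < m" "j < n"
  shows "mat_act A (unit_coord j) i = A $$ (i, j)"
proof -
  have "(\<Sum>l<n. A $$ (i, l) * unit_coord j l) = (\<Sum>l<n. if l = j then A $$ (i, j) else 0)"
    by (intro sum.cong) (auto simp: unit_coord_def)
  then show ?thesis using assms by (simp add: mat_act_def)
qed

lemma mat_eq_of_act:
  assumes "A \<in> carrier_mat m n" "B \<in> carrier_mat m n"
    and "\<And>v. v \<in> topspace (complex_space n) \<Longrightarrow> mat_act A v = mat_act B v"
  shows "A = B"
proof (rule eq_matI)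
  fix i j assume "i < dim_row B" "j < dim_col B"
  then have "i < m" "j < n" using assms(2) by auto
  then show "A $$ (i, j) = B $$ (i, j)"
    using assms(3)[OF unit_coord_mem] mat_act_unit[OF assms(1)] mat_act_unit[OF assms(2)] by metis
qed (use assms in auto)

lemma linear_map_matrix:
  assumes L: "\<And>v. v \<in> topspace (complex_space n) \<Longrightarrow> L v \<in> topspace (complex_space m)"
    and add: "\<And>v w. v \<in> topspace (complex_space n) \<Longrightarrow> w \<in> topspace (complex_space n) \<Longrightarrow>
      L (\<lambda>i. v i + w i) = (\<lambda>i. L v i + L w i)"
    and scale: "\<And>c v. v \<in> topspace (complex_space n) \<Longrightarrow> L (\<lambda>i. c * v i) = (\<lambda>i. c * L v i)"
  obtains A where "A \<in> carrier_mat m n" "\<And>v. v \<in> topspace (complex_space n) \<Longrightarrow> L v = mat_act A v"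
proof
  define A where "A = mat m n (\<lambda>(i, j). L (unit_coord j) i)"
  show A: "A \<in> carrier_mat m n" by (simp add: A_def)
  \<comment> \<open>Truncation to the first \<open>k\<close> coordinates, so that induction on
    \<open>k\<close> expands \<open>v\<close> in unit vectors one at a time.\<close>
  define cut where "cut k v = (\<lambda>i. if i < k then v i else 0)" for k :: nat and v :: "nat \<Rightarrow> complex"
  have cut: "cut k v \<in> topspace (complex_space n)" if "v \<in> topspace (complex_space n)" for k v
    using that by (auto simp: cut_def topspace_complex_space)
  show "L v = mat_act A v" if v: "v \<in> topspace (complex_space n)" for v
  proof -
    have "L (cut k v) = mat_act A (cut k v)" if "k \<le> n" for k
      using that
    proof (induction k)
      case 0
      have z: "cut 0 v = (\<lambda>i. 0 * v i)" by (auto simp: cut_def)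
      show ?case unfolding z scale[OF v] mat_act_scale by simp
    next
      case (Suc k)
      have k: "k < n" using Suc.prems by simp
      have dec: "cut (Suc k) v = (\<lambda>i. cut k v i + (\<lambda>i. v k * unit_coord k i) i)"
        by (auto simp: cut_def unit_coord_def fun_eq_iff less_Suc_eq)
      have e: "L (unit_coord k) = mat_act A (unit_coord k)"
      proof
        fix i
        show "L (unit_coord k) i = mat_act A (unit_coord k) i"
        proof (cases "i < m")
          case True
          then show ?thesis using mat_act_unit[OF A True k] k by (simp add: A_def)
        next
          case False
          then show ?thesis
            using L[OF unit_coord_mem[OF k]] mat_act_mem[OF A, of "unit_coord k"] by (auto simp: topspace_complex_space)
        qed
      qed
      have "L (cut (Suc k) v) = (\<lambda>i. L (cut k v) i + L (\<lambda>i. v k * unit_coord k i) i)"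
        unfolding dec by (rule add[OF cut[OF v] complex_space_closed(2)[OF unit_coord_mem[OF k]]])
      also have "\<dots> = mat_act A (cut (Suc k) v)"
        unfolding dec mat_act_add using Suc.IH k
        by (simp add: scale[OF unit_coord_mem[OF k]] e mat_act_scale)
      finally show ?case .
    qed
    from this[of n] have "L (cut n v) = mat_act A (cut n v)" by simp
    moreover have "cut n v = v" using v by (auto simp: cut_def topspace_complex_space)
    ultimately show ?thesis by simp
  qed
qed

text \<open>The traces of \<open>A * B\<close> and \<open>B * A\<close> agree, and they are
  \<open>m\<close> and \<open>n\<close>. This makes the rank of a bundle at a point well
  defined.\<close>

lemma inverse_pair_square:
  assumes A: "A \<in> carrier_mat m n" and B: "B \<in> carrier_mat n m" and "A * B = 1\<^sub>m m" "B * A = (1\<^sub>m n :: complex mat)"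
  shows "m = n"
proof -
  have "of_nat m = (\<Sum>i<m. (A * B) $$ (i, i))" using assms by simp
  also have "\<dots> = (\<Sum>i<m. \<Sum>j<n. A $$ (i, j) * B $$ (j, i))"
    using A B by (simp add: scalar_prod_def lessThan_atLeast0)
  also have "\<dots> = (\<Sum>j<n. \<Sum>i<m. B $$ (j, i) * A $$ (i, j))"
    by (subst sum.swap) (simp add: mult.commute)
  also have "\<dots> = (\<Sum>j<n. (B * A) $$ (j, j))"
    using A B by (simp add: scalar_prod_def lessThan_atLeast0)
  also have "\<dots> = of_nat n" using assms by simp
  finally show ?thesis by simp
qed

section \<open>Linear coordinates on fibres\<close>

lemma fibre_coordsD:
  assumes "fibre_coords E x n \<beta>"
  shows "v \<in> topspace (complex_space n) \<Longrightarrow> \<beta> v \<in> topspace (total_space E)"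
    and "v \<in> topspace (complex_space n) \<Longrightarrow> bproj E (\<beta> v) = x"
    and "v \<in> topspace (complex_space n) \<Longrightarrow> w \<in> topspace (complex_space n) \<Longrightarrow>
      \<beta> (\<lambda>i. v i + w i) = fadd E (\<beta> v) (\<beta> w)"
    and "v \<in> topspace (complex_space n) \<Longrightarrow> \<beta> (\<lambda>i. c * v i) = fscale E c (\<beta> v)"
    and "v \<in> topspace (complex_space n) \<Longrightarrow> w \<in> topspace (complex_space n) \<Longrightarrow> \<beta> v = \<beta> w \<Longrightarrow> v = w"
    and "e \<in> topspace (total_space E) \<Longrightarrow> bproj E e = x \<Longrightarrow> \<exists>v\<in>topspace (complex_space n). e = \<beta> v"
proof -
  have bij: "bij_betw \<beta> (topspace (complex_space n)) (fibre E x)" using assms by (simp add: fibre_coords_def)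
  show "v \<in> topspace (complex_space n) \<Longrightarrow> \<beta> v \<in> topspace (total_space E)"
    "v \<in> topspace (complex_space n) \<Longrightarrow> bproj E (\<beta> v) = x"
    using bij_betw_apply[OF bij] by (auto simp: fibre_def)
  show "v \<in> topspace (complex_space n) \<Longrightarrow> w \<in> topspace (complex_space n) \<Longrightarrow> \<beta> v = \<beta> w \<Longrightarrow> v = w"
    using bij by (auto simp: bij_betw_def dest: inj_onD)
  show "e \<in> topspace (total_space E) \<Longrightarrow> bproj E e = x \<Longrightarrow> \<exists>v\<in>topspace (complex_space n). e = \<beta> v"
    using bij by (auto simp: bij_betw_def fibre_def)
qed (use assms in \<open>simp_all add: fibre_coords_def\<close>)

lemma fibre_coordsI:
  assumes "\<And>v. v \<in> topspace (complex_space n) \<Longrightarrow> \<beta> v \<in> topspace (total_space E) \<and> bproj E (\<beta> v) = x"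
    and "\<And>v w. v \<in> topspace (complex_space n) \<Longrightarrow> w \<in> topspace (complex_space n) \<Longrightarrow>
      \<beta> (\<lambda>i. v i + w i) = fadd E (\<beta> v) (\<beta> w)"
    and "\<And>c v. v \<in> topspace (complex_space n) \<Longrightarrow> \<beta> (\<lambda>i. c * v i) = fscale E c (\<beta> v)"
    and "\<And>v w. v \<in> topspace (complex_space n) \<Longrightarrow> w \<in> topspace (complex_space n) \<Longrightarrow> \<beta> v = \<beta> w \<Longrightarrow> v = w"
    and "\<And>e. e \<in> topspace (total_space E) \<Longrightarrow> bproj E e = x \<Longrightarrow> \<exists>v\<in>topspace (complex_space n). e = \<beta> v"
  shows "fibre_coords E x n \<beta>"
  unfolding fibre_coords_def
proof (intro conjI ballI allI)
  have "inj_on \<beta> (topspace (complex_space n))" using assms(4) by (intro inj_onI)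
  moreover have "\<beta> ` topspace (complex_space n) = fibre E x" using assms(1,5) by (auto simp: fibre_def)
  ultimately show "bij_betw \<beta> (topspace (complex_space n)) (fibre E x)" by (simp add: bij_betw_def)
qed (use assms(2,3) in blast)+

lemma fibre_coords_transition:
  assumes \<beta>: "fibre_coords E x n \<beta>" and \<gamma>: "fibre_coords E x m \<gamma>"
  obtains A where "A \<in> carrier_mat m n" "\<And>v. v \<in> topspace (complex_space n) \<Longrightarrow> \<beta> v = \<gamma> (mat_act A v)"
proof -
  have "\<exists>w. v \<in> topspace (complex_space n) \<longrightarrow> w \<in> topspace (complex_space m) \<and> \<beta> v = \<gamma> w" for v
    using fibre_coordsD(6)[OF \<gamma> fibre_coordsD(1,2)[OF \<beta>]] by blast
  then obtain L where L: "\<And>v. v \<in> topspace (complex_space n) \<Longrightarrow> L v \<in> topspace (complex_space m)"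
    "\<And>v. v \<in> topspace (complex_space n) \<Longrightarrow> \<beta> v = \<gamma> (L v)" by metis
  obtain A where "A \<in> carrier_mat m n" "\<And>v. v \<in> topspace (complex_space n) \<Longrightarrow> L v = mat_act A v"
  proof (rule linear_map_matrix[of n L m])
    fix v w assume v: "v \<in> topspace (complex_space n)" and w: "w \<in> topspace (complex_space n)"
    have "\<gamma> (L (\<lambda>i. v i + w i)) = \<gamma> (\<lambda>i. L v i + L w i)"
      using L v w complex_space_closed(1)[OF v w] fibre_coordsD(3)[OF \<beta> v w] fibre_coordsD(3)[OF \<gamma> L(1)[OF v] L(1)[OF w]]
      by metis
    then show "L (\<lambda>i. v i + w i) = (\<lambda>i. L v i + L w i)"
      by (rule fibre_coordsD(5)[OF \<gamma> L(1)[OF complex_space_closed(1)[OF v w]] complex_space_closed(1)[OF L(1)[OF v] L(1)[OF w]]])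
  next
    fix c v assume v: "v \<in> topspace (complex_space n)"
    have "\<gamma> (L (\<lambda>i. c * v i)) = \<gamma> (\<lambda>i. c * L v i)"
      using L v complex_space_closed(2)[OF v] fibre_coordsD(4)[OF \<beta> v] fibre_coordsD(4)[OF \<gamma> L(1)[OF v]] by metis
    then show "L (\<lambda>i. c * v i) = (\<lambda>i. c * L v i)"
      by (rule fibre_coordsD(5)[OF \<gamma> L(1)[OF complex_space_closed(2)[OF v]] complex_space_closed(2)[OF L(1)[OF v]]])
  qed (use L in auto)
  then show thesis using that L by metis
qed

lemma fibre_coords_change:
  assumes \<beta>: "fibre_coords E x n \<beta>" and \<gamma>: "fibre_coords E x m \<gamma>"
  obtains A where "n = m" "A \<in> carrier_mat n n" "invertible_mat A"
    "\<And>v. v \<in> topspace (complex_space n) \<Longrightarrow> \<beta> v = \<gamma> (mat_act A v)"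
proof -
  obtain A where A: "A \<in> carrier_mat m n" "\<And>v. v \<in> topspace (complex_space n) \<Longrightarrow> \<beta> v = \<gamma> (mat_act A v)"
    by (rule fibre_coords_transition[OF \<beta> \<gamma>]) (rule that)
  obtain B where B: "B \<in> carrier_mat n m" "\<And>v. v \<in> topspace (complex_space m) \<Longrightarrow> \<gamma> v = \<beta> (mat_act B v)"
    by (rule fibre_coords_transition[OF \<gamma> \<beta>]) (rule that)
  have BA: "B * A = 1\<^sub>m n"
  proof (rule mat_eq_of_act)
    fix v assume v: "v \<in> topspace (complex_space n)"
    have "\<beta> v = \<beta> (mat_act B (mat_act A v))" using A(2)[OF v] B(2)[OF mat_act_mem[OF A(1)]] by simp
    then show "mat_act (B * A) v = mat_act (1\<^sub>m n) v"
      unfolding mat_act_mult[OF B(1) A(1)] mat_act_one[OF v]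
      using fibre_coordsD(5)[OF \<beta> v mat_act_mem[OF B(1)]] by metis
  qed (use A B in auto)
  have AB: "A * B = 1\<^sub>m m"
  proof (rule mat_eq_of_act)
    fix v assume v: "v \<in> topspace (complex_space m)"
    have "\<gamma> v = \<gamma> (mat_act A (mat_act B v))" using B(2)[OF v] A(2)[OF mat_act_mem[OF B(1)]] by simp
    then show "mat_act (A * B) v = mat_act (1\<^sub>m m) v"
      unfolding mat_act_mult[OF A(1) B(1)] mat_act_one[OF v]
      using fibre_coordsD(5)[OF \<gamma> v mat_act_mem[OF A(1)]] by metis
  qed (use A B in auto)
  have nm: "n = m" by (rule inverse_pair_square[OF A(1) B(1) AB BA, symmetric])
  show thesis
  proof (rule that[OF nm])
    show A': "A \<in> carrier_mat n n" using A(1) nm by simp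
    show "invertible_mat A" using invertible_matI[OF A', of B] B(1) AB nm by simp
  qed (rule A(2))
qed

lemma fibre_coords_mat_act:
  assumes \<beta>: "fibre_coords E x n \<beta>" and A: "A \<in> carrier_mat n n" "invertible_mat A"
  shows "fibre_coords E x n (\<lambda>v. \<beta> (mat_act A v))"
proof -
  obtain B where B: "B \<in> carrier_mat n n" "A * B = 1\<^sub>m n" "B * A = 1\<^sub>m n" using A invertible_matE by metis
  note m = mat_act_mem[OF A(1)]
  show ?thesis
  proof (rule fibre_coordsI)
    fix v w assume v: "v \<in> topspace (complex_space n)" and w: "w \<in> topspace (complex_space n)" and "\<beta> (mat_act A v) = \<beta> (mat_act A w)"
    then have "mat_act A v = mat_act A w" using fibre_coordsD(5)[OF \<beta> m m] by blast
    then have "mat_act (B * A) v = mat_act (B * A) w" by (simp add: mat_act_mult[OF B(1) A(1)])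
    then show "v = w" unfolding B(3) mat_act_one[OF v] mat_act_one[OF w] .
  next
    fix e assume "e \<in> topspace (total_space E)" "bproj E e = x"
    then obtain v where v: "v \<in> topspace (complex_space n)" "e = \<beta> v" using fibre_coordsD(6)[OF \<beta>] by blast
    have "mat_act A (mat_act B v) = v" using mat_act_one[OF v(1)] by (simp flip: B(2) mat_act_mult[OF A(1) B(1)])
    then show "\<exists>v\<in>topspace (complex_space n). e = \<beta> (mat_act A v)"
      using v mat_act_mem[OF B(1)] by metis
  qed (use fibre_coordsD(1,2)[OF \<beta> m] fibre_coordsD(3)[OF \<beta> m m] fibre_coordsD(4)[OF \<beta> m] in \<open>auto simp: mat_act_add mat_act_scale\<close>)
qed

lemma continuous_map_mat_act:
  assumes A: "mat_continuous Z m n A" and v: "continuous_map Z (complex_space n) v"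
  shows "continuous_map Z (complex_space m) (\<lambda>z. mat_act (A z) (v z))"
proof (rule continuous_map_into_complex_space)
  fix i assume i: "i < m"
  have "continuous_map Z euclidean (\<lambda>z. \<Sum>j<n. A z $$ (i, j) * v z j)"
    using mat_continuous_entry[OF A i] continuous_map_coordinate[OF v] by (intro continuous_intros) auto
  then show "continuous_map Z euclidean (\<lambda>z. mat_act (A z) (v z) i)"
    by (rule continuous_map_eq) (use i mat_continuous_carrier[OF A] in \<open>auto simp: mat_act_def\<close>)
qed (use mat_act_mem[OF mat_continuous_carrier[OF A]] in \<open>auto simp: topspace_complex_space\<close>)

section \<open>Equivariant bundles, their isomorphisms and fibre representations\<close>

context compact_group
begin

abbreviation gvb :: "'x topology \<Rightarrow> ('a \<Rightarrow> 'x \<Rightarrow> 'x) \<Rightarrow> ('e, 'x, 'a) gbundle \<Rightarrow> bool" where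
  "gvb X a E \<equiv> is_bundle G T X a E"

lemma bundle_proj:
  assumes "gvb X a E" "e \<in> topspace (total_space E)"
  shows "bproj E e \<in> topspace X"
proof -
  have "continuous_map (total_space E) X (bproj E)"
    using assms(1) unfolding is_bundle_def by (rule conjunct1)
  then show ?thesis using continuous_map_funspace assms(2) by blast
qed

lemma bundle_local_triv:
  assumes E: "gvb X a E" and x: "x \<in> topspace X"
  obtains U n h where "openin X U" "x \<in> U"
    "homeomorphic_map (prod_topology (subtopology X U) (complex_space n))
       (subtopology (total_space E) {e \<in> topspace (total_space E). bproj E e \<in> U}) h"
    "\<And>y. y \<in> U \<Longrightarrow> fibre_coords E y n (\<lambda>v. h (y, v))"
proof -
  have "\<forall>x\<in>topspace X. \<exists>U n h. openin X U \<and> x \<in> U \<and>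
        homeomorphic_map (prod_topology (subtopology X U) (complex_space n))
          (subtopology (total_space E) {e \<in> topspace (total_space E). bproj E e \<in> U}) h \<and>
        (\<forall>y\<in>U. fibre_coords E y n (\<lambda>v. h (y, v)))"
    using E unfolding is_bundle_def by (elim conjE)
  from bspec[OF this x] show thesis by (elim exE conjE) (rule that, auto)
qed

lemma bundle_coords:
  assumes E: "gvb X a E" and x: "x \<in> topspace X"
  obtains n \<beta> where "fibre_coords E x n \<beta>"
proof -
  obtain U n h where "x \<in> U" "\<And>y. y \<in> U \<Longrightarrow> fibre_coords E y n (\<lambda>v. h (y, v))"
    by (rule bundle_local_triv[OF E x]) (rule that)
  then show thesis using that by blast
qed

lemma bundle_act:
  assumes "gvb X a E"
  shows "continuous_map (prod_topology T (total_space E)) (total_space E) (\<lambda>(g, e). gact E g e)"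
    and "e \<in> topspace (total_space E) \<Longrightarrow> gact E \<one> e = e"
    and "g \<in> carrier G \<Longrightarrow> h \<in> carrier G \<Longrightarrow> e \<in> topspace (total_space E) \<Longrightarrow>
      gact E (g \<otimes> h) e = gact E g (gact E h e)"
    and "g \<in> carrier G \<Longrightarrow> e \<in> topspace (total_space E) \<Longrightarrow> bproj E (gact E g e) = a g (bproj E e)"
    and "g \<in> carrier G \<Longrightarrow> e \<in> topspace (total_space E) \<Longrightarrow> e' \<in> topspace (total_space E) \<Longrightarrow>
      bproj E e = bproj E e' \<Longrightarrow> gact E g (fadd E e e') = fadd E (gact E g e) (gact E g e')"
    and "g \<in> carrier G \<Longrightarrow> e \<in> topspace (total_space E) \<Longrightarrow> gact E g (fscale E c e) = fscale E c (gact E g e)"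
    and "g \<in> carrier G \<Longrightarrow> e \<in> topspace (total_space E) \<Longrightarrow> gact E g e \<in> topspace (total_space E)"
proof -
  have act1: "\<forall>e\<in>topspace (total_space E). gact E \<one> e = e"
    using assms unfolding is_bundle_def by (elim conjE)
  have act2: "\<forall>g\<in>carrier G. \<forall>h\<in>carrier G. \<forall>e\<in>topspace (total_space E). gact E (g \<otimes> h) e = gact E g (gact E h e)"
    using assms unfolding is_bundle_def by (elim conjE)
  have act3: "\<forall>g\<in>carrier G. \<forall>e\<in>topspace (total_space E). bproj E (gact E g e) = a g (bproj E e)"
    using assms unfolding is_bundle_def by (elim conjE)
  have act4: "\<forall>g\<in>carrier G. \<forall>x\<in>topspace X. \<forall>e\<in>fibre E x. \<forall>e'\<in>fibre E x.
      gact E g (fadd E e e') = fadd E (gact E g e) (gact E g e')"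
    using assms unfolding is_bundle_def by (elim conjE)
  have act5: "\<forall>g\<in>carrier G. \<forall>c. \<forall>e\<in>topspace (total_space E). gact E g (fscale E c e) = fscale E c (gact E g e)"
    using assms unfolding is_bundle_def by (elim conjE)
  have cont: "continuous_map (prod_topology T (total_space E)) (total_space E) (\<lambda>(g, e). gact E g e)"
    using assms unfolding is_bundle_def by (elim conjE)
  show "continuous_map (prod_topology T (total_space E)) (total_space E) (\<lambda>(g, e). gact E g e)" by (rule cont)
  show "g \<in> carrier G \<Longrightarrow> e \<in> topspace (total_space E) \<Longrightarrow> gact E g e \<in> topspace (total_space E)"
    using continuous_map_funspace[OF cont] by (auto simp: Pi_iff topspace_eq)
  show "e \<in> topspace (total_space E) \<Longrightarrow> gact E \<one> e = e" using act1 by blast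
  show "g \<in> carrier G \<Longrightarrow> h \<in> carrier G \<Longrightarrow> e \<in> topspace (total_space E) \<Longrightarrow>
      gact E (g \<otimes> h) e = gact E g (gact E h e)" using act2 by blast
  show "g \<in> carrier G \<Longrightarrow> e \<in> topspace (total_space E) \<Longrightarrow> bproj E (gact E g e) = a g (bproj E e)"
    using act3 by blast
  show "g \<in> carrier G \<Longrightarrow> e \<in> topspace (total_space E) \<Longrightarrow> gact E g (fscale E c e) = fscale E c (gact E g e)"
    using act5 by blast
  assume g: "g \<in> carrier G" and e: "e \<in> topspace (total_space E)" "e' \<in> topspace (total_space E)" "bproj E e = bproj E e'"
  show "gact E g (fadd E e e') = fadd E (gact E g e) (gact E g e')"
    using act4 g bundle_proj[OF assms e(1)] e unfolding fibre_def by auto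
qed

lemma bundle_fibre_closed:
  assumes E: "gvb X a E" and e: "e \<in> topspace (total_space E)"
  shows "e' \<in> topspace (total_space E) \<Longrightarrow> bproj E e' = bproj E e \<Longrightarrow> fadd E e e' \<in> topspace (total_space E)"
    and "fscale E c e \<in> topspace (total_space E)"
proof -
  obtain n \<beta> where \<beta>: "fibre_coords E (bproj E e) n \<beta>"
    by (rule bundle_coords[OF E bundle_proj[OF E e]])
  obtain v where v: "v \<in> topspace (complex_space n)" "e = \<beta> v" using fibre_coordsD(6)[OF \<beta> e refl] by blast
  show "fscale E c e \<in> topspace (total_space E)"
    using fibre_coordsD(1)[OF \<beta> complex_space_closed(2)[OF v(1)]] unfolding fibre_coordsD(4)[OF \<beta> v(1)] v(2) .
  assume "e' \<in> topspace (total_space E)" "bproj E e' = bproj E e"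
  then obtain w where w: "w \<in> topspace (complex_space n)" "e' = \<beta> w" using fibre_coordsD(6)[OF \<beta>] by blast
  show "fadd E e e' \<in> topspace (total_space E)"
    using fibre_coordsD(1)[OF \<beta> complex_space_closed(1)[OF v(1) w(1)]]
    unfolding fibre_coordsD(3)[OF \<beta> v(1) w(1)] v(2) w(2) .
qed

lemma bundle_isoE:
  assumes "bundle_iso G E F"
  obtains f where "homeomorphic_map (total_space E) (total_space F) f"
    "\<And>e. e \<in> topspace (total_space E) \<Longrightarrow> f e \<in> topspace (total_space F)"
    "\<And>e. e \<in> topspace (total_space E) \<Longrightarrow> bproj F (f e) = bproj E e"
    "\<And>e e'. e \<in> topspace (total_space E) \<Longrightarrow> e' \<in> topspace (total_space E) \<Longrightarrow> bproj E e = bproj E e' \<Longrightarrow>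
      f (fadd E e e') = fadd F (f e) (f e')"
    "\<And>c e. e \<in> topspace (total_space E) \<Longrightarrow> f (fscale E c e) = fscale F c (f e)"
    "\<And>g e. g \<in> carrier G \<Longrightarrow> e \<in> topspace (total_space E) \<Longrightarrow> f (gact E g e) = gact F g (f e)"
proof -
  obtain f where f: "homeomorphic_map (total_space E) (total_space F) f"
    "\<forall>e\<in>topspace (total_space E). bproj F (f e) = bproj E e"
    "\<forall>e\<in>topspace (total_space E). \<forall>e'\<in>topspace (total_space E). bproj E e = bproj E e' \<longrightarrow>
           f (fadd E e e') = fadd F (f e) (f e')"
    "\<forall>c. \<forall>e\<in>topspace (total_space E). f (fscale E c e) = fscale F c (f e)"
    "\<forall>g\<in>carrier G. \<forall>e\<in>topspace (total_space E). f (gact E g e) = gact F g (f e)"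
    using assms unfolding bundle_iso_def by blast
  have "f ` topspace (total_space E) = topspace (total_space F)"
    using f(1) by (rule homeomorphic_imp_surjective_map)
  then show thesis using f by (intro that[of f]) auto
qed

lemma bundle_iso_refl: "bundle_iso G E E"
  unfolding bundle_iso_def by (intro exI[of _ id]) auto

lemma bundle_iso_trans:
  assumes "bundle_iso G E F" "bundle_iso G F H"
  shows "bundle_iso G E H"
proof -
  obtain f where f: "homeomorphic_map (total_space E) (total_space F) f"
    "\<And>e. e \<in> topspace (total_space E) \<Longrightarrow> f e \<in> topspace (total_space F)"
    "\<And>e. e \<in> topspace (total_space E) \<Longrightarrow> bproj F (f e) = bproj E e"
    "\<And>e e'. e \<in> topspace (total_space E) \<Longrightarrow> e' \<in> topspace (total_space E) \<Longrightarrow> bproj E e = bproj E e' \<Longrightarrow>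
      f (fadd E e e') = fadd F (f e) (f e')"
    "\<And>c e. e \<in> topspace (total_space E) \<Longrightarrow> f (fscale E c e) = fscale F c (f e)"
    "\<And>g e. g \<in> carrier G \<Longrightarrow> e \<in> topspace (total_space E) \<Longrightarrow> f (gact E g e) = gact F g (f e)"
    by (rule bundle_isoE[OF assms(1)]) (rule that)
  obtain f' where f': "homeomorphic_map (total_space F) (total_space H) f'"
    "\<And>e. e \<in> topspace (total_space F) \<Longrightarrow> f' e \<in> topspace (total_space H)"
    "\<And>e. e \<in> topspace (total_space F) \<Longrightarrow> bproj H (f' e) = bproj F e"
    "\<And>e e'. e \<in> topspace (total_space F) \<Longrightarrow> e' \<in> topspace (total_space F) \<Longrightarrow> bproj F e = bproj F e' \<Longrightarrow>
      f' (fadd F e e') = fadd H (f' e) (f' e')"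
    "\<And>c e. e \<in> topspace (total_space F) \<Longrightarrow> f' (fscale F c e) = fscale H c (f' e)"
    "\<And>g e. g \<in> carrier G \<Longrightarrow> e \<in> topspace (total_space F) \<Longrightarrow> f' (gact F g e) = gact H g (f' e)"
    by (rule bundle_isoE[OF assms(2)]) (rule that)
  have "homeomorphic_map (total_space E) (total_space H) (f' \<circ> f)"
    using f(1) f'(1) by (rule homeomorphic_map_compose)
  then show ?thesis
    unfolding bundle_iso_def by (intro exI[of _ "f' \<circ> f"]) (simp add: f(2-) f'(2-))
qed

text \<open>Linearity of the inverse \<open>k\<close> is obtained by applying \<open>k\<close> to
  the linearity of \<open>f\<close>; since \<open>E\<close> is a bundle, sums and multiples stay in
  its total space, where \<open>k\<close> inverts \<open>f\<close>.\<close>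

lemma bundle_iso_sym:
  assumes E: "gvb X a E" and "bundle_iso G E F"
  shows "bundle_iso G F E"
proof -
  obtain f where f: "homeomorphic_map (total_space E) (total_space F) f"
    "\<And>e. e \<in> topspace (total_space E) \<Longrightarrow> f e \<in> topspace (total_space F)"
    "\<And>e. e \<in> topspace (total_space E) \<Longrightarrow> bproj F (f e) = bproj E e"
    "\<And>e e'. e \<in> topspace (total_space E) \<Longrightarrow> e' \<in> topspace (total_space E) \<Longrightarrow> bproj E e = bproj E e' \<Longrightarrow>
      f (fadd E e e') = fadd F (f e) (f e')"
    "\<And>c e. e \<in> topspace (total_space E) \<Longrightarrow> f (fscale E c e) = fscale F c (f e)"
    "\<And>g e. g \<in> carrier G \<Longrightarrow> e \<in> topspace (total_space E) \<Longrightarrow> f (gact E g e) = gact F g (f e)"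
    by (rule bundle_isoE[OF assms(2)]) (rule that)
  obtain k where k: "homeomorphic_maps (total_space E) (total_space F) f k"
    using f(1) unfolding homeomorphic_map_maps by blast
  have hk: "homeomorphic_map (total_space F) (total_space E) k"
    using k homeomorphic_maps_map homeomorphic_maps_sym by blast
  have kt: "k u \<in> topspace (total_space E)" if "u \<in> topspace (total_space F)" for u
    using homeomorphic_imp_surjective_map[OF hk] that by blast
  have kf: "k (f e) = e" if "e \<in> topspace (total_space E)" for e
    using k that unfolding homeomorphic_maps_def by blast
  have fk: "f (k u) = u" if "u \<in> topspace (total_space F)" for u
    using k that unfolding homeomorphic_maps_def by blast
  have p: "bproj E (k u) = bproj F u" if "u \<in> topspace (total_space F)" for u
    using f(3)[OF kt[OF that]] fk[OF that] by simp
  show ?thesis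
    unfolding bundle_iso_def
  proof (intro exI[of _ k] conjI ballI allI impI hk p)
    fix u u' assume u: "u \<in> topspace (total_space F)" "u' \<in> topspace (total_space F)" "bproj F u = bproj F u'"
    have "k (fadd F u u') = k (f (fadd E (k u) (k u')))"
      using f(4)[OF kt[OF u(1)] kt[OF u(2)]] u by (simp add: p fk)
    then show "k (fadd F u u') = fadd E (k u) (k u')"
      using kf[OF bundle_fibre_closed(1)[OF E kt[OF u(1)] kt[OF u(2)]]] u by (simp add: p)
  next
    fix c u assume u: "u \<in> topspace (total_space F)"
    have "k (fscale F c u) = k (f (fscale E c (k u)))" using f(5)[OF kt[OF u]] u by (simp add: fk)
    then show "k (fscale F c u) = fscale E c (k u)" using kf[OF bundle_fibre_closed(2)[OF E kt[OF u]]] by simp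
  next
    fix g u assume g: "g \<in> carrier G" and u: "u \<in> topspace (total_space F)"
    have "k (gact F g u) = k (f (gact E g (k u)))" using f(6)[OF g kt[OF u]] u by (simp add: fk)
    then show "k (gact F g u) = gact E g (k u)" using kf[OF bundle_act(7)[OF E g kt[OF u]]] by simp
  qed
qed

lemma fibre_coords_iso:
  assumes \<beta>: "fibre_coords E x n \<beta>"
    and f: "homeomorphic_map (total_space E) (total_space F) f"
    "\<And>e. e \<in> topspace (total_space E) \<Longrightarrow> bproj F (f e) = bproj E e"
    "\<And>e e'. e \<in> topspace (total_space E) \<Longrightarrow> e' \<in> topspace (total_space E) \<Longrightarrow> bproj E e = bproj E e' \<Longrightarrow>
      f (fadd E e e') = fadd F (f e) (f e')"
    "\<And>c e. e \<in> topspace (total_space E) \<Longrightarrow> f (fscale E c e) = fscale F c (f e)"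
  shows "fibre_coords F x n (\<lambda>v. f (\<beta> v))"
proof (rule fibre_coordsI)
  have surj: "f ` topspace (total_space E) = topspace (total_space F)"
    using f(1) by (rule homeomorphic_imp_surjective_map)
  have inj: "inj_on f (topspace (total_space E))"
    using f(1) by (rule homeomorphic_imp_injective_map)
  note b = fibre_coordsD[OF \<beta>]
  show "f (\<beta> v) \<in> topspace (total_space F) \<and> bproj F (f (\<beta> v)) = x" if "v \<in> topspace (complex_space n)" for v
    using b(1,2)[OF that] f(2) surj by auto
  show "f (\<beta> (\<lambda>i. v i + w i)) = fadd F (f (\<beta> v)) (f (\<beta> w))"
    if "v \<in> topspace (complex_space n)" "w \<in> topspace (complex_space n)" for v w
    using b(1,2)[OF that(1)] b(1,2)[OF that(2)] b(3)[OF that] f(3) by simp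
  show "f (\<beta> (\<lambda>i. c * v i)) = fscale F c (f (\<beta> v))" if "v \<in> topspace (complex_space n)" for c v
    using b(1)[OF that] b(4)[OF that] f(4) by simp
  show "v = w" if "v \<in> topspace (complex_space n)" "w \<in> topspace (complex_space n)" "f (\<beta> v) = f (\<beta> w)" for v w
    using inj_onD[OF inj that(3) b(1)[OF that(1)] b(1)[OF that(2)]] b(5)[OF that(1,2)] by blast
  show "\<exists>v\<in>topspace (complex_space n). u = f (\<beta> v)" if u: "u \<in> topspace (total_space F)" "bproj F u = x" for u
  proof -
    obtain e where e: "e \<in> topspace (total_space E)" "u = f e" using u(1) surj by blast
    then have "bproj E e = x" using f(2) u(2) by simp
    then show ?thesis using b(6)[OF e(1)] e(2) by blast
  qed
qed

lemma fibre_coords_gact: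
  assumes E: "gvb X a E" and \<beta>: "fibre_coords E x n \<beta>" and g: "g \<in> carrier G"
    and a: "a (inv g) (a g x) = x"
  shows "fibre_coords E (a g x) n (\<lambda>v. gact E g (\<beta> v))"
proof (rule fibre_coordsI)
  note b = fibre_coordsD[OF \<beta>] and act = bundle_act[OF E]
  show "gact E g (\<beta> v) \<in> topspace (total_space E) \<and> bproj E (gact E g (\<beta> v)) = a g x"
    if "v \<in> topspace (complex_space n)" for v
    using b(1,2)[OF that] act(4,7)[OF g] by simp
  show "gact E g (\<beta> (\<lambda>i. v i + w i)) = fadd E (gact E g (\<beta> v)) (gact E g (\<beta> w))"
    if "v \<in> topspace (complex_space n)" "w \<in> topspace (complex_space n)" for v w
    using b(1,2)[OF that(1)] b(1,2)[OF that(2)] b(3)[OF that] act(5)[OF g] by simp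
  show "gact E g (\<beta> (\<lambda>i. c * v i)) = fscale E c (gact E g (\<beta> v))" if "v \<in> topspace (complex_space n)" for c v
    using b(1)[OF that] b(4)[OF that] act(6)[OF g] by simp
  have inv: "gact E (inv g) (gact E g e) = e" if "e \<in> topspace (total_space E)" for e
    using act(3)[OF inv_closed[OF g] g that] g act(2)[OF that] by simp
  have inv': "gact E g (gact E (inv g) e) = e" if "e \<in> topspace (total_space E)" for e
    using act(3)[OF g inv_closed[OF g] that] g act(2)[OF that] by simp
  show "v = w" if "v \<in> topspace (complex_space n)" "w \<in> topspace (complex_space n)"
    "gact E g (\<beta> v) = gact E g (\<beta> w)" for v w
    using arg_cong[OF that(3), of "gact E (inv g)"] inv[OF b(1)[OF that(1)]] inv[OF b(1)[OF that(2)]] b(5)[OF that(1,2)] by simp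
  show "\<exists>v\<in>topspace (complex_space n). e = gact E g (\<beta> v)"
    if e: "e \<in> topspace (total_space E)" "bproj E e = a g x" for e
  proof -
    have "bproj E (gact E (inv g) e) = x" using act(4)[OF inv_closed[OF g] e(1)] e(2) a by simp
    then obtain v where "v \<in> topspace (complex_space n)" "gact E (inv g) e = \<beta> v"
      using b(6)[OF act(7)[OF inv_closed[OF g] e(1)]] by blast
    then show ?thesis using inv'[OF e(1)] by metis
  qed
qed

lemma mem_bundle_class: "F \<in> bundle_class G T X a E \<longleftrightarrow> gvb X a F \<and> bundle_iso G E F"
  by (simp add: bundle_class_def)

lemma bundle_class_eqI:
  assumes E: "gvb X a E" and "bundle_iso G E F"
  shows "bundle_class G T X a E = bundle_class G T X a F"
proof (rule Set.set_eqI)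
  fix H
  show "H \<in> bundle_class G T X a E \<longleftrightarrow> H \<in> bundle_class G T X a F"
    unfolding mem_bundle_class
    using bundle_iso_trans[OF assms(2), of H] bundle_iso_trans[OF bundle_iso_sym[OF E assms(2)], of H] by blast
qed

lemma fibre_rep_class_iso:
  assumes "bundle_iso G E F"
  shows "fibre_rep_class G T x E \<subseteq> fibre_rep_class G T x F"
proof
  fix r assume "r \<in> fibre_rep_class G T x E"
  then obtain n \<beta> where r: "rep n r" and \<beta>: "fibre_coords E x n \<beta>"
    and act: "\<forall>g\<in>carrier G. \<forall>v\<in>topspace (complex_space n). \<beta> (mat_act (r g) v) = gact E g (\<beta> v)"
    unfolding fibre_rep_class_def by blast
  obtain f where f: "homeomorphic_map (total_space E) (total_space F) f"
    "\<And>e. e \<in> topspace (total_space E) \<Longrightarrow> f e \<in> topspace (total_space F)"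
    "\<And>e. e \<in> topspace (total_space E) \<Longrightarrow> bproj F (f e) = bproj E e"
    "\<And>e e'. e \<in> topspace (total_space E) \<Longrightarrow> e' \<in> topspace (total_space E) \<Longrightarrow> bproj E e = bproj E e' \<Longrightarrow>
      f (fadd E e e') = fadd F (f e) (f e')"
    "\<And>c e. e \<in> topspace (total_space E) \<Longrightarrow> f (fscale E c e) = fscale F c (f e)"
    "\<And>g e. g \<in> carrier G \<Longrightarrow> e \<in> topspace (total_space E) \<Longrightarrow> f (gact E g e) = gact F g (f e)"
    by (rule bundle_isoE[OF assms]) (rule that)
  have "fibre_coords F x n (\<lambda>v. f (\<beta> v))" by (rule fibre_coords_iso[OF \<beta> f(1,3,4,5)])
  moreover have "f (\<beta> (mat_act (r g) v)) = gact F g (f (\<beta> v))"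
    if "g \<in> carrier G" "v \<in> topspace (complex_space n)" for g v
    using act that f(6)[OF that(1) fibre_coordsD(1)[OF \<beta> that(2)]] by simp
  ultimately show "r \<in> fibre_rep_class G T x F"
    unfolding fibre_rep_class_def using r by blast
qed

text \<open>A change of linear coordinates on the fibre amounts to conjugation by an invertible
  matrix. Therefore the set of all coordinate forms of the fibre is a full isomorphism class as soon
  as it is nonempty.\<close>

lemma fibre_rep_class_eq:
  assumes r: "r \<in> fibre_rep_class G T x E"
  shows "fibre_rep_class G T x E = cls r"
proof -
  obtain n \<beta> where rn: "rep n r" and \<beta>: "fibre_coords E x n \<beta>"
    and act: "\<And>g v. g \<in> carrier G \<Longrightarrow> v \<in> topspace (complex_space n) \<Longrightarrow> \<beta> (mat_act (r g) v) = gact E g (\<beta> v)"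
    using r unfolding fibre_rep_class_def by blast
  show ?thesis
  proof (rule Set.set_eqI, rule iffI)
    fix s assume "s \<in> fibre_rep_class G T x E"
    then obtain m \<gamma> where s: "rep m s" and \<gamma>: "fibre_coords E x m \<gamma>"
      and act': "\<And>g v. g \<in> carrier G \<Longrightarrow> v \<in> topspace (complex_space m) \<Longrightarrow> \<gamma> (mat_act (s g) v) = gact E g (\<gamma> v)"
      unfolding fibre_rep_class_def by blast
    obtain A where A: "n = m" "A \<in> carrier_mat n n" "invertible_mat A"
      "\<And>v. v \<in> topspace (complex_space n) \<Longrightarrow> \<beta> v = \<gamma> (mat_act A v)"
      by (rule fibre_coords_change[OF \<beta> \<gamma>]) (rule that)
    have "A * r g = s g * A" if g: "g \<in> carrier G" for g
    proof (rule mat_eq_of_act[of _ n n])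
      note c = rep_carrier[OF rn g] rep_carrier[OF s g, folded A(1)]
      show "A * r g \<in> carrier_mat n n" "s g * A \<in> carrier_mat n n" using c A(2) by auto
      fix v assume v: "v \<in> topspace (complex_space n)"
      have "\<gamma> (mat_act A (mat_act (r g) v)) = gact E g (\<beta> v)"
        using A(4)[OF mat_act_mem[OF c(1)]] act[OF g v] by simp
      also have "\<dots> = \<gamma> (mat_act (s g) (mat_act A v))"
        using A(4)[OF v] act'[OF g, of "mat_act A v"] mat_act_mem[OF A(2)] A(1) by simp
      finally have "mat_act A (mat_act (r g) v) = mat_act (s g) (mat_act A v)"
        using fibre_coordsD(5)[OF \<gamma>] mat_act_mem[OF A(2)] mat_act_mem[OF c(2)] A(1) by blast
      then show "mat_act (A * r g) v = mat_act (s g * A) v"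
        by (simp add: mat_act_mult[OF A(2) c(1)] mat_act_mult[OF c(2) A(2)])
    qed
    then show "s \<in> cls r" unfolding mem_cls_iff[OF rn] rep_equiv_def using s A by blast
  next
    fix s assume "s \<in> cls r"
    then have s: "rep n s" "rep_equiv (carrier G) n r s" by (simp_all add: mem_cls_iff[OF rn])
    then obtain P where P: "P \<in> carrier_mat n n" "invertible_mat P" "\<And>g. g \<in> carrier G \<Longrightarrow> P * s g = r g * P"
      using rep_equiv_symD[OF rn s] unfolding rep_equiv_def by blast
    have "\<beta> (mat_act P (mat_act (s g) v)) = gact E g (\<beta> (mat_act P v))"
      if g: "g \<in> carrier G" and v: "v \<in> topspace (complex_space n)" for g v
      unfolding mat_act_mult[OF P(1) rep_carrier[OF s(1) g], symmetric] P(3)[OF g]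
        mat_act_mult[OF rep_carrier[OF rn g] P(1)] by (rule act[OF g mat_act_mem[OF P(1)]])
    then show "s \<in> fibre_rep_class G T x E"
      unfolding fibre_rep_class_def using s(1) fibre_coords_mat_act[OF \<beta> P(1,2)] by blast
  qed
qed

end

section \<open>Bundles given by matrix cocycles\<close>

definition cocycle_bundle ::
  "'x topology \<Rightarrow> ('g \<Rightarrow> 'x \<Rightarrow> 'x) \<Rightarrow> nat \<Rightarrow> ('g \<Rightarrow> 'x \<Rightarrow> complex mat) \<Rightarrow> ('x \<times> (nat \<Rightarrow> complex), 'x, 'g) gbundle"
  where
  "cocycle_bundle X a n c =
     \<lparr>total_space = prod_topology X (complex_space n),
      bproj = fst,
      fadd = (\<lambda>(x, v) (y, w). (x, \<lambda>i. v i + w i)),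
      fscale = (\<lambda>k (x, v). (x, \<lambda>i. k * v i)),
      gact = (\<lambda>g (x, v). (a g x, mat_act (c g x) v))\<rparr>"

lemma cocycle_bundle_simps [simp]:
  "total_space (cocycle_bundle X a n c) = prod_topology X (complex_space n)"
  "bproj (cocycle_bundle X a n c) = fst"
  "fadd (cocycle_bundle X a n c) (x, v) (y, w) = (x, \<lambda>i. v i + w i)"
  "fscale (cocycle_bundle X a n c) k (x, v) = (x, \<lambda>i. k * v i)"
  "gact (cocycle_bundle X a n c) g (x, v) = (a g x, mat_act (c g x) v)"
  by (simp_all add: cocycle_bundle_def)

lemma product_bundle_eq: "product_bundle X a n r = cocycle_bundle X a n (\<lambda>g x. r g)"
  by (simp add: product_bundle_def cocycle_bundle_def)

lemma fibre_coords_cocycle_bundle: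
  "x \<in> topspace X \<Longrightarrow> fibre_coords (cocycle_bundle X a n c) x n (\<lambda>v. (x, v))"
  by (rule fibre_coordsI) auto

locale gspace = compact_group G T for G (structure) and T :: "'a topology" +
  fixes X :: "'x topology" and a :: "'a \<Rightarrow> 'x \<Rightarrow> 'x"
  assumes act_continuous: "continuous_map (prod_topology T X) X (\<lambda>(g, x). a g x)"
    and act_one: "x \<in> topspace X \<Longrightarrow> a \<one> x = x"
    and act_mult: "g \<in> carrier G \<Longrightarrow> h \<in> carrier G \<Longrightarrow> x \<in> topspace X \<Longrightarrow> a (g \<otimes> h) x = a g (a h x)"
begin

lemma act_closed: "g \<in> carrier G \<Longrightarrow> x \<in> topspace X \<Longrightarrow> a g x \<in> topspace X"
  using continuous_map_funspace[OF act_continuous] by (auto simp: Pi_iff topspace_eq)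

lemma act_inv: "g \<in> carrier G \<Longrightarrow> x \<in> topspace X \<Longrightarrow> a (inv g) (a g x) = x"
  by (simp add: act_one flip: act_mult)

text \<open>\<open>c g x\<close> is the matrix of \<open>g\<close> as a map from the fibre at
  \<open>x\<close> to the fibre at \<open>a g x\<close>; the last clause expresses that the action
  is compatible with products.\<close>

definition cocycle :: "nat \<Rightarrow> ('a \<Rightarrow> 'x \<Rightarrow> complex mat) \<Rightarrow> bool" where
  "cocycle n c \<longleftrightarrow> mat_continuous (prod_topology T X) n n (\<lambda>(g, x). c g x) \<and>
     (\<forall>x\<in>topspace X. c \<one> x = 1\<^sub>m n) \<and>
     (\<forall>g\<in>carrier G. \<forall>h\<in>carrier G. \<forall>x\<in>topspace X. c (g \<otimes> h) x = c g (a h x) * c h x)"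

lemma cocycleD:
  assumes "cocycle n c"
  shows "mat_continuous (prod_topology T X) n n (\<lambda>(g, x). c g x)"
    and "g \<in> carrier G \<Longrightarrow> x \<in> topspace X \<Longrightarrow> c g x \<in> carrier_mat n n"
    and "x \<in> topspace X \<Longrightarrow> c \<one> x = 1\<^sub>m n"
    and "g \<in> carrier G \<Longrightarrow> h \<in> carrier G \<Longrightarrow> x \<in> topspace X \<Longrightarrow> c (g \<otimes> h) x = c g (a h x) * c h x"
  using assms mat_continuous_carrier[of "prod_topology T X" n n "\<lambda>(g, x). c g x" "(g, x)"]
  unfolding cocycle_def by (auto simp: topspace_eq)

lemma cocycle_inv:
  assumes c: "cocycle n c" and g: "g \<in> carrier G" and x: "x \<in> topspace X"
  shows "c (inv g) (a g x) * c g x = 1\<^sub>m n" "c g x * c (inv g) (a g x) = 1\<^sub>m n"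
proof -
  show 1: "c (inv g) (a g x) * c g x = 1\<^sub>m n"
    using cocycleD(4)[OF c inv_closed[OF g] g x] cocycleD(3)[OF c x] g by simp
  show "c g x * c (inv g) (a g x) = 1\<^sub>m n"
    using mat_mult_left_right_inverse[OF cocycleD(2)[OF c inv_closed[OF g] act_closed[OF g x]] cocycleD(2)[OF c g x] 1] .
qed

abbreviation cb :: "nat \<Rightarrow> ('a \<Rightarrow> 'x \<Rightarrow> complex mat) \<Rightarrow> ('x \<times> (nat \<Rightarrow> complex), 'x, 'a) gbundle" where
  "cb \<equiv> cocycle_bundle X a"

lemma cocycle_bundle_is_bundle:
  assumes c: "cocycle n c"
  shows "gvb X a (cb n c)"
  unfolding is_bundle_def
proof (intro conjI ballI allI)
  show "continuous_map (total_space (cb n c)) X (bproj (cb n c))" by (simp add: continuous_map_fst)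
  show "\<exists>U m h. openin X U \<and> x \<in> U \<and>
        homeomorphic_map (prod_topology (subtopology X U) (complex_space m))
          (subtopology (total_space (cb n c)) {e \<in> topspace (total_space (cb n c)). bproj (cb n c) e \<in> U}) h \<and>
        (\<forall>y\<in>U. fibre_coords (cb n c) y m (\<lambda>v. h (y, v)))" if x: "x \<in> topspace X" for x
  proof (intro exI conjI ballI)
    have "{e \<in> topspace (prod_topology X (complex_space n)). fst e \<in> topspace X} = topspace (prod_topology X (complex_space n))"
      by auto
    then show "homeomorphic_map (prod_topology (subtopology X (topspace X)) (complex_space n))
       (subtopology (total_space (cb n c)) {e \<in> topspace (total_space (cb n c)). bproj (cb n c) e \<in> topspace X}) (\<lambda>e. e)"
      by (simp only: cocycle_bundle_simps subtopology_topspace) (simp add: homeomorphic_map_id[unfolded id_def])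
    show "fibre_coords (cb n c) y n (\<lambda>v. (y, v))" if "y \<in> topspace X" for y
      by (rule fibre_coords_cocycle_bundle[OF that])
  qed (use x in auto)
  let ?P = "prod_topology T (prod_topology X (complex_space n))"
  have 1: "continuous_map ?P (prod_topology T X) (\<lambda>p. (fst p, fst (snd p)))"
    by (intro continuous_map_pairedI continuous_map_fst continuous_map_compose[OF continuous_map_snd continuous_map_fst, unfolded o_def])
  have 2: "continuous_map ?P (complex_space n) (\<lambda>p. snd (snd p))"
    by (rule continuous_map_compose[OF continuous_map_snd continuous_map_snd, unfolded o_def])
  have "continuous_map ?P (prod_topology X (complex_space n))
      (\<lambda>p. (a (fst p) (fst (snd p)), mat_act (c (fst p) (fst (snd p))) (snd (snd p))))"
    using continuous_map_compose[OF 1 act_continuous] mat_continuous_compose[OF cocycleD(1)[OF c] 1]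
    by (intro continuous_map_pairedI continuous_map_mat_act[OF _ 2]) (simp_all add: o_def)
  moreover have "(\<lambda>p. (a (fst p) (fst (snd p)), mat_act (c (fst p) (fst (snd p))) (snd (snd p)))) = (\<lambda>(g, e). gact (cb n c) g e)"
    by auto
  ultimately show "continuous_map (prod_topology T (total_space (cb n c))) (total_space (cb n c)) (\<lambda>(g, e). gact (cb n c) g e)"
    by simp
next
  fix e assume "e \<in> topspace (total_space (cb n c))"
  then obtain x v where e: "e = (x, v)" "x \<in> topspace X" "v \<in> topspace (complex_space n)" by auto
  show "gact (cb n c) \<one> e = e"
    unfolding e(1) using e cocycleD(3)[OF c e(2)] act_one[OF e(2)] mat_act_one[OF e(3)] by simp
  fix g assume g: "g \<in> carrier G"
  show "bproj (cb n c) (gact (cb n c) g e) = a g (bproj (cb n c) e)" by (simp add: e)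
  show "gact (cb n c) g (fscale (cb n c) k e) = fscale (cb n c) k (gact (cb n c) g e)" for k
    by (simp add: e mat_act_scale)
  fix h assume h: "h \<in> carrier G"
  show "gact (cb n c) (g \<otimes> h) e = gact (cb n c) g (gact (cb n c) h e)"
    unfolding e(1) using g h e cocycleD(4)[OF c g h e(2)] act_mult[OF g h e(2)]
      mat_act_mult[OF cocycleD(2)[OF c g act_closed[OF h e(2)]] cocycleD(2)[OF c h e(2)], of v] by simp
next
  fix g x e e' assume "g \<in> carrier G" "e \<in> fibre (cb n c) x" "e' \<in> fibre (cb n c) x"
  then show "gact (cb n c) g (fadd (cb n c) e e') = fadd (cb n c) (gact (cb n c) g e) (gact (cb n c) g e')"
    by (auto simp: fibre_def mat_act_add)
qed

text \<open>A continuous frame has a continuous inverse, because in a local trivialization inverting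
  it means inverting a continuous matrix function. The cocycle then consists of the matrices of the
  action in this frame.\<close>

lemma bundle_of_frame:
  fixes E :: "('e, 'x, 'a) gbundle"
  assumes E: "gvb X a E" and h: "continuous_map (prod_topology X (complex_space n)) (total_space E) h"
    and hc: "\<And>x. x \<in> topspace X \<Longrightarrow> fibre_coords E x n (\<lambda>v. h (x, v))"
  obtains c where "cocycle n c" "bundle_iso G (cb n c) E"
proof -
  let ?Z = "prod_topology X (complex_space n)"
  let ?V = "topspace (complex_space n)"
  note b = fibre_coordsD[OF hc]
  have surj: "\<exists>x v. x \<in> topspace X \<and> v \<in> ?V \<and> e = h (x, v)" if "e \<in> topspace (total_space E)" for e
    using b(6)[OF bundle_proj[OF E that] that refl] bundle_proj[OF E that] by blast
  have inj: "p = q" if pq: "p \<in> topspace ?Z" "q \<in> topspace ?Z" "h p = h q" for p q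
  proof -
    obtain x v y w where p: "p = (x, v)" "x \<in> topspace X" "v \<in> ?V" "q = (y, w)" "y \<in> topspace X" "w \<in> ?V"
      using pq(1,2) by auto
    have "x = y" using b(2)[OF p(2,3)] b(2)[OF p(5,6)] pq(3) p(1,4) by simp
    then show ?thesis using b(5)[OF p(2,3), of w] p pq(3) by simp
  qed
  define k where "k = inv_into (topspace ?Z) h"
  have kh: "k (h (x, v)) = (x, v)" if "x \<in> topspace X" "v \<in> ?V" for x v
    unfolding k_def using that inj by (intro inv_into_f_f inj_onI) auto
  have k_mem: "k e \<in> topspace ?Z" "h (k e) = e" if "e \<in> topspace (total_space E)" for e
    using surj[OF that] kh by auto
  have k: "continuous_map (total_space E) ?Z k"
  proof -
    have loc: "\<exists>W. openin X W \<and> x0 \<in> W \<and> continuous_map (subtopology (total_space E) {e \<in> topspace (total_space E). bproj E e \<in> W}) ?Z k"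
      if x0: "x0 \<in> topspace X" for x0
    proof -
      obtain U m \<phi> where U: "openin X U" "x0 \<in> U"
        "homeomorphic_map (prod_topology (subtopology X U) (complex_space m))
          (subtopology (total_space E) {e \<in> topspace (total_space E). bproj E e \<in> U}) \<phi>"
        "\<And>y. y \<in> U \<Longrightarrow> fibre_coords E y m (\<lambda>v. \<phi> (y, v))"
        by (rule bundle_local_triv[OF E x0]) (rule that)
      have UX: "U \<subseteq> topspace X" using U(1) by (rule openin_subset)
      have tU: "topspace (subtopology X U) = U" using UX by auto
      have m: "n = m"
        by (rule fibre_coords_change[OF hc[OF x0] U(4)[OF U(2)]])
      let ?EU = "subtopology (total_space E) {e \<in> topspace (total_space E). bproj E e \<in> U}"
      let ?ZU = "prod_topology (subtopology X U) (complex_space n)"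
      obtain \<psi> where \<psi>: "homeomorphic_maps ?ZU ?EU \<phi> \<psi>"
        using U(3) m unfolding homeomorphic_map_maps by blast
      have c\<psi>: "continuous_map ?EU ?ZU \<psi>" using \<psi> unfolding homeomorphic_maps_def by blast
      have \<psi>\<phi>: "\<psi> (\<phi> (x, v)) = (x, v)" if "x \<in> U" "v \<in> ?V" for x v
        using \<psi> that UX unfolding homeomorphic_maps_def by auto
      have "\<exists>A. A \<in> carrier_mat n n \<and> invertible_mat A \<and> (\<forall>v\<in>?V. h (x, v) = \<phi> (x, mat_act A v))" if x: "x \<in> U" for x
        by (rule fibre_coords_change[OF hc U(4)[OF x]]) (use x UX in blast)+
      then obtain A where A: "\<And>x. x \<in> U \<Longrightarrow> A x \<in> carrier_mat n n" "\<And>x. x \<in> U \<Longrightarrow> invertible_mat (A x)"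
        "\<And>x v. x \<in> U \<Longrightarrow> v \<in> ?V \<Longrightarrow> h (x, v) = \<phi> (x, mat_act (A x) v)"
        by metis
      have hU: "continuous_map ?ZU ?EU h"
      proof (rule continuous_map_into_subtopology)
        show "continuous_map ?ZU (total_space E) h"
          using continuous_map_from_subtopology[OF h, of "U \<times> topspace (complex_space n)"] by (simp add: prod_topology_subtopology(1))
        show "h \<in> topspace ?ZU \<rightarrow> {e \<in> topspace (total_space E). bproj E e \<in> U}"
          using b(1,2) UX by (auto simp: tU)
      qed
      \<comment> \<open>Column \<open>j\<close> of \<open>A x\<close> is the local expression of the
        frame on the unit vector \<open>j\<close>, which depends continuously on
        \<open>x\<close>.\<close>
      have mA: "mat_continuous (subtopology X U) n n A"
      proof (rule mat_continuousI[where F = "\<lambda>i j x. snd (\<psi> (h (x, unit_coord j))) i"])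
        fix i j assume ij: "i < n" "j < n"
        have "continuous_map (subtopology X U) ?ZU (\<lambda>x. (x, unit_coord j))"
          using unit_coord_mem[OF ij(2)] by (intro continuous_map_pairedI) auto
        then have "continuous_map (subtopology X U) (complex_space n) (\<lambda>x. snd (\<psi> (h (x, unit_coord j))))"
          using continuous_map_compose[OF continuous_map_compose[OF continuous_map_compose[OF _ hU] c\<psi>] continuous_map_snd]
          by (simp add: o_def)
        then show "continuous_map (subtopology X U) euclidean (\<lambda>x. snd (\<psi> (h (x, unit_coord j))) i)"
          by (rule continuous_map_coordinate)
        fix x assume "x \<in> topspace (subtopology X U)"
        then have x: "x \<in> U" by (simp add: tU)
        show "A x $$ (i, j) = snd (\<psi> (h (x, unit_coord j))) i"
          using A(3)[OF x unit_coord_mem[OF ij(2)]] \<psi>\<phi>[OF x mat_act_mem[OF A(1)[OF x]]] mat_act_unit[OF A(1)[OF x] ij] by simp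
      qed (use A tU in auto)
      obtain B where B: "mat_continuous (subtopology X U) n n B" "\<And>x. x \<in> U \<Longrightarrow> A x * B x = 1\<^sub>m n" "\<And>x. x \<in> U \<Longrightarrow> B x * A x = 1\<^sub>m n"
        using mat_continuous_inverse[OF mA] A(2) tU by metis
      have fst\<psi>: "continuous_map ?EU (subtopology X U) (\<lambda>e. fst (\<psi> e))" and snd\<psi>: "continuous_map ?EU (complex_space n) (\<lambda>e. snd (\<psi> e))"
        using continuous_map_compose[OF c\<psi> continuous_map_fst] continuous_map_compose[OF c\<psi> continuous_map_snd] by (simp_all add: o_def)
      \<comment> \<open>The inverse of the frame over \<open>U\<close>: local coordinates followed
        by the inverse \<open>B\<close> of the comparison matrix \<open>A\<close>.\<close>
      have "continuous_map ?EU ?Z (\<lambda>e. (fst (\<psi> e), mat_act (B (fst (\<psi> e))) (snd (\<psi> e))))"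
        by (intro continuous_map_pairedI continuous_map_mat_act[OF mat_continuous_compose[OF B(1) fst\<psi>] snd\<psi>]
            continuous_map_into_fulltopology[OF fst\<psi>])
      then have "continuous_map ?EU ?Z k"
      proof (rule continuous_map_eq)
        fix e assume e: "e \<in> topspace ?EU"
        then obtain v where v: "v \<in> ?V" "e = h (bproj E e, v)" and eU: "bproj E e \<in> U"
          using b(6)[of "bproj E e" e] UX by auto
        have "\<psi> e = (bproj E e, mat_act (A (bproj E e)) v)"
          using A(3)[OF eU v(1)] v(2) \<psi>\<phi>[OF eU mat_act_mem[OF A(1)[OF eU]]] by metis
        moreover have "mat_act (B (bproj E e)) (mat_act (A (bproj E e)) v) = v"
        proof -
          have "bproj E e \<in> topspace (subtopology X U)" using eU tU by simp
          from mat_act_mult[OF mat_continuous_carrier[OF B(1) this] A(1)[OF eU], of v]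
          show ?thesis unfolding B(3)[OF eU] mat_act_one[OF v(1)] by (rule sym)
        qed
        moreover have "k e = (bproj E e, v)" using kh[of "bproj E e" v] v eU UX by auto
        ultimately show "(fst (\<psi> e), mat_act (B (fst (\<psi> e))) (snd (\<psi> e))) = k e" by simp
      qed
      then show ?thesis using U by blast
    qed
    then have "\<forall>x\<in>topspace X. \<exists>W. openin X W \<and> x \<in> W \<and>
        continuous_map (subtopology (total_space E) {e \<in> topspace (total_space E). bproj E e \<in> W}) ?Z k"
      by (rule ballI)
    from bchoice[OF this] obtain W where W: "\<forall>x\<in>topspace X. openin X (W x) \<and> x \<in> W x \<and>
        continuous_map (subtopology (total_space E) {e \<in> topspace (total_space E). bproj E e \<in> W x}) ?Z k"
      by (rule exE)
    have cp: "continuous_map (total_space E) X (bproj E)" using E unfolding is_bundle_def by (elim conjE)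
    show ?thesis
    proof (rule pasting_lemma[where I = "topspace X" and T = "\<lambda>x. {e \<in> topspace (total_space E). bproj E e \<in> W x}" and f = "\<lambda>x. k"])
      show "openin (total_space E) {e \<in> topspace (total_space E). bproj E e \<in> W x}" if "x \<in> topspace X" for x
        using openin_continuous_map_preimage[OF cp] W that by blast
      show "\<exists>j. j \<in> topspace X \<and> e \<in> {e \<in> topspace (total_space E). bproj E e \<in> W j} \<and> k e = k e" if "e \<in> topspace (total_space E)" for e
        using W bundle_proj[OF E that] that by blast
      show "continuous_map (subtopology (total_space E) {e \<in> topspace (total_space E). bproj E e \<in> W x}) ?Z k"
        if "x \<in> topspace X" for x
        using W that by blast
    qed (rule refl)
  qed
  have homeo: "homeomorphic_map ?Z (total_space E) h"
    unfolding homeomorphic_map_maps homeomorphic_maps_def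
    using h k kh k_mem by (intro exI[of _ k]) auto
  \<comment> \<open>Following the frame at \<open>x\<close> by \<open>g\<close> gives linear
    coordinates on the fibre at \<open>a g x\<close>; \<open>C\<close> compares them with the frame
    there.\<close>
  have "\<exists>C. C \<in> carrier_mat n n \<and> (\<forall>v\<in>?V. gact E g (h (x, v)) = h (a g x, mat_act C v))"
    if g: "g \<in> carrier G" and x: "x \<in> topspace X" for g x
  proof -
    have "fibre_coords E (a g x) n (\<lambda>v. gact E g (h (x, v)))"
      by (rule fibre_coords_gact[OF E hc[OF x] g act_inv[OF g x]])
    obtain C where "n = n" "C \<in> carrier_mat n n" "invertible_mat C"
      "\<And>v. v \<in> ?V \<Longrightarrow> gact E g (h (x, v)) = h (a g x, mat_act C v)"
      by (rule fibre_coords_change[OF \<open>fibre_coords E (a g x) n (\<lambda>v. gact E g (h (x, v)))\<close> hc[OF act_closed[OF g x]]]) (rule that)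
    then show ?thesis by blast
  qed
  then obtain c where c: "\<And>g x. g \<in> carrier G \<Longrightarrow> x \<in> topspace X \<Longrightarrow> c g x \<in> carrier_mat n n"
    "\<And>g x v. g \<in> carrier G \<Longrightarrow> x \<in> topspace X \<Longrightarrow> v \<in> ?V \<Longrightarrow> gact E g (h (x, v)) = h (a g x, mat_act (c g x) v)"
    by metis
  have "cocycle n c"
    unfolding cocycle_def
  proof (intro conjI ballI)
    show "mat_continuous (prod_topology T X) n n (\<lambda>(g, x). c g x)"
    proof (rule mat_continuousI[where F = "\<lambda>i j p. snd (k (gact E (fst p) (h (snd p, unit_coord j)))) i"])
      fix i j assume ij: "i < n" "j < n"
      have "continuous_map (prod_topology T X) ?Z (\<lambda>p. (snd p, unit_coord j))"
        using unit_coord_mem[OF ij(2)] by (intro continuous_map_pairedI continuous_map_snd) auto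
      from continuous_map_compose[OF this h]
      have "continuous_map (prod_topology T X) (prod_topology T (total_space E)) (\<lambda>p. (fst p, h (snd p, unit_coord j)))"
        by (intro continuous_map_pairedI continuous_map_fst) (simp add: o_def)
      from continuous_map_compose[OF continuous_map_compose[OF continuous_map_compose[OF this bundle_act(1)[OF E]] k] continuous_map_snd]
      show "continuous_map (prod_topology T X) euclidean (\<lambda>p. snd (k (gact E (fst p) (h (snd p, unit_coord j)))) i)"
        by (intro continuous_map_coordinate) (simp add: o_def)
      fix p assume "p \<in> topspace (prod_topology T X)"
      then obtain g x where p: "p = (g, x)" "g \<in> carrier G" "x \<in> topspace X" by (auto simp: topspace_eq)
      show "(case p of (g, x) \<Rightarrow> c g x) $$ (i, j) = snd (k (gact E (fst p) (h (snd p, unit_coord j)))) i"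
        unfolding p(1) using c(2)[OF p(2,3) unit_coord_mem[OF ij(2)]] kh[OF act_closed[OF p(2,3)] mat_act_mem[OF c(1)[OF p(2,3)]]]
          mat_act_unit[OF c(1)[OF p(2,3)] ij] by simp
    qed (use c(1) in \<open>auto simp: topspace_eq\<close>)
    show "c \<one> x = 1\<^sub>m n" if x: "x \<in> topspace X" for x
    proof (rule mat_eq_of_act[OF c(1)[OF one_closed x]])
      fix v assume v: "v \<in> ?V"
      have "h (x, mat_act (c \<one> x) v) = h (x, v)"
        using c(2)[OF one_closed x v] bundle_act(2)[OF E b(1)[OF x v]] act_one[OF x] by simp
      then have "mat_act (c \<one> x) v = v"
        using b(5)[OF x mat_act_mem[OF c(1)[OF one_closed x]] v] by blast
      then show "mat_act (c \<one> x) v = mat_act (1\<^sub>m n) v" by (simp add: mat_act_one[OF v])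
    qed simp
    show "c (g \<otimes> g') x = c g (a g' x) * c g' x" if g: "g \<in> carrier G" and g': "g' \<in> carrier G" and x: "x \<in> topspace X" for g g' x
    proof (rule mat_eq_of_act[OF c(1)[OF m_closed[OF g g'] x]])
      note x' = act_closed[OF g' x]
      show "c g (a g' x) * c g' x \<in> carrier_mat n n" using c(1)[OF g x'] c(1)[OF g' x] by simp
      fix v assume v: "v \<in> ?V"
      have "h (a g (a g' x), mat_act (c (g \<otimes> g') x) v) = h (a g (a g' x), mat_act (c g (a g' x)) (mat_act (c g' x) v))"
        using c(2)[OF m_closed[OF g g'] x v] bundle_act(3)[OF E g g' b(1)[OF x v]] c(2)[OF g' x v]
          c(2)[OF g x' mat_act_mem[OF c(1)[OF g' x]], of v] act_mult[OF g g' x] by simp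
      then show "mat_act (c (g \<otimes> g') x) v = mat_act (c g (a g' x) * c g' x) v"
        unfolding mat_act_mult[OF c(1)[OF g x'] c(1)[OF g' x]]
        using b(5)[OF act_closed[OF g x'] mat_act_mem[OF c(1)[OF m_closed[OF g g'] x]] mat_act_mem[OF c(1)[OF g x']]] by blast
    qed
  qed
  moreover have "bundle_iso G (cb n c) E"
    unfolding bundle_iso_def
    using homeo b c(2) by (intro exI[of _ h]) auto
  ultimately show thesis using that by blast
qed

end

section \<open>Sums, tensor products and restrictions of bundles\<close>

lemma sum_lessThan_add: "(\<Sum>j<n + (m::nat). f j) = (\<Sum>j<n. f j) + (\<Sum>j<m. f (n + j) :: 'a :: comm_monoid_add)"
  by (induction m) (simp_all add: add.assoc)

definition take_coords :: "nat \<Rightarrow> (nat \<Rightarrow> complex) \<Rightarrow> nat \<Rightarrow> complex" where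
  "take_coords n v = (\<lambda>i. if i < n then v i else 0)"

definition drop_coords :: "nat \<Rightarrow> (nat \<Rightarrow> complex) \<Rightarrow> nat \<Rightarrow> complex" where
  "drop_coords n v = (\<lambda>i. v (n + i))"

definition join_coords :: "nat \<Rightarrow> (nat \<Rightarrow> complex) \<Rightarrow> (nat \<Rightarrow> complex) \<Rightarrow> nat \<Rightarrow> complex" where
  "join_coords n v w = (\<lambda>i. if i < n then v i else w (i - n))"

lemma mat_act_diag_block:
  assumes A: "A \<in> carrier_mat n n" and B: "B \<in> carrier_mat m m"
  shows "take_coords n (mat_act (diag_block A B) v) = mat_act A (take_coords n v)"
    and "drop_coords n (mat_act (diag_block A B) v) = mat_act B (drop_coords n v)"
  using A B by (auto simp: mat_act_def take_coords_def drop_coords_def sum_lessThan_add fun_eq_iff)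

lemma kron_vec_mem:
  assumes "v \<in> topspace (complex_space n)" "w \<in> topspace (complex_space m)"
  shows "kron_vec m v w \<in> topspace (complex_space (n * m))"
proof -
  have "v (k div m) * w (k mod m) = 0" if "n * m \<le> k" for k
  proof (cases "m = 0")
    case False
    then have "n \<le> k div m" using that by (metis div_le_mono div_mult_self_is_m neq0_conv)
    then show ?thesis using assms(1) by (simp add: topspace_complex_space)
  qed (use assms(2) in \<open>simp add: topspace_complex_space\<close>)
  then show ?thesis by (simp add: topspace_complex_space kron_vec_def)
qed

lemma mat_act_kron:
  assumes A: "A \<in> carrier_mat n n" and B: "B \<in> carrier_mat m m"
  shows "mat_act (kron_mat A B) (kron_vec m v w) = kron_vec m (mat_act A v) (mat_act B w)"
proof
  fix i
  show "mat_act (kron_mat A B) (kron_vec m v w) i = kron_vec m (mat_act A v) (mat_act B w) i"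
  proof (cases "i < n * m")
    case True
    note im = div_mod_less[OF True]
    have "mat_act (kron_mat A B) (kron_vec m v w) i = (\<Sum>k<n * m. kron_mat A B $$ (i, k) * kron_vec m v w k)"
      using kron_mat_carrier[OF A B] True by (simp add: mat_act_def)
    also have "\<dots> = (\<Sum>k<n * m. (\<lambda>k l. (A $$ (i div m, k) * v k) * (B $$ (i mod m, l) * w l)) (k div m) (k mod m))"
      by (intro sum.cong refl) (simp add: kron_mat_entry[OF A B True] kron_vec_def)
    also have "\<dots> = (\<Sum>k<n. \<Sum>l<m. (A $$ (i div m, k) * v k) * (B $$ (i mod m, l) * w l))"
      by (rule sum_div_mod)
    also have "\<dots> = (\<Sum>k<n. A $$ (i div m, k) * v k) * (\<Sum>l<m. B $$ (i mod m, l) * w l)"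
      by (simp add: sum_product)
    also have "\<dots> = kron_vec m (mat_act A v) (mat_act B w) i"
      using A B im by (simp add: mat_act_def kron_vec_def)
    finally show ?thesis .
  next
    case False
    then show ?thesis
      using mat_act_mem[OF kron_mat_carrier[OF A B], of "kron_vec m v w"]
        kron_vec_mem[OF mat_act_mem[OF A] mat_act_mem[OF B], of v w] by (simp add: topspace_complex_space)
  qed
qed

text \<open>Basis vectors of the tensor product are pure tensors, so a matrix is determined by its
  action on pure tensors. This is how the action on the fibre of a tensor product is
  identified.\<close>

lemma unit_coord_kron:
  assumes "k < n * m"
  shows "unit_coord k = kron_vec m (unit_coord (k div m)) (unit_coord (k mod m))"
proof
  fix i
  have "i = k \<longleftrightarrow> i div m = k div m \<and> i mod m = k mod m" by (metis div_mult_mod_eq)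
  then show "unit_coord k i = kron_vec m (unit_coord (k div m)) (unit_coord (k mod m)) i"
    by (auto simp: unit_coord_def kron_vec_def)
qed

context compact_group
begin

text \<open>The action in the prescribed coordinates \<open>\<beta>\<close> is conjugate to
  \<open>r\<close> and takes its continuity from it.\<close>

lemma fibre_rep_in_coords:
  assumes r: "r \<in> fibre_rep_class G T x E" and \<beta>: "fibre_coords E x n \<beta>"
  obtains s where "rep n s" "s \<in> fibre_rep_class G T x E"
    "\<And>g v. g \<in> carrier G \<Longrightarrow> v \<in> topspace (complex_space n) \<Longrightarrow> \<beta> (mat_act (s g) v) = gact E g (\<beta> v)"
proof -
  obtain m \<gamma> where r: "rep m r" and \<gamma>: "fibre_coords E x m \<gamma>"
    and act: "\<And>g v. g \<in> carrier G \<Longrightarrow> v \<in> topspace (complex_space m) \<Longrightarrow> \<gamma> (mat_act (r g) v) = gact E g (\<gamma> v)"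
    using r unfolding fibre_rep_class_def by blast
  obtain A where A: "n = m" "A \<in> carrier_mat n n" "invertible_mat A"
    "\<And>v. v \<in> topspace (complex_space n) \<Longrightarrow> \<beta> v = \<gamma> (mat_act A v)"
    by (rule fibre_coords_change[OF \<beta> \<gamma>]) (rule that)
  note r = r[folded A(1)] and act = act[folded A(1)] and \<gamma> = \<gamma>[folded A(1)]
  obtain B where B: "B \<in> carrier_mat n n" "A * B = 1\<^sub>m n" "B * A = 1\<^sub>m n" using A invertible_matE by metis
  define s where "s g = B * r g * A" for g
  have s: "rep n s" unfolding s_def[abs_def] by (rule rep_conj[OF r B(1) A(2) B(3,2)])
  have sact: "\<beta> (mat_act (s g) v) = gact E g (\<beta> v)" if g: "g \<in> carrier G" and v: "v \<in> topspace (complex_space n)" for g v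
  proof -
    have "A * s g = r g * A"
    proof -
      note c = rep_carrier[OF r g]
      have "A * (B * r g * A) = A * (B * (r g * A))"
        by (simp only: assoc_mult_mat[OF B(1) c A(2)])
      also have "\<dots> = A * B * (r g * A)"
        by (rule assoc_mult_mat[symmetric, OF A(2) B(1) mult_carrier_mat[OF c A(2)]])
      also have "\<dots> = r g * A"
        unfolding B(2) by (rule left_mult_one_mat[OF mult_carrier_mat[OF c A(2)]])
      finally show ?thesis unfolding s_def .
    qed
    then have "mat_act A (mat_act (s g) v) = mat_act (r g) (mat_act A v)"
      using mat_act_mult[OF A(2) rep_carrier[OF s g]] mat_act_mult[OF rep_carrier[OF r g] A(2)] by metis
    then show ?thesis
      using A(4)[OF mat_act_mem[OF rep_carrier[OF s g]]] A(4)[OF v] act[OF g mat_act_mem[OF A(2)]] by simp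
  qed
  have "s \<in> fibre_rep_class G T x E" unfolding fibre_rep_class_def using s \<beta> sact by blast
  then show thesis using that s sact by blast
qed

text \<open>Valid for every bundle \<open>P\<close> that satisfies the tensor product predicate:
  equivariance of the bilinear map determines the action on pure tensors, and hence on the fibre.
  Thus the fibre class of a product depends only on those of the factors, before it is known that
  the product bundle is unique.\<close>

lemma fibre_rep_tensor:
  assumes P: "gvb X a P" and t: "is_bundle_tensor G X E F P" and x: "x \<in> topspace X" "\<And>g. g \<in> carrier G \<Longrightarrow> a g x = x"
    and r: "r \<in> fibre_rep_class G T x E" and s: "s \<in> fibre_rep_class G T x F"
  shows "fibre_rep_class G T x P = cls r \<otimes>\<^bsub>Rep\<^esub> cls s"
proof -
  obtain f where f: "\<forall>g\<in>carrier G. \<forall>(e, e')\<in>topspace (fibre_product E F). f (gact E g e, gact F g e') = gact P g (f (e, e'))"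
    and loc: "\<forall>x\<in>topspace X. \<exists>m n \<beta> \<gamma> \<delta>.
           fibre_coords E x m \<beta> \<and> fibre_coords F x n \<gamma> \<and> fibre_coords P x (m * n) \<delta> \<and>
           (\<forall>v\<in>topspace (complex_space m). \<forall>w\<in>topspace (complex_space n). f (\<beta> v, \<gamma> w) = \<delta> (kron_vec n v w))"
    using t unfolding is_bundle_tensor_def by (elim exE conjE) (rule that)
  obtain m n \<beta> \<gamma> \<delta> where \<beta>: "fibre_coords E x m \<beta>" and \<gamma>: "fibre_coords F x n \<gamma>" and \<delta>: "fibre_coords P x (m * n) \<delta>"
    and fk: "\<forall>v\<in>topspace (complex_space m). \<forall>w\<in>topspace (complex_space n). f (\<beta> v, \<gamma> w) = \<delta> (kron_vec n v w)"
    using bspec[OF loc x(1)] by (elim exE conjE) (rule that)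
  obtain r' where r': "rep m r'" "r' \<in> fibre_rep_class G T x E"
    "\<And>g v. g \<in> carrier G \<Longrightarrow> v \<in> topspace (complex_space m) \<Longrightarrow> \<beta> (mat_act (r' g) v) = gact E g (\<beta> v)"
    by (rule fibre_rep_in_coords[OF r \<beta>]) (rule that)
  obtain s' where s': "rep n s'" "s' \<in> fibre_rep_class G T x F"
    "\<And>g v. g \<in> carrier G \<Longrightarrow> v \<in> topspace (complex_space n) \<Longrightarrow> \<gamma> (mat_act (s' g) v) = gact F g (\<gamma> v)"
    by (rule fibre_rep_in_coords[OF s \<gamma>]) (rule that)
  have act: "\<delta> (mat_act (rep_tensor r' s' g) u) = gact P g (\<delta> u)"
    if g: "g \<in> carrier G" and u: "u \<in> topspace (complex_space (m * n))" for g u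
  proof -
    note c = rep_carrier[OF r'(1) g] rep_carrier[OF s'(1) g]
    have "fibre_coords P x (m * n) (\<lambda>v. gact P g (\<delta> v))"
      using fibre_coords_gact[OF P \<delta> g] x(2)[OF g] x(2)[OF inv_closed[OF g]] by simp
    then obtain C where C: "C \<in> carrier_mat (m * n) (m * n)"
      "\<And>v. v \<in> topspace (complex_space (m * n)) \<Longrightarrow> gact P g (\<delta> v) = \<delta> (mat_act C v)"
      by (rule fibre_coords_transition[OF _ \<delta>]) (rule that)
    have K: "kron_mat (r' g) (s' g) \<in> carrier_mat (m * n) (m * n)" by (rule kron_mat_carrier[OF c])
    have key: "mat_act C (kron_vec n v w) = mat_act (kron_mat (r' g) (s' g)) (kron_vec n v w)"
      if v: "v \<in> topspace (complex_space m)" and w: "w \<in> topspace (complex_space n)" for v w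
    proof -
      have "(\<beta> v, \<gamma> w) \<in> topspace (fibre_product E F)"
        using fibre_coordsD(1,2)[OF \<beta> v] fibre_coordsD(1,2)[OF \<gamma> w] by (simp add: fibre_product_def)
      then have "f (gact E g (\<beta> v), gact F g (\<gamma> w)) = gact P g (f (\<beta> v, \<gamma> w))" using f g by blast
      then have "f (\<beta> (mat_act (r' g) v), \<gamma> (mat_act (s' g) w)) = gact P g (\<delta> (kron_vec n v w))"
        using r'(3)[OF g v] s'(3)[OF g w] fk v w by simp
      then have "\<delta> (kron_vec n (mat_act (r' g) v) (mat_act (s' g) w)) = \<delta> (mat_act C (kron_vec n v w))"
        using fk mat_act_mem[OF c(1)] mat_act_mem[OF c(2)] C(2)[OF kron_vec_mem[OF v w]] by metis
      then show ?thesis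
        unfolding mat_act_kron[OF c]
        using fibre_coordsD(5)[OF \<delta> kron_vec_mem[OF mat_act_mem[OF c(1)] mat_act_mem[OF c(2)]] mat_act_mem[OF C(1)]] by metis
    qed
    \<comment> \<open>\<open>C\<close> is the matrix of \<open>g\<close> on the fibre of
      \<open>P\<close>; by \<open>key\<close> it agrees with the Kronecker product on pure
      tensors.\<close>
    have "C = kron_mat (r' g) (s' g)"
    proof (rule eq_matI)
      fix i j assume "i < dim_row (kron_mat (r' g) (s' g))" "j < dim_col (kron_mat (r' g) (s' g))"
      then have ij: "i < m * n" "j < m * n" using K by auto
      have "mat_act C (unit_coord j) = mat_act (kron_mat (r' g) (s' g)) (unit_coord j)"
        unfolding unit_coord_kron[OF ij(2)] using div_mod_less[OF ij(2)] by (intro key unit_coord_mem) auto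
      then show "C $$ (i, j) = kron_mat (r' g) (s' g) $$ (i, j)"
        using mat_act_unit[OF C(1) ij] mat_act_unit[OF K ij] by metis
    qed (use C(1) K in auto)
    then show ?thesis using C(2)[OF u] by (simp add: rep_tensor_def)
  qed
  have "rep_tensor r' s' \<in> fibre_rep_class G T x P"
    unfolding fibre_rep_class_def using rep_tensor[OF r'(1) s'(1)] \<delta> act by blast
  then have "fibre_rep_class G T x P = cls (rep_tensor r' s')" by (rule fibre_rep_class_eq)
  also have "\<dots> = cls r' \<otimes>\<^bsub>Rep\<^esub> cls s'" by (rule Rep_mult[OF r'(1) s'(1), symmetric])
  also have "cls r' = cls r" using fibre_rep_class_eq[OF r] fibre_rep_class_eq[OF r'(2)] by simp
  also have "cls s' = cls s" using fibre_rep_class_eq[OF s] fibre_rep_class_eq[OF s'(2)] by simp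
  finally show ?thesis .
qed

lemma whitney_sum_iso:
  assumes "bundle_iso G E E'" "bundle_iso G F F'"
  shows "bundle_iso G (whitney_sum E F) (whitney_sum E' F')"
proof -
  obtain f where f: "homeomorphic_map (total_space E) (total_space E') f"
    "\<And>e. e \<in> topspace (total_space E) \<Longrightarrow> f e \<in> topspace (total_space E')"
    "\<And>e. e \<in> topspace (total_space E) \<Longrightarrow> bproj E' (f e) = bproj E e"
    "\<And>e e'. e \<in> topspace (total_space E) \<Longrightarrow> e' \<in> topspace (total_space E) \<Longrightarrow> bproj E e = bproj E e' \<Longrightarrow>
      f (fadd E e e') = fadd E' (f e) (f e')"
    "\<And>c e. e \<in> topspace (total_space E) \<Longrightarrow> f (fscale E c e) = fscale E' c (f e)"
    "\<And>g e. g \<in> carrier G \<Longrightarrow> e \<in> topspace (total_space E) \<Longrightarrow> f (gact E g e) = gact E' g (f e)"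
    by (rule bundle_isoE[OF assms(1)]) (rule that)
  obtain h where h: "homeomorphic_map (total_space F) (total_space F') h"
    "\<And>e. e \<in> topspace (total_space F) \<Longrightarrow> h e \<in> topspace (total_space F')"
    "\<And>e. e \<in> topspace (total_space F) \<Longrightarrow> bproj F' (h e) = bproj F e"
    "\<And>e e'. e \<in> topspace (total_space F) \<Longrightarrow> e' \<in> topspace (total_space F) \<Longrightarrow> bproj F e = bproj F e' \<Longrightarrow>
      h (fadd F e e') = fadd F' (h e) (h e')"
    "\<And>c e. e \<in> topspace (total_space F) \<Longrightarrow> h (fscale F c e) = fscale F' c (h e)"
    "\<And>g e. g \<in> carrier G \<Longrightarrow> e \<in> topspace (total_space F) \<Longrightarrow> h (gact F g e) = gact F' g (h e)"
    by (rule bundle_isoE[OF assms(2)]) (rule that)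
  obtain f' where f': "homeomorphic_maps (total_space E) (total_space E') f f'"
    using f(1) unfolding homeomorphic_map_maps by blast
  obtain h' where h': "homeomorphic_maps (total_space F) (total_space F') h h'"
    using h(1) unfolding homeomorphic_map_maps by blast
  have pair: "homeomorphic_maps (prod_topology (total_space E) (total_space F)) (prod_topology (total_space E') (total_space F'))
      (\<lambda>(e, u). (f e, h u)) (\<lambda>(e, u). (f' e, h' u))"
    using f' h' unfolding homeomorphic_maps_prod by blast
  have p': "bproj E (f' e) = bproj E' e" if "e \<in> topspace (total_space E')" for e
  proof -
    have "f' e \<in> topspace (total_space E)" "f (f' e) = e"
      using f' that unfolding homeomorphic_maps_def continuous_map_def by auto
    then show ?thesis using f(3) by metis
  qed
  have q': "bproj F (h' e) = bproj F' e" if "e \<in> topspace (total_space F')" for e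
  proof -
    have "h' e \<in> topspace (total_space F)" "h (h' e) = e"
      using h' that unfolding homeomorphic_maps_def continuous_map_def by auto
    then show ?thesis using h(3) by metis
  qed
  have "homeomorphic_maps (fibre_product E F) (fibre_product E' F') (\<lambda>(e, u). (f e, h u)) (\<lambda>(e, u). (f' e, h' u))"
    unfolding fibre_product_def
    by (rule homeomorphic_maps_subtopologies_alt[OF pair]) (auto simp: f(3) h(3) p' q')
  then have "homeomorphic_map (total_space (whitney_sum E F)) (total_space (whitney_sum E' F')) (\<lambda>(e, u). (f e, h u))"
    by (auto simp: whitney_sum_def homeomorphic_map_maps)
  then show ?thesis
    unfolding bundle_iso_def
    by (intro exI[of _ "\<lambda>(e, u). (f e, h u)"] conjI)
      (auto simp: whitney_sum_def fibre_product_def f(3-6) h(3-6))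
qed

lemma restrict_bundle_iso:
  assumes "bundle_iso G E F"
  shows "bundle_iso G (restrict_bundle Y E) (restrict_bundle Y F)"
proof -
  obtain f where f: "homeomorphic_map (total_space E) (total_space F) f"
    "\<And>e. e \<in> topspace (total_space E) \<Longrightarrow> f e \<in> topspace (total_space F)"
    "\<And>e. e \<in> topspace (total_space E) \<Longrightarrow> bproj F (f e) = bproj E e"
    "\<And>e e'. e \<in> topspace (total_space E) \<Longrightarrow> e' \<in> topspace (total_space E) \<Longrightarrow> bproj E e = bproj E e' \<Longrightarrow>
      f (fadd E e e') = fadd F (f e) (f e')"
    "\<And>c e. e \<in> topspace (total_space E) \<Longrightarrow> f (fscale E c e) = fscale F c (f e)"
    "\<And>g e. g \<in> carrier G \<Longrightarrow> e \<in> topspace (total_space E) \<Longrightarrow> f (gact E g e) = gact F g (f e)"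
    by (rule bundle_isoE[OF assms]) (rule that)
  have "homeomorphic_map (subtopology (total_space E) {e. bproj E e \<in> Y}) (subtopology (total_space F) {e. bproj F e \<in> Y}) f"
    by (rule homeomorphic_map_subtopologies_alt[OF f(1)]) (simp add: f(3))
  then show ?thesis
    unfolding bundle_iso_def by (intro exI[of _ f]) (simp add: restrict_bundle_def f(3-6))
qed

lemma restrict_cocycle_bundle:
  fixes X :: "'x topology" and Y :: "'x set"
  shows "restrict_bundle Y (cocycle_bundle X a n c) = cocycle_bundle (subtopology X Y) a n c"
proof -
  have "{e :: 'x \<times> (nat \<Rightarrow> complex). fst e \<in> Y} \<inter> topspace (prod_topology X (complex_space n)) =
      Y \<times> topspace (complex_space n) \<inter> topspace (prod_topology X (complex_space n))" by auto
  then have "subtopology (prod_topology X (complex_space n)) {e. fst e \<in> Y} = prod_topology (subtopology X Y) (complex_space n)"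
    unfolding prod_topology_subtopology(1) by (metis Int_commute subtopology_restrict)
  then show ?thesis by (simp add: restrict_bundle_def cocycle_bundle_def)
qed

end

context gspace
begin

lemma bundle_iso_gauge:
  assumes c: "cocycle n c" and d: "cocycle n d" and P: "mat_continuous X n n P" "\<And>x. x \<in> topspace X \<Longrightarrow> invertible_mat (P x)"
    and gauge: "\<And>g x. g \<in> carrier G \<Longrightarrow> x \<in> topspace X \<Longrightarrow> P (a g x) * c g x = d g x * P x"
  shows "bundle_iso G (cb n c) (cb n d)"
proof -
  obtain Q where Q: "mat_continuous X n n Q" "\<And>x. x \<in> topspace X \<Longrightarrow> P x * Q x = 1\<^sub>m n" "\<And>x. x \<in> topspace X \<Longrightarrow> Q x * P x = 1\<^sub>m n"
    by (rule mat_continuous_inverse[OF P]) (assumption, rule that)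
  let ?Z = "prod_topology X (complex_space n)"
  have cont: "continuous_map ?Z ?Z (\<lambda>p. (fst p, mat_act (P (fst p)) (snd p)))" if "mat_continuous X n n P" for P
    by (intro continuous_map_pairedI continuous_map_fst continuous_map_mat_act[OF mat_continuous_compose[OF that continuous_map_fst] continuous_map_snd])
  have inv: "mat_act (Q x) (mat_act (P x) v) = v" "mat_act (P x) (mat_act (Q x) v) = v"
    if "x \<in> topspace X" "v \<in> topspace (complex_space n)" for x v
    using that mat_act_mult[OF mat_continuous_carrier[OF Q(1) that(1)] mat_continuous_carrier[OF P(1) that(1)], of v]
      mat_act_mult[OF mat_continuous_carrier[OF P(1) that(1)] mat_continuous_carrier[OF Q(1) that(1)], of v]
    by (simp_all add: Q(2,3) mat_act_one)
  have "homeomorphic_map ?Z ?Z (\<lambda>p. (fst p, mat_act (P (fst p)) (snd p)))"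
    unfolding homeomorphic_map_maps homeomorphic_maps_def
    using cont[OF P(1)] cont[OF Q(1)] inv by (intro exI[of _ "\<lambda>p. (fst p, mat_act (Q (fst p)) (snd p))"]) auto
  moreover have "mat_act (P (a g x)) (mat_act (c g x) v) = mat_act (d g x) (mat_act (P x) v)"
    if "g \<in> carrier G" "x \<in> topspace X" for g x v
    using gauge[OF that] that mat_act_mult[OF mat_continuous_carrier[OF P(1) act_closed[OF that]] cocycleD(2)[OF c that], of v]
      mat_act_mult[OF cocycleD(2)[OF d that] mat_continuous_carrier[OF P(1) that(2)], of v] by simp
  ultimately show ?thesis
    unfolding bundle_iso_def
    by (intro exI[of _ "\<lambda>p. (fst p, mat_act (P (fst p)) (snd p))"]) (auto simp: mat_act_add mat_act_scale)
qed

definition cocycle_sum :: "('a \<Rightarrow> 'x \<Rightarrow> complex mat) \<Rightarrow> ('a \<Rightarrow> 'x \<Rightarrow> complex mat) \<Rightarrow> 'a \<Rightarrow> 'x \<Rightarrow> complex mat" where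
  "cocycle_sum c d = (\<lambda>g x. diag_block (c g x) (d g x))"

definition cocycle_tensor :: "('a \<Rightarrow> 'x \<Rightarrow> complex mat) \<Rightarrow> ('a \<Rightarrow> 'x \<Rightarrow> complex mat) \<Rightarrow> 'a \<Rightarrow> 'x \<Rightarrow> complex mat" where
  "cocycle_tensor c d = (\<lambda>g x. kron_mat (c g x) (d g x))"

lemma cocycle_cocycle_sum:
  assumes c: "cocycle n c" and d: "cocycle m d"
  shows "cocycle (n + m) (cocycle_sum c d)"
  unfolding cocycle_def cocycle_sum_def
proof (intro conjI ballI)
  show "mat_continuous (prod_topology T X) (n + m) (n + m) (\<lambda>(g, x). diag_block (c g x) (d g x))"
    using mat_continuous_diag_block[OF cocycleD(1)[OF c] cocycleD(1)[OF d]] by (simp add: case_prod_unfold)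
  show "diag_block (c \<one> x) (d \<one> x) = 1\<^sub>m (n + m)" if "x \<in> topspace X" for x
    by (simp add: cocycleD(3)[OF c that] cocycleD(3)[OF d that])
  fix g h x assume g: "g \<in> carrier G" and h: "h \<in> carrier G" and x: "x \<in> topspace X"
  show "diag_block (c (g \<otimes> h) x) (d (g \<otimes> h) x) = diag_block (c g (a h x)) (d g (a h x)) * diag_block (c h x) (d h x)"
    unfolding cocycleD(4)[OF c g h x] cocycleD(4)[OF d g h x]
    by (rule diag_block_times[symmetric]) (use cocycleD(2)[OF c] cocycleD(2)[OF d] g h x act_closed[OF h x] in blast)+
qed

lemma cocycle_cocycle_tensor:
  assumes c: "cocycle n c" and d: "cocycle m d"
  shows "cocycle (n * m) (cocycle_tensor c d)"
  unfolding cocycle_def cocycle_tensor_def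
proof (intro conjI ballI)
  show "mat_continuous (prod_topology T X) (n * m) (n * m) (\<lambda>(g, x). kron_mat (c g x) (d g x))"
    using mat_continuous_kron[OF cocycleD(1)[OF c] cocycleD(1)[OF d]] by (simp add: case_prod_unfold)
  show "kron_mat (c \<one> x) (d \<one> x) = 1\<^sub>m (n * m)" if "x \<in> topspace X" for x
    by (simp add: cocycleD(3)[OF c that] cocycleD(3)[OF d that] kron_mat_one)
  fix g h x assume g: "g \<in> carrier G" and h: "h \<in> carrier G" and x: "x \<in> topspace X"
  show "kron_mat (c (g \<otimes> h) x) (d (g \<otimes> h) x) = kron_mat (c g (a h x)) (d g (a h x)) * kron_mat (c h x) (d h x)"
    unfolding cocycleD(4)[OF c g h x] cocycleD(4)[OF d g h x]
    by (rule kron_mat_times[symmetric]) (use cocycleD(2)[OF c] cocycleD(2)[OF d] g h x act_closed[OF h x] in blast)+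
qed

lemma cocycle_rep:
  assumes r: "rep n r"
  shows "cocycle n (\<lambda>g x. r g)"
  unfolding cocycle_def
proof (intro conjI ballI)
  show "mat_continuous (prod_topology T X) n n (\<lambda>(g, x). r g)"
    using mat_continuous_compose[OF rep_continuous[OF r] continuous_map_fst] by (simp add: case_prod_unfold)
qed (simp_all add: rep_one[OF r] rep_mult[OF r])

lemma whitney_sum_cocycle_bundle:
  assumes c: "cocycle n c" and d: "cocycle m d"
  shows "bundle_iso G (cb (n + m) (cocycle_sum c d)) (whitney_sum (cb n c) (cb m d))"
proof -
  let ?Z = "prod_topology X (complex_space (n + m))"
  let ?W = "fibre_product (cb n c) (cb m d)"
  let ?f = "\<lambda>p. ((fst p, take_coords n (snd p)), (fst p, drop_coords n (snd p)))"
  let ?k = "\<lambda>q. (fst (fst q), join_coords n (snd (fst q)) (snd (snd q)))"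
  have W: "?W = subtopology (prod_topology (prod_topology X (complex_space n)) (prod_topology X (complex_space m))) {(e, u). fst e = fst u}"
    by (simp add: fibre_product_def)
  have sndZ: "continuous_map ?Z (complex_space (n + m)) (\<lambda>p. snd p)" by (rule continuous_map_snd)
  have t: "continuous_map ?Z (complex_space n) (\<lambda>p. take_coords n (snd p))"
    by (rule continuous_map_into_complex_space) (auto simp: take_coords_def continuous_map_coordinate[OF sndZ])
  have dr: "continuous_map ?Z (complex_space m) (\<lambda>p. drop_coords n (snd p))"
    by (rule continuous_map_into_complex_space) (auto simp: drop_coords_def continuous_map_coordinate[OF sndZ] topspace_complex_space)
  have "continuous_map ?Z (prod_topology (prod_topology X (complex_space n)) (prod_topology X (complex_space m))) ?f"
    by (intro continuous_map_pairedI continuous_map_fst t dr)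
  then have 1: "continuous_map ?Z ?W ?f" unfolding W by (rule continuous_map_into_subtopology) auto
  have ss: "continuous_map ?W (prod_topology X (complex_space n)) fst" "continuous_map ?W (prod_topology X (complex_space m)) snd"
    unfolding W by (rule continuous_map_from_subtopology, rule continuous_map_fst continuous_map_snd)+
  have s1: "continuous_map ?W X (\<lambda>q. fst (fst q))" and s2: "continuous_map ?W (complex_space n) (\<lambda>q. snd (fst q))"
    and s3: "continuous_map ?W (complex_space m) (\<lambda>q. snd (snd q))"
    using continuous_map_compose[OF ss(1) continuous_map_fst] continuous_map_compose[OF ss(1) continuous_map_snd]
      continuous_map_compose[OF ss(2) continuous_map_snd] by (simp_all add: o_def)
  have "continuous_map ?W (complex_space (n + m)) (\<lambda>q. join_coords n (snd (fst q)) (snd (snd q)))"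
  proof (rule continuous_map_into_complex_space)
    show "continuous_map ?W euclidean (\<lambda>q. join_coords n (snd (fst q)) (snd (snd q)) i)" for i
      using continuous_map_coordinate[OF s2, of i] continuous_map_coordinate[OF s3, of "i - n"]
      by (cases "i < n") (simp_all add: join_coords_def)
    show "join_coords n (snd (fst q)) (snd (snd q)) i = 0" if "q \<in> topspace ?W" "n + m \<le> i" for q i
      using that by (auto simp: W join_coords_def topspace_complex_space)
  qed
  then have 2: "continuous_map ?W ?Z ?k" by (intro continuous_map_pairedI s1)
  have 3: "?k (?f p) = p" if "p \<in> topspace ?Z" for p
    by (auto simp: join_coords_def take_coords_def drop_coords_def prod_eq_iff fun_eq_iff)
  have 4: "?f (?k q) = q" if "q \<in> topspace ?W" for q
    using that by (auto simp: W join_coords_def take_coords_def drop_coords_def fun_eq_iff topspace_complex_space)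
  have "homeomorphic_map ?Z ?W ?f"
    unfolding homeomorphic_map_maps homeomorphic_maps_def using 1 2 3 4 by blast
  moreover have "?f (gact (cb (n + m) (cocycle_sum c d)) g p) = gact (whitney_sum (cb n c) (cb m d)) g (?f p)"
    if "g \<in> carrier G" "p \<in> topspace ?Z" for g p
    using that mat_act_diag_block[OF cocycleD(2)[OF c that(1)] cocycleD(2)[OF d that(1)], of "fst p" "fst p" "snd p"]
    by (auto simp: whitney_sum_def cocycle_sum_def)
  ultimately show ?thesis
    unfolding bundle_iso_def
    by (intro exI[of _ ?f]) (auto simp: whitney_sum_def take_coords_def drop_coords_def fun_eq_iff)
qed

lemma tensor_cocycle_bundle:
  assumes c: "cocycle n c" and d: "cocycle m d" and P: "bundle_iso G (cb (n * m) (cocycle_tensor c d)) P"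
  shows "is_bundle_tensor G X (cb n c) (cb m d) P"
proof -
  obtain f where f: "homeomorphic_map (total_space (cb (n * m) (cocycle_tensor c d))) (total_space P) f"
    "\<And>e. e \<in> topspace (total_space (cb (n * m) (cocycle_tensor c d))) \<Longrightarrow> f e \<in> topspace (total_space P)"
    "\<And>e. e \<in> topspace (total_space (cb (n * m) (cocycle_tensor c d))) \<Longrightarrow> bproj P (f e) = bproj (cb (n * m) (cocycle_tensor c d)) e"
    "\<And>e e'. e \<in> topspace (total_space (cb (n * m) (cocycle_tensor c d))) \<Longrightarrow> e' \<in> topspace (total_space (cb (n * m) (cocycle_tensor c d))) \<Longrightarrow>
      bproj (cb (n * m) (cocycle_tensor c d)) e = bproj (cb (n * m) (cocycle_tensor c d)) e' \<Longrightarrow>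
      f (fadd (cb (n * m) (cocycle_tensor c d)) e e') = fadd P (f e) (f e')"
    "\<And>k e. e \<in> topspace (total_space (cb (n * m) (cocycle_tensor c d))) \<Longrightarrow> f (fscale (cb (n * m) (cocycle_tensor c d)) k e) = fscale P k (f e)"
    "\<And>g e. g \<in> carrier G \<Longrightarrow> e \<in> topspace (total_space (cb (n * m) (cocycle_tensor c d))) \<Longrightarrow>
      f (gact (cb (n * m) (cocycle_tensor c d)) g e) = gact P g (f e)"
    by (rule bundle_isoE[OF P]) (rule that)
  let ?Z = "prod_topology X (complex_space (n * m))"
  let ?W = "fibre_product (cb n c) (cb m d)"
  let ?t = "\<lambda>q. (fst (fst q), kron_vec m (snd (fst q)) (snd (snd q)))"
  have W: "?W = subtopology (prod_topology (prod_topology X (complex_space n)) (prod_topology X (complex_space m))) {(e, u). fst e = fst u}"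
    by (simp add: fibre_product_def)
  have ss: "continuous_map ?W (prod_topology X (complex_space n)) fst" "continuous_map ?W (prod_topology X (complex_space m)) snd"
    unfolding W by (rule continuous_map_from_subtopology, rule continuous_map_fst continuous_map_snd)+
  have s1: "continuous_map ?W X (\<lambda>q. fst (fst q))" and s2: "continuous_map ?W (complex_space n) (\<lambda>q. snd (fst q))"
    and s3: "continuous_map ?W (complex_space m) (\<lambda>q. snd (snd q))"
    using continuous_map_compose[OF ss(1) continuous_map_fst] continuous_map_compose[OF ss(1) continuous_map_snd]
      continuous_map_compose[OF ss(2) continuous_map_snd] by (simp_all add: o_def)
  have "continuous_map ?W (complex_space (n * m)) (\<lambda>q. kron_vec m (snd (fst q)) (snd (snd q)))"
  proof (rule continuous_map_into_complex_space)
    show "continuous_map ?W euclidean (\<lambda>q. kron_vec m (snd (fst q)) (snd (snd q)) i)" for i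
      unfolding kron_vec_def using continuous_map_coordinate[OF s2] continuous_map_coordinate[OF s3]
      by (intro continuous_intros)
    show "kron_vec m (snd (fst q)) (snd (snd q)) i = 0" if "q \<in> topspace ?W" "n * m \<le> i" for q i
    proof -
      have "kron_vec m (snd (fst q)) (snd (snd q)) \<in> topspace (complex_space (n * m))"
        using that(1) by (intro kron_vec_mem) (auto simp: W)
      then show ?thesis using that(2) by (simp add: topspace_complex_space)
    qed
  qed
  then have t: "continuous_map ?W ?Z ?t" by (intro continuous_map_pairedI s1)
  have mem: "?t q \<in> topspace ?Z" if "q \<in> topspace ?W" for q
    using continuous_map_funspace[OF t] that by blast
  have Ztot: "total_space (cb (n * m) (cocycle_tensor c d)) = ?Z" by simp
  show ?thesis
    unfolding is_bundle_tensor_def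
  proof (intro exI[of _ "f \<circ> ?t"] conjI ballI)
    show "continuous_map ?W (total_space P) (f \<circ> ?t)"
      using continuous_map_compose[OF t homeomorphic_imp_continuous_map[OF f(1)[unfolded Ztot]]] .
    show "case q of (e, u) \<Rightarrow> bproj P ((f \<circ> ?t) (e, u)) = bproj (cb n c) e" if "q \<in> topspace ?W" for q
      using f(3)[unfolded Ztot, OF mem[OF that]] by (simp add: case_prod_unfold)
    show "case q of (e, u) \<Rightarrow> (f \<circ> ?t) (gact (cb n c) g e, gact (cb m d) g u) = gact P g ((f \<circ> ?t) (e, u))"
      if g: "g \<in> carrier G" and q: "q \<in> topspace ?W" for g q
    proof -
      obtain x v w where qeq: "q = ((x, v), (x, w))" and x: "x \<in> topspace X" using q by (auto simp: W)
      have "gact (cb (n * m) (cocycle_tensor c d)) g (?t q) =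
          ?t (gact (cb n c) g (fst q), gact (cb m d) g (snd q))"
        using mat_act_kron[OF cocycleD(2)[OF c g x] cocycleD(2)[OF d g x]] by (simp add: qeq cocycle_tensor_def)
      then show ?thesis using f(6)[unfolded Ztot, OF g mem[OF q]] by (simp add: case_prod_unfold)
    qed
    show "\<exists>k l \<beta> \<gamma> \<delta>. fibre_coords (cb n c) x k \<beta> \<and> fibre_coords (cb m d) x l \<gamma> \<and> fibre_coords P x (k * l) \<delta> \<and>
        (\<forall>v\<in>topspace (complex_space k). \<forall>w\<in>topspace (complex_space l). (f \<circ> ?t) (\<beta> v, \<gamma> w) = \<delta> (kron_vec l v w))"
      if x: "x \<in> topspace X" for x
    proof (rule exI[of _ n], rule exI[of _ m], rule exI[of _ "\<lambda>v. (x, v)"], rule exI[of _ "\<lambda>w. (x, w)"],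
        rule exI[of _ "\<lambda>v. f (x, v)"], intro conjI ballI)
      show "fibre_coords P x (n * m) (\<lambda>v. f (x, v))"
        by (rule fibre_coords_iso[OF fibre_coords_cocycle_bundle[OF x] f(1,3,4,5)])
    qed (simp_all add: fibre_coords_cocycle_bundle[OF x])
  qed
qed

lemma fibre_rep_cocycle_bundle:
  assumes c: "cocycle n c" and x: "x \<in> topspace X" and fixed: "\<And>g. g \<in> carrier G \<Longrightarrow> a g x = x"
  shows "rep n (\<lambda>g. c g x)" "fibre_rep_class G T x (cb n c) = cls (\<lambda>g. c g x)"
proof -
  have "continuous_map T (prod_topology T X) (\<lambda>g. (g, x))"
    using x by (intro continuous_map_pairedI) auto
  from mat_continuous_compose[OF cocycleD(1)[OF c] this]
  show r: "rep n (\<lambda>g. c g x)"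
    unfolding rep_iff using x cocycleD(3,4)[OF c] fixed by auto
  have "(\<lambda>g. c g x) \<in> fibre_rep_class G T x (cb n c)"
    unfolding fibre_rep_class_def using r fibre_coords_cocycle_bundle[OF x, of a n c] fixed
    by (intro CollectI exI[of _ n] exI[of _ "\<lambda>v. (x, v)"]) simp
  then show "fibre_rep_class G T x (cb n c) = cls (\<lambda>g. c g x)" by (rule fibre_rep_class_eq)
qed

end

section \<open>Spaces whose bundles are determined by their fibres at fixed points\<close>

locale classified_gspace = gspace G T X a for G (structure) and T :: "'a topology" and X :: "'x topology" and a +
  fixes F :: "'x set"
  assumes F_subset: "F \<subseteq> topspace X" and F_nonempty: "F \<noteq> {}"
    and F_fixed: "x \<in> F \<Longrightarrow> g \<in> carrier G \<Longrightarrow> a g x = x"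
    and frames: "gvb X a (E :: ('x, 'a) vbundle) \<Longrightarrow> \<exists>n h. continuous_map (prod_topology X (complex_space n)) (total_space E) h \<and>
      (\<forall>x\<in>topspace X. fibre_coords E x n (\<lambda>v. h (x, v)))"
    and classify: "cocycle n c \<Longrightarrow> cocycle n d \<Longrightarrow>
      (\<And>x. x \<in> F \<Longrightarrow> rep_equiv (carrier G) n (\<lambda>g. c g x) (\<lambda>g. d g x)) \<Longrightarrow>
      \<exists>P. mat_continuous X n n P \<and> (\<forall>x\<in>topspace X. invertible_mat (P x)) \<and>
        (\<forall>g\<in>carrier G. \<forall>x\<in>topspace X. P (a g x) * c g x = d g x * P x)"
begin

abbreviation Bun :: "('x, 'a) vbundle set ring" where
  "Bun \<equiv> bundle_semiring G T X a"

abbreviation bcl :: "nat \<Rightarrow> ('a \<Rightarrow> 'x \<Rightarrow> complex mat) \<Rightarrow> ('x, 'a) vbundle set" where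
  "bcl n c \<equiv> bundle_class G T X a (cb n c)"

abbreviation Phi :: "'x \<Rightarrow> ('x, 'a) vbundle set \<Rightarrow> ('a \<Rightarrow> complex mat) set" where
  "Phi x C \<equiv> \<Union>E\<in>C. fibre_rep_class G T x E"

lemma bundle_class_mem:
  assumes "gvb X a (E :: ('x, 'a) vbundle)"
  shows "bundle_class G T X a E \<in> carrier Bun"
  unfolding bundle_semiring_def partial_object.simps by (intro CollectI exI[of _ E] conjI refl assms)

text \<open>The hypothesis \<open>frames\<close> provides a frame for each bundle, so statements
  about bundle classes reduce to statements about cocycles.\<close>

lemma Bun_carrierE:
  assumes "C \<in> carrier Bun" obtains n c where "cocycle n c" "C = bcl n c"
proof -
  obtain E :: "('x, 'a) vbundle" where E: "gvb X a E" "C = bundle_class G T X a E"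
    using assms by (auto simp: bundle_semiring_def)
  obtain n h where h: "continuous_map (prod_topology X (complex_space n)) (total_space E) h"
    "\<And>x. x \<in> topspace X \<Longrightarrow> fibre_coords E x n (\<lambda>v. h (x, v))"
    using frames[OF E(1)] by blast
  obtain c where "cocycle n c" "bundle_iso G (cb n c) E" by (rule bundle_of_frame[OF E(1) h]) (assumption, rule that)
  then show thesis using that bundle_class_eqI[OF cocycle_bundle_is_bundle] E(2) by metis
qed

lemma bcl_mem: "cocycle n c \<Longrightarrow> bcl n c \<in> carrier Bun"
  by (rule bundle_class_mem[OF cocycle_bundle_is_bundle])

lemma cb_mem_bcl: "cocycle n c \<Longrightarrow> cb n c \<in> bcl n c"
  by (simp add: mem_bundle_class cocycle_bundle_is_bundle bundle_iso_refl)

lemma fixed_point: "x \<in> F \<Longrightarrow> x \<in> topspace X"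
  using F_subset by blast

lemma rep_at_fixed_point: "cocycle n c \<Longrightarrow> x \<in> F \<Longrightarrow> rep n (\<lambda>g. c g x)"
  by (rule fibre_rep_cocycle_bundle(1)[OF _ fixed_point]) (auto simp: F_fixed)

lemma frc_cb: "cocycle n c \<Longrightarrow> x \<in> F \<Longrightarrow> fibre_rep_class G T x (cb n c) = cls (\<lambda>g. c g x)"
  by (rule fibre_rep_cocycle_bundle(2)[OF _ fixed_point]) (auto simp: F_fixed)

lemma frc_bcl:
  assumes c: "cocycle n c" and E: "E \<in> bcl n c" and x: "x \<in> F"
  shows "fibre_rep_class G T x E = cls (\<lambda>g. c g x)"
proof -
  have "(\<lambda>g. c g x) \<in> fibre_rep_class G T x E"
    using fibre_rep_class_iso[of "cb n c" E x] frc_cb[OF c x] cls_self[OF rep_at_fixed_point[OF c x]] E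
    by (auto simp: mem_bundle_class)
  then show ?thesis by (rule fibre_rep_class_eq)
qed

lemma Phi_bcl: "cocycle n c \<Longrightarrow> x \<in> F \<Longrightarrow> Phi x (bcl n c) = cls (\<lambda>g. c g x)"
proof (rule subset_antisym)
  assume c: "cocycle n c" and x: "x \<in> F"
  show "Phi x (bcl n c) \<subseteq> cls (\<lambda>g. c g x)" by (intro UN_least) (simp only: frc_bcl[OF c _ x] subset_refl)
  show "cls (\<lambda>g. c g x) \<subseteq> Phi x (bcl n c)" using UN_upper[OF cb_mem_bcl[OF c]] frc_cb[OF c x] by metis
qed

lemma Phi_mem: "C \<in> carrier Bun \<Longrightarrow> x \<in> F \<Longrightarrow> Phi x C \<in> carrier Rep"
  by (elim Bun_carrierE) (simp only: Phi_bcl cls_mem[OF rep_at_fixed_point])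

lemma bcl_eqI:
  assumes c: "cocycle n c" and d: "cocycle m d" and eq: "\<And>x. x \<in> F \<Longrightarrow> cls (\<lambda>g. c g x) = cls (\<lambda>g. d g x)"
  shows "bcl n c = bcl m d"
proof -
  note iff = cls_eq_iff[OF rep_at_fixed_point[OF c] rep_at_fixed_point[OF d]]
  \<comment> \<open>The ranks are compared at a point of \<open>F\<close>, which has to be nonempty
    for this.\<close>
  have nm: "m = n" using eq iff F_nonempty by blast
  obtain P where P: "mat_continuous X n n P" "\<And>x. x \<in> topspace X \<Longrightarrow> invertible_mat (P x)"
    "\<And>g x. g \<in> carrier G \<Longrightarrow> x \<in> topspace X \<Longrightarrow> P (a g x) * c g x = d g x * P x"
    using classify[OF c d[unfolded nm]] eq iff by blast
  show ?thesis unfolding nm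
    by (rule bundle_class_eqI[OF cocycle_bundle_is_bundle[OF c] bundle_iso_gauge[OF c d[unfolded nm] P]])
qed

text \<open>The main form in which the hypotheses \<open>frames\<close> and \<open>classify\<close>
  are used: an identity between bundle classes may be checked on representations at the points of
  \<open>F\<close>.\<close>

lemma Phi_inj:
  assumes "C \<in> carrier Bun" "D \<in> carrier Bun" "\<And>x. x \<in> F \<Longrightarrow> Phi x C = Phi x D"
  shows "C = D"
proof -
  obtain n c where c: "cocycle n c" "C = bcl n c" using assms(1) by (rule Bun_carrierE)
  obtain m d where d: "cocycle m d" "D = bcl m d" using assms(2) by (rule Bun_carrierE)
  show ?thesis unfolding c(2) d(2)
    using assms(3) Phi_bcl[OF c(1)] Phi_bcl[OF d(1)] unfolding c(2) d(2) by (intro bcl_eqI[OF c(1) d(1)]) metis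
qed

lemma Bun_add:
  assumes c: "cocycle n c" and d: "cocycle m d"
  shows "bcl n c \<oplus>\<^bsub>Bun\<^esub> bcl m d = bcl (n + m) (cocycle_sum c d)"
proof -
  have "bundle_class G T X a (whitney_sum E E') = bcl (n + m) (cocycle_sum c d)"
    if "E \<in> bcl n c" "E' \<in> bcl m d" for E E' :: "('x, 'a) vbundle"
  proof -
    have "bundle_iso G (whitney_sum (cb n c) (cb m d)) (whitney_sum E E')"
      using that by (intro whitney_sum_iso) (auto simp: mem_bundle_class)
    then have "bundle_iso G (cb (n + m) (cocycle_sum c d)) (whitney_sum E E')"
      by (rule bundle_iso_trans[OF whitney_sum_cocycle_bundle[OF c d]])
    then show ?thesis
      by (rule bundle_class_eqI[OF cocycle_bundle_is_bundle[OF cocycle_cocycle_sum[OF c d]], symmetric])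
  qed
  then show ?thesis using cb_mem_bcl[OF c] cb_mem_bcl[OF d] by (auto simp: bundle_semiring_def)
qed

text \<open>The product collects all tensor products of representatives. Each of them has a frame,
  its fibres at \<open>F\<close> are the tensor products of the fibres, and the classification
  identifies it with the bundle of the Kronecker cocycle. Uniqueness of the tensor product thus
  comes from the fixed points.\<close>

lemma Bun_mult:
  assumes c: "cocycle n c" and d: "cocycle m d"
  shows "bcl n c \<otimes>\<^bsub>Bun\<^esub> bcl m d = bcl (n * m) (cocycle_tensor c d)"
proof -
  let ?k = "cocycle_tensor c d"
  note k = cocycle_cocycle_tensor[OF c d]
  have "P \<in> bcl (n * m) ?k"
    if P: "gvb X a P" and E: "E \<in> bcl n c" and E': "E' \<in> bcl m d" and t: "is_bundle_tensor G X E E' P"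
    for E E' P :: "('x, 'a) vbundle"
  proof -
    obtain l b where b: "cocycle l b" "bundle_class G T X a P = bcl l b"
      using bundle_class_mem[OF P] by (rule Bun_carrierE)
    have P': "P \<in> bcl l b" unfolding b(2)[symmetric] by (simp add: mem_bundle_class P bundle_iso_refl)
    have "cls (\<lambda>g. b g x) = cls (\<lambda>g. ?k g x)" if x: "x \<in> F" for x
    proof -
      note r = rep_at_fixed_point[OF c x] rep_at_fixed_point[OF d x]
      have "fibre_rep_class G T x P = cls (\<lambda>g. c g x) \<otimes>\<^bsub>Rep\<^esub> cls (\<lambda>g. d g x)"
        using frc_bcl[OF c E x] frc_bcl[OF d E' x] cls_self[OF r(1)] cls_self[OF r(2)] F_fixed[OF x]
        by (intro fibre_rep_tensor[OF P t fixed_point[OF x]]) auto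
      then show ?thesis
        using frc_bcl[OF b(1) P' x] by (simp add: Rep_mult[OF r] rep_tensor_def cocycle_tensor_def)
    qed
    then have "bcl l b = bcl (n * m) ?k" by (rule bcl_eqI[OF b(1) k])
    then show ?thesis using P' by simp
  qed
  moreover have "\<exists>E\<in>bcl n c. \<exists>E'\<in>bcl m d. is_bundle_tensor G X E E' P" if "P \<in> bcl (n * m) ?k" for P
    by (intro bexI[OF _ cb_mem_bcl[OF c]] bexI[OF _ cb_mem_bcl[OF d]] tensor_cocycle_bundle[OF c d])
      (use that in \<open>simp add: mem_bundle_class\<close>)
  moreover have "bcl n c \<otimes>\<^bsub>Bun\<^esub> bcl m d = {P. gvb X a P \<and> (\<exists>E\<in>bcl n c. \<exists>E'\<in>bcl m d. is_bundle_tensor G X E E' P)}"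
    by (simp add: bundle_semiring_def)
  moreover have "gvb X a P" if "P \<in> bcl (n * m) ?k" for P using that by (simp add: mem_bundle_class)
  ultimately show ?thesis by (intro subset_antisym subsetI) (simp_all, fast)
qed

lemma Bun_zero: "\<zero>\<^bsub>Bun\<^esub> = bcl 0 (\<lambda>g x. triv_rep 0 g)"
  by (simp add: bundle_semiring_def product_bundle_eq)

lemma cocycle_zero: "cocycle 0 (\<lambda>g x. triv_rep 0 g)"
  by (rule cocycle_rep[OF rep_triv])

lemma Bun_closed:
  assumes "C \<in> carrier Bun" "D \<in> carrier Bun"
  shows "C \<oplus>\<^bsub>Bun\<^esub> D \<in> carrier Bun" "C \<otimes>\<^bsub>Bun\<^esub> D \<in> carrier Bun"
proof -
  obtain n c where c: "cocycle n c" "C = bcl n c" using assms(1) by (rule Bun_carrierE)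
  obtain m d where d: "cocycle m d" "D = bcl m d" using assms(2) by (rule Bun_carrierE)
  show "C \<oplus>\<^bsub>Bun\<^esub> D \<in> carrier Bun" "C \<otimes>\<^bsub>Bun\<^esub> D \<in> carrier Bun"
    unfolding c(2) d(2) Bun_add[OF c(1) d(1)] Bun_mult[OF c(1) d(1)]
    by (rule bcl_mem[OF cocycle_cocycle_sum[OF c(1) d(1)]], rule bcl_mem[OF cocycle_cocycle_tensor[OF c(1) d(1)]])
qed

lemma Bun_zero_closed: "\<zero>\<^bsub>Bun\<^esub> \<in> carrier Bun"
  unfolding Bun_zero by (rule bcl_mem[OF cocycle_zero])

lemma Phi_add:
  assumes "C \<in> carrier Bun" "D \<in> carrier Bun" and x: "x \<in> F"
  shows "Phi x (C \<oplus>\<^bsub>Bun\<^esub> D) = Phi x C \<oplus>\<^bsub>Rep\<^esub> Phi x D"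
proof -
  obtain n c where c: "cocycle n c" "C = bcl n c" using assms(1) by (rule Bun_carrierE)
  obtain m d where d: "cocycle m d" "D = bcl m d" using assms(2) by (rule Bun_carrierE)
  have "rep_sum (\<lambda>g. c g x) (\<lambda>g. d g x) = (\<lambda>g. cocycle_sum c d g x)"
    by (rule ext) (simp only: rep_sum_eq cocycle_sum_def)
  then show ?thesis
    unfolding c(2) d(2) Bun_add[OF c(1) d(1)] Phi_bcl[OF c(1) x] Phi_bcl[OF d(1) x]
      Phi_bcl[OF cocycle_cocycle_sum[OF c(1) d(1)] x] Rep_add[OF rep_at_fixed_point[OF c(1) x] rep_at_fixed_point[OF d(1) x]]
    by simp
qed

lemma Phi_mult:
  assumes "C \<in> carrier Bun" "D \<in> carrier Bun" and x: "x \<in> F"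
  shows "Phi x (C \<otimes>\<^bsub>Bun\<^esub> D) = Phi x C \<otimes>\<^bsub>Rep\<^esub> Phi x D"
proof -
  obtain n c where c: "cocycle n c" "C = bcl n c" using assms(1) by (rule Bun_carrierE)
  obtain m d where d: "cocycle m d" "D = bcl m d" using assms(2) by (rule Bun_carrierE)
  show ?thesis
    unfolding c(2) d(2) Bun_mult[OF c(1) d(1)] Phi_bcl[OF c(1) x] Phi_bcl[OF d(1) x]
      Phi_bcl[OF cocycle_cocycle_tensor[OF c(1) d(1)] x] Rep_mult[OF rep_at_fixed_point[OF c(1) x] rep_at_fixed_point[OF d(1) x]]
    by (simp add: rep_tensor_def cocycle_tensor_def)
qed

lemma Phi_zero: "x \<in> F \<Longrightarrow> Phi x \<zero>\<^bsub>Bun\<^esub> = \<zero>\<^bsub>Rep\<^esub>"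
  unfolding Bun_zero Rep_zero by (rule Phi_bcl[OF cocycle_zero])

text \<open>The maps \<open>Phi x\<close> preserve the operations and are jointly injective, so each
  law follows from the same law in \<open>Rep\<close>.\<close>

lemma presemiring_Bun: "presemiring Bun"
proof -
  have "abelian_monoid Bun"
  proof (rule abelian_monoidI)
    fix x y z assume x: "x \<in> carrier Bun" and y: "y \<in> carrier Bun"
    show "x \<oplus>\<^bsub>Bun\<^esub> y \<in> carrier Bun" by (rule Bun_closed(1)[OF x y])
    show "\<zero>\<^bsub>Bun\<^esub> \<oplus>\<^bsub>Bun\<^esub> x = x"
      by (rule Phi_inj) (simp_all only: Bun_closed Bun_zero_closed Phi_add Phi_zero x Phi_mem Rep.l_zero)
    show "x \<oplus>\<^bsub>Bun\<^esub> y = y \<oplus>\<^bsub>Bun\<^esub> x"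
      by (rule Phi_inj) (simp_all only: Bun_closed Phi_add x y Phi_mem Rep.a_comm)
    assume z: "z \<in> carrier Bun"
    show "x \<oplus>\<^bsub>Bun\<^esub> y \<oplus>\<^bsub>Bun\<^esub> z = x \<oplus>\<^bsub>Bun\<^esub> (y \<oplus>\<^bsub>Bun\<^esub> z)"
      by (rule Phi_inj) (simp_all only: Bun_closed Phi_add x y z Phi_mem Rep.a_assoc)
  qed (rule Bun_zero_closed)
  then interpret abelian_monoid Bun .
  show ?thesis
  proof unfold_locales
    fix x y z assume x: "x \<in> carrier Bun" and y: "y \<in> carrier Bun"
    show "x \<otimes>\<^bsub>Bun\<^esub> y \<in> carrier Bun" by (rule Bun_closed(2)[OF x y])
    assume z: "z \<in> carrier Bun"
    show "(x \<oplus>\<^bsub>Bun\<^esub> y) \<otimes>\<^bsub>Bun\<^esub> z = x \<otimes>\<^bsub>Bun\<^esub> z \<oplus>\<^bsub>Bun\<^esub> y \<otimes>\<^bsub>Bun\<^esub> z"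
      by (rule Phi_inj) (simp_all only: Bun_closed Phi_add Phi_mult x y z Phi_mem Rep.l_distr)
    show "z \<otimes>\<^bsub>Bun\<^esub> (x \<oplus>\<^bsub>Bun\<^esub> y) = z \<otimes>\<^bsub>Bun\<^esub> x \<oplus>\<^bsub>Bun\<^esub> z \<otimes>\<^bsub>Bun\<^esub> y"
      by (rule Phi_inj) (simp_all only: Bun_closed Phi_add Phi_mult x y z Phi_mem Rep.r_distr)
  qed
qed

sublocale Bun: presemiring Bun by (rule presemiring_Bun)

lemma Bun_groth_diff_eqI:
  assumes "A \<in> carrier Bun" "B \<in> carrier Bun" "C \<in> carrier Bun" "D \<in> carrier Bun"
    and "\<And>x. x \<in> F \<Longrightarrow> Phi x A \<oplus>\<^bsub>Rep\<^esub> Phi x D = Phi x C \<oplus>\<^bsub>Rep\<^esub> Phi x B"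
  shows "groth_diff Bun A B = groth_diff Bun C D"
  by (rule Bun.groth_diff_eqI[OF assms(1-4)], rule Phi_inj) (simp_all only: Bun_closed assms Phi_add)

lemma K_fibre_groth_diff:
  assumes "C \<in> carrier Bun" "D \<in> carrier Bun" "x \<in> F"
  shows "K_fibre G T x (groth_diff Bun C D) = groth_diff Rep (Phi x C) (Phi x D)"
  unfolding K_fibre_def
  by (rule Bun.groth_map_diff[OF Rep.abelian_monoid_axioms]) (auto simp only: assms Phi_mem Phi_add)

abbreviation product_class :: "('a \<Rightarrow> complex mat) set \<Rightarrow> ('x, 'a) vbundle set" where
  "product_class C \<equiv> \<Union>r\<in>C. bundle_class G T X a (product_bundle X a (dim_row (r \<one>)) r)"

lemma product_class_cls:
  assumes r: "rep n r"
  shows "product_class (cls r) = bcl n (\<lambda>g x. r g)"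
proof (rule UN_cls[OF r])
  fix s assume s: "rep n s" and e: "rep_equiv (carrier G) n r s"
  have "bundle_class G T X a (product_bundle X a (dim_row (s \<one>)) s) = bcl n (\<lambda>g x. s g)"
    by (simp add: rep_one[OF s] product_bundle_eq)
  also have "\<dots> = bcl n (\<lambda>g x. r g)"
    using cls_eqI[OF r s e] by (intro bcl_eqI cocycle_rep r s) simp
  finally show "bundle_class G T X a (product_bundle X a (dim_row (s \<one>)) s) = bcl n (\<lambda>g x. r g)" .
qed

lemma product_class_mem: "c \<in> carrier Rep \<Longrightarrow> product_class c \<in> carrier Bun"
  by (elim Rep_carrierE) (simp only: product_class_cls bcl_mem[OF cocycle_rep])

lemma Phi_product_class: "c \<in> carrier Rep \<Longrightarrow> x \<in> F \<Longrightarrow> Phi x (product_class c) = c"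
  by (elim Rep_carrierE) (simp only: product_class_cls Phi_bcl[OF cocycle_rep])

lemma product_class_add:
  "c \<in> carrier Rep \<Longrightarrow> d \<in> carrier Rep \<Longrightarrow> product_class (c \<oplus>\<^bsub>Rep\<^esub> d) = product_class c \<oplus>\<^bsub>Bun\<^esub> product_class d"
  by (rule Phi_inj) (simp_all only: Bun_closed product_class_mem Rep.a_closed Phi_add Phi_product_class)

lemma K_scalar_groth_diff:
  assumes "c \<in> carrier Rep" "d \<in> carrier Rep"
  shows "K_scalar G T X a (groth_diff Rep c d) = groth_diff Bun (product_class c) (product_class d)"
  unfolding K_scalar_def
  by (rule Rep.groth_map_diff[OF Bun.abelian_monoid_axioms]) (simp_all only: assms product_class_mem product_class_add)

end

text \<open>The base point as an instance of the same locale, which makes the target of the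
  restriction map accessible. A local trivialization at \<open>b\<close> is already a global frame,
  and an intertwiner at \<open>b\<close> is a constant change of frame.\<close>

lemma (in gspace) point_classified:
  assumes b: "b \<in> topspace X" "\<And>g. g \<in> carrier G \<Longrightarrow> a g b = b"
  shows "classified_gspace G T (subtopology X {b}) a {b}"
proof -
  let ?Y = "subtopology X {b}"
  have Y: "topspace ?Y = {b}" using b by simp
  have "continuous_map (prod_topology T ?Y) ?Y (\<lambda>(g, x). a g x)"
    unfolding continuous_map_in_subtopology
  proof
    have "subtopology (prod_topology T X) (topspace T \<times> {b}) = prod_topology T ?Y"
      by (simp add: prod_topology_subtopology)
    then show "continuous_map (prod_topology T ?Y) X (\<lambda>(g, x). a g x)"
      using continuous_map_from_subtopology[OF act_continuous, of "topspace T \<times> {b}"] by simp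
  qed (use b(2) in \<open>auto simp: topspace_eq\<close>)
  then interpret Y: gspace G T ?Y a
    by unfold_locales (simp_all add: act_one act_mult)
  show ?thesis
  proof unfold_locales
    show "\<exists>n h. continuous_map (prod_topology ?Y (complex_space n)) (total_space E) h \<and>
        (\<forall>x\<in>topspace ?Y. fibre_coords E x n (\<lambda>v. h (x, v)))"
      if E: "gvb ?Y a E" for E :: "('x, 'a) vbundle"
    proof -
      obtain U n h where U: "openin ?Y U" "b \<in> U"
        and h: "homeomorphic_map (prod_topology (subtopology ?Y U) (complex_space n))
          (subtopology (total_space E) {e \<in> topspace (total_space E). bproj E e \<in> U}) h"
        and hc: "\<forall>y\<in>U. fibre_coords E y n (\<lambda>v. h (y, v))"
        by (rule bundle_local_triv[OF E, of b]) (simp add: b(1), rule that, assumption+, blast)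
      have "U = topspace ?Y" using openin_subset[OF U(1)] U(2) unfolding Y by blast
      then have "continuous_map (prod_topology ?Y (complex_space n)) (total_space E) h" "\<forall>x\<in>topspace ?Y. fibre_coords E x n (\<lambda>v. h (x, v))"
        using homeomorphic_imp_continuous_map[OF h] hc unfolding continuous_map_in_subtopology
        by (simp_all only: subtopology_topspace)
      then show ?thesis by (intro exI conjI)
    qed
    show "\<exists>P. mat_continuous ?Y n n P \<and> (\<forall>x\<in>topspace ?Y. invertible_mat (P x)) \<and>
        (\<forall>g\<in>carrier G. \<forall>x\<in>topspace ?Y. P (a g x) * c g x = d g x * P x)"
      if eq: "\<And>x. x \<in> {b} \<Longrightarrow> rep_equiv (carrier G) n (\<lambda>g. c g x) (\<lambda>g. d g x)" for n c d
    proof -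
      obtain P where "P \<in> carrier_mat n n" "invertible_mat P" "\<forall>g\<in>carrier G. P * c g b = d g b * P"
        using eq[OF singletonI] unfolding rep_equiv_def by (elim bexE conjE)
      then have "mat_continuous ?Y n n (\<lambda>x. P)" "\<forall>x\<in>topspace ?Y. invertible_mat P"
        "\<forall>g\<in>carrier G. \<forall>x\<in>topspace ?Y. P * c g x = d g x * P"
        unfolding Y by (simp_all add: mat_continuous_const)
      then show ?thesis by (intro exI[of _ "\<lambda>x. P"] conjI)
    qed
  qed (simp_all add: b)
qed

text \<open>Over the base point a bundle is a representation, and representations cancel. Hence the
  stable equality that expresses the vanishing of the restricted difference is an isomorphism of
  fibres, and elements of the reduced group are differences of bundles with isomorphic fibres at
  \<open>b\<close>.\<close>

lemma (in classified_gspace) K_restrict_groth_diff: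
  assumes b: "b \<in> F" and C: "C \<in> carrier Bun" and D: "D \<in> carrier Bun"
  shows "K_restrict G T X a {b} (groth_diff Bun C D) = \<zero>\<^bsub>K_ring G T (subtopology X {b}) a\<^esub> \<longleftrightarrow> Phi b C = Phi b D"
proof -
  let ?Y = "subtopology X {b}"
  interpret Y: classified_gspace G T ?Y a "{b}"
    by (rule point_classified[OF fixed_point[OF b] F_fixed[OF b]])
  let ?r = "\<lambda>C. \<Union>E\<in>C. bundle_class G T ?Y a (restrict_bundle {b} E)"
  have cY: "Y.cocycle n c" if c: "cocycle n c" for n c
    unfolding Y.cocycle_def
  proof (intro conjI ballI)
    have "subtopology (prod_topology T X) (topspace T \<times> {b}) = prod_topology T ?Y"
      by (simp add: prod_topology_subtopology)
    then show "mat_continuous (prod_topology T ?Y) n n (\<lambda>(g, x). c g x)"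
      using mat_continuous_subtopology[OF cocycleD(1)[OF c], of "topspace T \<times> {b}"] by simp
  qed (use cocycleD(3,4)[OF c] in auto)
  have r: "?r (bcl n c) = Y.bcl n c" if c: "cocycle n c" for n c
  proof -
    have "bundle_class G T ?Y a (restrict_bundle {b} E) = Y.bcl n c" if "E \<in> bcl n c" for E
    proof (rule bundle_class_eqI[symmetric, OF Y.cocycle_bundle_is_bundle[OF cY[OF c]]])
      show "bundle_iso G (cocycle_bundle ?Y a n c) (restrict_bundle {b} E)"
        using restrict_bundle_iso[of "cb n c" E "{b}"] that by (simp add: mem_bundle_class restrict_cocycle_bundle)
    qed
    then show ?thesis using cb_mem_bcl[OF c] by blast
  qed
  have rmem: "?r C \<in> carrier Y.Bun" and rPhi: "Y.Phi b (?r C) = Phi b C" if C': "C \<in> carrier Bun" for C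
  proof -
    obtain n c where c: "cocycle n c" "C = bcl n c" using C' by (rule Bun_carrierE)
    show "?r C \<in> carrier Y.Bun" unfolding c(2) r[OF c(1)] by (rule Y.bcl_mem[OF cY[OF c(1)]])
    show "Y.Phi b (?r C) = Phi b C" unfolding c(2) r[OF c(1)]
      using Y.Phi_bcl[OF cY[OF c(1)], of b] Phi_bcl[OF c(1) b] by simp
  qed
  have radd: "?r (C \<oplus>\<^bsub>Bun\<^esub> D) = ?r C \<oplus>\<^bsub>Y.Bun\<^esub> ?r D" if "C \<in> carrier Bun" "D \<in> carrier Bun" for C D
  proof (rule Y.Phi_inj)
    fix x assume "x \<in> {b}"
    then have x: "x = b" "b \<in> {b}" by auto
    show "Y.Phi x (?r (C \<oplus>\<^bsub>Bun\<^esub> D)) = Y.Phi x (?r C \<oplus>\<^bsub>Y.Bun\<^esub> ?r D)"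
      unfolding x(1) rPhi[OF Bun_closed(1)[OF that]] Phi_add[OF that b] Y.Phi_add[OF rmem[OF that(1)] rmem[OF that(2)] x(2)]
        rPhi[OF that(1)] rPhi[OF that(2)] ..
  qed (rule rmem Y.Bun_closed Bun_closed that)+
  have "K_restrict G T X a {b} (groth_diff Bun C D) = groth_diff Y.Bun (?r C) (?r D)"
    unfolding K_restrict_def by (rule Bun.groth_map_diff[OF Y.Bun.abelian_monoid_axioms rmem radd C D])
  then have "K_restrict G T X a {b} (groth_diff Bun C D) = \<zero>\<^bsub>K_ring G T ?Y a\<^esub> \<longleftrightarrow>
      (\<exists>k\<in>carrier Y.Bun. ?r C \<oplus>\<^bsub>Y.Bun\<^esub> k = ?r D \<oplus>\<^bsub>Y.Bun\<^esub> k)"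
    unfolding K_ring_def using Y.Bun.groth_diff_eq_zero_iff[OF rmem[OF C] rmem[OF D]] by simp
  also have "\<dots> \<longleftrightarrow> Phi b C = Phi b D"
  proof
    assume "\<exists>k\<in>carrier Y.Bun. ?r C \<oplus>\<^bsub>Y.Bun\<^esub> k = ?r D \<oplus>\<^bsub>Y.Bun\<^esub> k"
    then obtain k where k: "k \<in> carrier Y.Bun" "?r C \<oplus>\<^bsub>Y.Bun\<^esub> k = ?r D \<oplus>\<^bsub>Y.Bun\<^esub> k" by blast
    have bb: "b \<in> {b}" by simp
    have "Phi b C \<oplus>\<^bsub>Rep\<^esub> Y.Phi b k = Phi b D \<oplus>\<^bsub>Rep\<^esub> Y.Phi b k"
      using Y.Phi_add[OF rmem[OF C] k(1) bb] Y.Phi_add[OF rmem[OF D] k(1) bb] unfolding k(2) rPhi[OF C] rPhi[OF D] by simp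
    then show "Phi b C = Phi b D"
      using Rep_cancel[OF Phi_mem[OF C b] Phi_mem[OF D b] Y.Phi_mem[OF k(1) bb]]
        Rep.a_comm[OF Phi_mem[OF C b] Y.Phi_mem[OF k(1) bb]] Rep.a_comm[OF Phi_mem[OF D b] Y.Phi_mem[OF k(1) bb]] by simp
  next
    assume e: "Phi b C = Phi b D"
    have "?r C = ?r D"
    proof (rule Y.Phi_inj[OF rmem[OF C] rmem[OF D]])
      fix x assume "x \<in> {b}"
      then have "x = b" by simp
      then show "Y.Phi x (?r C) = Y.Phi x (?r D)" using e unfolding rPhi[OF C, symmetric] rPhi[OF D, symmetric] by (simp only:)
    qed
    then show "\<exists>k\<in>carrier Y.Bun. ?r C \<oplus>\<^bsub>Y.Bun\<^esub> k = ?r D \<oplus>\<^bsub>Y.Bun\<^esub> k"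
      using Y.Bun_zero_closed by (intro bexI[of _ "\<zero>\<^bsub>Y.Bun\<^esub>"]) auto
  qed
  finally show ?thesis .
qed

section \<open>Bundles over the circle\<close>

lemma continuous_map_complex_circle:
  "continuous_map unit_circle euclideanreal Re" "continuous_map unit_circle euclideanreal Im"
  by (auto simp: unit_circle_def intro!: continuous_intros)

lemma topspace_unit_circle: "topspace unit_circle = sphere 0 1"
  by (simp add: unit_circle_def)

lemma continuous_map_cis:
  assumes "continuous_map X euclideanreal f"
  shows "continuous_map X unit_circle (\<lambda>x. cis (f x))"
proof -
  have "continuous_map euclideanreal unit_circle cis"
    by (auto simp: unit_circle_def continuous_map_in_subtopology intro!: continuous_intros)
  then show ?thesis using continuous_map_compose[OF assms] by (simp add: o_def)
qed

lemma circle_abs_Re: "z \<in> sphere 0 1 \<Longrightarrow> \<bar>Re z\<bar> \<le> 1"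
  using abs_Re_le_cmod[of z] by simp

text \<open>The angle of a point on the upper half circle lies between 0 and \<open>pi\<close>, that
  of a point on the lower half between \<open>pi\<close> and \<open>2 * pi\<close>; both are
  continuous functions of the real part.\<close>

lemma cis_arccos_Re:
  assumes z: "z \<in> sphere 0 1"
  shows "0 \<le> Im z \<Longrightarrow> cis (arccos (Re z)) = z" "Im z \<le> 0 \<Longrightarrow> cis (2 * pi - arccos (Re z)) = z"
proof -
  have R: "-1 \<le> Re z" "Re z \<le> 1" using circle_abs_Re[OF z] by auto
  have sq: "(Re z)\<^sup>2 + (Im z)\<^sup>2 = 1" using z by (simp add: cmod_power2[symmetric])
  then have "1 - (Re z)\<^sup>2 = (Im z)\<^sup>2" by simp
  then have "sin (arccos (Re z)) = \<bar>Im z\<bar>" using R by (simp only: sin_arccos real_sqrt_abs)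
  then show "0 \<le> Im z \<Longrightarrow> cis (arccos (Re z)) = z" "Im z \<le> 0 \<Longrightarrow> cis (2 * pi - arccos (Re z)) = z"
    using R by (auto simp: complex_eq_iff cos_diff sin_diff)
qed

lemma continuous_map_arccos_Re: "continuous_map unit_circle euclideanreal (\<lambda>z. arccos (Re z))"
  using circle_abs_Re by (auto simp: unit_circle_def abs_le_iff intro!: continuous_intros)

lemma arccos_Re_range:
  assumes "z \<in> topspace unit_circle"
  shows "arccos (Re z) \<in> {0..pi}" "arccos (Re z) \<in> {0..2 * pi}" "2 * pi - arccos (Re z) \<in> {0..2 * pi}"
proof -
  have "0 \<le> arccos (Re z)" "arccos (Re z) \<le> pi"
    using circle_abs_Re[of z] assms arccos_lbound[of "Re z"] arccos_ubound[of "Re z"] by (auto simp: topspace_unit_circle)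
  then show "arccos (Re z) \<in> {0..pi}" "arccos (Re z) \<in> {0..2 * pi}" "2 * pi - arccos (Re z) \<in> {0..2 * pi}"
    using pi_ge_zero unfolding atLeastAtMost_iff by argo+
qed

section \<open>Global frames over the circle\<close>

context compact_group
begin

text \<open>At the common endpoint the two frames differ by a constant invertible matrix
  \<open>A\<close>; changing the second frame by \<open>A\<close> on its whole interval makes them
  agree there.\<close>

lemma frame_join:
  assumes E: "gvb unit_circle a E" and abc: "a' \<le> b" "b \<le> c"
    and h1: "continuous_map (prod_topology (top_of_set {a'..b}) (complex_space n)) (total_space E) h1"
      "\<And>t. t \<in> {a'..b} \<Longrightarrow> fibre_coords E (cis t) n (\<lambda>v. h1 (t, v))"
    and h2: "continuous_map (prod_topology (top_of_set {b..c}) (complex_space m)) (total_space E) h2"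
      "\<And>t. t \<in> {b..c} \<Longrightarrow> fibre_coords E (cis t) m (\<lambda>v. h2 (t, v))"
  obtains h where "continuous_map (prod_topology (top_of_set {a'..c}) (complex_space n)) (total_space E) h"
      "\<And>t. t \<in> {a'..c} \<Longrightarrow> fibre_coords E (cis t) n (\<lambda>v. h (t, v))"
proof -
  have b: "b \<in> {a'..b}" "b \<in> {b..c}" using abc by auto
  obtain A where A: "n = m" "A \<in> carrier_mat n n" "invertible_mat A"
    "\<And>v. v \<in> topspace (complex_space n) \<Longrightarrow> h1 (b, v) = h2 (b, mat_act A v)"
    by (rule fibre_coords_change[OF h1(2)[OF b(1)] h2(2)[OF b(2)]]) (rule that)
  let ?Z = "prod_topology (top_of_set {a'..c}) (complex_space n)"
  define h where "h p = (if fst p \<le> b then h1 p else h2 (fst p, mat_act A (snd p)))" for p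
  have fst: "continuous_map ?Z euclideanreal fst"
    using continuous_map_fst[of "top_of_set {a'..c}" "complex_space n"] by (simp add: continuous_map_in_subtopology)
  have sub: "subtopology ?Z {p \<in> topspace ?Z. fst p \<le> b} = prod_topology (top_of_set {a'..b}) (complex_space n)"
    "subtopology ?Z {p \<in> topspace ?Z. b \<le> fst p} = prod_topology (top_of_set {b..c}) (complex_space n)"
  proof -
    have 1: "{p \<in> topspace ?Z. fst p \<le> b} = {a'..b} \<times> topspace (complex_space n)" using abc by auto
    have 2: "{p \<in> topspace ?Z. b \<le> fst p} = {b..c} \<times> topspace (complex_space n)" using abc by auto
    have i: "{a'..c} \<inter> {a'..b} = {a'..b}" "{a'..c} \<inter> {b..c} = {b..c}" using abc by auto
    show "subtopology ?Z {p \<in> topspace ?Z. fst p \<le> b} = prod_topology (top_of_set {a'..b}) (complex_space n)"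
      "subtopology ?Z {p \<in> topspace ?Z. b \<le> fst p} = prod_topology (top_of_set {b..c}) (complex_space n)"
      unfolding 1 2 by (simp_all only: subtopology_Times subtopology_topspace subtopology_subtopology i)
  qed
  have "continuous_map ?Z (total_space E) h"
    unfolding h_def[abs_def]
  proof (rule continuous_map_cases_le[OF fst])
    show "continuous_map (subtopology ?Z {p \<in> topspace ?Z. fst p \<le> b}) (total_space E) h1"
      unfolding sub by (rule h1(1))
    have "continuous_map (prod_topology (top_of_set {b..c}) (complex_space n)) (prod_topology (top_of_set {b..c}) (complex_space n))
        (\<lambda>p. (fst p, mat_act A (snd p)))"
      by (intro continuous_map_pairedI continuous_map_fst continuous_map_mat_act[OF mat_continuous_const[OF A(2)] continuous_map_snd])
    from continuous_map_compose[OF this h2(1)[folded A(1)]]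
    show "continuous_map (subtopology ?Z {p \<in> topspace ?Z. b \<le> fst p}) (total_space E) (\<lambda>p. h2 (fst p, mat_act A (snd p)))"
      unfolding sub by (simp add: o_def)
    show "h1 p = h2 (fst p, mat_act A (snd p))" if "p \<in> topspace ?Z" "fst p = b" for p
      using A(4)[of "snd p"] that by (cases p) auto
  qed simp
  moreover have "fibre_coords E (cis t) n (\<lambda>v. h (t, v))" if t: "t \<in> {a'..c}" for t
  proof (cases "t \<le> b")
    case True
    then show ?thesis using h1(2)[of t] t by (simp add: h_def)
  next
    case False
    then show ?thesis using fibre_coords_mat_act[OF h2(2)[of t, folded A(1)] A(2,3)] t by (simp add: h_def)
  qed
  ultimately show thesis by (rule that)
qed

text \<open>A frame of the bundle pulled back along \<open>cis\<close>. Local triviality supplies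
  frames on short intervals, \<open>frame_join\<close> glues them, and the Bolzano principle passes
  to the whole interval.\<close>

lemma frame_interval:
  assumes E: "gvb unit_circle a E" and "p \<le> q"
  shows "\<exists>n h. continuous_map (prod_topology (top_of_set {p..q}) (complex_space n)) (total_space E) h \<and>
    (\<forall>t\<in>{p..q}. fibre_coords E (cis t) n (\<lambda>v. h (t, v)))"
  using \<open>p \<le> q\<close>
proof (induction rule: Bolzano)
  case (trans x y z)
  obtain n h1 where h1: "continuous_map (prod_topology (top_of_set {x..y}) (complex_space n)) (total_space E) h1"
      "\<And>t. t \<in> {x..y} \<Longrightarrow> fibre_coords E (cis t) n (\<lambda>v. h1 (t, v))" using trans(1) by blast
  obtain m h2 where h2: "continuous_map (prod_topology (top_of_set {y..z}) (complex_space m)) (total_space E) h2"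
      "\<And>t. t \<in> {y..z} \<Longrightarrow> fibre_coords E (cis t) m (\<lambda>v. h2 (t, v))" using trans(2) by blast
  obtain h where "continuous_map (prod_topology (top_of_set {x..z}) (complex_space n)) (total_space E) h"
      "\<And>t. t \<in> {x..z} \<Longrightarrow> fibre_coords E (cis t) n (\<lambda>v. h (t, v))"
    by (rule frame_join[OF E trans(3,4) h1 h2]) (assumption+, rule that)
  then show ?case by blast
next
  case (local x)
  have x: "cis x \<in> topspace unit_circle" by (simp add: topspace_unit_circle)
  obtain U n h where U: "openin unit_circle U" "cis x \<in> U"
    and h: "homeomorphic_map (prod_topology (subtopology unit_circle U) (complex_space n))
       (subtopology (total_space E) {e \<in> topspace (total_space E). bproj E e \<in> U}) h"
    and hc: "\<And>y. y \<in> U \<Longrightarrow> fibre_coords E y n (\<lambda>v. h (y, v))"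
    by (rule bundle_local_triv[OF E x]) (rule that)
  have cis: "continuous_map euclideanreal unit_circle cis"
    using continuous_map_cis[of euclideanreal "\<lambda>t. t"] by simp
  have "open {t. cis t \<in> U}"
    using openin_continuous_map_preimage[OF cis U(1)] by simp
  then obtain d where d: "d > 0" "ball x d \<subseteq> {t. cis t \<in> U}"
    using U(2) unfolding open_contains_ball by blast
  have "continuous_map (prod_topology (top_of_set {u..v}) (complex_space n)) (total_space E) (\<lambda>p. h (cis (fst p), snd p)) \<and>
      (\<forall>t\<in>{u..v}. fibre_coords E (cis t) n (\<lambda>w. h (cis (fst (t, w)), snd (t, w))))"
    if uv: "u \<le> x \<and> x \<le> v \<and> v - u < d" for u v
  proof
    have inU: "cis t \<in> U" if "t \<in> {u..v}" for t
      using d(2) uv that by (auto simp: dist_real_def subset_iff)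
    let ?Z = "prod_topology (top_of_set {u..v}) (complex_space n)"
    have "continuous_map ?Z euclideanreal fst"
      using continuous_map_fst[of "top_of_set {u..v}" "complex_space n"] by (simp add: continuous_map_in_subtopology)
    then have "continuous_map ?Z (subtopology unit_circle U) (\<lambda>p. cis (fst p))"
      using continuous_map_cis inU by (auto simp: continuous_map_in_subtopology)
    then have "continuous_map ?Z (prod_topology (subtopology unit_circle U) (complex_space n)) (\<lambda>p. (cis (fst p), snd p))"
      by (intro continuous_map_pairedI continuous_map_snd)
    from continuous_map_compose[OF this homeomorphic_imp_continuous_map[OF h]]
    show "continuous_map ?Z (total_space E) (\<lambda>p. h (cis (fst p), snd p))"
      by (simp add: o_def continuous_map_in_subtopology)
    show "\<forall>t\<in>{u..v}. fibre_coords E (cis t) n (\<lambda>w. h (cis (fst (t, w)), snd (t, w)))" using hc inU by simp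
  qed
  then show ?case using d(1) by blast
qed

text \<open>A frame over one full turn returns to itself up to an invertible matrix
  \<open>A\<close>. Multiplying it by a path of invertible matrices from the identity to
  \<open>A\<close> makes its values at 0 and \<open>2 * pi\<close> agree.\<close>

lemma frame_circle:
  assumes E: "gvb unit_circle a E"
  shows "\<exists>n h. continuous_map (prod_topology unit_circle (complex_space n)) (total_space E) h \<and>
    (\<forall>x\<in>topspace unit_circle. fibre_coords E x n (\<lambda>v. h (x, v)))"
proof -
  obtain n h where h: "continuous_map (prod_topology (top_of_set {0..2 * pi}) (complex_space n)) (total_space E) h"
      "\<And>t. t \<in> {0..2 * pi} \<Longrightarrow> fibre_coords E (cis t) n (\<lambda>v. h (t, v))"
    using frame_interval[OF E, of 0 "2 * pi"] by auto
  have "fibre_coords E 1 n (\<lambda>v. h (0, v))" "fibre_coords E 1 n (\<lambda>v. h (2 * pi, v))"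
    using h(2)[of 0] h(2)[of "2 * pi"] by (simp_all add: cis_2pi)
  then obtain A where A: "A \<in> carrier_mat n n" "invertible_mat A"
    "\<And>v. v \<in> topspace (complex_space n) \<Longrightarrow> h (0, v) = h (2 * pi, mat_act A v)"
    by (rule fibre_coords_change) (rule that)
  obtain \<gamma> :: "real \<Rightarrow> complex" where \<gamma>: "continuous_on {0..1} \<gamma>" "\<gamma> 0 = 0" "\<gamma> 1 = 1"
    "\<And>t. t \<in> {0..1} \<Longrightarrow> invertible_mat (1\<^sub>m n + \<gamma> t \<cdot>\<^sub>m (A - 1\<^sub>m n))"
    by (rule path_in_invertible_pencil[OF one_carrier_mat invertible_one_mat A(1,2)]) (rule that)
  \<comment> \<open>The path in the pencil through the identity and \<open>A\<close>, reparametrized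
    to the interval of angles.\<close>
  define M where "M t = 1\<^sub>m n + \<gamma> (t / (2 * pi)) \<cdot>\<^sub>m (A - 1\<^sub>m n)" for t
  have M: "M t \<in> carrier_mat n n" "t \<in> {0..2 * pi} \<Longrightarrow> invertible_mat (M t)" for t
    using A(1) \<gamma>(4)[of "t / (2 * pi)"] by (auto simp: M_def)
  have M01: "M 0 = 1\<^sub>m n" "M (2 * pi) = A"
    using A(1) by (auto simp: M_def \<gamma>(2,3) intro!: eq_matI)
  have "continuous_on {0..2 * pi} (\<lambda>t. \<gamma> (t / (2 * pi)))"
    by (intro continuous_on_compose2[OF \<gamma>(1)] continuous_intros) auto
  then have Mc: "mat_continuous (top_of_set {0..2 * pi}) n n M"
    unfolding M_def[abs_def] using A(1)
    by (intro mat_continuous_add mat_continuous_smult mat_continuous_const) (auto)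
  let ?Z = "prod_topology (top_of_set {0..2 * pi}) (complex_space n)"
  define k where "k p = h (fst p, mat_act (M (fst p)) (snd p))" for p
  have "continuous_map ?Z ?Z (\<lambda>p. (fst p, mat_act (M (fst p)) (snd p)))"
    by (intro continuous_map_pairedI continuous_map_fst continuous_map_mat_act[OF mat_continuous_compose[OF Mc continuous_map_fst] continuous_map_snd])
  from continuous_map_compose[OF this h(1)] have kc: "continuous_map ?Z (total_space E) k"
    by (simp add: o_def k_def[abs_def])
  have kf: "fibre_coords E (cis t) n (\<lambda>v. k (t, v))" if "t \<in> {0..2 * pi}" for t
    using fibre_coords_mat_act[OF h(2)[OF that] M(1) M(2)[OF that]] by (simp add: k_def)
  have k01: "k (0, v) = k (2 * pi, v)" if "v \<in> topspace (complex_space n)" for v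
    using A(3)[OF that] that by (simp add: k_def M01 mat_act_one)
  let ?C = "prod_topology unit_circle (complex_space n)"
  define g where "g p = (if 0 \<le> Im (fst p) then k (arccos (Re (fst p)), snd p) else k (2 * pi - arccos (Re (fst p)), snd p))" for p
  have cont: "continuous_map ?C (total_space E) (\<lambda>p. k (f (fst p), snd p))"
    if f: "continuous_map unit_circle euclideanreal f" "\<And>z. z \<in> topspace unit_circle \<Longrightarrow> f z \<in> {0..2 * pi}" for f
  proof -
    have "continuous_map unit_circle (top_of_set {0..2 * pi}) f"
      using f by (auto simp: continuous_map_in_subtopology)
    from continuous_map_compose[OF continuous_map_fst this]
    have "continuous_map ?C ?Z (\<lambda>p. (f (fst p), snd p))"
      by (intro continuous_map_pairedI continuous_map_snd) (simp add: o_def)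
    from continuous_map_compose[OF this kc] show ?thesis by (simp add: o_def)
  qed
  have "continuous_map ?C (total_space E) g"
    unfolding g_def[abs_def]
  proof (rule continuous_map_cases_le)
    show "continuous_map ?C euclideanreal (\<lambda>p. Im (fst p))"
      using continuous_map_compose[OF continuous_map_fst continuous_map_complex_circle(2)] by (simp add: o_def)
    show "continuous_map (subtopology ?C {p \<in> topspace ?C. 0 \<le> Im (fst p)}) (total_space E) (\<lambda>p. k (arccos (Re (fst p)), snd p))"
      by (intro continuous_map_from_subtopology cont continuous_map_arccos_Re arccos_Re_range)
    have "continuous_map unit_circle euclideanreal (\<lambda>z. 2 * pi - arccos (Re z))"
      by (intro continuous_map_diff continuous_map_arccos_Re) simp
    then show "continuous_map (subtopology ?C {p \<in> topspace ?C. Im (fst p) \<le> 0}) (total_space E) (\<lambda>p. k (2 * pi - arccos (Re (fst p)), snd p))"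
      by (intro continuous_map_from_subtopology cont arccos_Re_range)
    \<comment> \<open>The formulas for the two half circles meet at \<open>-1\<close>, where both
      angles equal \<open>pi\<close>, and at 1, where the angles are 0 and \<open>2 * pi\<close> and
      \<open>k01\<close> closes the frame.\<close>
    fix p assume p: "p \<in> topspace ?C" "0 = Im (fst p)"
    then have "(Re (fst p))\<^sup>2 = 1" using cmod_power2[of "fst p"] by (auto simp: topspace_unit_circle)
    then have "Re (fst p) = 1 \<or> Re (fst p) = -1" by (simp add: power2_eq_1_iff)
    then show "k (arccos (Re (fst p)), snd p) = k (2 * pi - arccos (Re (fst p)), snd p)"
      using k01[of "snd p"] p(1) by (auto simp: arccos_minus_1)
  qed simp
  moreover have "fibre_coords E z n (\<lambda>v. g (z, v))" if z: "z \<in> topspace unit_circle" for z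
  proof (cases "0 \<le> Im z")
    case True
    then show ?thesis
      using kf[of "arccos (Re z)"] cis_arccos_Re(1)[of z] arccos_Re_range[OF z] z by (simp add: g_def topspace_unit_circle)
  next
    case False
    then show ?thesis
      using kf[of "2 * pi - arccos (Re z)"] cis_arccos_Re(2)[of z] arccos_Re_range[OF z] z by (simp add: g_def topspace_unit_circle)
  qed
  ultimately show ?thesis by blast
qed

end

section \<open>Rigidity of continuous families of representations\<close>

lemma intertwine_comp:
  fixes X Y :: "complex mat"
  assumes "X \<in> carrier_mat n n" "Y \<in> carrier_mat n n" "a \<in> carrier_mat n n" "b \<in> carrier_mat n n" "c \<in> carrier_mat n n"
    and "X * a = b * X" "Y * b = c * Y"
  shows "Y * X * a = c * (Y * X)"
proof -
  have "Y * X * a = Y * (X * a)" using assms by (intro assoc_mult_mat)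
  also have "\<dots> = Y * b * X" unfolding assms(6) using assms(1-5) by (intro assoc_mult_mat[symmetric])
  also have "\<dots> = c * (Y * X)" unfolding assms(7) using assms(1-5) by (intro assoc_mult_mat)
  finally show ?thesis .
qed

lemma intertwine_inverse:
  fixes X Y :: "complex mat"
  assumes c: "X \<in> carrier_mat n n" "Y \<in> carrier_mat n n" "a \<in> carrier_mat n n" "b \<in> carrier_mat n n"
    and "X * a = b * X" "X * Y = 1\<^sub>m n" "Y * X = 1\<^sub>m n"
  shows "Y * b = a * Y"
proof -
  have "Y * b = Y * b * (X * Y)" using c by (simp add: assms(6))
  also have "\<dots> = Y * (b * X) * Y" using c by (simp add: assoc_mult_mat[of _ n n _ n _ n] mult_carrier_mat[of _ n n _ n])
  also have "\<dots> = (Y * X) * (a * Y)" using c by (simp add: assms(5)[symmetric] assoc_mult_mat[of _ n n _ n _ n] mult_carrier_mat[of _ n n _ n])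
  also have "\<dots> = a * Y" using c by (simp add: assms(7))
  finally show ?thesis .
qed

lemma intertwine_pencil:
  fixes p q :: "complex mat"
  assumes c: "p \<in> carrier_mat n n" "q \<in> carrier_mat n n" "a \<in> carrier_mat n n" "b \<in> carrier_mat n n"
    and e: "p * a = b * p" "q * a = b * q"
  shows "(p + z \<cdot>\<^sub>m (q - p)) * a = b * (p + z \<cdot>\<^sub>m (q - p))"
proof -
  have d: "q - p \<in> carrier_mat n n" by (rule minus_carrier_mat[OF c(1)])
  have "(p + z \<cdot>\<^sub>m (q - p)) * a = p * a + z \<cdot>\<^sub>m (q * a - p * a)"
    using c d by (simp add: add_mult_distrib_mat[of _ n n] mult_smult_assoc_mat[of _ n n] minus_mult_distrib_mat[of _ n n])
  also have "\<dots> = b * (p + z \<cdot>\<^sub>m (q - p))"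
    unfolding e using c d by (simp add: mult_add_distrib_mat[of _ n n] mult_smult_distrib[of _ n n] mult_minus_distrib_mat[of _ n n])
  finally show ?thesis .
qed

lemma mat_continuous_cases_le:
  assumes p: "continuous_map X euclideanreal p" and q: "continuous_map X euclideanreal q"
    and f: "mat_continuous (subtopology X {x \<in> topspace X. p x \<le> q x}) m n f"
    and g: "mat_continuous (subtopology X {x \<in> topspace X. q x \<le> p x}) m n g"
    and eq: "\<And>x. x \<in> topspace X \<Longrightarrow> p x = q x \<Longrightarrow> f x = g x"
  shows "mat_continuous X m n (\<lambda>x. if p x \<le> q x then f x else g x)"
  unfolding mat_continuous_def
proof (intro conjI ballI allI impI)
  fix x assume "x \<in> topspace X"
  then show "(if p x \<le> q x then f x else g x) \<in> carrier_mat m n"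
    using mat_continuous_carrier[OF f, of x] mat_continuous_carrier[OF g, of x] by auto
next
  fix i j assume ij: "i < m" "j < n"
  have "continuous_map X euclidean (\<lambda>x. if p x \<le> q x then f x $$ (i, j) else g x $$ (i, j))"
    by (rule continuous_map_cases_le[OF p q mat_continuous_entry[OF f ij] mat_continuous_entry[OF g ij]]) (simp add: eq)
  then show "continuous_map X euclidean (\<lambda>x. (if p x \<le> q x then f x else g x) $$ (i, j))"
    by (simp add: if_distrib[of "\<lambda>A. A $$ (i, j)"])
qed

context compact_group
begin

text \<open>The tube lemma: compactness of the group turns continuity at each \<open>(g, t0)\<close>
  into an estimate that is uniform in \<open>g\<close>.\<close>

lemma uniformly_continuous_parameter:
  assumes f: "mat_continuous (prod_topology T euclideanreal) q p (\<lambda>(g, t). f g t)" and e: "(0::real) < e"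
  shows "\<forall>\<^sub>F t in nhds t0. \<forall>g\<in>carrier G. \<forall>i<q. \<forall>j<p. cmod (f g t $$ (i, j) - f g t0 $$ (i, j)) \<le> e"
proof -
  let ?Z = "prod_topology T euclideanreal"
  have "\<forall>\<^sub>F t in nhds t0. \<forall>g\<in>carrier G. cmod (f g t $$ (i, j) - f g t0 $$ (i, j)) \<le> e" if ij: "i < q" "j < p" for i j
  proof -
    let ?d = "\<lambda>x. f (fst x) (snd x) $$ (i, j) - f (fst x) t0 $$ (i, j)"
    have f': "continuous_map ?Z euclidean (\<lambda>x. f (fst x) (snd x) $$ (i, j))"
      using mat_continuous_entry[OF f ij] by (simp add: case_prod_unfold)
    have "continuous_map ?Z ?Z (\<lambda>x. (fst x, t0))" by (intro continuous_map_pairedI continuous_map_fst) simp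
    from continuous_map_compose[OF this f'] have "continuous_map ?Z euclidean (\<lambda>x. f (fst x) t0 $$ (i, j))"
      by (simp add: o_def)
    then have "continuous_map ?Z euclideanreal (\<lambda>x. cmod (?d x))"
      by (intro continuous_intros f')
    from openin_continuous_map_preimage[OF this, of "{..<e}"]
    have W: "openin ?Z {x \<in> topspace ?Z. cmod (?d x) \<in> {..<e}}" by simp
    have sub: "topspace T \<times> {t0} \<subseteq> {x \<in> topspace ?Z. cmod (?d x) \<in> {..<e}}" using e by auto
    obtain U V where UV: "openin T U" "openin euclideanreal V" "topspace T \<subseteq> U" "t0 \<in> V"
      "U \<times> V \<subseteq> {x \<in> topspace ?Z. cmod (?d x) \<in> {..<e}}"
      using tube_lemma_left[OF W compact[unfolded compact_space_def] _ sub] by auto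
    have "cmod (f g t $$ (i, j) - f g t0 $$ (i, j)) \<le> e" if "t \<in> V" "g \<in> carrier G" for t g
    proof -
      have "(g, t) \<in> U \<times> V" using that UV(3) by (auto simp: topspace_eq)
      then have "cmod (?d (g, t)) < e" using UV(5) by blast
      then show ?thesis by simp
    qed
    then show ?thesis unfolding eventually_nhds using UV(2,4) by (intro exI[of _ V]) auto
  qed
  then have "\<forall>\<^sub>F t in nhds t0. \<forall>i\<in>{..<q}. \<forall>j\<in>{..<p}. \<forall>g\<in>carrier G. cmod (f g t $$ (i, j) - f g t0 $$ (i, j)) \<le> e"
    by - (rule eventually_ball_finite[OF finite_lessThan], rule ballI, rule eventually_ball_finite[OF finite_lessThan], simp)
  then show ?thesis by (rule eventually_mono) auto
qed

text \<open>The mean over \<open>g\<close> of \<open>c g s * c (inv g) t\<close> would be an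
  intertwiner from the representation at \<open>t\<close> to that at \<open>s\<close>; it equals the
  identity at \<open>t = s\<close> and stays invertible nearby. A fixed point from
  \<open>equivariant_family\<close> takes the place of the mean.\<close>

lemma rep_isotopy_local:
  assumes c: "mat_continuous (prod_topology T euclideanreal) n n (\<lambda>(g, t). c g t)" and r: "\<And>t. rep n (\<lambda>g. c g t)"
  obtains Q d where "0 < d" "mat_continuous euclideanreal n n Q" "\<And>t. \<bar>t - s\<bar> < d \<Longrightarrow> invertible_mat (Q t)"
    "\<And>g t. g \<in> carrier G \<Longrightarrow> Q t * c g t = c g s * Q t"
proof -
  note car = rep_carrier[OF r]
  \<comment> \<open>The orbit of the identity matrix. At \<open>t = s\<close> it is constant, which
    determines the fixed point there; the zero translation part matches the form of
    \<open>equivariant_family\<close>.\<close>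
  define orb where "orb t g = c g s * 1\<^sub>m n * c (inv g) t + 0\<^sub>m n n" for t g
  have orb: "orb t g = c g s * c (inv g) t" if "g \<in> carrier G" for t g
    using car[OF that, of s] car[OF inv_closed[OF that], of t] by (simp add: orb_def)
  have orbs: "orb s g = 1\<^sub>m n" if "g \<in> carrier G" for g
    using rep_inv[OF r that] by (simp add: orb[OF that])
  have gc: "mat_continuous (prod_topology T euclideanreal) n n (\<lambda>(g, t). orb t g)"
  proof (rule mat_continuous_cong)
    let ?Z = "prod_topology T euclideanreal"
    have "continuous_map ?Z ?Z (\<lambda>x. (inv (fst x), snd x))"
      using continuous_map_compose[OF continuous_map_fst continuous_inv]
      by (intro continuous_map_pairedI continuous_map_snd) (simp add: o_def)
    from mat_continuous_compose[OF c this]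
    have 1: "mat_continuous ?Z n n (\<lambda>x. c (inv (fst x)) (snd x))" by simp
    have 2: "mat_continuous ?Z n n (\<lambda>x. c (fst x) s)"
      by (rule mat_continuous_compose[OF rep_continuous[OF r] continuous_map_fst])
    show "mat_continuous ?Z n n (\<lambda>x. c (fst x) s * c (inv (fst x)) (snd x))"
      by (rule mat_continuous_mult[OF 2 1])
  qed (auto simp: orb topspace_eq)
  obtain X where X: "\<And>t. X t \<in> carrier_mat n n"
    "\<And>t g. g \<in> carrier G \<Longrightarrow> c g s * X t * c (inv g) t + 0\<^sub>m n n = X t"
    "\<And>t t' i j e. i < n \<Longrightarrow> j < n \<Longrightarrow>
      (\<And>g. g \<in> carrier G \<Longrightarrow> cmod (orb t g $$ (i, j) - orb t' g $$ (i, j)) \<le> e) \<Longrightarrow>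
      cmod (X t $$ (i, j) - X t' $$ (i, j)) \<le> e"
    "\<And>t i j y e. i < n \<Longrightarrow> j < n \<Longrightarrow>
      (\<And>g. g \<in> carrier G \<Longrightarrow> cmod (orb t g $$ (i, j) - y) \<le> e) \<Longrightarrow> cmod (X t $$ (i, j) - y) \<le> e"
  proof (rule equivariant_family[where G = G and D = "\<lambda>t g. c g s" and A = "\<lambda>t g. c (inv g) t" and B = "\<lambda>t g. 0\<^sub>m n n"
        and q = n and p = n and ?X0.0 = "1\<^sub>m n"])
    show "\<exists>C. \<forall>g\<in>carrier G. (\<forall>i<n. \<forall>j<n. cmod (c g s $$ (i, j)) \<le> C) \<and>
        (\<forall>i<n. \<forall>j<n. cmod (c (inv g) t $$ (i, j)) \<le> C) \<and> (\<forall>i<n. \<forall>j<n. cmod (0\<^sub>m n n $$ (i, j) :: complex) \<le> C)" for t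
    proof -
      obtain C1 where 1: "\<forall>g\<in>carrier G. \<forall>i<n. \<forall>j<n. cmod (c g s $$ (i, j)) \<le> C1"
        using bounded_entries[OF rep_continuous[OF r]] by blast
      obtain C2 where 2: "\<forall>g\<in>carrier G. \<forall>i<n. \<forall>j<n. cmod (c (inv g) t $$ (i, j)) \<le> C2"
        using bounded_entries[OF mat_continuous_rep_inv[OF r]] by blast
      show ?thesis
        using 1 2 by (intro exI[of _ "max 0 (max C1 C2)"]) (auto simp: le_max_iff_disj)
    qed
    show "c (g \<otimes> h) s = c g s * c h s" if "g \<in> carrier G" "h \<in> carrier G" for g h by (rule rep_mult[OF r that])
    show "c (inv (g \<otimes> h)) t = c (inv h) t * c (inv g) t" if "g \<in> carrier G" "h \<in> carrier G" for t g h
      using rep_mult[OF r, of "inv h" "inv g" t] that by (simp add: inv_mult_group)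
    show "0\<^sub>m n n = c g s * 0\<^sub>m n n * c (inv g) t + 0\<^sub>m n n" if "g \<in> carrier G" "h \<in> carrier G" for t g h
      using car[OF that(1), of s] car[OF inv_closed[OF that(1)], of t] by simp
  qed (use car rep_one[OF r] that in \<open>auto simp: orb_def is_group\<close>)
  \<comment> \<open>At \<open>s\<close> the whole orbit is the identity matrix, so the disc bound
    with radius 0 applies.\<close>
  have Xs: "X s = 1\<^sub>m n"
  proof (rule eq_matI)
    fix i j assume "i < dim_row (1\<^sub>m n)" "j < dim_col (1\<^sub>m n)"
    then have ij: "i < n" "j < n" by auto
    have "cmod (X s $$ (i, j) - 1\<^sub>m n $$ (i, j)) \<le> 0" by (rule X(4)[OF ij]) (simp add: orbs)
    then show "X s $$ (i, j) = 1\<^sub>m n $$ (i, j)" by simp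
  qed (use X(1)[of s] in auto)
  have Xc: "mat_continuous euclideanreal n n X"
    unfolding mat_continuous_def
  proof (intro conjI ballI allI impI X(1))
    fix i j assume ij: "i < n" "j < n"
    \<comment> \<open>The bound on differences of fixed points by differences of orbits, combined
      with the estimate uniform in \<open>g\<close>. It gives a weak inequality, hence the half of
      \<open>e\<close>.\<close>
    have lim: "((\<lambda>t. X t $$ (i, j)) \<longlongrightarrow> X t0 $$ (i, j)) (nhds t0)" for t0
    proof (rule tendstoI)
      fix e :: real assume "0 < e"
      then have e: "0 < e / 2" by simp
      from uniformly_continuous_parameter[OF gc e, of t0]
      show "\<forall>\<^sub>F t in nhds t0. dist (X t $$ (i, j)) (X t0 $$ (i, j)) < e"
      proof (rule eventually_mono)
        fix t assume "\<forall>g\<in>carrier G. \<forall>i<n. \<forall>j<n. cmod (orb t g $$ (i, j) - orb t0 g $$ (i, j)) \<le> e / 2"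
        then have "cmod (X t $$ (i, j) - X t0 $$ (i, j)) \<le> e / 2" using ij by (intro X(3)) auto
        then show "dist (X t $$ (i, j)) (X t0 $$ (i, j)) < e" using e by (simp add: dist_norm)
      qed
    qed
    have "isCont (\<lambda>t. X t $$ (i, j)) t0" for t0
      unfolding isCont_def by (rule tendsto_mono[OF _ lim]) (simp add: at_within_def)
    then show "continuous_map euclideanreal euclidean (\<lambda>t. X t $$ (i, j))"
      by (simp add: continuous_on_eq_continuous_at)
  qed
  have "continuous_map euclideanreal euclidean (\<lambda>t. Determinant.det (X t))" by (rule continuous_map_det[OF Xc])
  then have "open {t. Determinant.det (X t) \<in> - {0}}"
    using openin_continuous_map_preimage[of euclideanreal euclidean _ "- {0}"] by fastforce
  moreover have "s \<in> {t. Determinant.det (X t) \<in> - {0}}" by (simp add: Xs)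
  ultimately obtain d where d: "d > 0" "ball s d \<subseteq> {t. Determinant.det (X t) \<in> - {0}}"
    unfolding open_contains_ball by blast
  show thesis
  proof (rule that[OF d(1) Xc])
    show "invertible_mat (X t)" if "\<bar>t - s\<bar> < d" for t
      using d(2) that invertible_mat_iff_det[OF X(1)] by (auto simp: dist_real_def subset_iff abs_minus_commute)
    show "X t * c g t = c g s * X t" if g: "g \<in> carrier G" for g t
    proof -
      note k = car[OF g, of t] car[OF inv_closed[OF g], of t] car[OF g, of s]
      have "c (inv g) t * c g t = 1\<^sub>m n" using rep_inv[OF r inv_closed[OF g], of t] g by simp
      moreover have "c g s * X t * c (inv g) t = X t"
        using X(2)[OF g, of t] right_add_zero_mat[OF mult_carrier_mat[OF mult_carrier_mat[OF k(3) X(1)] k(2)]] by simp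
      then have "X t * c g t = c g s * X t * (c (inv g) t * c g t)"
        using assoc_mult_mat[OF mult_carrier_mat[OF k(3) X(1)[of t]] k(2,1)] by simp
      ultimately show ?thesis using right_mult_one_mat[OF mult_carrier_mat[OF k(3) X(1)[of t]]] by simp
    qed
  qed
qed

text \<open>The local intertwiners compose along the interval. The normalization at the left
  endpoint makes consecutive pieces fit together.\<close>

lemma rep_isotopy:
  assumes c: "mat_continuous (prod_topology T euclideanreal) n n (\<lambda>(g, t). c g t)" and r: "\<And>t. rep n (\<lambda>g. c g t)"
    and ab: "(a::real) \<le> b"
  shows "\<exists>Q. mat_continuous (top_of_set {a..b}) n n Q \<and> (\<forall>t\<in>{a..b}. invertible_mat (Q t)) \<and>
    (\<forall>t\<in>{a..b}. \<forall>g\<in>carrier G. Q t * c g t = c g a * Q t) \<and> Q a = 1\<^sub>m n"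
  using ab
proof (induction rule: Bolzano)
  case (trans x y z)
  note car = rep_carrier[OF r]
  obtain Q where Q: "mat_continuous (top_of_set {x..y}) n n Q" "\<And>t. t \<in> {x..y} \<Longrightarrow> invertible_mat (Q t)"
    "\<And>t g. t \<in> {x..y} \<Longrightarrow> g \<in> carrier G \<Longrightarrow> Q t * c g t = c g x * Q t" "Q x = 1\<^sub>m n" using trans(1) by blast
  obtain R where R: "mat_continuous (top_of_set {y..z}) n n R" "\<And>t. t \<in> {y..z} \<Longrightarrow> invertible_mat (R t)"
    "\<And>t g. t \<in> {y..z} \<Longrightarrow> g \<in> carrier G \<Longrightarrow> R t * c g t = c g y * R t" "R y = 1\<^sub>m n" using trans(2) by blast
  have Qc: "Q t \<in> carrier_mat n n" if "t \<in> {x..y}" for t using mat_continuous_carrier[OF Q(1)] that by simp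
  have Rc: "R t \<in> carrier_mat n n" if "t \<in> {y..z}" for t using mat_continuous_carrier[OF R(1)] that by simp
  have y: "y \<in> {x..y}" using trans by simp
  \<comment> \<open>Beyond \<open>y\<close>, transport back to \<open>y\<close> and from there to
    \<open>x\<close>; the pieces agree at \<open>y\<close> since \<open>R y\<close> is the
    identity.\<close>
  define P where "P t = (if t \<le> y then Q t else Q y * R t)" for t
  have "mat_continuous (top_of_set {x..z}) n n P"
    unfolding P_def[abs_def]
  proof (rule mat_continuous_cases_le)
    have i: "{x..z} \<inter> {x..y} = {x..y}" "{x..z} \<inter> {y..z} = {y..z}" using trans by auto
    have e: "{t \<in> topspace (top_of_set {x..z}). t \<le> y} = {x..y}" "{t \<in> topspace (top_of_set {x..z}). y \<le> t} = {y..z}"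
      using trans by auto
    show "mat_continuous (subtopology (top_of_set {x..z}) {t \<in> topspace (top_of_set {x..z}). t \<le> y}) n n Q"
      unfolding e subtopology_subtopology i by (rule Q(1))
    show "mat_continuous (subtopology (top_of_set {x..z}) {t \<in> topspace (top_of_set {x..z}). y \<le> t}) n n (\<lambda>t. Q y * R t)"
      unfolding e subtopology_subtopology i by (rule mat_continuous_mult[OF mat_continuous_const[OF Qc[OF y]] R(1)])
  qed (use R(4) Qc[OF y] in \<open>auto simp: continuous_map_in_subtopology\<close>)
  moreover have "invertible_mat (P t)" if "t \<in> {x..z}" for t
    using Q(2)[of t] invertible_mat_times[OF Q(2)[OF y] R(2) Qc[OF y] Rc, of t] that by (simp add: P_def)
  moreover have "P t * c g t = c g x * P t" if t: "t \<in> {x..z}" and g: "g \<in> carrier G" for t g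
  proof (cases "t \<le> y")
    case False
    then have t': "t \<in> {y..z}" using t by simp
    show ?thesis
      using intertwine_comp[OF Rc[OF t'] Qc[OF y] car[OF g] car[OF g] car[OF g] R(3)[OF t' g] Q(3)[OF y g]] False by (simp add: P_def)
  qed (use Q(3)[of t g] t g in \<open>simp add: P_def\<close>)
  moreover have "P x = 1\<^sub>m n" using trans Q(4) by (simp add: P_def)
  ultimately show ?case by blast
next
  case (local x)
  note car = rep_carrier[OF r]
  obtain Q :: "real \<Rightarrow> complex mat" and d where d: "0 < d" and Q: "mat_continuous euclideanreal n n Q" "\<And>t. \<bar>t - x\<bar> < d \<Longrightarrow> invertible_mat (Q t)"
    "\<And>g t. g \<in> carrier G \<Longrightarrow> Q t * c g t = c g x * Q t"
    by (rule rep_isotopy_local[OF c r, where s = x]) (rule that)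
  have "\<exists>Q. mat_continuous (top_of_set {u..v}) n n Q \<and> (\<forall>t\<in>{u..v}. invertible_mat (Q t)) \<and>
      (\<forall>t\<in>{u..v}. \<forall>g\<in>carrier G. Q t * c g t = c g u * Q t) \<and> Q u = 1\<^sub>m n" if uv: "u \<le> x \<and> x \<le> v \<and> v - u < d" for u v
  proof -
    have Qc: "Q t \<in> carrier_mat n n" for t using mat_continuous_carrier[OF Q(1)] by simp
    have inv: "invertible_mat (Q t)" if "t \<in> {u..v}" for t using Q(2)[of t] that uv by auto
    \<comment> \<open>The local intertwiner refers to the midpoint \<open>x\<close> of the covering
      argument rather than to \<open>u\<close>; composing with the inverse of its value at
      \<open>u\<close> normalizes it.\<close>
    obtain R where R: "R \<in> carrier_mat n n" "Q u * R = 1\<^sub>m n" "R * Q u = 1\<^sub>m n"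
      by (rule invertible_matE[OF inv[of u] Qc]) (use uv in simp, rule that)
    have "mat_continuous (top_of_set {u..v}) n n (\<lambda>t. R * Q t)"
      by (rule mat_continuous_mult[OF mat_continuous_const[OF R(1)] mat_continuous_subtopology[OF Q(1)]])
    moreover have "invertible_mat (R * Q t)" if "t \<in> {u..v}" for t
      using invertible_mat_times[OF invertible_matI[OF R(1) Qc R(3)] inv[OF that] R(1) Qc] .
    moreover have "R * Q t * c g t = c g u * (R * Q t)" if g: "g \<in> carrier G" for t g
      by (rule intertwine_comp[OF Qc R(1) car[OF g] car[OF g] car[OF g] Q(3)[OF g]
            intertwine_inverse[OF Qc R(1) car[OF g] car[OF g] Q(3)[OF g] R(2,3)]])
    ultimately show ?thesis using R(3) by (intro exI[of _ "\<lambda>t. R * Q t"]) simp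
  qed
  then show ?case using d by blast
qed

end

section \<open>The circle with a reflection, and classification of its bundles\<close>

locale circle_reflection = gspace G T unit_circle a for G (structure) and T :: "'a topology" and a +
  fixes sg :: "'a \<Rightarrow> complex" and g0 :: 'a
  assumes sg_cases: "g \<in> carrier G \<Longrightarrow> sg g = 1 \<or> sg g = -1"
    and sg_mult: "g \<in> carrier G \<Longrightarrow> h \<in> carrier G \<Longrightarrow> sg (g \<otimes> h) = sg g * sg h"
    and sg_continuous: "continuous_map T euclidean sg"
    and g0: "g0 \<in> carrier G" "sg g0 = -1"
    and act_eq: "g \<in> carrier G \<Longrightarrow> a g z = (if sg g = 1 then z else cnj z)"
begin

lemma sg_one: "sg \<one> = 1"
  using sg_mult[OF one_closed one_closed] sg_cases[OF one_closed] by auto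

lemma sg_inv: "g \<in> carrier G \<Longrightarrow> sg (inv g) = sg g"
  using sg_mult[of g "inv g"] sg_cases[of g] sg_cases[of "inv g"] sg_one by auto

definition H :: "'a set" where
  "H = {g \<in> carrier G. sg g = 1}"

lemma H_subgroup: "subgroup H G"
  by (rule subgroupI) (auto simp: H_def sg_inv sg_mult intro: exI[of _ \<one>] sg_one)

text \<open>\<open>H\<close> is closed, as the preimage of 1 under the continuous character
  \<open>sg\<close>, hence compact.\<close>

lemma H_compact_group: "compact_group (G\<lparr>carrier := H\<rparr>) (subtopology T H)"
proof -
  interpret H: group "G\<lparr>carrier := H\<rparr>" by (rule subgroup.subgroup_is_group[OF H_subgroup is_group])
  have HG: "H \<subseteq> carrier G" by (auto simp: H_def)
  have H': "H = {x \<in> topspace T. sg x \<in> {1}}" by (auto simp: H_def topspace_eq)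
  show ?thesis
  proof unfold_locales
    show "topspace (subtopology T H) = carrier (G\<lparr>carrier := H\<rparr>)" using HG by (auto simp: topspace_eq)
    have "closedin T H"
      unfolding H' by (rule closedin_continuous_map_preimage[OF sg_continuous]) simp
    then show "compact_space (subtopology T H)"
      using compact by (simp add: closedin_compact_space compact_space_subtopology)
    have "continuous_map (subtopology T H) (subtopology T H) (\<lambda>x. inv x)"
      using HG by (auto simp: continuous_map_in_subtopology H_def sg_inv topspace_eq intro: continuous_map_from_subtopology[OF continuous_inv])
    then show "continuous_map (subtopology T H) (subtopology T H) (\<lambda>x. inv\<^bsub>G\<lparr>carrier := H\<rparr>\<^esub> x)"
      by (rule continuous_map_eq) (use m_inv_consistent[OF H_subgroup] in \<open>auto simp: topspace_eq\<close>)
  qed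
qed

lemma cis_topspace: "cis t \<in> topspace unit_circle"
  by (simp add: topspace_unit_circle)

text \<open>\<open>H\<close> fixes every point of the circle, so a cocycle restricts to a continuous
  family of representations of \<open>H\<close> along the upper half circle. \<open>Q t\<close>
  transports the fibre at \<open>cis t\<close> to the fibre at 1, and \<open>R t\<close> transports
  back.\<close>

lemma H_isotopy:
  assumes c: "cocycle n c"
  obtains Q R where "mat_continuous (top_of_set {0..pi}) n n Q" "mat_continuous (top_of_set {0..pi}) n n R"
    "\<And>t. t \<in> {0..pi} \<Longrightarrow> Q t * R t = 1\<^sub>m n" "\<And>t. t \<in> {0..pi} \<Longrightarrow> R t * Q t = 1\<^sub>m n"
    "\<And>t h. t \<in> {0..pi} \<Longrightarrow> h \<in> H \<Longrightarrow> Q t * c h (cis t) = c h 1 * Q t"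
    "\<And>t h. t \<in> {0..pi} \<Longrightarrow> h \<in> H \<Longrightarrow> R t * c h 1 = c h (cis t) * R t" "Q 0 = 1\<^sub>m n" "R 0 = 1\<^sub>m n"
proof -
  interpret H: compact_group "G\<lparr>carrier := H\<rparr>" "subtopology T H" by (rule H_compact_group)
  have HG: "h \<in> carrier G" if "h \<in> H" for h using that by (auto simp: H_def)
  let ?Z = "prod_topology (subtopology T H) euclideanreal"
  have "continuous_map ?Z T fst"
    using continuous_map_compose[OF continuous_map_fst continuous_map_from_subtopology[OF continuous_map_id]] by (simp add: o_def id_def)
  then have "continuous_map ?Z (prod_topology T unit_circle) (\<lambda>p. (fst p, cis (snd p)))"
    by (intro continuous_map_pairedI continuous_map_cis continuous_map_snd)
  from mat_continuous_compose[OF cocycleD(1)[OF c] this]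
  have cc: "mat_continuous ?Z n n (\<lambda>(g, t). c g (cis t))" by (simp add: case_prod_unfold)
  \<comment> \<open>Since \<open>h\<close> fixes \<open>cis t\<close>, the cocycle identity at this
    point is multiplicativity.\<close>
  have r: "H.rep n (\<lambda>g. c g (cis t))" for t
    unfolding H.rep_iff
  proof (intro conjI ballI)
    have "continuous_map (subtopology T H) ?Z (\<lambda>g. (g, t))"
      by (intro continuous_map_pairedI) (auto intro: continuous_map_from_subtopology continuous_map_id[unfolded id_def])
    from mat_continuous_compose[OF cc this] show "mat_continuous (subtopology T H) n n (\<lambda>g. c g (cis t))" by simp
    show "c \<one>\<^bsub>G\<lparr>carrier := H\<rparr>\<^esub> (cis t) = 1\<^sub>m n" using cocycleD(3)[OF c cis_topspace] by simp
    fix g h assume g: "g \<in> carrier (G\<lparr>carrier := H\<rparr>)" and h: "h \<in> carrier (G\<lparr>carrier := H\<rparr>)"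
    then show "c (g \<otimes>\<^bsub>G\<lparr>carrier := H\<rparr>\<^esub> h) (cis t) = c g (cis t) * c h (cis t)"
      using cocycleD(4)[OF c HG HG cis_topspace, of g h t] act_eq[of h "cis t"] by (simp add: H_def)
  qed
  obtain Q where Q: "mat_continuous (top_of_set {0..pi}) n n Q" "\<And>t. t \<in> {0..pi} \<Longrightarrow> invertible_mat (Q t)"
    "\<And>t h. t \<in> {0..pi} \<Longrightarrow> h \<in> H \<Longrightarrow> Q t * c h (cis t) = c h 1 * Q t" "Q 0 = 1\<^sub>m n"
    using H.rep_isotopy[OF cc r, of 0 pi] by auto
  obtain R where R: "mat_continuous (top_of_set {0..pi}) n n R" "\<And>t. t \<in> topspace (top_of_set {0..pi}) \<Longrightarrow> Q t * R t = 1\<^sub>m n"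
    "\<And>t. t \<in> topspace (top_of_set {0..pi}) \<Longrightarrow> R t * Q t = 1\<^sub>m n"
    by (rule mat_continuous_inverse[OF Q(1)]) (simp add: Q(2), rule that)
  have car: "Q t \<in> carrier_mat n n" "R t \<in> carrier_mat n n" if "t \<in> {0..pi}" for t
    using mat_continuous_carrier[OF Q(1), of t] mat_continuous_carrier[OF R(1), of t] that by simp_all
  have one: "(1::complex) \<in> topspace unit_circle" by (simp add: topspace_unit_circle)
  show thesis
  proof (rule that[OF Q(1) R(1)])
    show "Q t * R t = 1\<^sub>m n" "R t * Q t = 1\<^sub>m n" if "t \<in> {0..pi}" for t using R(2,3) that by simp_all
    show "Q t * c h (cis t) = c h 1 * Q t" if "t \<in> {0..pi}" "h \<in> H" for t h by (rule Q(3)[OF that])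
    show "R t * c h 1 = c h (cis t) * R t" if "t \<in> {0..pi}" "h \<in> H" for t h
      using R(2,3) that by (intro intertwine_inverse[OF car[OF that(1)] cocycleD(2)[OF c HG cis_topspace] cocycleD(2)[OF c HG one] Q(3)[OF that]]) simp_all
    show "R 0 = 1\<^sub>m n" using R(3)[of 0] car[of 0] Q(4) by simp
  qed (rule Q(4))
qed

text \<open>
  An isomorphism over the upper half circle only has to be \<open>H\<close>-equivariant, and it extends uniquely to
  a \<open>G\<close>-isomorphism if it is \<open>G\<close>-equivariant at the two fixed points.  These two prescribed values can be
  joined by a path, since the intertwiners of two \<open>H\<close>-modules that are not isomorphisms are the zeros of a
  polynomial.
\<close>

lemma cocycle_classify:
  assumes c: "cocycle n c" and d: "cocycle n d"
    and eq: "\<And>x. x \<in> {1, -1} \<Longrightarrow> rep_equiv (carrier G) n (\<lambda>g. c g x) (\<lambda>g. d g x)"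
  shows "\<exists>P. mat_continuous unit_circle n n P \<and> (\<forall>x\<in>topspace unit_circle. invertible_mat (P x)) \<and>
    (\<forall>g\<in>carrier G. \<forall>x\<in>topspace unit_circle. P (a g x) * c g x = d g x * P x)"
proof -
  let ?I = "top_of_set {0..pi}"
  have HG: "h \<in> carrier G" if "h \<in> H" for h using that by (auto simp: H_def)
  have pm: "(1::complex) \<in> topspace unit_circle" "(-1::complex) \<in> topspace unit_circle" by (simp_all add: topspace_unit_circle)
  have 0: "(0::real) \<in> {0..pi}" "pi \<in> {0..pi}" by auto
  obtain p where p: "p \<in> carrier_mat n n" "invertible_mat p" "\<And>g. g \<in> carrier G \<Longrightarrow> p * c g 1 = d g 1 * p"
    using eq[of 1] unfolding rep_equiv_def by blast
  obtain q where q: "q \<in> carrier_mat n n" "invertible_mat q" "\<And>g. g \<in> carrier G \<Longrightarrow> q * c g (-1) = d g (-1) * q"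
    using eq[of "-1"] unfolding rep_equiv_def by blast
  obtain Q R where Q: "mat_continuous ?I n n Q" "mat_continuous ?I n n R"
    "\<And>t. t \<in> {0..pi} \<Longrightarrow> Q t * R t = 1\<^sub>m n" "\<And>t. t \<in> {0..pi} \<Longrightarrow> R t * Q t = 1\<^sub>m n"
    "\<And>t h. t \<in> {0..pi} \<Longrightarrow> h \<in> H \<Longrightarrow> Q t * c h (cis t) = c h 1 * Q t"
    "\<And>t h. t \<in> {0..pi} \<Longrightarrow> h \<in> H \<Longrightarrow> R t * c h 1 = c h (cis t) * R t" "Q 0 = 1\<^sub>m n" "R 0 = 1\<^sub>m n"
    by (rule H_isotopy[OF c]) (rule that)
  obtain Q' R' where Q': "mat_continuous ?I n n Q'" "mat_continuous ?I n n R'"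
    "\<And>t. t \<in> {0..pi} \<Longrightarrow> Q' t * R' t = 1\<^sub>m n" "\<And>t. t \<in> {0..pi} \<Longrightarrow> R' t * Q' t = 1\<^sub>m n"
    "\<And>t h. t \<in> {0..pi} \<Longrightarrow> h \<in> H \<Longrightarrow> Q' t * d h (cis t) = d h 1 * Q' t"
    "\<And>t h. t \<in> {0..pi} \<Longrightarrow> h \<in> H \<Longrightarrow> R' t * d h 1 = d h (cis t) * R' t" "Q' 0 = 1\<^sub>m n" "R' 0 = 1\<^sub>m n"
    by (rule H_isotopy[OF d]) (rule that)
  have car: "Q t \<in> carrier_mat n n" "R t \<in> carrier_mat n n" "Q' t \<in> carrier_mat n n" "R' t \<in> carrier_mat n n"
    if "t \<in> {0..pi}" for t
    using that Q(1,2) Q'(1,2) mat_continuous_carrier[of ?I n n _ t] by simp_all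
  note car0 = car[OF 0(1)] and carpi = car[OF 0(2)]
  note cc = cocycleD(2)[OF c] and dd = cocycleD(2)[OF d]
  have inv: "invertible_mat (Q t)" "invertible_mat (R t)" "invertible_mat (Q' t)" "invertible_mat (R' t)"
    if "t \<in> {0..pi}" for t
    using invertible_matI[OF car(1)[OF that] car(2)[OF that] Q(3)[OF that]]
      invertible_matI[OF car(2)[OF that] car(1)[OF that] Q(4)[OF that]]
      invertible_matI[OF car(3)[OF that] car(4)[OF that] Q'(3)[OF that]]
      invertible_matI[OF car(4)[OF that] car(3)[OF that] Q'(4)[OF that]] .
  \<comment> \<open>The isomorphism \<open>q\<close> prescribed at \<open>-1\<close>, moved to the
    fibres at 1 along the upper half circle. Like \<open>p\<close>, it intertwines two
    representations of \<open>H\<close> there, so the two values can be joined.\<close>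
  define b where "b = Q' pi * (q * R pi)"
  have qR: "q * R pi \<in> carrier_mat n n" using q(1) carpi by simp
  have b: "b \<in> carrier_mat n n" unfolding b_def using qR carpi by simp
  have binv: "invertible_mat b"
    unfolding b_def by (intro invertible_mat_times[OF inv(3)[OF 0(2)] invertible_mat_times[OF q(2) inv(2)[OF 0(2)] q(1) carpi(2)] carpi(3) qR])
  have bH: "b * c h 1 = d h 1 * b" if h: "h \<in> H" for h
  proof -
    have "q * R pi * c h 1 = d h (-1) * (q * R pi)"
      using Q(6)[OF 0(2) h] q(3)[OF HG[OF h]]
      by (intro intertwine_comp[OF carpi(2) q(1) cc[OF HG[OF h] pm(1)] cc[OF HG[OF h] pm(2)] dd[OF HG[OF h] pm(2)]]) simp_all
    then show ?thesis
      unfolding b_def using Q'(5)[OF 0(2) h]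
      by (intro intertwine_comp[OF qR carpi(3) cc[OF HG[OF h] pm(1)] dd[OF HG[OF h] pm(2)] dd[OF HG[OF h] pm(1)]]) simp_all
  qed
  obtain \<gamma> :: "real \<Rightarrow> complex" where \<gamma>: "continuous_on {0..1} \<gamma>" "\<gamma> 0 = 0" "\<gamma> 1 = 1"
    "\<And>t. t \<in> {0..1} \<Longrightarrow> invertible_mat (p + \<gamma> t \<cdot>\<^sub>m (b - p))"
    by (rule path_in_invertible_pencil[OF p(1,2) b binv]) (rule that)
  \<comment> \<open>All points of the pencil are \<open>H\<close>-intertwiners at 1; the path avoids
    the singular ones and leads from \<open>p\<close> to \<open>b\<close>.\<close>
  define M where "M t = p + \<gamma> (t / pi) \<cdot>\<^sub>m (b - p)" for t
  have M: "M t \<in> carrier_mat n n" "t \<in> {0..pi} \<Longrightarrow> invertible_mat (M t)" for t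
    using p(1) b \<gamma>(4)[of "t / pi"] by (auto simp: M_def)
  have M01: "M 0 = p" "M pi = b"
    using p(1) b by (auto simp: M_def \<gamma>(2,3) intro!: eq_matI)
  have "continuous_on {0..pi} (\<lambda>t. \<gamma> (t / pi))"
    by (intro continuous_on_compose2[OF \<gamma>(1)] continuous_intros) auto
  then have Mc: "mat_continuous ?I n n M"
    unfolding M_def[abs_def] using p(1) b
    by (intro mat_continuous_add mat_continuous_smult mat_continuous_const) auto
  \<comment> \<open>Transport to the fibre at 1, the isomorphism \<open>M t\<close> there, and
    transport back. Its end values are \<open>p\<close> and \<open>q\<close>, because
    \<open>b\<close> was built from \<open>q\<close> by the reverse transports.\<close>
  define N where "N t = R' t * (M t * Q t)" for t
  have Nc: "mat_continuous ?I n n N"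
    unfolding N_def[abs_def] by (intro mat_continuous_mult[OF Q'(2) mat_continuous_mult[OF Mc Q(1)]])
  have N: "N t \<in> carrier_mat n n" if "t \<in> {0..pi}" for t using mat_continuous_carrier[OF Nc] that by simp
  have Ninv: "invertible_mat (N t)" if t: "t \<in> {0..pi}" for t
    unfolding N_def
    by (intro invertible_mat_times[OF inv(4)[OF t] invertible_mat_times[OF M(2)[OF t] inv(1)[OF t] M(1) car(1)[OF t]] car(4)[OF t]]
        mult_carrier_mat[OF M(1) car(1)[OF t]])
  have N0: "N 0 = p" using p(1) by (simp add: N_def M01 Q(7) Q'(8))
  have Npi: "N pi = q"
  proof -
    have "b * Q pi = Q' pi * (q * R pi * Q pi)" unfolding b_def by (rule assoc_mult_mat[OF carpi(3) qR carpi(1)])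
    also have "q * R pi * Q pi = q" using assoc_mult_mat[OF q(1) carpi(2,1)] Q(4)[OF 0(2)] q(1) by simp
    finally have "R' pi * (b * Q pi) = R' pi * Q' pi * q" using assoc_mult_mat[OF carpi(4,3) q(1)] by simp
    then show ?thesis using q(1) by (simp add: N_def M01 Q'(4)[OF 0(2)])
  qed
  have NH: "N t * c h (cis t) = d h (cis t) * N t" if t: "t \<in> {0..pi}" and h: "h \<in> H" for t h
  proof -
    note k = cc[OF HG[OF h] cis_topspace[of t]] cc[OF HG[OF h] pm(1)] dd[OF HG[OF h] cis_topspace[of t]] dd[OF HG[OF h] pm(1)]
    have "M t * c h 1 = d h 1 * M t"
      unfolding M_def by (rule intertwine_pencil[OF p(1) b k(2,4) p(3)[OF HG[OF h]] bH[OF h]])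
    then have "M t * Q t * c h (cis t) = d h 1 * (M t * Q t)"
      by (rule intertwine_comp[OF car(1)[OF t] M(1) k(1,2,4) Q(5)[OF t h]])
    then show ?thesis
      unfolding N_def by (rule intertwine_comp[OF mult_carrier_mat[OF M(1) car(1)[OF t]] car(4)[OF t] k(1,4,3) _ Q'(6)[OF t h]])
  qed
  define tau where "tau z = arccos (Re z)" for z :: complex
  have tau: "tau z \<in> {0..pi}" if "z \<in> topspace unit_circle" for z
    using arccos_Re_range(1)[OF that] by (simp add: tau_def)
  have tau_cnj: "tau (cnj z) = tau z" for z by (simp add: tau_def)
  have cis_tau: "cis (tau z) = z" if "z \<in> topspace unit_circle" "0 \<le> Im z" for z
    using cis_arccos_Re(1)[of z] that by (simp add: tau_def topspace_unit_circle)
  have cnj: "cnj z \<in> topspace unit_circle" if "z \<in> topspace unit_circle" for z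
    using that by (simp add: topspace_unit_circle)
  have real: "z = 1 \<or> z = -1" if "z \<in> topspace unit_circle" "Im z = 0" for z
  proof -
    have "(Re z)\<^sup>2 = 1" using that cmod_power2[of z] by (auto simp: topspace_unit_circle)
    then have "Re z = 1 \<or> Re z = -1" by (simp add: power2_eq_1_iff)
    then show ?thesis using that by (auto simp: complex_eq_iff)
  qed
  have Ngen: "N (tau z) * c g z = d g z * N (tau z)" if "z = 1 \<or> z = -1" "g \<in> carrier G" for z g
    using that p(3) q(3) by (auto simp: tau_def N0 Npi arccos_minus_1)
  have g0a: "a g0 z = cnj z" for z using act_eq[OF g0(1)] g0(2) by simp
  \<comment> \<open>The value on the lower half circle dictated by equivariance under
    \<open>g0\<close>. The factor \<open>c (inv g0) z\<close> is the inverse of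
    \<open>c g0 (cnj z)\<close>.\<close>
  define low where "low z = d g0 (cnj z) * (N (tau z) * c (inv g0) z)" for z
  define P where "P z = (if 0 \<le> Im z then N (tau z) else low z)" for z
  have lowc: "low z \<in> carrier_mat n n" if "z \<in> topspace unit_circle" for z
    unfolding low_def using dd[OF g0(1) cnj[OF that]] cc[OF inv_closed[OF g0(1)] that] N[OF tau[OF that]] by (intro mult_carrier_mat)
  have low: "low (cnj z) * c g0 z = d g0 z * N (tau z)" if z: "z \<in> topspace unit_circle" for z
  proof -
    note k = dd[OF g0(1) z] N[OF tau[OF z]] cc[OF inv_closed[OF g0(1)] cnj[OF z]] cc[OF g0(1) z]
    have "low (cnj z) * c g0 z = d g0 z * (N (tau z) * (c (inv g0) (cnj z) * c g0 z))"
      using k by (simp add: low_def tau_cnj assoc_mult_mat[of _ n n _ n _ n] mult_carrier_mat[of _ n n _ n])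
    then show ?thesis using cocycle_inv(1)[OF c g0(1) z] k(2) by (simp add: g0a)
  qed
  \<comment> \<open>At the two fixed points, both definitions agree precisely because
    \<open>p\<close> and \<open>q\<close> commute with \<open>g0\<close> and not only with
    \<open>H\<close>.\<close>
  have low_real: "low z = N (tau z)" if z: "z = 1 \<or> z = -1" for z
  proof -
    have z': "z \<in> topspace unit_circle" "cnj z = z" using z pm by auto
    note k = dd[OF g0(1) z'(1)] N[OF tau[OF z'(1)]] cc[OF inv_closed[OF g0(1)] z'(1)] cc[OF g0(1) z'(1)]
    have "low z = N (tau z) * c g0 z * c (inv g0) z"
      unfolding low_def z'(2) Ngen[OF z g0(1)] by (rule assoc_mult_mat[symmetric, OF k(1,2,3)])
    also have "\<dots> = N (tau z) * (c g0 z * c (inv g0) z)" by (rule assoc_mult_mat[OF k(2,4,3)])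
    also have "c g0 z * c (inv g0) z = 1\<^sub>m n" using cocycle_inv(2)[OF c g0(1) z'(1)] by (simp add: g0a z'(2))
    finally show ?thesis using k(2) by simp
  qed
  have Pc: "P z \<in> carrier_mat n n" if "z \<in> topspace unit_circle" for z
    using lowc[OF that] N[OF tau[OF that]] by (simp add: P_def)
  have "mat_continuous unit_circle n n P"
    unfolding P_def[abs_def]
  proof (rule mat_continuous_cases_le)
    have "continuous_map unit_circle ?I tau"
      using continuous_map_arccos_Re tau by (auto simp: tau_def[abs_def] continuous_map_in_subtopology)
    from mat_continuous_compose[OF Nc this] have Nt: "mat_continuous unit_circle n n (\<lambda>z. N (tau z))" .
    then show "mat_continuous (subtopology unit_circle {z \<in> topspace unit_circle. 0 \<le> Im z}) n n (\<lambda>z. N (tau z))"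
      by (rule mat_continuous_subtopology)
    have "continuous_map unit_circle unit_circle cnj"
      by (auto simp: unit_circle_def continuous_map_in_subtopology intro!: continuous_intros)
    then have 1: "continuous_map unit_circle (prod_topology T unit_circle) (\<lambda>z. (g0, cnj z))"
      using g0(1) by (intro continuous_map_pairedI) (auto simp: topspace_eq)
    have 2: "continuous_map unit_circle (prod_topology T unit_circle) (\<lambda>z. (inv g0, z))"
      using g0(1) by (intro continuous_map_pairedI) (auto simp: topspace_eq)
    have "mat_continuous unit_circle n n low"
      unfolding low_def[abs_def]
      using mat_continuous_mult[OF mat_continuous_compose[OF cocycleD(1)[OF d] 1] mat_continuous_mult[OF Nt mat_continuous_compose[OF cocycleD(1)[OF c] 2]]]
      by simp
    then show "mat_continuous (subtopology unit_circle {z \<in> topspace unit_circle. Im z \<le> 0}) n n low"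
      by (rule mat_continuous_subtopology)
    show "N (tau z) = low z" if "z \<in> topspace unit_circle" "0 = Im z" for z
      using low_real[OF real[OF that(1)]] that(2) by simp
  qed (simp_all add: continuous_map_complex_circle)
  moreover have "invertible_mat (P z)" if z: "z \<in> topspace unit_circle" for z
  proof (cases "0 \<le> Im z")
    case False
    note ci = cocycle_inv[OF c g0(1) cnj[OF z]] and di = cocycle_inv[OF d g0(1) cnj[OF z]]
    have "invertible_mat (d g0 (cnj z))"
      using di(2) by (intro invertible_matI[OF dd[OF g0(1) cnj[OF z]] dd[OF inv_closed[OF g0(1)] z]]) (simp add: g0a)
    moreover have "invertible_mat (c (inv g0) z)"
      using ci(1) by (intro invertible_matI[OF cc[OF inv_closed[OF g0(1)] z] cc[OF g0(1) cnj[OF z]]]) (simp add: g0a)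
    ultimately have "invertible_mat (low z)"
      unfolding low_def using Ninv[OF tau[OF z]] N[OF tau[OF z]] dd[OF g0(1) cnj[OF z]] cc[OF inv_closed[OF g0(1)] z]
      by (intro invertible_mat_times[of _ _ n] mult_carrier_mat[of _ n n _ n])
    then show ?thesis using False by (simp add: P_def)
  qed (use Ninv[OF tau[OF z]] in \<open>simp add: P_def\<close>)
  moreover have "P (a g z) * c g z = d g z * P z" if g: "g \<in> carrier G" and z: "z \<in> topspace unit_circle" for g z
  proof -
    have up: "P (a g z) * c g z = d g z * P z" if g: "g \<in> carrier G" and z: "z \<in> topspace unit_circle" "0 \<le> Im z" for g z
    proof (cases "g \<in> H")
      case True
      then show ?thesis using NH[OF tau[OF z(1)] True] cis_tau[OF z] z(2) act_eq[OF g] by (simp add: P_def H_def)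
    next
      case False
      then have sgg: "sg g = -1" using sg_cases[OF g] g by (auto simp: H_def)
      then have az: "a g z = cnj z" using act_eq[OF g] by simp
      show ?thesis
      proof (cases "Im z = 0")
        case True
        then show ?thesis using Ngen[OF real[OF z(1)] g] by (simp add: P_def az tau_cnj)
      next
        case im: False
        \<comment> \<open>An element outside \<open>H\<close> is \<open>g0\<close> followed after an
          element of \<open>H\<close>, so equivariance reduces to that of \<open>N\<close> under
          \<open>H\<close> and to \<open>low\<close>.\<close>
        define h where "h = inv g0 \<otimes> g"
        have h: "h \<in> H" using g g0 sgg by (simp add: h_def H_def sg_mult sg_inv)
        have hz: "a h z = z" using act_eq[OF HG[OF h]] h by (simp add: H_def)
        have gh: "g0 \<otimes> h = g" unfolding h_def using g g0(1) by (simp add: m_assoc[symmetric])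
        note k = cc[OF HG[OF h] z(1)] cc[OF g0(1) z(1)] lowc[OF cnj[OF z(1)]] dd[OF HG[OF h] z(1)] dd[OF g0(1) z(1)] N[OF tau[OF z(1)]]
        have "low (cnj z) * c g z = low (cnj z) * (c g0 z * c h z)"
          using cocycleD(4)[OF c g0(1) HG[OF h] z(1)] by (simp add: gh hz)
        also have "\<dots> = d g0 z * N (tau z) * c h z"
          unfolding low[OF z(1), symmetric] using k by (intro assoc_mult_mat[symmetric])
        also have "\<dots> = d g0 z * (N (tau z) * c h z)" using k by (intro assoc_mult_mat)
        also have "N (tau z) * c h z = d h z * N (tau z)" using NH[OF tau[OF z(1)] h] cis_tau[OF z] by simp
        also have "d g0 z * (d h z * N (tau z)) = d g z * N (tau z)"
          using cocycleD(4)[OF d g0(1) HG[OF h] z(1)] assoc_mult_mat[OF k(5,4,6)] by (simp add: gh hz)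
        finally show ?thesis using im z(2) by (simp add: P_def az)
      qed
    qed
    show ?thesis
    proof (cases "0 \<le> Im z")
      case False
      \<comment> \<open>A point of the lower half circle is the image under \<open>g0\<close> of a
        point \<open>w\<close> of the upper one. Equivariance at \<open>w\<close> under
        \<open>g \<otimes> g0\<close> and \<open>g0\<close> gives the claim up to the factor
        \<open>c g0 w\<close>, which is invertible.\<close>
      define w where "w = cnj z"
      have w: "w \<in> topspace unit_circle" "0 \<le> Im w" "a g0 w = z" using cnj[OF z] False by (simp_all add: w_def g0a)
      have gg: "g \<otimes> g0 \<in> carrier G" using g g0(1) by simp
      have agz: "a (g \<otimes> g0) w = a g z" using act_mult[OF g g0(1) w(1)] w(3) by simp
      have az: "a g z \<in> topspace unit_circle" by (rule act_closed[OF g z])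
      note k = cc[OF g z] cc[OF g0(1) w(1)] dd[OF g z] dd[OF g0(1) w(1)] Pc[OF z] Pc[OF w(1)] Pc[OF az] cc[OF inv_closed[OF g0(1)] z]
      have 1: "P z * c g0 w = d g0 w * P w" using up[OF g0(1) w(1,2)] by (simp add: w(3))
      have "P (a g z) * (c g z * c g0 w) = d (g \<otimes> g0) w * P w"
        using up[OF gg w(1,2)] cocycleD(4)[OF c g g0(1) w(1)] by (simp add: agz w(3))
      also have "\<dots> = d g z * (d g0 w * P w)"
        using cocycleD(4)[OF d g g0(1) w(1)] assoc_mult_mat[OF k(3,4,6)] by (simp add: w(3))
      also have "\<dots> = d g z * P z * c g0 w"
        unfolding 1[symmetric] by (rule assoc_mult_mat[symmetric, OF k(3,5,2)])
      finally have e: "P (a g z) * c g z * c g0 w = d g z * P z * c g0 w"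
        using assoc_mult_mat[OF k(7,1,2)] by simp
      have ci: "c g0 w * c (inv g0) z = 1\<^sub>m n" using cocycle_inv(2)[OF c g0(1) w(1)] by (simp add: w(3))
      have "P (a g z) * c g z * (c g0 w * c (inv g0) z) = d g z * P z * (c g0 w * c (inv g0) z)"
        using arg_cong[OF e, of "\<lambda>A. A * c (inv g0) z"]
          assoc_mult_mat[OF mult_carrier_mat[OF k(7,1)] k(2,8)] assoc_mult_mat[OF mult_carrier_mat[OF k(3,5)] k(2,8)] by simp
      then show ?thesis using ci k mult_carrier_mat[OF k(7,1)] mult_carrier_mat[OF k(3,5)] by simp
    qed (rule up[OF g z])
  qed
  ultimately show ?thesis by blast
qed

lemma classified: "classified_gspace G T unit_circle a {1, -1}"
proof unfold_locales
  show "{1, -1} \<subseteq> topspace unit_circle" by (simp add: topspace_unit_circle)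
  show "a g x = x" if "x \<in> {1, -1}" "g \<in> carrier G" for x g using act_eq[OF that(2), of x] that(1) by auto
qed (rule insert_not_empty, rule frame_circle, assumption, rule cocycle_classify, assumption, assumption, blast)

end

section \<open>The reduced K-group and restriction to the fibre at 1\<close>

context circle_reflection
begin

sublocale classified_gspace G T unit_circle a "{1, -1}" by (rule classified)

abbreviation Kred :: "((complex, 'a) vbundle set \<times> (complex, 'a) vbundle set) set ring" where
  "Kred \<equiv> reduced_K G T unit_circle a (-1)"

abbreviation res where
  "res \<equiv> K_fibre G T (1 :: complex)"

abbreviation sgn_class :: "('a \<Rightarrow> complex mat) set" where
  "sgn_class \<equiv> cls (\<lambda>g. sg g \<cdot>\<^sub>m 1\<^sub>m 1)"

lemma smult_mat_one: "(1 :: complex) \<cdot>\<^sub>m A = A"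
  by (rule eq_matI) auto

lemma rep_twist:
  assumes r: "rep n r"
  shows "rep n (\<lambda>g. sg g \<cdot>\<^sub>m r g)"
  unfolding rep_iff
proof (intro conjI ballI)
  show "mat_continuous T n n (\<lambda>g. sg g \<cdot>\<^sub>m r g)" by (rule mat_continuous_smult[OF sg_continuous rep_continuous[OF r]])
  show "sg \<one> \<cdot>\<^sub>m r \<one> = 1\<^sub>m n" by (simp add: sg_one rep_one[OF r] smult_mat_one)
  fix g h assume g: "g \<in> carrier G" and h: "h \<in> carrier G"
  note k = rep_carrier[OF r g] rep_carrier[OF r h]
  show "sg (g \<otimes> h) \<cdot>\<^sub>m r (g \<otimes> h) = sg g \<cdot>\<^sub>m r g * (sg h \<cdot>\<^sub>m r h)"
    unfolding sg_mult[OF g h] rep_mult[OF r g h]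
      mult_smult_assoc_mat[OF k(1) smult_carrier_mat[OF k(2)]] mult_smult_distrib[OF k]
    by (rule eq_matI) (use k in \<open>auto simp: mult.assoc\<close>)
qed

lemma rep_sgn: "rep 1 (\<lambda>g. sg g \<cdot>\<^sub>m 1\<^sub>m 1)"
  using rep_twist[OF rep_triv[of 1]] by (simp add: triv_rep_def)

lemma sgn_class_mem: "sgn_class \<in> carrier Rep"
  by (rule cls_mem[OF rep_sgn])

lemma triv_class_mem: "cls (triv_rep 1) \<in> carrier Rep"
  by (rule cls_mem[OF rep_triv])

lemma kron_mat_scalar:
  assumes "A \<in> carrier_mat n n"
  shows "kron_mat A (c \<cdot>\<^sub>m 1\<^sub>m 1) = c \<cdot>\<^sub>m A"
  using assms by (intro eq_matI) (auto simp: kron_mat_def)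

lemma cls_mult_sgn:
  assumes r: "rep n r"
  shows "cls r \<otimes>\<^bsub>Rep\<^esub> sgn_class = cls (\<lambda>g. sg g \<cdot>\<^sub>m r g)"
proof -
  have "rep (n * 1) (rep_tensor r (\<lambda>g. sg g \<cdot>\<^sub>m 1\<^sub>m 1))" by (rule rep_tensor[OF r rep_sgn])
  then show ?thesis
    unfolding Rep_mult[OF r rep_sgn]
    by (rule cls_cong) (simp add: rep_tensor_def kron_mat_scalar[OF rep_carrier[OF r]] del: One_nat_def)
qed

lemma mult_triv_class:
  assumes "A \<in> carrier Rep"
  shows "A \<otimes>\<^bsub>Rep\<^esub> cls (triv_rep 1) = A"
proof -
  obtain r n where r: "rep n r" "A = cls r" using assms by (rule Rep_carrierE)
  have "kron_mat (r g) (triv_rep 1 g) = r g" if "g \<in> carrier G" for g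
    using rep_carrier[OF r(1) that] kron_mat_scalar[OF rep_carrier[OF r(1) that], of 1]
    by (simp add: triv_rep_def smult_mat_one del: One_nat_def)
  then have "cls (rep_tensor r (triv_rep 1)) = cls r"
    using rep_tensor[OF r(1) rep_triv[of 1]] by (intro cls_cong) (auto simp: rep_tensor_def)
  then show ?thesis unfolding r(2) Rep_mult[OF r(1) rep_triv] .
qed

text \<open>The tensor product of \<open>A\<close> with the complexified Moebius bundle: in the
  frame multiplied by an antiperiodic square root of \<open>1 / z\<close>, the reflection acts
  trivially on that line bundle. Its fibres at 1 and \<open>-1\<close> are the trivial and the sign
  representation.\<close>

lemma moebius_class:
  assumes "A \<in> carrier Rep"
  obtains C where "C \<in> carrier Bun" "Phi 1 C = A" "Phi (-1) C = A \<otimes>\<^bsub>Rep\<^esub> sgn_class"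
proof -
  obtain r n where r: "rep n r" "A = cls r" using assms by (rule Rep_carrierE)
  define k where "k g z = (if sg g = 1 then 1 else z)" for g and z :: complex
  define c where "c g z = k g z \<cdot>\<^sub>m r g" for g and z :: complex
  have c: "cocycle n c"
    unfolding cocycle_def
  proof (intro conjI ballI)
    let ?Z = "prod_topology T unit_circle"
    have id: "continuous_map ?Z euclidean snd"
      using continuous_map_snd[of T unit_circle] unfolding unit_circle_def by (simp add: continuous_map_in_subtopology)
    have s: "continuous_map ?Z euclidean (\<lambda>x. sg (fst x))"
      using continuous_map_compose[OF continuous_map_fst sg_continuous] by (simp add: o_def)
    \<comment> \<open>The case distinction in \<open>k\<close> written as a polynomial in
      \<open>sg\<close> and \<open>z\<close>, which exhibits its continuity.\<close>
    have "continuous_map ?Z euclidean (\<lambda>x. 1 + (1 - sg (fst x)) * (1 / 2) * (snd x - 1))"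
      by (intro continuous_intros s id)
    then have "continuous_map ?Z euclidean (\<lambda>x. k (fst x) (snd x))"
    proof (rule continuous_map_eq)
      fix x assume "x \<in> topspace ?Z"
      then have "fst x \<in> carrier G" by (auto simp: topspace_eq)
      from sg_cases[OF this] show "1 + (1 - sg (fst x)) * (1 / 2) * (snd x - 1) = k (fst x) (snd x)"
        by (auto simp: k_def field_simps)
    qed
    then have "mat_continuous ?Z n n (\<lambda>x. k (fst x) (snd x) \<cdot>\<^sub>m r (fst x))"
      by (rule mat_continuous_smult[OF _ mat_continuous_compose[OF rep_continuous[OF r(1)] continuous_map_fst]])
    then show "mat_continuous ?Z n n (\<lambda>(g, z). c g z)" by (simp add: c_def case_prod_unfold)
    show "c \<one> x = 1\<^sub>m n" for x by (simp add: c_def k_def sg_one rep_one[OF r(1)] smult_mat_one)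
    fix g h x assume g: "g \<in> carrier G" and h: "h \<in> carrier G" and x: "x \<in> topspace unit_circle"
    note m = rep_carrier[OF r(1) g] rep_carrier[OF r(1) h]
    \<comment> \<open>Needed for two elements outside \<open>H\<close>: the second one moves
      \<open>x\<close> to \<open>cnj x\<close>, and the two factors cancel on the unit
      circle.\<close>
    have "cnj x * x = 1" using x complex_norm_square[of x] by (simp add: topspace_unit_circle mult.commute)
    then have "k (g \<otimes> h) x = k g (a h x) * k h x"
      using sg_cases[OF g] sg_cases[OF h] by (auto simp: k_def sg_mult[OF g h] act_eq[OF h])
    then show "c (g \<otimes> h) x = c g (a h x) * c h x"
      unfolding c_def rep_mult[OF r(1) g h] mult_smult_assoc_mat[OF m(1) smult_carrier_mat[OF m(2)]] mult_smult_distrib[OF m]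
      by (intro eq_matI) (use m in \<open>auto simp: mult.assoc\<close>)
  qed
  have F: "1 \<in> {1, -1 :: complex}" "-1 \<in> {1, -1 :: complex}" by auto
  have "cls (\<lambda>g. c g 1) = cls r"
    by (rule cls_cong[OF rep_at_fixed_point[OF c F(1)]]) (use rep_carrier[OF r(1)] in \<open>auto simp: c_def k_def intro!: eq_matI\<close>)
  moreover have "cls (\<lambda>g. c g (-1)) = cls (\<lambda>g. sg g \<cdot>\<^sub>m r g)"
    by (rule cls_cong[OF rep_at_fixed_point[OF c F(2)]]) (auto simp: c_def k_def dest: sg_cases)
  ultimately show thesis
    using that[OF bcl_mem[OF c]] Phi_bcl[OF c F(1)] Phi_bcl[OF c F(2)] cls_mult_sgn[OF r(1)] r(2) by simp
qed

lemma fibres_at_fixed_points: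
  assumes "C \<in> carrier Bun"
  obtains U S where "U \<in> carrier Rep" "S \<in> carrier Rep" "Phi (-1) C = U \<oplus>\<^bsub>Rep\<^esub> S"
    "Phi 1 C = U \<oplus>\<^bsub>Rep\<^esub> S \<otimes>\<^bsub>Rep\<^esub> sgn_class"
proof -
  obtain n c where c: "cocycle n c" "C = bcl n c" using assms by (rule Bun_carrierE)
  have F: "1 \<in> {1, -1 :: complex}" "-1 \<in> {1, -1 :: complex}" by auto
  note r = rep_at_fixed_point[OF c(1) F(1)] rep_at_fixed_point[OF c(1) F(2)]
  obtain Q R where Q: "mat_continuous (top_of_set {0..pi}) n n Q" "mat_continuous (top_of_set {0..pi}) n n R"
    "\<And>t. t \<in> {0..pi} \<Longrightarrow> Q t * R t = 1\<^sub>m n" "\<And>t. t \<in> {0..pi} \<Longrightarrow> R t * Q t = 1\<^sub>m n"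
    "\<And>t h. t \<in> {0..pi} \<Longrightarrow> h \<in> H \<Longrightarrow> Q t * c h (cis t) = c h 1 * Q t"
    "\<And>t h. t \<in> {0..pi} \<Longrightarrow> h \<in> H \<Longrightarrow> R t * c h 1 = c h (cis t) * R t" "Q 0 = 1\<^sub>m n" "R 0 = 1\<^sub>m n"
    by (rule H_isotopy[OF c(1)]) (rule that)
  have pi: "pi \<in> {0..pi}" by simp
  have car: "Q pi \<in> carrier_mat n n" "R pi \<in> carrier_mat n n"
    using mat_continuous_carrier[OF Q(1), of pi] mat_continuous_carrier[OF Q(2), of pi] by simp_all
  \<comment> \<open>\<open>Q pi\<close> is the transport along the upper half circle from the fibre
    at \<open>-1\<close> to the fibre at 1; it is equivariant over \<open>H\<close> only.\<close>
  have "rep_equiv {g \<in> carrier G. sg g = 1} n (\<lambda>g. c g (-1)) (\<lambda>g. c g 1)"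
    unfolding rep_equiv_def
    using Q(5)[OF pi] invertible_matI[OF car Q(3)[OF pi]] by (intro bexI[OF _ car(1)]) (auto simp: H_def)
  from rep_equiv_index_two[OF r(2,1) sg_cases sg_mult g0 this]
  obtain k l u s where u: "n = k + l" "rep k u" "rep l s" "rep l (\<lambda>g. sg g \<cdot>\<^sub>m s g)"
    "rep_equiv (carrier G) n (\<lambda>g. c g (-1)) (rep_sum u s)"
    "rep_equiv (carrier G) n (\<lambda>g. c g 1) (rep_sum u (\<lambda>g. sg g \<cdot>\<^sub>m s g))" by blast
  have "cls (\<lambda>g. c g (-1)) = cls (rep_sum u s)"
    by (rule cls_eqI[OF r(2) _ u(5)]) (use rep_sum[OF u(2,3)] u(1) in simp)
  moreover have "cls (\<lambda>g. c g 1) = cls (rep_sum u (\<lambda>g. sg g \<cdot>\<^sub>m s g))"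
    by (rule cls_eqI[OF r(1) _ u(6)]) (use rep_sum[OF u(2,4)] u(1) in simp)
  ultimately show thesis
    using that[OF cls_mem[OF u(2)] cls_mem[OF u(3)]] Phi_bcl[OF c(1) F(1)] Phi_bcl[OF c(1) F(2)] c(2)
      Rep_add[OF u(2,3)] Rep_add[OF u(2,4)] cls_mult_sgn[OF u(3)] by simp
qed

lemma K_ring_eq: "K_ring G T unit_circle a = groth_ring Bun"
  by (simp add: K_ring_def)

lemma Kred_carrierE:
  assumes "\<xi> \<in> carrier Kred"
  obtains C D where "C \<in> carrier Bun" "D \<in> carrier Bun" "Phi (-1) C = Phi (-1) D" "\<xi> = groth_diff Bun C D"
proof -
  have \<xi>: "\<xi> \<in> carrier (groth_ring Bun)"
    "K_restrict G T unit_circle a {-1} \<xi> = \<zero>\<^bsub>K_ring G T (subtopology unit_circle {-1}) a\<^esub>"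
    using assms by (simp_all add: reduced_K_def a_kernel_def' K_ring_eq)
  obtain C D where C: "C \<in> carrier Bun" "D \<in> carrier Bun" "\<xi> = groth_diff Bun C D"
    using \<xi>(1) by (rule Bun.groth_carrierE)
  then show thesis using that K_restrict_groth_diff[of "-1" C D] \<xi>(2) by simp
qed

lemma Kred_mem:
  assumes "C \<in> carrier Bun" "D \<in> carrier Bun" "Phi (-1) C = Phi (-1) D"
  shows "groth_diff Bun C D \<in> carrier Kred"
  using K_restrict_groth_diff[of "-1" C D] assms Bun.groth_diff_mem[OF assms(1,2)]
  by (simp add: reduced_K_def a_kernel_def' K_ring_eq)

lemma Kred_ops:
  "x \<oplus>\<^bsub>Kred\<^esub> y = x \<oplus>\<^bsub>groth_ring Bun\<^esub> y" "x \<otimes>\<^bsub>Kred\<^esub> y = x \<otimes>\<^bsub>groth_ring Bun\<^esub> y"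
  "\<zero>\<^bsub>Kred\<^esub> = \<zero>\<^bsub>groth_ring Bun\<^esub>" "[m] \<cdot>\<^bsub>Kred\<^esub> x = [m] \<cdot>\<^bsub>groth_ring Bun\<^esub> x" for m :: nat
  by (simp_all add: reduced_K_def K_ring_eq add_pow_def nat_pow_def)

lemma res_groth_diff:
  "C \<in> carrier Bun \<Longrightarrow> D \<in> carrier Bun \<Longrightarrow> res (groth_diff Bun C D) = groth_diff Rep (Phi 1 C) (Phi 1 D)"
  by (rule K_fibre_groth_diff) simp_all

lemma Phi1_mem: "C \<in> carrier Bun \<Longrightarrow> Phi 1 C \<in> carrier Rep" "C \<in> carrier Bun \<Longrightarrow> Phi (-1) C \<in> carrier Rep"
  by (rule Phi_mem; simp)+

lemma res_mem:
  assumes "\<xi> \<in> carrier Kred"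
  shows "res \<xi> \<in> carrier (rep_ring G T)"
proof -
  obtain C D where C: "C \<in> carrier Bun" "D \<in> carrier Bun" "\<xi> = groth_diff Bun C D" using assms by (rule Kred_carrierE)
  show ?thesis
    unfolding C(3) res_groth_diff[OF C(1,2)] rep_ring_def by (rule Rep.groth_diff_mem[OF Phi1_mem(1)[OF C(1)] Phi1_mem(1)[OF C(2)]])
qed

lemma res_add:
  assumes "\<xi> \<in> carrier Kred" "\<eta> \<in> carrier Kred"
  shows "res (\<xi> \<oplus>\<^bsub>Kred\<^esub> \<eta>) = res \<xi> \<oplus>\<^bsub>rep_ring G T\<^esub> res \<eta>"
proof -
  obtain C D where C: "C \<in> carrier Bun" "D \<in> carrier Bun" "\<xi> = groth_diff Bun C D" using assms(1) by (rule Kred_carrierE)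
  obtain A B where A: "A \<in> carrier Bun" "B \<in> carrier Bun" "\<eta> = groth_diff Bun A B" using assms(2) by (rule Kred_carrierE)
  show ?thesis
    unfolding Kred_ops C(3) A(3) rep_ring_def
    by (simp only: Bun.groth_add C A res_groth_diff Bun_closed Rep.groth_add Phi1_mem Phi_add[of _ _ 1] insertI1)
qed

lemma res_groth_mult:
  assumes c: "A \<in> carrier Bun" "B \<in> carrier Bun" "C \<in> carrier Bun" "D \<in> carrier Bun"
  shows "res (groth_diff Bun A B \<otimes>\<^bsub>groth_ring Bun\<^esub> groth_diff Bun C D) =
    groth_diff Rep (Phi 1 A) (Phi 1 B) \<otimes>\<^bsub>rep_ring G T\<^esub> groth_diff Rep (Phi 1 C) (Phi 1 D)"
  unfolding rep_ring_def
  by (simp only: Bun.groth_mult c res_groth_diff Bun_closed Rep.groth_mult Phi1_mem Phi_add[of _ _ 1] Phi_mult[of _ _ 1] insertI1)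

lemma res_mult:
  assumes "\<xi> \<in> carrier Kred" "\<eta> \<in> carrier Kred"
  shows "res (\<xi> \<otimes>\<^bsub>Kred\<^esub> \<eta>) = res \<xi> \<otimes>\<^bsub>rep_ring G T\<^esub> res \<eta>"
proof -
  obtain C D where C: "C \<in> carrier Bun" "D \<in> carrier Bun" "\<xi> = groth_diff Bun C D" using assms(1) by (rule Kred_carrierE)
  obtain A B where A: "A \<in> carrier Bun" "B \<in> carrier Bun" "\<eta> = groth_diff Bun A B" using assms(2) by (rule Kred_carrierE)
  show ?thesis unfolding Kred_ops C(3) A(3) by (simp only: res_groth_mult res_groth_diff C A)
qed

lemma K_smult_res:
  assumes \<alpha>: "\<alpha> \<in> carrier (rep_ring G T)" and \<xi>: "\<xi> \<in> carrier Kred"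
  shows "K_smult G T unit_circle a \<alpha> \<xi> \<in> carrier Kred"
    and "res (K_smult G T unit_circle a \<alpha> \<xi>) = \<alpha> \<otimes>\<^bsub>rep_ring G T\<^esub> res \<xi>"
proof -
  obtain C D where C: "C \<in> carrier Bun" "D \<in> carrier Bun" "Phi (-1) C = Phi (-1) D" "\<xi> = groth_diff Bun C D"
    using \<xi> by (rule Kred_carrierE)
  obtain c d where c: "c \<in> carrier Rep" "d \<in> carrier Rep" "\<alpha> = groth_diff Rep c d"
    using \<alpha> unfolding rep_ring_def by (rule Rep.groth_carrierE)
  let ?c = "product_class c" and ?d = "product_class d"
  note m = product_class_mem[OF c(1)] product_class_mem[OF c(2)]
  have eq: "K_smult G T unit_circle a \<alpha> \<xi> = groth_diff Bun ?c ?d \<otimes>\<^bsub>groth_ring Bun\<^esub> groth_diff Bun C D"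
    unfolding K_smult_def K_ring_eq c(3) C(4) K_scalar_groth_diff[OF c(1,2)] ..
  have F: "-1 \<in> {1, -1 :: complex}" by simp
  show "K_smult G T unit_circle a \<alpha> \<xi> \<in> carrier Kred"
    unfolding eq Bun.groth_mult[OF m C(1,2)]
    by (rule Kred_mem) (simp_all only: Bun_closed m C Phi_add[OF _ _ F] Phi_mult[OF _ _ F])
  show "res (K_smult G T unit_circle a \<alpha> \<xi>) = \<alpha> \<otimes>\<^bsub>rep_ring G T\<^esub> res \<xi>"
    unfolding eq res_groth_mult[OF m C(1,2)] unfolding C(4) res_groth_diff[OF C(1,2)]
    by (simp only: Phi_product_class c insertI1)
qed

text \<open>Both elements vanish at \<open>-1\<close>, where the required equality of fibres is
  automatic; at 1 it follows from the hypothesis, since \<open>Rep\<close> is cancellative.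
  Agreement at both fixed points suffices.\<close>

lemma res_inj: "inj_on res (carrier Kred)"
proof (rule inj_onI)
  fix \<xi> \<eta> assume \<xi>: "\<xi> \<in> carrier Kred" and \<eta>: "\<eta> \<in> carrier Kred" and eq: "res \<xi> = res \<eta>"
  obtain C D where C: "C \<in> carrier Bun" "D \<in> carrier Bun" "Phi (-1) C = Phi (-1) D" "\<xi> = groth_diff Bun C D"
    using \<xi> by (rule Kred_carrierE)
  obtain A B where A: "A \<in> carrier Bun" "B \<in> carrier Bun" "Phi (-1) A = Phi (-1) B" "\<eta> = groth_diff Bun A B"
    using \<eta> by (rule Kred_carrierE)
  note m = Phi1_mem[OF C(1)] Phi1_mem[OF C(2)] Phi1_mem[OF A(1)] Phi1_mem[OF A(2)]
  have 1: "Phi 1 C \<oplus>\<^bsub>Rep\<^esub> Phi 1 B = Phi 1 A \<oplus>\<^bsub>Rep\<^esub> Phi 1 D"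
    using eq Rep_groth_diff_eq_iff[OF m(1,3,5,7)] unfolding C(4) A(4) res_groth_diff[OF C(1,2)] res_groth_diff[OF A(1,2)] by simp
  have 2: "Phi (-1) C \<oplus>\<^bsub>Rep\<^esub> Phi (-1) B = Phi (-1) A \<oplus>\<^bsub>Rep\<^esub> Phi (-1) D"
    unfolding A(3) C(3) by (rule Rep.a_comm[OF m(4,8)])
  show "\<xi> = \<eta>" unfolding C(4) A(4)
    by (rule Bun_groth_diff_eqI[OF C(1,2) A(1,2)]) (use 1 2 in \<open>elim insertE emptyE; simp only:\<close>)
qed

lemma res_image:
  "res ` carrier Kred = {x \<otimes>\<^bsub>rep_ring G T\<^esub> groth_diff Rep (cls (triv_rep 1)) sgn_class | x. x \<in> carrier (rep_ring G T)}"
proof (rule subset_antisym; rule subsetI)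
  note e = triv_class_mem sgn_class_mem
  let ?tw = "\<lambda>A. A \<otimes>\<^bsub>Rep\<^esub> sgn_class"
  \<comment> \<open>With \<sigma> the sign class,
    \<open>(A - B)(1 - \<sigma>) = (A + B \<sigma>) - (A \<sigma> + B)\<close>.\<close>
  have prod: "groth_diff Rep A B \<otimes>\<^bsub>rep_ring G T\<^esub> groth_diff Rep (cls (triv_rep 1)) sgn_class =
      groth_diff Rep (A \<oplus>\<^bsub>Rep\<^esub> ?tw B) (?tw A \<oplus>\<^bsub>Rep\<^esub> B)" if "A \<in> carrier Rep" "B \<in> carrier Rep" for A B
    unfolding rep_ring_def by (simp only: Rep.groth_mult that e mult_triv_class)
  have tw: "?tw A \<in> carrier Rep" if "A \<in> carrier Rep" for A by (rule Rep.m_closed[OF that e(2)])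
  fix y
  {
    assume "y \<in> res ` carrier Kred"
    then obtain \<xi> where \<xi>: "\<xi> \<in> carrier Kred" "y = res \<xi>" by blast
    obtain C D where C: "C \<in> carrier Bun" "D \<in> carrier Bun" "Phi (-1) C = Phi (-1) D" "\<xi> = groth_diff Bun C D"
      using \<xi>(1) by (rule Kred_carrierE)
    obtain U S where U: "U \<in> carrier Rep" "S \<in> carrier Rep" "Phi (-1) C = U \<oplus>\<^bsub>Rep\<^esub> S" "Phi 1 C = U \<oplus>\<^bsub>Rep\<^esub> ?tw S"
      using C(1) by (rule fibres_at_fixed_points)
    obtain U' S' where U': "U' \<in> carrier Rep" "S' \<in> carrier Rep" "Phi (-1) D = U' \<oplus>\<^bsub>Rep\<^esub> S'" "Phi 1 D = U' \<oplus>\<^bsub>Rep\<^esub> ?tw S'"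
      using C(2) by (rule fibres_at_fixed_points)
    note m = U(1,2) U'(1,2) tw[OF U(2)] tw[OF U'(2)]
    have us: "U \<oplus>\<^bsub>Rep\<^esub> S = U' \<oplus>\<^bsub>Rep\<^esub> S'" using C(3) U(3) U'(3) by simp
    \<comment> \<open>Since \<open>U + S = U' + S'\<close>, the difference of the fibres at 1 is
      \<open>(U - U') + (S - S') \<sigma> = (S' - S)(1 - \<sigma>)\<close>, with \<sigma> the sign
      class; this is the multiplier \<open>S' - S\<close> used below.\<close>
    have "(U \<oplus>\<^bsub>Rep\<^esub> ?tw S) \<oplus>\<^bsub>Rep\<^esub> (?tw S' \<oplus>\<^bsub>Rep\<^esub> S) = (U \<oplus>\<^bsub>Rep\<^esub> S) \<oplus>\<^bsub>Rep\<^esub> (?tw S \<oplus>\<^bsub>Rep\<^esub> ?tw S')"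
      using m by (simp only: Rep.a_ac Rep.a_closed)
    also have "\<dots> = (S' \<oplus>\<^bsub>Rep\<^esub> ?tw S) \<oplus>\<^bsub>Rep\<^esub> (U' \<oplus>\<^bsub>Rep\<^esub> ?tw S')"
      unfolding us using m by (simp only: Rep.a_ac Rep.a_closed)
    finally have "y = groth_diff Rep (S' \<oplus>\<^bsub>Rep\<^esub> ?tw S) (?tw S' \<oplus>\<^bsub>Rep\<^esub> S)"
      unfolding \<xi>(2) C(4) res_groth_diff[OF C(1,2)] U(4) U'(4)
      by (intro Rep.groth_diff_eqI Rep.a_closed m)
    also have "\<dots> = groth_diff Rep S' S \<otimes>\<^bsub>rep_ring G T\<^esub> groth_diff Rep (cls (triv_rep 1)) sgn_class"
      by (rule prod[symmetric, OF m(4,2)])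
    finally show "y \<in> {x \<otimes>\<^bsub>rep_ring G T\<^esub> groth_diff Rep (cls (triv_rep 1)) sgn_class | x. x \<in> carrier (rep_ring G T)}"
      using Rep.groth_diff_mem[OF m(4,2)] unfolding rep_ring_def by blast
  next
    assume "y \<in> {x \<otimes>\<^bsub>rep_ring G T\<^esub> groth_diff Rep (cls (triv_rep 1)) sgn_class | x. x \<in> carrier (rep_ring G T)}"
    then obtain x where x: "x \<in> carrier (groth_ring Rep)" "y = x \<otimes>\<^bsub>rep_ring G T\<^esub> groth_diff Rep (cls (triv_rep 1)) sgn_class"
      unfolding rep_ring_def by blast
    obtain A B where A: "A \<in> carrier Rep" "B \<in> carrier Rep" "x = groth_diff Rep A B" using x(1) by (rule Rep.groth_carrierE)
    obtain M where M: "M \<in> carrier Bun" "Phi 1 M = A" "Phi (-1) M = ?tw A" using A(1) by (rule moebius_class)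
    obtain N where N: "N \<in> carrier Bun" "Phi 1 N = B" "Phi (-1) N = ?tw B" using A(2) by (rule moebius_class)
    \<comment> \<open>Product bundles that correct the fibres of \<open>M\<close> and
      \<open>N\<close> at \<open>-1\<close>: the formal difference
      \<open>(M + ?B) - (?A + N)\<close> vanishes there, and its value at 1 is the expression in
      \<open>prod\<close>.\<close>
    let ?A = "product_class (?tw A)" and ?B = "product_class (?tw B)"
    note m = product_class_mem[OF tw[OF A(1)]] product_class_mem[OF tw[OF A(2)]]
    have F: "1 \<in> {1, -1 :: complex}" "-1 \<in> {1, -1 :: complex}" by auto
    have "groth_diff Bun (M \<oplus>\<^bsub>Bun\<^esub> ?B) (?A \<oplus>\<^bsub>Bun\<^esub> N) \<in> carrier Kred"
      by (rule Kred_mem) (simp_all only: Bun_closed m M N Phi_add[OF _ _ F(2)] Phi_product_class[OF _ F(2)] tw A)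
    moreover have "res (groth_diff Bun (M \<oplus>\<^bsub>Bun\<^esub> ?B) (?A \<oplus>\<^bsub>Bun\<^esub> N)) = y"
      unfolding x(2) A(3) prod[OF A(1,2)]
      by (simp only: res_groth_diff Bun_closed m M N Phi_add[OF _ _ F(1)] Phi_product_class[OF _ F(1)] tw A)
    ultimately show "y \<in> res ` carrier Kred" by blast
  }
qed

text \<open>If \<open>m\<close> times \<open>C - D\<close> vanishes, the multiples of
  \<open>C\<close> and \<open>D\<close> are stably isomorphic. Their fibres at 1 are then isomorphic
  by cancellation, and torsion-freeness of \<open>Rep\<close> removes the factor \<open>m\<close>.
  As the fibres at \<open>-1\<close> agree from the start, \<open>C = D\<close>.\<close>

lemma Kred_torsion_free:
  fixes m :: nat
  assumes \<xi>: "\<xi> \<in> carrier Kred" and m: "m > 0" and zero: "[m] \<cdot>\<^bsub>Kred\<^esub> \<xi> = \<zero>\<^bsub>Kred\<^esub>"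
  shows "\<xi> = \<zero>\<^bsub>Kred\<^esub>"
proof -
  obtain C D where C: "C \<in> carrier Bun" "D \<in> carrier Bun" "Phi (-1) C = Phi (-1) D" "\<xi> = groth_diff Bun C D"
    using \<xi> by (rule Kred_carrierE)
  have F: "1 \<in> {1, -1 :: complex}" by auto
  have pow: "Phi 1 ([k] \<cdot>\<^bsub>Bun\<^esub> E) = [k] \<cdot>\<^bsub>Rep\<^esub> Phi 1 E" if E: "E \<in> carrier Bun" for E and k :: nat
  proof (induction k)
    case 0
    show ?case unfolding Bun.add.nat_pow_0 Rep.add.nat_pow_0 by (rule Phi_zero[OF F])
  next
    case (Suc k)
    show ?case
      unfolding Bun.add.nat_pow_Suc Rep.add.nat_pow_Suc Phi_add[OF Bun.add.nat_pow_closed[OF E] E F] Suc.IH ..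
  qed
  have mC: "[m] \<cdot>\<^bsub>Bun\<^esub> C \<in> carrier Bun" "[m] \<cdot>\<^bsub>Bun\<^esub> D \<in> carrier Bun"
    by (rule Bun.add.nat_pow_closed[OF C(1)], rule Bun.add.nat_pow_closed[OF C(2)])
  have "groth_diff Bun ([m] \<cdot>\<^bsub>Bun\<^esub> C) ([m] \<cdot>\<^bsub>Bun\<^esub> D) = \<zero>\<^bsub>groth_ring Bun\<^esub>"
    using zero unfolding Kred_ops C(4) Bun.groth_nat_pow[OF C(1,2)] .
  then obtain k where k: "k \<in> carrier Bun" "[m] \<cdot>\<^bsub>Bun\<^esub> C \<oplus>\<^bsub>Bun\<^esub> k = [m] \<cdot>\<^bsub>Bun\<^esub> D \<oplus>\<^bsub>Bun\<^esub> k"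
    unfolding Bun.groth_diff_eq_zero_iff[OF mC] by blast
  note r = Phi1_mem(1)[OF C(1)] Phi1_mem(1)[OF C(2)] Phi1_mem(1)[OF k(1)]
  note rm = Phi1_mem(1)[OF mC(1), unfolded pow[OF C(1)]] Phi1_mem(1)[OF mC(2), unfolded pow[OF C(2)]]
  have "[m] \<cdot>\<^bsub>Rep\<^esub> Phi 1 C \<oplus>\<^bsub>Rep\<^esub> Phi 1 k = [m] \<cdot>\<^bsub>Rep\<^esub> Phi 1 D \<oplus>\<^bsub>Rep\<^esub> Phi 1 k"
    using Phi_add[OF mC(1) k(1) F] Phi_add[OF mC(2) k(1) F] unfolding k(2) pow[OF C(1)] pow[OF C(2)] by simp
  then have "[m] \<cdot>\<^bsub>Rep\<^esub> Phi 1 C = [m] \<cdot>\<^bsub>Rep\<^esub> Phi 1 D"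
    using Rep_cancel[OF rm r(3)] unfolding Rep.a_comm[OF rm(1) r(3)] Rep.a_comm[OF rm(2) r(3)] by simp
  then have "Phi 1 C = Phi 1 D" by (rule Rep_torsion_free[OF r(1,2) m])
  then have "C = D" by (intro Phi_inj[OF C(1,2)]) (use C(3) in \<open>elim insertE emptyE; simp only:\<close>)
  then show ?thesis
    unfolding C(4) Kred_ops using Bun.groth_diff_eq_zero_iff[OF C(2,2)] Bun_zero_closed by blast
qed

end

section \<open>The action through the reflection group of order two\<close>

lemma D1_entries:
  "(Finite_Cartesian_Product.mat 1 :: real^2^2) $ 2 $ 2 = 1" "x_axis_reflection $ 2 $ 2 = -1"
  "x_axis_reflection \<noteq> Finite_Cartesian_Product.mat 1" "x_axis_reflection ** x_axis_reflection = Finite_Cartesian_Product.mat 1"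
proof -
  show e: "(Finite_Cartesian_Product.mat 1 :: real^2^2) $ 2 $ 2 = 1" "x_axis_reflection $ 2 $ 2 = -1"
    by (simp_all add: x_axis_reflection_def Finite_Cartesian_Product.mat_def)
  show "x_axis_reflection \<noteq> Finite_Cartesian_Product.mat 1" using e by fastforce
  show "x_axis_reflection ** x_axis_reflection = Finite_Cartesian_Product.mat 1"
    unfolding Finite_Cartesian_Product.vec_eq_iff forall_2
    by (simp add: matrix_matrix_mult_def sum_2 x_axis_reflection_def Finite_Cartesian_Product.mat_def)
qed

lemma circle_act_D1:
  "\<rho> g = Finite_Cartesian_Product.mat 1 \<Longrightarrow> circle_act \<rho> g z = z"
  "\<rho> g = x_axis_reflection \<Longrightarrow> circle_act \<rho> g z = cnj z"
  by (simp_all add: circle_act_def complex_eq_iff matrix_vector_mult_def sum_2 x_axis_reflection_def Finite_Cartesian_Product.mat_def)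

theorem theorem10p1:
  fixes G :: "('g, 'm) monoid_scheme"
    and T :: "'g topology"
    and n :: nat
    and \<A> :: "'g chart set"
    and \<rho> :: "'g \<Rightarrow> real^2^2"
  assumes "compact_lie_group G T n \<A>"
    and "orthogonal_rep G T \<rho>"
    and "\<rho> ` carrier G = D1"
  defines "K \<equiv> reduced_K G T unit_circle (circle_act \<rho>) (-1)"
    and "R \<equiv> rep_ring G T"
    and "res \<equiv> K_fibre G T (1 :: complex)"
  shows "res \<in> hom (add_monoid K) (add_monoid R) \<and>
         res \<in> hom K R \<and>
         (\<forall>\<alpha>\<in>carrier R. \<forall>\<xi>\<in>carrier K.
            K_smult G T unit_circle (circle_act \<rho>) \<alpha> \<xi> \<in> carrier K \<and>
            res (K_smult G T unit_circle (circle_act \<rho>) \<alpha> \<xi>) = \<alpha> \<otimes>\<^bsub>R\<^esub> res \<xi>) \<and>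
         inj_on res (carrier K) \<and>
         res ` carrier K = PIdl\<^bsub>R\<^esub> (rep_elem G T (C_plus \<rho>) \<ominus>\<^bsub>R\<^esub> rep_elem G T (C_minus \<rho>)) \<and>
         (\<forall>\<xi>\<in>carrier K. \<forall>m::nat. m > 0 \<longrightarrow> [m] \<cdot>\<^bsub>K\<^esub> \<xi> = \<zero>\<^bsub>K\<^esub> \<longrightarrow> \<xi> = \<zero>\<^bsub>K\<^esub>)"
proof -
  interpret L: compact_lie_group G T n \<A> by fact
  interpret compact_group G T
    by unfold_locales (rule L.topspace_eq L.compact L.continuous_inv)+
  have hom: "\<rho> \<in> hom G O2" and cont: "continuous_map T euclidean \<rho>"
    using assms(2) by (simp_all add: orthogonal_rep_def)
  have \<rho>_mult: "\<rho> (g \<otimes>\<^bsub>G\<^esub> h) = \<rho> g ** \<rho> h" if "g \<in> carrier G" "h \<in> carrier G" for g h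
    using hom_mult[OF hom that] by (simp add: O2_def)
  have \<rho>_cases: "\<rho> g = Finite_Cartesian_Product.mat 1 \<or> \<rho> g = x_axis_reflection" if "g \<in> carrier G" for g
    using imageI[OF that, of \<rho>] unfolding assms(3) D1_def by (simp add: disj_commute)
  have "x_axis_reflection \<in> \<rho> ` carrier G" unfolding assms(3) D1_def by simp
  then obtain g0 where g0: "g0 \<in> carrier G" "\<rho> g0 = x_axis_reflection"
    by (elim imageE) (rule that, assumption, rule sym)
  \<comment> \<open>The lower right entry separates the two elements of \<open>D1\<close> and is
    multiplicative on \<open>D1\<close>. Taking it as the sign character makes continuity immediate
    from that of \<open>\<rho>\<close>.\<close>
  define sg :: "'g \<Rightarrow> complex" where "sg g = of_real (\<rho> g $ 2 $ 2)" for g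
  have sg: "sg g = (if \<rho> g = Finite_Cartesian_Product.mat 1 then 1 else -1)" if "g \<in> carrier G" for g
    using \<rho>_cases[OF that] by (auto simp: sg_def D1_entries)
  have sg_cont: "continuous_map T euclidean sg"
  proof -
    have "continuous_map euclidean euclidean (\<lambda>A :: real^2^2. complex_of_real (A $ 2 $ 2))"
      by (simp add: continuous_intros)
    from continuous_map_compose[OF cont this] show ?thesis by (simp add: o_def sg_def[abs_def])
  qed
  have sg_mult: "sg (g \<otimes>\<^bsub>G\<^esub> h) = sg g * sg h" if "g \<in> carrier G" "h \<in> carrier G" for g h
    using \<rho>_cases[OF that(1)] \<rho>_cases[OF that(2)] by (auto simp: sg_def \<rho>_mult[OF that] D1_entries)
  have act: "circle_act \<rho> g z = (if sg g = 1 then z else cnj z)" if "g \<in> carrier G" for g z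
    using \<rho>_cases[OF that] circle_act_D1[of \<rho> g z] by (auto simp: sg_def D1_entries)
  interpret circle_reflection G T "circle_act \<rho>" sg g0
  proof unfold_locales
    let ?Z = "prod_topology T unit_circle"
    show "continuous_map ?Z unit_circle (\<lambda>(g, x). circle_act \<rho> g x)"
    proof (rule continuous_map_eq)
      have z: "continuous_map ?Z euclidean snd"
        using continuous_map_snd[of T unit_circle] unfolding unit_circle_def by (simp add: continuous_map_in_subtopology)
      have s: "continuous_map ?Z euclidean (\<lambda>p. sg (fst p))"
        using continuous_map_compose[OF continuous_map_fst sg_cont] by (simp add: o_def)
      have c: "continuous_map ?Z euclidean (\<lambda>p. cnj (snd p))"
        using continuous_map_compose[OF z, of euclidean cnj] by (simp add: o_def continuous_intros)
      \<comment> \<open>Interpolation between \<open>z\<close> and \<open>cnj z\<close> with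
        coefficients depending on the sign: it agrees with the action for both values of
        \<open>sg\<close> and is visibly continuous in the group element and the point
        together.\<close>
      have "continuous_map ?Z euclidean (\<lambda>p. (1 + sg (fst p)) * (1 / 2) * snd p + (1 - sg (fst p)) * (1 / 2) * cnj (snd p))"
        by (intro continuous_intros s z c)
      moreover have eq: "(1 + sg (fst p)) * (1 / 2) * snd p + (1 - sg (fst p)) * (1 / 2) * cnj (snd p) = circle_act \<rho> (fst p) (snd p)"
        if "p \<in> topspace ?Z" for p
      proof -
        have "fst p \<in> carrier G" using that by (auto simp: topspace_eq)
        from sg[OF this] act[OF this, of "snd p"] show ?thesis by (auto split: if_splits)
      qed
      moreover have "circle_act \<rho> (fst p) (snd p) \<in> sphere 0 1" if "p \<in> topspace ?Z" for p
        using that act[of "fst p" "snd p"] by (auto simp: topspace_eq topspace_unit_circle)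
      ultimately show "continuous_map ?Z unit_circle
          (\<lambda>p. (1 + sg (fst p)) * (1 / 2) * snd p + (1 - sg (fst p)) * (1 / 2) * cnj (snd p))"
        unfolding unit_circle_def continuous_map_in_subtopology by (simp add: Pi_iff unit_circle_def)
      show "(1 + sg (fst p)) * (1 / 2) * snd p + (1 - sg (fst p)) * (1 / 2) * cnj (snd p) = (case p of (g, x) \<Rightarrow> circle_act \<rho> g x)"
        if "p \<in> topspace ?Z" for p
        using eq[OF that] by (simp add: case_prod_unfold)
    qed
    show "circle_act \<rho> \<one>\<^bsub>G\<^esub> x = x" for x
      using act[OF L.one_closed, of x] sg_mult[OF L.one_closed L.one_closed] sg[OF L.one_closed] by (auto split: if_splits)
    show "circle_act \<rho> (g \<otimes>\<^bsub>G\<^esub> h) x = circle_act \<rho> g (circle_act \<rho> h x)" if "g \<in> carrier G" "h \<in> carrier G" for g h x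
      using sg[OF that(1)] sg[OF that(2)] by (simp add: act that sg_mult)
    show "sg g = 1 \<or> sg g = -1" if "g \<in> carrier G" for g using sg[OF that] by simp
    show "sg g0 = -1" using sg[OF g0(1)] g0(2) D1_entries(3) by simp
  qed (fact sg_mult sg_cont g0(1) act)+
  have elem: "rep_elem G T (C_plus \<rho>) = groth_diff Rep (cls (triv_rep 1)) \<zero>\<^bsub>Rep\<^esub>"
    "rep_elem G T (C_minus \<rho>) = groth_diff Rep sgn_class \<zero>\<^bsub>Rep\<^esub>"
  proof -
    have "C_plus \<rho> = triv_rep 1" by (simp add: C_plus_def triv_rep_def)
    then show "rep_elem G T (C_plus \<rho>) = groth_diff Rep (cls (triv_rep 1)) \<zero>\<^bsub>Rep\<^esub>"
      by (simp add: rep_elem_def groth_of_def)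
    have "sg g \<cdot>\<^sub>m 1\<^sub>m 1 = C_minus \<rho> g" if "g \<in> carrier G" for g
      unfolding sg[OF that] C_minus_def by (auto intro!: eq_matI)
    then have "sgn_class = cls (C_minus \<rho>)" by (rule cls_cong[OF rep_sgn])
    then show "rep_elem G T (C_minus \<rho>) = groth_diff Rep sgn_class \<zero>\<^bsub>Rep\<^esub>"
      by (simp add: rep_elem_def groth_of_def)
  qed
  have "rep_elem G T (C_plus \<rho>) \<ominus>\<^bsub>R\<^esub> rep_elem G T (C_minus \<rho>) = groth_diff Rep (cls (triv_rep 1)) sgn_class"
    unfolding elem R_def rep_ring_def Rep.groth_minus[OF triv_class_mem Rep.zero_closed sgn_class_mem Rep.zero_closed]
    using triv_class_mem sgn_class_mem by simp
  then have image: "res ` carrier K = PIdl\<^bsub>R\<^esub> (rep_elem G T (C_plus \<rho>) \<ominus>\<^bsub>R\<^esub> rep_elem G T (C_minus \<rho>))"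
    unfolding cgenideal_def K_def R_def res_def res_image by simp
  have hom_add: "res \<in> hom (add_monoid K) (add_monoid R)"
    unfolding hom_def K_def R_def res_def
    by (intro CollectI conjI funcsetI ballI) (simp_all add: res_mem res_add)
  have hom_mult: "res \<in> hom K R"
    unfolding hom_def K_def R_def res_def
    by (intro CollectI conjI funcsetI ballI) (simp_all only: res_mem res_mult)
  have smult: "\<forall>\<alpha>\<in>carrier R. \<forall>\<xi>\<in>carrier K.
            K_smult G T unit_circle (circle_act \<rho>) \<alpha> \<xi> \<in> carrier K \<and>
            res (K_smult G T unit_circle (circle_act \<rho>) \<alpha> \<xi>) = \<alpha> \<otimes>\<^bsub>R\<^esub> res \<xi>"
    unfolding K_def R_def res_def by (intro ballI conjI K_smult_res)
  have inj: "inj_on res (carrier K)"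
    unfolding K_def res_def by (rule res_inj)
  have torsion_free: "\<forall>\<xi>\<in>carrier K. \<forall>m::nat. m > 0 \<longrightarrow> [m] \<cdot>\<^bsub>K\<^esub> \<xi> = \<zero>\<^bsub>K\<^esub> \<longrightarrow> \<xi> = \<zero>\<^bsub>K\<^esub>"
    unfolding K_def by (intro ballI allI impI) (rule Kred_torsion_free)
  show ?thesis by (intro conjI hom_add hom_mult smult inj image torsion_free)
qed

end
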